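(* For all symmetric $f\in\mathcal{C}^\infty_c(\mathbb{C}^n_{\neq},\mathbb{R})$, $$\mathcal{E}_{\mu_n}(f,f)-2\operatorname{Var}_{\mu_n}(f)=2\|r\|^2_{L^2(\mu_n)}+\frac4n\sum_{j,k=1}^n\|\bar\partial_{z_j}\bar\partial_{z_k}v\|^2_{L^2(\gamma_n)},$$ $$\|A_nf\|^2_{L^2(\mu_n)}-2\mathcal{E}_{\mu_n}(f,f)=\|(A_n+2)\widetilde f\|^2_{L^2(\mu_n)}+4\|r\|^2_{L^2(\mu_n)}+\frac8n\sum_{j,k=1}^n\|\bar\partial_{z_j}\bar\partial_{z_k}v\|^2_{L^2(\gamma_n)},$$ where $\widetilde f=f-\int_{\mathbb{C}^n}f\,\mathrm{d}\mu_n$, $h=U^{-1}\operatorname{proj}_{\mathcal{H}_n}(U\widetilde f)$, $\overline h$ is the pointwise complex conjugate of $h$, $r=\widetilde f-h-\overline h$, and $$v=\mathcal{N}_n^{-1/2}\operatorname{proj}_{\mathcal{H}_n^\perp}(U\widetilde f),\qquad \mathcal{N}_n=\sum_{j=1}^n(-\partial_{z_j}+n\overline z_j)\bar\partial_{z_j}.$$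
   Context: $n\ge1$; $\mathbb{C}^n\equiv\mathbb{R}^{2n}$; $\mathbb{C}^n_{\neq}=\{z\in\mathbb{C}^n:z_j\ne z_k\ \forall j\neq k\}$. A function is symmetric if it is invariant under permutations of the coordinates. $\gamma_n$ is the probability measure on $\mathbb{C}^n$ with density $(\frac n\pi)^n\mathrm{e}^{-n|z|^2}$, $V_n(z)=\prod_{1\le j<k\le n}(z_k-z_j)$, and $\mathrm{d}\mu_n=\frac1{c_n'}|V_n|^2\mathrm{d}\gamma_n$ with $c_n'$ the normalizing constant making $\mu_n$ a probability measure. $L^2(\mu_n)$, $L^2(\gamma_n)$ consist of complex-valued functions. $U:L^2(\mu_n)\to L^2(\gamma_n)$, $Uf=\frac1{\sqrt{c_n'}}V_nf$, which is unitary. $\mathcal{H}_n$ is the closed subspace of $L^2(\gamma_n)$ of holomorphic functions on $\mathbb{C}^n$ lying in $L^2(\gamma_n)$; $\operatorname{proj}$ denotes orthogonal projection in $L^2(\gamma_n)$. $\operatorname{Var}_{\mu_n}(f)=\int f^2\mathrm{d}\mu_n-(\int f\,\mathrm{d}\mu_n)^2$ and $\mathcal{E}_{\mu_n}(f,f)=\frac1n\int_{\mathbb{C}^n}|\nabla f|^2\mathrm{d}\mu_n$ with the Euclidean gradient on $\mathbb{R}^{2n}$. On smooth functions on $\mathbb{C}^n_{\ne}$, $A_n=\frac1n(\Delta-\nabla\Phi_n\cdot\nabla)$ with $\Phi_n(z)=n\sum_{j=1}^n|z_j|^2-2\sum_{j<k}\log|z_j-z_k|$. For $z_k=x_k+\mathrm{i}y_k$,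 $\partial_{z_k}=\frac12(\partial_{x_k}-\mathrm{i}\partial_{y_k})$ and $\bar\partial_{z_k}=\frac12(\partial_{x_k}+\mathrm{i}\partial_{y_k})$ (in the weak sense where needed). $\mathcal{N}_n$ denotes the nonnegative self-adjoint operator on $L^2(\gamma_n)$ associated with the closed quadratic form $w\mapsto\sum_{j=1}^n\|\bar\partial_{z_j}w\|^2_{L^2(\gamma_n)}$ (with domain the $w\in L^2(\gamma_n)$ whose weak derivatives $\bar\partial_{z_j}w$ all belong to $L^2(\gamma_n)$), given on smooth compactly supported functions by the displayed formula; its kernel is $\mathcal{H}_n$ and its spectrum is contained in $\{0\}\cup[n,\infty)$. $\mathcal{N}_n^{-1/2}$ is defined by spectral calculus, with value zero on $\mathcal{H}_n$. *)

theory Defs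
  imports "HOL-Analysis.Analysis"
begin

section \<open>Smooth functions and differential operators\<close>

text \<open>
  Only used for open \<open>S\<close>. Over all directions \<open>v\<close>, the directional derivatives carry the same
  information as the partial derivatives.
\<close>

primrec Ck_on ::
  "nat \<Rightarrow> 'a::real_normed_vector set \<Rightarrow> ('a \<Rightarrow> 'b::real_normed_vector) \<Rightarrow> bool" where
  "Ck_on 0 S f \<longleftrightarrow> continuous_on S f"
| "Ck_on (Suc k) S f \<longleftrightarrow>
     f differentiable_on S \<and> (\<forall>v. Ck_on k S (\<lambda>x. frechet_derivative f (at x) v))"

definition smooth_on ::
  "'a::real_normed_vector set \<Rightarrow> ('a \<Rightarrow> 'b::real_normed_vector) \<Rightarrow> bool" where
  "smooth_on S f \<longleftrightarrow> (\<forall>k. Ck_on k S f)"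

text \<open>
  For open \<open>S\<close>, the space of smooth functions with compact support in \<open>S\<close>. As usual, its members
  are extended by zero to the whole space.
\<close>

definition test_functions ::
  "'a::real_normed_vector set \<Rightarrow> ('a \<Rightarrow> 'b::real_normed_vector) set" where
  "test_functions S = {f. smooth_on S f \<and> (\<exists>K. compact K \<and> K \<subseteq> S \<and> (\<forall>x. x \<notin> K \<longrightarrow> f x = 0))}"

definition grad :: "('a::euclidean_space \<Rightarrow> real) \<Rightarrow> 'a \<Rightarrow> 'a" where
  "grad f x = (\<Sum>b\<in>Basis. frechet_derivative f (at x) b *\<^sub>R b)"

definition laplacian :: "('a::euclidean_space \<Rightarrow> real) \<Rightarrow> 'a \<Rightarrow> real" where
  "laplacian f x = (\<Sum>b\<in>Basis. frechet_derivative (\<lambda>y. frechet_derivative f (at y) b) (at x) b)"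

definition dbar :: "'n::finite \<Rightarrow> (complex^'n \<Rightarrow> complex) \<Rightarrow> complex^'n \<Rightarrow> complex" where
  "dbar j f z =
     (frechet_derivative f (at z) (axis j 1) + \<i> * frechet_derivative f (at z) (axis j \<i>)) / 2"

definition locally_integrable :: "('a::euclidean_space \<Rightarrow> complex) \<Rightarrow> bool" where
  "locally_integrable f \<longleftrightarrow>
     f \<in> borel_measurable borel \<and> (\<forall>K. compact K \<longrightarrow> set_integrable lborel K f)"

definition has_weak_dbar ::
  "'n::finite \<Rightarrow> (complex^'n \<Rightarrow> complex) \<Rightarrow> (complex^'n \<Rightarrow> complex) \<Rightarrow> bool" where
  "has_weak_dbar j u g \<longleftrightarrow> locally_integrable u \<and> locally_integrable g \<and>
     (\<forall>\<phi>\<in>test_functions UNIV.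
        (\<integral>z. u z * dbar j \<phi> z \<partial>lborel) = - (\<integral>z. g z * \<phi> z \<partial>lborel))"

text \<open>A representative of the weak derivative, which is unique up to null sets if it exists.\<close>

definition weak_dbar :: "'n::finite \<Rightarrow> (complex^'n \<Rightarrow> complex) \<Rightarrow> complex^'n \<Rightarrow> complex" where
  "weak_dbar j u = (SOME g. has_weak_dbar j u g)"

text \<open>Holomorphy in several variables: the real derivative exists and is complex linear.\<close>

definition entire :: "(complex^'n::finite \<Rightarrow> complex) \<Rightarrow> bool" where
  "entire f \<longleftrightarrow> (\<forall>z. \<exists>D. (f has_derivative D) (at z) \<and> (\<forall>c v. D (c *s v) = c * D v))"


section \<open>The Hilbert space of square-integrable functions\<close>

text \<open>
  Elements of \<open>L\<^sup>2\<close> are represented by functions, and two functions that agree almost everywhere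
  represent the same element. Operators and closed subspaces are described by representatives.
\<close>

definition L2 :: "'a measure \<Rightarrow> ('a \<Rightarrow> complex) set" where
  "L2 M = {f \<in> borel_measurable M. integrable M (\<lambda>x. (norm (f x))\<^sup>2)}"

definition L2_inner :: "'a measure \<Rightarrow> ('a \<Rightarrow> complex) \<Rightarrow> ('a \<Rightarrow> complex) \<Rightarrow> complex" where
  "L2_inner M f g = (\<integral>x. f x * cnj (g x) \<partial>M)"

definition L2_norm :: "'a measure \<Rightarrow> ('a \<Rightarrow> 'b::real_normed_vector) \<Rightarrow> real" where
  "L2_norm M f = sqrt (\<integral>x. (norm (f x))\<^sup>2 \<partial>M)"

definition L2_orth :: "'a measure \<Rightarrow> ('a \<Rightarrow> complex) set \<Rightarrow> ('a \<Rightarrow> complex) set" where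
  "L2_orth M S = {f \<in> L2 M. \<forall>s\<in>S. L2_inner M f s = 0}"

text \<open>Orthogonal projection onto a closed subspace \<open>S\<close>.\<close>

definition L2_proj ::
  "'a measure \<Rightarrow> ('a \<Rightarrow> complex) set \<Rightarrow> ('a \<Rightarrow> complex) \<Rightarrow> 'a \<Rightarrow> complex" where
  "L2_proj M S f = (SOME p. p \<in> S \<and> (\<lambda>x. f x - p x) \<in> L2_orth M S)"


section \<open>Spectral calculus of self-adjoint operators\<close>

text \<open>An unbounded operator is given by its graph, which is closed under almost everywhere equality.\<close>

type_synonym 'a L2_operator = "(('a \<Rightarrow> complex) \<times> ('a \<Rightarrow> complex)) set"

text \<open>The self-adjoint operator associated with a closed nonnegative form \<open>q\<close> with domain \<open>D\<close>.\<close>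

definition form_operator ::
  "'a measure \<Rightarrow> ('a \<Rightarrow> complex) set \<Rightarrow> (('a \<Rightarrow> complex) \<Rightarrow> ('a \<Rightarrow> complex) \<Rightarrow> complex) \<Rightarrow> 'a L2_operator"
  where "form_operator M D q = {(u, g). u \<in> D \<and> g \<in> L2 M \<and> (\<forall>w\<in>D. q u w = L2_inner M g w)}"

definition orthogonal_projector ::
  "'a measure \<Rightarrow> (('a \<Rightarrow> complex) \<Rightarrow> 'a \<Rightarrow> complex) \<Rightarrow> bool" where
  "orthogonal_projector M P \<longleftrightarrow>
     (\<forall>f\<in>L2 M. P f \<in> L2 M) \<and>
     (\<forall>f\<in>L2 M. \<forall>g\<in>L2 M. \<forall>c. AE x in M. P (\<lambda>x. f x + c * g x) x = P f x + c * P g x) \<and>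
     (\<forall>f\<in>L2 M. AE x in M. P (P f) x = P f x) \<and>
     (\<forall>f\<in>L2 M. \<forall>g\<in>L2 M. L2_inner M (P f) g = L2_inner M f (P g))"

definition projection_valued_measure ::
  "'a measure \<Rightarrow> (real set \<Rightarrow> ('a \<Rightarrow> complex) \<Rightarrow> 'a \<Rightarrow> complex) \<Rightarrow> bool" where
  "projection_valued_measure M E \<longleftrightarrow>
     (\<forall>B\<in>sets borel. orthogonal_projector M (E B)) \<and>
     (\<forall>f\<in>L2 M. AE x in M. E UNIV f x = f x) \<and>
     (\<forall>A\<in>sets borel. \<forall>B\<in>sets borel. \<forall>f\<in>L2 M. AE x in M. E (A \<inter> B) f x = E A (E B f) x) \<and>
     (\<forall>f\<in>L2 M. measure_space UNIV (sets borel) (\<lambda>B. ennreal (Re (L2_inner M (E B f) f))))"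

definition scalar_spectral_measure ::
  "'a measure \<Rightarrow> (real set \<Rightarrow> ('a \<Rightarrow> complex) \<Rightarrow> 'a \<Rightarrow> complex) \<Rightarrow> ('a \<Rightarrow> complex) \<Rightarrow> real measure" where
  "scalar_spectral_measure M E f =
     measure_of UNIV (sets borel) (\<lambda>B. ennreal (Re (L2_inner M (E B f) f)))"

definition spectral_integral_dom ::
  "'a measure \<Rightarrow> (real set \<Rightarrow> ('a \<Rightarrow> complex) \<Rightarrow> 'a \<Rightarrow> complex) \<Rightarrow> (real \<Rightarrow> real) \<Rightarrow> ('a \<Rightarrow> complex) set"
  where
  "spectral_integral_dom M E \<phi> =
     {f \<in> L2 M. (\<integral>\<^sup>+ t. ennreal ((\<phi> t)\<^sup>2) \<partial>scalar_spectral_measure M E f) < \<infinity>}"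

text \<open>
  The operator \<open>\<integral> \<phi> dE\<close>: its value \<open>g\<close> at \<open>f\<close> satisfies \<open>\<langle>g, u\<rangle> = \<integral> \<phi>(t) d\<langle>E(t) f, u\<rangle>\<close> for all \<open>u\<close> in
  the dense domain. The complex measure on the right is written out by polarization.
\<close>

definition spectral_integral ::
  "'a measure \<Rightarrow> (real set \<Rightarrow> ('a \<Rightarrow> complex) \<Rightarrow> 'a \<Rightarrow> complex) \<Rightarrow> (real \<Rightarrow> real) \<Rightarrow> 'a L2_operator" where
  "spectral_integral M E \<phi> =
     {(f, g). f \<in> spectral_integral_dom M E \<phi> \<and> g \<in> L2 M \<and>
        (\<forall>u\<in>spectral_integral_dom M E \<phi>.
           let I = (\<lambda>c. complex_of_real
                      (\<integral>t. \<phi> t \<partial>scalar_spectral_measure M E (\<lambda>x. f x + c * u x)))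
           in L2_inner M g u = (I 1 - I (- 1) + \<i> * I \<i> - \<i> * I (- \<i>)) / 4)}"

text \<open>The spectral measure of a self-adjoint operator \<open>T\<close>, unique up to almost everywhere equality.\<close>

definition spectral_measure ::
  "'a measure \<Rightarrow> 'a L2_operator \<Rightarrow> real set \<Rightarrow> ('a \<Rightarrow> complex) \<Rightarrow> 'a \<Rightarrow> complex" where
  "spectral_measure M T =
     (SOME E. projection_valued_measure M E \<and> T = spectral_integral M E (\<lambda>t. t))"

definition spectral_calculus ::
  "'a measure \<Rightarrow> 'a L2_operator \<Rightarrow> (real \<Rightarrow> real) \<Rightarrow> ('a \<Rightarrow> complex) \<Rightarrow> 'a \<Rightarrow> complex" where
  "spectral_calculus M T \<phi> f = (SOME g. (f, g) \<in> spectral_integral M (spectral_measure M T) \<phi>)"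


section \<open>The Ginibre ensemble\<close>

text \<open>
  The dimension \<open>n \<ge> 1\<close> is \<open>CARD('n)\<close>. The linear order on the index type gives a meaning to \<open>j < k\<close>.
\<close>

definition distinct_coords :: "(complex^'n::finite) set" where
  "distinct_coords = {z. \<forall>j k. j \<noteq> k \<longrightarrow> z $ j \<noteq> z $ k}"

definition symmetric_fun :: "(complex^'n::finite \<Rightarrow> 'b) \<Rightarrow> bool" where
  "symmetric_fun f \<longleftrightarrow> (\<forall>\<sigma> z. bij \<sigma> \<longrightarrow> f (\<chi> i. z $ \<sigma> i) = f z)"

definition gauss :: "(complex^'n::finite) measure" where
  "gauss = density lborel
     (\<lambda>z. ennreal ((real CARD('n) / pi) ^ CARD('n) * exp (- real CARD('n) * (norm z)\<^sup>2)))"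

definition vandermonde :: "complex^'n::{finite,linorder} \<Rightarrow> complex" where
  "vandermonde z = (\<Prod>(j, k)\<in>{(j, k). j < k}. z $ k - z $ j)"

definition norm_const :: "'n::{finite,linorder} itself \<Rightarrow> real" where
  "norm_const _ = (\<integral>z. (norm (vandermonde z))\<^sup>2 \<partial>(gauss :: (complex^'n::{finite,linorder}) measure))"

definition ginibre :: "(complex^'n::{finite,linorder}) measure" where
  "ginibre = density gauss (\<lambda>z. ennreal ((norm (vandermonde z))\<^sup>2 / norm_const TYPE('n)))"

definition U_map :: "(complex^'n::{finite,linorder} \<Rightarrow> complex) \<Rightarrow> complex^'n::{finite,linorder} \<Rightarrow> complex" where
  "U_map f z = vandermonde z * f z / complex_of_real (sqrt (norm_const TYPE('n)))"

text \<open>The zero set of the Vandermonde determinant is a null set, so the values there are irrelevant.\<close>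

definition U_inv :: "(complex^'n::{finite,linorder} \<Rightarrow> complex) \<Rightarrow> complex^'n::{finite,linorder} \<Rightarrow> complex" where
  "U_inv g z = complex_of_real (sqrt (norm_const TYPE('n))) * g z / vandermonde z"

definition energy :: "(complex^'n::{finite,linorder} \<Rightarrow> real) \<Rightarrow> real" where
  "energy f = (\<integral>z. (norm (grad f z))\<^sup>2 \<partial>ginibre) / real CARD('n)"

definition mean :: "(complex^'n::{finite,linorder} \<Rightarrow> real) \<Rightarrow> real" where
  "mean f = (\<integral>z. f z \<partial>ginibre)"

definition Var :: "(complex^'n::{finite,linorder} \<Rightarrow> real) \<Rightarrow> real" where
  "Var f = (\<integral>z. (f z)\<^sup>2 \<partial>ginibre) - (mean f)\<^sup>2"

definition potential :: "complex^'n::{finite,linorder} \<Rightarrow> real" where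
  "potential z = real CARD('n) * (\<Sum>j\<in>UNIV. (norm (z $ j))\<^sup>2)
     - 2 * (\<Sum>(j, k)\<in>{(j, k). j < k}. ln (norm (z $ j - z $ k)))"

definition generator :: "(complex^'n::{finite,linorder} \<Rightarrow> real) \<Rightarrow> complex^'n::{finite,linorder} \<Rightarrow> real" where
  "generator f z = (laplacian f z - grad potential z \<bullet> grad f z) / real CARD('n)"

definition fock_space :: "(complex^'n::finite \<Rightarrow> complex) set" where
  "fock_space = {g \<in> L2 gauss. entire g}"

definition dbar_form_dom :: "(complex^'n::finite \<Rightarrow> complex) set" where
  "dbar_form_dom = {w \<in> L2 gauss. \<forall>j. \<exists>g\<in>L2 gauss. has_weak_dbar j w g}"

text \<open>
  The sesquilinear form whose quadratic form is \<open>w \<mapsto> \<Sum>j. \<parallel>\<partial>bar\<^sub>j w\<parallel>\<^sup>2\<close>. Since the adjoint of \<open>\<partial>bar\<^sub>j\<close> with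
  respect to the Gaussian measure is \<open>- \<partial>\<^sub>j + n z\<^sub>j\<close> (with \<open>z\<^sub>j\<close> conjugated), the associated operator acts
  on test functions as \<open>\<Sum>j. (- \<partial>\<^sub>j + n z\<^sub>j) \<partial>bar\<^sub>j\<close>.
\<close>

definition dbar_form ::
  "(complex^'n::finite \<Rightarrow> complex) \<Rightarrow> (complex^'n \<Rightarrow> complex) \<Rightarrow> complex" where
  "dbar_form u w = (\<Sum>j\<in>UNIV. L2_inner gauss (weak_dbar j u) (weak_dbar j w))"

definition dbar_laplacian :: "(complex^'n::finite) L2_operator" where
  "dbar_laplacian = form_operator gauss dbar_form_dom dbar_form"

text \<open>The inverse square root has value zero on the kernel.\<close>

definition inv_sqrt_dbar_laplacian ::
  "(complex^'n::finite \<Rightarrow> complex) \<Rightarrow> complex^'n \<Rightarrow> complex" where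
  "inv_sqrt_dbar_laplacian =
     spectral_calculus gauss dbar_laplacian (\<lambda>t. if t > 0 then 1 / sqrt t else 0)"

end

theory Submission
  imports Defs "HOL-Complex_Analysis.Complex_Analysis"
begin

text \<open>
  Write \<open>w = U f\<close> for the centred function \<open>f\<close>, \<open>P\<close> for the projection of \<open>w\<close> onto the holomorphic functions,
  and \<open>p = w - P\<close>. Both identities are linear relations between \<open>\<parallel>w\<parallel>\<^sup>2 = Var f\<close>, \<open>\<parallel>P\<parallel>\<^sup>2\<close> and
  \<open>\<Sum>\<^sub>j \<parallel>\<partial>bar\<^sub>j w\<parallel>\<^sup>2\<close>. The last sum is \<open>n / 4\<close> times the energy of \<open>f\<close>, because the Vandermonde determinant \<open>V\<close> is
  holomorphic and \<open>\<partial>bar\<^sub>j\<close> therefore passes through \<open>U\<close> (\<open>U_map_dbar_form\<close>).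

  The second derivatives of \<open>v\<close>. The complex Hermite polynomials \<open>H\<^sub>a\<^sub>b\<close>, with multi-indices \<open>a\<close> and \<open>b\<close>, are
  a complete orthogonal system (\<open>Hermite_total\<close>), and \<open>\<partial>bar\<^sub>j\<close> lowers \<open>b\<^sub>j\<close> by one. Hence \<open>N\<close> is diagonal with
  eigenvalue \<open>n \<bar>b\<bar>\<close> (\<open>dbar_laplacian_diagonal\<close>), and the holomorphic functions are those with
  coefficients only at \<open>b = 0\<close>. The spectral measure of a diagonal operator is determined by the operator
  (\<open>spectral_measure_diagonalizes\<close>), so \<open>v\<close> is obtained by dividing the coefficients of \<open>p\<close> by the square
  roots of the eigenvalues. A first derivative of \<open>v\<close> contributes the weight \<open>\<lambda>\<close>, a second one the weight \<open>\<lambda> - n\<close>, and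
  \<open>\<Sum>\<^sub>j\<^sub>k \<parallel>\<partial>bar\<^sub>j \<partial>bar\<^sub>k v\<parallel>\<^sup>2 = \<Sum>\<^sub>j \<parallel>\<partial>bar\<^sub>j w\<parallel>\<^sup>2 - n \<parallel>p\<parallel>\<^sup>2\<close> follows (\<open>second_dbar_derivatives\<close>).

  The remainder. Complex conjugation on \<open>L\<^sup>2(\<mu>)\<close> becomes the isometry \<open>C g = cnj g * V / cnj V\<close> under \<open>U\<close>, and
  \<open>U r = w - P - C P\<close>. Since \<open>f\<close> is real, \<open>C w = w\<close>, so all inner products in \<open>\<parallel>w - P - C P\<parallel>\<^sup>2\<close> are equal to
  \<open>\<parallel>P\<parallel>\<^sup>2\<close> except \<open>\<langle>P, C P\<rangle> = \<integral>h\<^sup>2 d\<mu>\<close>. This one vanishes. Since \<open>f\<close> is symmetric, \<open>w\<close> is alternating, and it is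
  orthogonal to \<open>V\<close> because \<open>f\<close> has mean zero. Hence only monomials of degree larger than \<open>deg V\<close>
  occur in \<open>P\<close> (\<open>hcoef_low_degree\<close>), and the rotations \<open>z \<mapsto> c z\<close> annihilate the integral of \<open>P\<^sup>2 * cnj V / V\<close>
  (\<open>integral_fock_square\<close>). So \<open>\<parallel>r\<parallel>\<^sup>2 = \<parallel>w\<parallel>\<^sup>2 - 2 \<parallel>P\<parallel>\<^sup>2\<close> (\<open>remainder_norm\<close>).

  With \<open>\<parallel>p\<parallel>\<^sup>2 = \<parallel>w\<parallel>\<^sup>2 - \<parallel>P\<parallel>\<^sup>2\<close> the first identity is arithmetic. The second one follows from the first, since
  integration by parts gives \<open>\<parallel>(A + 2) f\<parallel>\<^sup>2 = \<parallel>A f\<parallel>\<^sup>2 - 4 E(f, f) + 4 Var f\<close> (\<open>generator_integration_by_parts\<close>).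
\<close>

section \<open>The Hilbert space of square-integrable functions\<close>

lemma L2_measurable [measurable_dest]: "f \<in> L2 M \<Longrightarrow> f \<in> borel_measurable M"
  by (simp add: L2_def)

lemma L2_integrable_square: "f \<in> L2 M \<Longrightarrow> integrable M (\<lambda>x. (norm (f x))\<^sup>2)"
  by (simp add: L2_def)

lemma L2_I:
  "f \<in> borel_measurable M \<Longrightarrow> integrable M (\<lambda>x. (norm (f x))\<^sup>2) \<Longrightarrow> f \<in> L2 M"
  by (simp add: L2_def)

lemma L2_bound:
  assumes "f \<in> borel_measurable M" "integrable M g" "AE x in M. (norm (f x))\<^sup>2 \<le> g x"
  shows "f \<in> L2 M"
proof (rule L2_I)
  show "integrable M (\<lambda>x. (norm (f x))\<^sup>2)"
    by (rule Bochner_Integration.integrable_bound[OF assms(2)]) (use assms in auto)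
qed fact

lemma L2_cong_AE:
  assumes "f \<in> L2 M" "g \<in> borel_measurable M" "AE x in M. f x = g x"
  shows "g \<in> L2 M"
proof (rule L2_I)
  show "integrable M (\<lambda>x. (norm (g x))\<^sup>2)"
    using L2_integrable_square[OF assms(1)]
    by (rule integrable_cong_AE_imp) (use assms in auto)
qed fact

lemma L2_integrable_mult:
  assumes "f \<in> L2 M" "g \<in> L2 M"
  shows "integrable M (\<lambda>x. f x * g x)"
proof (rule Bochner_Integration.integrable_bound)
  show "integrable M (\<lambda>x. (norm (f x))\<^sup>2 + (norm (g x))\<^sup>2)"
    using assms by (auto intro!: Bochner_Integration.integrable_add L2_integrable_square)
  have "norm (f x * g x) \<le> norm ((norm (f x))\<^sup>2 + (norm (g x))\<^sup>2)" for x
  proof -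
    have "0 \<le> norm (f x) * norm (g x)"
      by simp
    then have "norm (f x) * norm (g x) \<le> (norm (f x))\<^sup>2 + (norm (g x))\<^sup>2"
      using sum_squares_bound[of "norm (f x)" "norm (g x)"] by linarith
    then show ?thesis
      by (simp add: norm_mult)
  qed
  then show "AE x in M. norm (f x * g x) \<le> norm ((norm (f x))\<^sup>2 + (norm (g x))\<^sup>2)"
    by simp
qed (use assms in \<open>auto intro!: borel_measurable_times L2_measurable\<close>)

lemma borel_measurable_cnj [measurable]: "cnj \<in> borel_measurable borel"
  by (intro borel_measurable_continuous_onI continuous_intros)

lemma L2_cnj: "f \<in> L2 M \<Longrightarrow> (\<lambda>x. cnj (f x)) \<in> L2 M"
  unfolding L2_def by (auto intro: measurable_compose[OF _ borel_measurable_cnj])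

lemma L2_integrable_inner:
  assumes "f \<in> L2 M" "g \<in> L2 M"
  shows "integrable M (\<lambda>x. f x * cnj (g x))"
  using L2_integrable_mult[OF assms(1) L2_cnj[OF assms(2)]] .

lemma L2_zero [simp]: "(\<lambda>x. 0) \<in> L2 M"
  by (simp add: L2_def)

lemma L2_cmult: "f \<in> L2 M \<Longrightarrow> (\<lambda>x. c * f x) \<in> L2 M"
  unfolding L2_def by (auto simp: norm_mult power_mult_distrib)

lemma L2_add:
  assumes "f \<in> L2 M" "g \<in> L2 M"
  shows "(\<lambda>x. f x + g x) \<in> L2 M"
proof (rule L2_bound)
  show "integrable M (\<lambda>x. 2 * (norm (f x))\<^sup>2 + 2 * (norm (g x))\<^sup>2)"
    using assms by (auto intro!: Bochner_Integration.integrable_add L2_integrable_square)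
  have "(norm (f x + g x))\<^sup>2 \<le> 2 * (norm (f x))\<^sup>2 + 2 * (norm (g x))\<^sup>2" for x
    using power_mono[OF norm_triangle_ineq[of "f x" "g x"] norm_ge_zero, of 2]
      sum_squares_bound[of "norm (f x)" "norm (g x)"]
    by (simp add: power2_sum)
  then show "AE x in M. (norm (f x + g x))\<^sup>2 \<le> 2 * (norm (f x))\<^sup>2 + 2 * (norm (g x))\<^sup>2"
    by simp
qed (use assms in \<open>auto intro!: borel_measurable_add L2_measurable\<close>)

lemma L2_diff: "f \<in> L2 M \<Longrightarrow> g \<in> L2 M \<Longrightarrow> (\<lambda>x. f x - g x) \<in> L2 M"
  using L2_add[of f M "\<lambda>x. - 1 * g x"] L2_cmult[of g M "- 1"] by simp

lemma L2_sum: "(\<And>i. i \<in> F \<Longrightarrow> f i \<in> L2 M) \<Longrightarrow> (\<lambda>x. \<Sum>i\<in>F. f i x) \<in> L2 M"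
  by (induction F rule: infinite_finite_induct) (auto intro!: L2_add)

lemma L2_inner_add_left:
  assumes "f \<in> L2 M" "g \<in> L2 M" "u \<in> L2 M"
  shows "L2_inner M (\<lambda>x. f x + g x) u = L2_inner M f u + L2_inner M g u"
  using assms by (simp add: L2_inner_def ring_distribs L2_integrable_inner)

lemma L2_inner_diff_left:
  assumes "f \<in> L2 M" "g \<in> L2 M" "u \<in> L2 M"
  shows "L2_inner M (\<lambda>x. f x - g x) u = L2_inner M f u - L2_inner M g u"
  using assms by (simp add: L2_inner_def ring_distribs L2_integrable_inner)

lemma L2_inner_cmult_left: "L2_inner M (\<lambda>x. c * f x) u = c * L2_inner M f u"
  by (simp add: L2_inner_def mult.assoc)

lemma L2_inner_commute: "L2_inner M g f = cnj (L2_inner M f g)"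
proof -
  have "cnj (L2_inner M f g) = (\<integral>x. cnj (f x * cnj (g x)) \<partial>M)"
    unfolding L2_inner_def by (rule Bochner_Integration.integral_cnj[symmetric])
  then show ?thesis
    by (simp add: L2_inner_def mult.commute)
qed

lemma L2_inner_sum_left:
  assumes "\<And>i. i \<in> F \<Longrightarrow> f i \<in> L2 M" "u \<in> L2 M"
  shows "L2_inner M (\<lambda>x. \<Sum>i\<in>F. f i x) u = (\<Sum>i\<in>F. L2_inner M (f i) u)"
  using assms
  by (induction F rule: infinite_finite_induct)
     (auto simp: L2_inner_add_left L2_sum, auto simp: L2_inner_def)

lemma L2_inner_cong_AE:
  assumes "f \<in> borel_measurable M" "g \<in> borel_measurable M" "f' \<in> borel_measurable M"
    "g' \<in> borel_measurable M" "AE x in M. f x = f' x" "AE x in M. g x = g' x"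
  shows "L2_inner M f g = L2_inner M f' g'"
  unfolding L2_inner_def by (rule integral_cong_AE) (use assms in auto)

lemma L2_inner_add_right:
  assumes "f \<in> L2 M" "g \<in> L2 M" "u \<in> L2 M"
  shows "L2_inner M u (\<lambda>x. f x + g x) = L2_inner M u f + L2_inner M u g"
  using assms by (simp add: L2_inner_def ring_distribs L2_integrable_inner)

lemma L2_inner_diff_right:
  assumes "f \<in> L2 M" "g \<in> L2 M" "u \<in> L2 M"
  shows "L2_inner M u (\<lambda>x. f x - g x) = L2_inner M u f - L2_inner M u g"
  using assms by (simp add: L2_inner_def ring_distribs L2_integrable_inner)

lemma L2_inner_cmult_right: "L2_inner M f (\<lambda>x. c * u x) = cnj c * L2_inner M f u"
  by (subst (1 2) L2_inner_commute) (simp add: L2_inner_cmult_left)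

lemma L2_norm_square: "(L2_norm M f)\<^sup>2 = (\<integral>x. (norm (f x))\<^sup>2 \<partial>M)"
  unfolding L2_norm_def by simp

lemma L2_inner_self: "L2_inner M f f = of_real ((L2_norm M f)\<^sup>2)"
proof -
  have "L2_inner M f f = (\<integral>x. complex_of_real ((norm (f x))\<^sup>2) \<partial>M)"
    unfolding L2_inner_def
    by (rule Bochner_Integration.integral_cong) (simp_all only: complex_norm_square)
  then show ?thesis
    by (simp add: L2_norm_square del: of_real_power)
qed

lemma L2_norm_square_eq_0:
  assumes "f \<in> L2 M" "(L2_norm M f)\<^sup>2 = 0"
  shows "AE x in M. f x = 0"
  using integral_nonneg_eq_0_iff_AE[OF L2_integrable_square[OF assms(1)]] assms(2)
  by (auto simp: L2_norm_square)

lemma L2_norm_square_diff: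
  assumes "f \<in> L2 M" "g \<in> L2 M"
  shows "(L2_norm M (\<lambda>x. f x - g x))\<^sup>2
           = (L2_norm M f)\<^sup>2 + (L2_norm M g)\<^sup>2 - 2 * Re (L2_inner M f g)"
proof -
  have "complex_of_real ((L2_norm M (\<lambda>x. f x - g x))\<^sup>2)
      = L2_inner M (\<lambda>x. f x - g x) (\<lambda>x. f x - g x)"
    by (simp add: L2_inner_self)
  also have "\<dots> = L2_inner M f f - L2_inner M f g - (cnj (L2_inner M f g) - L2_inner M g g)"
    using assms L2_inner_commute[of M g f]
    by (simp add: L2_inner_diff_left L2_inner_diff_right L2_diff)
  finally show ?thesis
    by (simp add: L2_inner_self complex_eq_iff)
qed

lemma L2_Cauchy_Schwarz:
  assumes "f \<in> L2 M" "g \<in> L2 M"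
  shows "(norm (L2_inner M f g))\<^sup>2 \<le> (L2_norm M f)\<^sup>2 * (L2_norm M g)\<^sup>2"
proof -
  define A B C where "A = (L2_norm M f)\<^sup>2" and "B = (L2_norm M g)\<^sup>2"
    and "C = norm (L2_inner M f g)"
  have nonneg: "A \<ge> 0" "B \<ge> 0" "C \<ge> 0"
    by (auto simp: A_def B_def C_def)
  have main: "2 * C * t \<le> A * t\<^sup>2 + B" for t :: real
  proof -
    \<comment> \<open>Rotate \<open>f\<close> so that its inner product with \<open>g\<close> becomes real and nonnegative.\<close>
    obtain c where c: "c * L2_inner M f g = of_real C" "norm c = 1"
    proof (cases "L2_inner M f g = 0")
      case False
      show ?thesis
      proof (rule that[of "cnj (sgn (L2_inner M f g))"])
        show "cnj (sgn (L2_inner M f g)) * L2_inner M f g = of_real C"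
          using False complex_norm_square[of "L2_inner M f g"]
          by (simp add: sgn_eq C_def field_simps power2_eq_square)
        show "norm (cnj (sgn (L2_inner M f g))) = 1"
          using False by (simp add: norm_sgn)
      qed
    qed (auto simp: C_def intro: that[of 1])
    have "0 \<le> (L2_norm M (\<lambda>x. (of_real t * c) * f x - g x))\<^sup>2"
      by simp
    also have "\<dots> = (L2_norm M (\<lambda>x. (of_real t * c) * f x))\<^sup>2 + B - 2 * Re (of_real t * (c * L2_inner M f g))"
      using assms by (subst L2_norm_square_diff) (auto intro!: L2_cmult simp: L2_inner_cmult_left B_def mult.assoc)
    also have "(L2_norm M (\<lambda>x. (of_real t * c) * f x))\<^sup>2 = A * t\<^sup>2"
      by (simp add: L2_norm_square norm_mult c power_mult_distrib A_def)
    finally show ?thesis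
      unfolding c by (simp add: algebra_simps)
  qed
  have "C\<^sup>2 \<le> A * B"
  proof (cases "A = 0")
    case True
    have "C = 0"
    proof (rule ccontr)
      assume "C \<noteq> 0"
      then have "2 * C * ((B + 1) / C) \<le> B"
        using main[of "(B + 1) / C"] True by simp
      then show False
        using \<open>C \<noteq> 0\<close> nonneg by simp
    qed
    then show ?thesis using nonneg by simp
  next
    case False
    then have "2 * C * (C / A) \<le> A * (C / A)\<^sup>2 + B"
      by (intro main)
    then have "C\<^sup>2 / A \<le> B"
      using False by (simp add: power2_eq_square)
    then show ?thesis
      using False nonneg by (simp add: divide_simps mult.commute split: if_splits)
  qed
  then show ?thesis
    by (simp add: A_def B_def C_def)
qed

lemma four_power_eq: "(4 :: real) ^ k = (2 ^ k)\<^sup>2"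
  using power_mult[of "2::real" 2 k] power_mult[of "2::real" k 2] by (simp add: mult.commute)

text \<open>
  The Riesz-Fischer argument: if the increments decay geometrically in the mean, then
  \<open>W = \<Sum>k. 4\<^sup>k \<bar>S\<^sub>k\<^sub>+\<^sub>1 - S\<^sub>k\<bar>\<^sup>2\<close> is integrable, and pointwise \<open>\<bar>S\<^sub>k\<^sub>+\<^sub>1 - S\<^sub>k\<bar> \<le> 2\<^sup>-\<^sup>k \<surd>W\<close>, so the sequence
  converges almost everywhere with the integrable error bound \<open>4 W / 4\<^sup>k\<close>.
\<close>

lemma L2_complete:
  fixes S :: "nat \<Rightarrow> 'a \<Rightarrow> complex"
  assumes S: "\<And>k. S k \<in> L2 M"
    and d: "\<And>k. (L2_norm M (\<lambda>x. S (Suc k) x - S k x))\<^sup>2 \<le> C / 8 ^ k"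
  shows "\<exists>u\<in>L2 M. (AE x in M. (\<lambda>k. S k x) \<longlonglongrightarrow> u x) \<and>
           (\<lambda>k. (L2_norm M (\<lambda>x. u x - S k x))\<^sup>2) \<longlonglongrightarrow> 0"
proof -
  have [measurable]: "S k \<in> borel_measurable M" for k
    using S by (rule L2_measurable)
  define D where "D k x = 4 ^ k * (norm (S (Suc k) x - S k x))\<^sup>2" for k x
  have intD: "integrable M (D k)" for k
    unfolding D_def
    by (intro Bochner_Integration.integrable_mult_right L2_integrable_square L2_diff S)
  have D_nonneg: "D k x \<ge> 0" for k x
    by (simp add: D_def)
  have D_le: "(\<integral>x. D k x \<partial>M) \<le> C * (1 / 2) ^ k" for k
  proof -
    have "(\<integral>x. D k x \<partial>M) = 4 ^ k * (L2_norm M (\<lambda>x. S (Suc k) x - S k x))\<^sup>2"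
      by (simp add: D_def L2_norm_square)
    also have "\<dots> \<le> 4 ^ k * (C / 8 ^ k)"
      using d by (intro mult_left_mono) auto
    also have "\<dots> = C * (1 / 2) ^ k"
      by (simp add: field_simps flip: power_mult_distrib)
    finally show ?thesis .
  qed
  have sumD: "summable (\<lambda>k. \<integral>x. D k x \<partial>M)"
    by (rule summable_comparison_test'[of "\<lambda>k. C * (1 / 2) ^ k" 0])
       (use D_le D_nonneg in \<open>auto intro!: summable_mult\<close>)
  have "AE x in M. (\<Sum>k. ennreal (D k x)) \<noteq> \<infinity>"
  proof (rule nn_integral_PInf_AE)
    have "(\<integral>\<^sup>+x. (\<Sum>k. ennreal (D k x)) \<partial>M) = (\<Sum>k. \<integral>\<^sup>+x. ennreal (D k x) \<partial>M)"
      by (rule nn_integral_suminf) (use intD in auto)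
    also have "\<dots> = (\<Sum>k. ennreal (\<integral>x. D k x \<partial>M))"
      using intD D_nonneg by (subst nn_integral_eq_integral) auto
    also have "\<dots> < \<infinity>"
      by (subst suminf_ennreal2[OF _ sumD]) (use D_nonneg in auto)
    finally show "(\<integral>\<^sup>+x. (\<Sum>k. ennreal (D k x)) \<partial>M) \<noteq> \<infinity>"
      by simp
  qed (use intD in auto)
  then have ae: "AE x in M. summable (\<lambda>k. D k x)"
    by (rule eventually_mono) (use D_nonneg in \<open>auto intro: summable_suminf_not_top\<close>)
  define W where "W x = (\<Sum>k. D k x)" for x
  have W: "integrable M W"
    unfolding W_def
    by (rule integrable_suminf[OF intD]) (use ae sumD D_nonneg in auto)
  define u where "u x = lim (\<lambda>k. S k x)" for x
  have u_meas [measurable]: "u \<in> borel_measurable M"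
    unfolding u_def by measurable
  have key: "(\<lambda>k. S k x) \<longlonglongrightarrow> u x \<and> (\<forall>k. (norm (u x - S k x))\<^sup>2 \<le> 4 / 4 ^ k * W x)"
    if sm: "summable (\<lambda>k. D k x)" for x
  proof -
    have W0: "W x \<ge> 0"
      unfolding W_def by (intro suminf_nonneg sm D_nonneg)
    have inc: "norm (S (Suc k) x - S k x) \<le> sqrt (W x) * (1 / 2) ^ k" for k
    proof (rule power2_le_imp_le)
      have "D k x \<le> W x"
        unfolding W_def using sum_le_suminf[OF sm, of "{k}"] D_nonneg by simp
      then have "(norm (S (Suc k) x - S k x))\<^sup>2 \<le> W x / 4 ^ k"
        by (simp add: D_def field_simps)
      also have "\<dots> = (sqrt (W x) * (1 / 2) ^ k)\<^sup>2"
        using W0 by (simp add: power_mult_distrib power_divide four_power_eq[of k])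
      finally show "(norm (S (Suc k) x - S k x))\<^sup>2 \<le> (sqrt (W x) * (1 / 2) ^ k)\<^sup>2" .
    qed (use W0 in auto)
    have sminc: "summable (\<lambda>k. S (Suc k) x - S k x)"
      by (rule summable_comparison_test'[of "\<lambda>k. sqrt (W x) * (1 / 2) ^ k" 0])
         (use inc in \<open>auto intro!: summable_mult\<close>)
    then have "convergent (\<lambda>k. \<Sum>i<k. S (Suc i) x - S i x)"
      by (simp add: summable_iff_convergent)
    then obtain a where "(\<lambda>k. S k x - S 0 x) \<longlonglongrightarrow> a"
      unfolding convergent_def sum_lessThan_telescope[of "\<lambda>i. S i x"] by blast
    from tendsto_add[OF this tendsto_const[of "S 0 x"]] have "convergent (\<lambda>k. S k x)"
      by (auto simp: convergent_def)
    then have lim: "(\<lambda>k. S k x) \<longlonglongrightarrow> u x"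
      unfolding u_def by (simp add: convergent_LIMSEQ_iff)
    have "(norm (u x - S k x))\<^sup>2 \<le> 4 / 4 ^ k * W x" for k
    proof -
      have bd: "norm (S (m + k) x - S k x) \<le> 2 * (1 / 2) ^ k * sqrt (W x)" for m
      proof -
        have "S (m + k) x - S k x = (\<Sum>i<m. S (Suc (i + k)) x - S (i + k) x)"
          using sum_lessThan_telescope[of "\<lambda>i. S (i + k) x" m] by simp
        also have "norm \<dots> \<le> (\<Sum>i<m. sqrt (W x) * (1 / 2) ^ (i + k))"
          by (intro sum_norm_le inc)
        also have "\<dots> = sqrt (W x) * (1 / 2) ^ k * (\<Sum>i<m. (1 / 2) ^ i)"
          by (simp add: sum_distrib_left power_add mult_ac)
        also have "\<dots> \<le> sqrt (W x) * (1 / 2) ^ k * 2"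
        proof -
          have "(\<Sum>i<m. (1 / 2 :: real) ^ i) \<le> (\<Sum>i. (1 / 2) ^ i)"
            by (intro sum_le_suminf summable_geometric) auto
          also have "\<dots> = 2"
            by (simp add: suminf_geometric)
          finally show ?thesis
            using W0 by (intro mult_left_mono) auto
        qed
        finally show ?thesis by (simp add: mult_ac)
      qed
      have "(\<lambda>m. norm (S (m + k) x - S k x)) \<longlonglongrightarrow> norm (u x - S k x)"
        by (intro tendsto_intros LIMSEQ_ignore_initial_segment lim)
      then have "norm (u x - S k x) \<le> 2 * (1 / 2) ^ k * sqrt (W x)"
        by (rule LIMSEQ_le_const2) (use bd in auto)
      then have "(norm (u x - S k x))\<^sup>2 \<le> (2 * (1 / 2) ^ k * sqrt (W x))\<^sup>2"
        by (rule power_mono) auto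
      also have "\<dots> = 4 / 4 ^ k * W x"
        using W0 by (simp add: power_mult_distrib power_divide four_power_eq[of k])
      finally show ?thesis .
    qed
    with lim show ?thesis by blast
  qed
  have diff: "(\<lambda>x. u x - S k x) \<in> L2 M" for k
    by (rule L2_bound[of _ _ "\<lambda>x. 4 / 4 ^ k * W x"]) (use W ae key in auto)
  have "u \<in> L2 M"
    using L2_add[OF diff[of 0] S[of 0]] by simp
  moreover have "AE x in M. (\<lambda>k. S k x) \<longlonglongrightarrow> u x"
    using ae by eventually_elim (use key in auto)
  moreover have "(\<lambda>k. (L2_norm M (\<lambda>x. u x - S k x))\<^sup>2) \<longlonglongrightarrow> 0"
  proof (rule tendsto_sandwich[OF _ _ tendsto_const])
    show "\<forall>\<^sub>F k in sequentially. (L2_norm M (\<lambda>x. u x - S k x))\<^sup>2 \<le> 4 * (\<integral>x. W x \<partial>M) * (1 / 4) ^ k"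
    proof (intro always_eventually allI)
      fix k
      have "(L2_norm M (\<lambda>x. u x - S k x))\<^sup>2 \<le> (\<integral>x. 4 / 4 ^ k * W x \<partial>M)"
        unfolding L2_norm_square
        by (rule integral_mono_AE) (use W ae key in \<open>auto intro!: L2_integrable_square diff\<close>)
      then show "(L2_norm M (\<lambda>x. u x - S k x))\<^sup>2 \<le> 4 * (\<integral>x. W x \<partial>M) * (1 / 4) ^ k"
        by (simp add: field_simps)
    qed
    have "(\<lambda>k. 4 * (\<integral>x. W x \<partial>M) * (1 / 4) ^ k) \<longlonglongrightarrow> 4 * (\<integral>x. W x \<partial>M) * 0"
      by (intro tendsto_intros LIMSEQ_power_zero) auto
    then show "(\<lambda>k. 4 * (\<integral>x. W x \<partial>M) * (1 / 4) ^ k) \<longlonglongrightarrow> 0"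
      by simp
  qed auto
  ultimately show ?thesis by blast
qed

section \<open>Orthonormal bases\<close>

lemma has_sum_diff:
  fixes f g :: "'i \<Rightarrow> complex"
  assumes "(f has_sum a) A" "(g has_sum b) A"
  shows "((\<lambda>i. f i - g i) has_sum (a - b)) A"
  using has_sum_add[OF assms(1), of "\<lambda>i. - g i" "- b"] assms(2) by (simp add: has_sum_uminus)

text \<open>
  The index set is arbitrary and all expansions are unordered sums, so no enumeration of the basis has to be
  chosen. Completeness is stated as totality, which is what the density argument for Hermite polynomials yields.
\<close>

locale L2_basis =
  fixes M :: "'a measure" and e :: "'i \<Rightarrow> 'a \<Rightarrow> complex"
  assumes basis_L2 [simp]: "e i \<in> L2 M"
    and orthonormal: "L2_inner M (e i) (e j) = (if i = j then 1 else 0)"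
    and total: "u \<in> L2 M \<Longrightarrow> (\<And>i. L2_inner M u (e i) = 0) \<Longrightarrow> AE x in M. u x = 0"
begin

abbreviation coef :: "('a \<Rightarrow> complex) \<Rightarrow> 'i \<Rightarrow> complex" where
  "coef u i \<equiv> L2_inner M u (e i)"

definition partial :: "('i \<Rightarrow> complex) \<Rightarrow> 'i set \<Rightarrow> 'a \<Rightarrow> complex" where
  "partial c F x = (\<Sum>i\<in>F. c i * e i x)"

lemma partial_L2: "partial c F \<in> L2 M"
  unfolding partial_def by (intro L2_sum L2_cmult basis_L2)

lemma inner_partial: "u \<in> L2 M \<Longrightarrow> L2_inner M (partial c F) u = (\<Sum>i\<in>F. c i * cnj (coef u i))"
  unfolding partial_def
  by (subst L2_inner_sum_left)
     (auto intro!: L2_cmult sum.cong simp: L2_inner_cmult_left L2_inner_commute[of M "e _" u])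

lemma coef_partial: "finite F \<Longrightarrow> coef (partial c F) i = (if i \<in> F then c i else 0)"
  by (simp add: inner_partial orthonormal if_distrib[of cnj] if_distrib[of "(*) _"] cong: if_cong)

lemma norm_partial:
  assumes "finite F"
  shows "(L2_norm M (partial c F))\<^sup>2 = (\<Sum>i\<in>F. (norm (c i))\<^sup>2)"
proof -
  have "complex_of_real ((L2_norm M (partial c F))\<^sup>2) = (\<Sum>i\<in>F. c i * cnj (c i))"
    unfolding L2_inner_self[symmetric] inner_partial[OF partial_L2]
    using assms by (intro sum.cong) (auto simp: coef_partial)
  also have "\<dots> = complex_of_real (\<Sum>i\<in>F. (norm (c i))\<^sup>2)"
    by (simp only: of_real_sum complex_norm_square)
  finally show ?thesis
    by (simp only: of_real_eq_iff)
qed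

lemma norm_diff_partial:
  assumes "u \<in> L2 M" "finite F"
  shows "(L2_norm M (\<lambda>x. u x - partial (coef u) F x))\<^sup>2
           = (L2_norm M u)\<^sup>2 - (\<Sum>i\<in>F. (norm (coef u i))\<^sup>2)"
proof -
  have "L2_inner M u (partial (coef u) F) = cnj (\<Sum>i\<in>F. coef u i * cnj (coef u i))"
    using assms by (subst L2_inner_commute) (simp add: inner_partial)
  also have "\<dots> = (\<Sum>i\<in>F. complex_of_real ((norm (coef u i))\<^sup>2))"
    unfolding complex_norm_square by (simp add: mult.commute)
  finally show ?thesis
    using assms by (simp add: L2_norm_square_diff partial_L2 norm_partial)
qed

lemma Bessel:
  assumes "u \<in> L2 M" "finite F"
  shows "(\<Sum>i\<in>F. (norm (coef u i))\<^sup>2) \<le> (L2_norm M u)\<^sup>2"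
  using norm_diff_partial[OF assms] zero_le_power2[of "L2_norm M (\<lambda>x. u x - partial (coef u) F x)"]
  by linarith

lemma coef_summable: "u \<in> L2 M \<Longrightarrow> (\<lambda>i. (norm (coef u i))\<^sup>2) summable_on UNIV"
  by (rule nonneg_bdd_above_summable_on) (auto intro!: bdd_aboveI2 Bessel)

lemma coef_add: "u \<in> L2 M \<Longrightarrow> w \<in> L2 M \<Longrightarrow> coef (\<lambda>x. u x + w x) i = coef u i + coef w i"
  by (simp add: L2_inner_add_left)

lemma coef_diff: "u \<in> L2 M \<Longrightarrow> w \<in> L2 M \<Longrightarrow> coef (\<lambda>x. u x - w x) i = coef u i - coef w i"
  by (simp add: L2_inner_diff_left)

lemma coef_cmult: "coef (\<lambda>x. c * u x) i = c * coef u i"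
  by (simp add: L2_inner_cmult_left)

lemma coef_basis: "coef (e j) i = (if i = j then 1 else 0)"
  by (auto simp: orthonormal)

lemma eq_AE_if_coef_eq:
  assumes "u \<in> L2 M" "w \<in> L2 M" "\<And>i. coef u i = coef w i"
  shows "AE x in M. u x = w x"
  using total[of "\<lambda>x. u x - w x"] assms by (simp add: L2_diff coef_diff)

lemma coef_cong_AE:
  assumes "u \<in> borel_measurable M" "w \<in> borel_measurable M" "AE x in M. u x = w x"
  shows "coef u i = coef w i"
  by (rule L2_inner_cong_AE) (use assms L2_measurable[OF basis_L2] in auto)

text \<open>
  Finite sets \<open>G k\<close> outside of which the squared coefficients sum to at most \<open>8\<^sup>-\<^sup>k\<close> make the partial
  sums converge geometrically. The sums themselves are part of the conclusion, because holomorphy of the limit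
  is later derived from their pointwise convergence.
\<close>

lemma Riesz_Fischer:
  assumes c: "(\<lambda>i. (norm (c i))\<^sup>2) summable_on UNIV"
  shows "\<exists>u\<in>L2 M. (\<forall>i. coef u i = c i) \<and>
     (\<exists>G. (\<forall>k. finite (G k)) \<and>
        (\<forall>k. (L2_norm M (\<lambda>x. partial c (G (Suc k)) x - partial c (G k) x))\<^sup>2 \<le> 1 / 8 ^ k) \<and>
        (AE x in M. (\<lambda>k. partial c (G k) x) \<longlonglongrightarrow> u x) \<and>
        (\<lambda>k. (L2_norm M (\<lambda>x. u x - partial c (G k) x))\<^sup>2) \<longlonglongrightarrow> 0)"
proof -
  define T where "T = (\<Sum>\<^sub>\<infinity>i. (norm (c i))\<^sup>2)"
  have sum_le: "(\<Sum>i\<in>F. (norm (c i))\<^sup>2) \<le> T" if "finite F" for F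
    unfolding T_def using that by (intro finite_sum_le_infsum c) auto
  have "\<exists>F. finite F \<and> (\<forall>F'. finite F' \<and> F \<subseteq> F' \<longrightarrow> T - (\<Sum>i\<in>F'. (norm (c i))\<^sup>2) \<le> 1 / 8 ^ k)" for k :: nat
  proof -
    have "((\<lambda>F. \<Sum>i\<in>F. (norm (c i))\<^sup>2) \<longlongrightarrow> T) (finite_subsets_at_top UNIV)"
      using has_sum_infsum[OF c] unfolding has_sum_def T_def .
    then have "\<forall>\<^sub>F F in finite_subsets_at_top UNIV. T - 1 / 8 ^ k < (\<Sum>i\<in>F. (norm (c i))\<^sup>2)"
      by (rule order_tendstoD) auto
    then have "\<forall>\<^sub>F F in finite_subsets_at_top UNIV. T - (\<Sum>i\<in>F. (norm (c i))\<^sup>2) \<le> 1 / 8 ^ k"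
      by eventually_elim linarith
    then show ?thesis
      unfolding eventually_finite_subsets_at_top by simp
  qed
  then obtain H where H: "\<And>k. finite (H k)"
    "\<And>k F'. finite F' \<Longrightarrow> H k \<subseteq> F' \<Longrightarrow> T - (\<Sum>i\<in>F'. (norm (c i))\<^sup>2) \<le> 1 / 8 ^ k"
    by metis
  define G where "G k = (\<Union>l\<le>k. H l)" for k
  have fin: "finite (G k)" for k
    using H by (auto simp: G_def)
  have tail: "T - (\<Sum>i\<in>F'. (norm (c i))\<^sup>2) \<le> 1 / 8 ^ k" if "finite F'" "G k \<subseteq> F'" for F' k
    by (rule H(2)[OF that(1)]) (use that in \<open>auto simp: G_def\<close>)
  have mono: "G k \<subseteq> G (Suc k)" for k
    by (auto simp: G_def intro: le_SucI)
  have inc: "(L2_norm M (\<lambda>x. partial c (G (Suc k)) x - partial c (G k) x))\<^sup>2 \<le> 1 / 8 ^ k" for k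
  proof -
    have split: "(\<Sum>i\<in>G (Suc k). h i) = (\<Sum>i\<in>G k. h i) + (\<Sum>i\<in>G (Suc k) - G k. h i)"
      for h :: "'i \<Rightarrow> 'b::comm_monoid_add"
      using sum.subset_diff[OF mono[of k] fin[of "Suc k"], of h] by (simp add: add.commute)
    have eq: "(\<lambda>x. partial c (G (Suc k)) x - partial c (G k) x) = partial c (G (Suc k) - G k)"
      by (rule ext) (simp add: partial_def split)
    have "(L2_norm M (\<lambda>x. partial c (G (Suc k)) x - partial c (G k) x))\<^sup>2
        = (\<Sum>i\<in>G (Suc k) - G k. (norm (c i))\<^sup>2)"
      unfolding eq by (rule norm_partial) (use fin in auto)
    also have "\<dots> \<le> 1 / 8 ^ k"
      using tail[OF fin order_refl, of k] sum_le[OF fin, of "Suc k"]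
        split[of "\<lambda>i. (norm (c i))\<^sup>2"] by linarith
    finally show ?thesis .
  qed
  obtain u where u: "u \<in> L2 M" "AE x in M. (\<lambda>k. partial c (G k) x) \<longlonglongrightarrow> u x"
    "(\<lambda>k. (L2_norm M (\<lambda>x. u x - partial c (G k) x))\<^sup>2) \<longlonglongrightarrow> 0"
    using L2_complete[of "\<lambda>k. partial c (G k)" M 1, OF partial_L2 inc] by blast
  have "coef u i = c i" for i
  proof -
    have conv: "(\<lambda>k. coef u i - coef (partial c (G k)) i) \<longlonglongrightarrow> 0"
    proof (rule Lim_null_comparison)
      show "\<forall>\<^sub>F k in sequentially. norm (coef u i - coef (partial c (G k)) i)
              \<le> sqrt ((L2_norm M (\<lambda>x. u x - partial c (G k) x))\<^sup>2)"
      proof (intro always_eventually allI real_le_rsqrt)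
        fix k
        have "norm (coef (\<lambda>x. u x - partial c (G k) x) i)^2
              \<le> (L2_norm M (\<lambda>x. u x - partial c (G k) x))\<^sup>2 * (L2_norm M (e i))\<^sup>2"
          by (intro L2_Cauchy_Schwarz L2_diff u partial_L2 basis_L2)
        moreover have "(L2_norm M (e i))\<^sup>2 = 1"
          using L2_inner_self[of M "e i"] orthonormal[of i i]
          by (simp add: of_real_eq_1_iff flip: of_real_power)
        ultimately show "(norm (coef u i - coef (partial c (G k)) i))\<^sup>2
              \<le> (L2_norm M (\<lambda>x. u x - partial c (G k) x))\<^sup>2"
          using u by (simp add: coef_diff partial_L2)
      qed
      show "(\<lambda>k. sqrt ((L2_norm M (\<lambda>x. u x - partial c (G k) x))\<^sup>2)) \<longlonglongrightarrow> 0"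
        using tendsto_real_sqrt[OF u(3)] by simp
    qed
    \<comment> \<open>An index outside all \<open>G k\<close> has coefficient zero, since adding it changes the sum by at most \<open>8\<^sup>-\<^sup>k\<close>.\<close>
    have "(\<lambda>k. c i - coef (partial c (G k)) i) \<longlonglongrightarrow> 0"
    proof (rule Lim_null_comparison)
      show "\<forall>\<^sub>F k in sequentially. norm (c i - coef (partial c (G k)) i) \<le> sqrt ((1 / 8) ^ k)"
      proof (intro always_eventually allI real_le_rsqrt)
        fix k
        show "(norm (c i - coef (partial c (G k)) i))\<^sup>2 \<le> (1 / 8) ^ k"
        proof (cases "i \<in> G k")
          case False
          then have "(norm (c i))\<^sup>2 + (\<Sum>i\<in>G k. (norm (c i))\<^sup>2) \<le> T"
            using sum_le[of "insert i (G k)"] fin by simp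
          then show ?thesis
            using tail[OF fin order_refl, of k] False fin by (simp add: coef_partial power_divide)
        qed (use fin in \<open>simp add: coef_partial\<close>)
      qed
      show "(\<lambda>k. sqrt ((1 / 8) ^ k)) \<longlonglongrightarrow> 0"
        using tendsto_real_sqrt[OF LIMSEQ_power_zero[of "1 / 8 :: real"]] by simp
    qed
    from tendsto_diff[OF conv this] have "(\<lambda>k. coef u i - c i) \<longlonglongrightarrow> 0"
      by simp
    then show ?thesis
      by (simp add: LIMSEQ_const_iff)
  qed
  with u fin inc show ?thesis by blast
qed

text \<open>
  The vector with the given coefficients that \<open>Riesz_Fischer\<close> provides agrees with \<open>u\<close> almost everywhere by
  totality, and it is a limit of partial sums, whose norms are known.
\<close>

lemma Parseval_norm:
  assumes u: "u \<in> L2 M"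
  shows "((\<lambda>i. (norm (coef u i))\<^sup>2) has_sum (L2_norm M u)\<^sup>2) UNIV"
proof -
  obtain u' G where u': "u' \<in> L2 M" "\<And>i. coef u' i = coef u i" and G: "\<And>k. finite (G k)"
    and lim: "(\<lambda>k. (L2_norm M (\<lambda>x. u' x - partial (coef u) (G k) x))\<^sup>2) \<longlonglongrightarrow> 0"
    using Riesz_Fischer[OF coef_summable[OF u]] by blast
  have ae: "AE x in M. u x = u' x"
    by (rule eq_AE_if_coef_eq) (use u u' in auto)
  have [measurable]: "u \<in> borel_measurable M" "u' \<in> borel_measurable M"
    "partial c F \<in> borel_measurable M" for c F
    using u u' partial_L2 L2_measurable by auto
  have "(L2_norm M (\<lambda>x. u' x - partial (coef u) (G k) x))\<^sup>2
      = (L2_norm M u)\<^sup>2 - (\<Sum>i\<in>G k. (norm (coef u i))\<^sup>2)" for k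
  proof -
    have "(L2_norm M (\<lambda>x. u' x - partial (coef u) (G k) x))\<^sup>2
        = (L2_norm M (\<lambda>x. u x - partial (coef u) (G k) x))\<^sup>2"
      unfolding L2_norm_square by (rule integral_cong_AE) (use ae in auto)
    then show ?thesis
      by (simp add: norm_diff_partial u G)
  qed
  then have "(\<lambda>k. (L2_norm M u)\<^sup>2 - (\<Sum>i\<in>G k. (norm (coef u i))\<^sup>2)) \<longlonglongrightarrow> 0"
    using lim by simp
  then have "(\<lambda>k. (L2_norm M u)\<^sup>2 - ((L2_norm M u)\<^sup>2 - (\<Sum>i\<in>G k. (norm (coef u i))\<^sup>2)))
      \<longlonglongrightarrow> (L2_norm M u)\<^sup>2 - 0"
    by (intro tendsto_diff tendsto_const)
  then have lim': "(\<lambda>k. \<Sum>i\<in>G k. (norm (coef u i))\<^sup>2) \<longlonglongrightarrow> (L2_norm M u)\<^sup>2"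
    by simp
  have "(L2_norm M u)\<^sup>2 \<le> (\<Sum>\<^sub>\<infinity>i. (norm (coef u i))\<^sup>2)"
    by (rule LIMSEQ_le_const2[OF lim'])
       (use G in \<open>auto intro!: exI finite_sum_le_infsum coef_summable u\<close>)
  moreover have "(\<Sum>\<^sub>\<infinity>i. (norm (coef u i))\<^sup>2) \<le> (L2_norm M u)\<^sup>2"
    by (rule infsum_le_finite_sums[OF coef_summable[OF u]]) (use Bessel u in auto)
  ultimately have "(\<Sum>\<^sub>\<infinity>i. (norm (coef u i))\<^sup>2) = (L2_norm M u)\<^sup>2"
    by simp
  then show ?thesis
    using has_sum_infsum[OF coef_summable[OF u]] by simp
qed

lemma complex_polarization:
  fixes a b :: complex
  shows "a * cnj b = (of_real ((norm (a + b))\<^sup>2) - of_real ((norm (a - b))\<^sup>2)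
           + \<i> * of_real ((norm (a + \<i> * b))\<^sup>2) - \<i> * of_real ((norm (a - \<i> * b))\<^sup>2)) / 4"
  unfolding complex_norm_square by (simp add: algebra_simps)

text \<open>Polarization of \<open>Parseval_norm\<close>.\<close>

lemma Parseval:
  assumes u: "u \<in> L2 M" and w: "w \<in> L2 M"
  shows "((\<lambda>i. coef u i * cnj (coef w i)) has_sum L2_inner M u w) UNIV"
proof -
  define N where "N c = (L2_norm M (\<lambda>x. u x + c * w x))\<^sup>2" for c
  have uw: "(\<lambda>x. u x + c * w x) \<in> L2 M" for c
    by (intro L2_add L2_cmult u w)
  have sums: "((\<lambda>i. complex_of_real ((norm (coef u i + c * coef w i))\<^sup>2)) has_sum of_real (N c)) UNIV" for c
    unfolding N_def
    using has_sum_of_real[OF Parseval_norm[OF uw[of c]], where ?'a = complex] u w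
    by (simp add: coef_add coef_cmult L2_cmult)
  have "((\<lambda>i. (of_real ((norm (coef u i + 1 * coef w i))\<^sup>2) - of_real ((norm (coef u i + (- 1) * coef w i))\<^sup>2)
           + \<i> * of_real ((norm (coef u i + \<i> * coef w i))\<^sup>2) - \<i> * of_real ((norm (coef u i + (- \<i>) * coef w i))\<^sup>2)) * (1 / 4))
       has_sum (of_real (N 1) - of_real (N (- 1)) + \<i> * of_real (N \<i>) - \<i> * of_real (N (- \<i>))) * (1 / 4)) UNIV"
    by (intro has_sum_cmult_left has_sum_cmult_right has_sum_add has_sum_diff sums)
  then have sum: "((\<lambda>i. coef u i * cnj (coef w i)) has_sum
      (of_real (N 1) - of_real (N (- 1)) + \<i> * of_real (N \<i>) - \<i> * of_real (N (- \<i>))) * (1 / 4)) UNIV"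
    by (subst complex_polarization) simp
  have N: "complex_of_real (N c) = L2_inner M u u + cnj c * L2_inner M u w
      + c * (cnj (L2_inner M u w) + cnj c * L2_inner M w w)" for c
    unfolding N_def L2_inner_self[symmetric] using u w
    by (simp add: L2_inner_add_left L2_inner_add_right L2_inner_cmult_left L2_inner_cmult_right
          L2_cmult L2_add L2_inner_commute[of M w u] algebra_simps)
  show ?thesis
    using sum unfolding N by (simp add: algebra_simps)
qed

end

section \<open>Diagonal operators and their spectral measures\<close>

lemma summable_on_iff_integrable_count_space:
  fixes g :: "'i \<Rightarrow> real"
  assumes "\<And>i. g i \<ge> 0"
  shows "g summable_on UNIV \<longleftrightarrow> integrable (count_space UNIV) g"
proof -
  have "g summable_on UNIV \<longleftrightarrow> (\<lambda>i. norm (g i)) summable_on UNIV"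
    using assms by simp
  also have "\<dots> \<longleftrightarrow> integrable (count_space UNIV) g"
    unfolding abs_summable_equivalent abs_summable_on_def ..
  finally show ?thesis .
qed

lemma integral_count_space_eq_infsum:
  fixes g :: "'i \<Rightarrow> 'b::{banach, second_countable_topology}"
  assumes "integrable (count_space UNIV) g"
  shows "integral\<^sup>L (count_space UNIV) g = infsum g UNIV"
  using infsetsum_infsum[of g UNIV] assms
  by (simp add: abs_summable_on_def infsetsum_def)

lemma nn_integral_count_space_eq_infsum:
  fixes g :: "'i \<Rightarrow> real"
  assumes "\<And>i. g i \<ge> 0" "g summable_on UNIV"
  shows "(\<integral>\<^sup>+i. ennreal (g i) \<partial>count_space UNIV) = ennreal (infsum g UNIV)"
  using assms nn_integral_eq_integral[of "count_space UNIV" g]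
  by (simp add: summable_on_iff_integrable_count_space integral_count_space_eq_infsum)

lemma summable_on_iff_nn_integral_count_space:
  fixes g :: "'i \<Rightarrow> real"
  assumes "\<And>i. g i \<ge> 0"
  shows "g summable_on UNIV \<longleftrightarrow> (\<integral>\<^sup>+i. ennreal (g i) \<partial>count_space UNIV) < \<infinity>"
  using assms by (subst summable_on_iff_integrable_count_space) (auto simp: integrable_iff_bounded)

lemma has_sum_single:
  assumes "\<And>k. k \<noteq> i \<Longrightarrow> f k = 0"
  shows "(f has_sum f i) UNIV"
  by (rule has_sum_cong_neutral[THEN iffD1, OF _ _ _ has_sum_finiteI[of "{i}" _ f]])
     (use assms in auto)

context L2_basis
begin

text \<open>
  Membership of \<open>g\<close> in \<open>L\<^sup>2\<close> imposes the maximal domain, on which the operator is self-adjoint.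
\<close>

definition diag_op :: "('i \<Rightarrow> real) \<Rightarrow> 'a L2_operator" where
  "diag_op l = {(u, g). u \<in> L2 M \<and> g \<in> L2 M \<and> (\<forall>i. coef g i = of_real (l i) * coef u i)}"

text \<open>
  The family \<open>E\<close> acts as the spectral projections of \<open>diag_op l\<close> do.
\<close>

definition diagonalizes :: "(real set \<Rightarrow> ('a \<Rightarrow> complex) \<Rightarrow> 'a \<Rightarrow> complex) \<Rightarrow> ('i \<Rightarrow> real) \<Rightarrow> bool" where
  "diagonalizes E l \<longleftrightarrow> (\<forall>B\<in>sets borel. \<forall>f\<in>L2 M. E B f \<in> L2 M \<and>
     (\<forall>i. coef (E B f) i = (if l i \<in> B then coef f i else 0)))"

text \<open>
  The scalar spectral measure of \<open>f\<close>: a point mass \<open>\<bar>coef f i\<bar>\<^sup>2\<close> at \<open>l i\<close> for every \<open>i\<close>.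
\<close>

definition weight :: "('i \<Rightarrow> real) \<Rightarrow> ('a \<Rightarrow> complex) \<Rightarrow> real measure" where
  "weight l f = distr (density (count_space UNIV) (\<lambda>i. ennreal ((norm (coef f i))\<^sup>2))) borel l"

lemma sets_weight [simp, measurable_cong]: "sets (weight l f) = sets borel"
  and space_weight [simp]: "space (weight l f) = UNIV"
  by (simp_all add: weight_def)

lemma emeasure_weight:
  assumes E: "diagonalizes E l" and f: "f \<in> L2 M" and B: "B \<in> sets borel"
  shows "emeasure (weight l f) B = ennreal (Re (L2_inner M (E B f) f))"
proof -
  have EB: "E B f \<in> L2 M" "\<And>i. coef (E B f) i = (if l i \<in> B then coef f i else 0)"
    using E f B by (auto simp: diagonalizes_def)
  let ?g = "\<lambda>i. if l i \<in> B then (norm (coef f i))\<^sup>2 else 0"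
  have "((\<lambda>i. Re (coef (E B f) i * cnj (coef f i))) has_sum Re (L2_inner M (E B f) f)) UNIV"
    by (intro has_sum_Re Parseval EB f)
  also have "(\<lambda>i. Re (coef (E B f) i * cnj (coef f i))) = ?g"
    by (rule ext) (auto simp: EB complex_mult_cnj cmod_power2 simp flip: power2_eq_square)
  finally have sum: "(?g has_sum Re (L2_inner M (E B f) f)) UNIV" .
  have "emeasure (weight l f) B
      = (\<integral>\<^sup>+i. ennreal ((norm (coef f i))\<^sup>2) * indicator (l -` B) i \<partial>count_space UNIV)"
    using B by (simp add: weight_def emeasure_distr emeasure_density)
  also have "\<dots> = (\<integral>\<^sup>+i. ennreal (?g i) \<partial>count_space UNIV)"
    by (rule nn_integral_cong) (auto simp: indicator_def)
  also have "\<dots> = ennreal (infsum ?g UNIV)"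
    using sum by (intro nn_integral_count_space_eq_infsum) (auto intro: has_sum_imp_summable)
  finally show ?thesis
    using infsumI[OF sum] by simp
qed

lemma scalar_spectral_measure_eq_weight:
  assumes "diagonalizes E l" "f \<in> L2 M"
  shows "scalar_spectral_measure M E f = weight l f"
proof -
  have "scalar_spectral_measure M E f = measure_of UNIV (sets borel) (emeasure (weight l f))"
    unfolding scalar_spectral_measure_def
    by (rule measure_of_eq)
       (use sets.sigma_sets_eq[of "borel :: real measure"] in \<open>auto simp: emeasure_weight[OF assms]\<close>)
  also have "\<dots> = weight l f"
    using measure_of_of_measure[of "weight l f"] by simp
  finally show ?thesis .
qed

lemma spectral_integral_dom_diagonal:
  assumes E: "diagonalizes E l" and \<phi> [measurable]: "\<phi> \<in> borel_measurable borel"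
  shows "spectral_integral_dom M E \<phi>
           = {f \<in> L2 M. (\<lambda>i. (\<phi> (l i))\<^sup>2 * (norm (coef f i))\<^sup>2) summable_on UNIV}"
proof -
  have "(\<integral>\<^sup>+ t. ennreal ((\<phi> t)\<^sup>2) \<partial>scalar_spectral_measure M E f) < \<infinity>
      \<longleftrightarrow> (\<lambda>i. (\<phi> (l i))\<^sup>2 * (norm (coef f i))\<^sup>2) summable_on UNIV" if f: "f \<in> L2 M" for f
  proof -
    have "(\<integral>\<^sup>+ t. ennreal ((\<phi> t)\<^sup>2) \<partial>scalar_spectral_measure M E f)
        = (\<integral>\<^sup>+ i. ennreal ((\<phi> (l i))\<^sup>2) \<partial>density (count_space UNIV) (\<lambda>i. ennreal ((norm (coef f i))\<^sup>2)))"
      unfolding scalar_spectral_measure_eq_weight[OF E f] weight_def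
      by (rule nn_integral_distr) auto
    also have "\<dots> = (\<integral>\<^sup>+ i. ennreal ((norm (coef f i))\<^sup>2) * ennreal ((\<phi> (l i))\<^sup>2) \<partial>count_space UNIV)"
      by (rule nn_integral_density) auto
    also have "\<dots> = (\<integral>\<^sup>+ i. ennreal ((\<phi> (l i))\<^sup>2 * (norm (coef f i))\<^sup>2) \<partial>count_space UNIV)"
      by (rule nn_integral_cong) (simp add: ennreal_mult' mult.commute)
    finally show ?thesis
      by (simp add: summable_on_iff_nn_integral_count_space)
  qed
  then show ?thesis
    by (auto simp: spectral_integral_dom_def)
qed

text \<open>From \<open>\<bar>x\<bar> \<le> x\<^sup>2 + 1\<close>.\<close>

lemma weighted_summable:
  assumes f: "f \<in> L2 M" and s: "(\<lambda>i. (\<psi> i)\<^sup>2 * (norm (coef f i))\<^sup>2) summable_on UNIV"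
  shows "(\<lambda>i. \<bar>\<psi> i\<bar> * (norm (coef f i))\<^sup>2) summable_on UNIV"
proof (rule summable_on_comparison_test)
  show "(\<lambda>i. (\<psi> i)\<^sup>2 * (norm (coef f i))\<^sup>2 + (norm (coef f i))\<^sup>2) summable_on UNIV"
    by (intro summable_on_add s coef_summable f)
  have "\<bar>\<psi> i\<bar> \<le> (\<psi> i)\<^sup>2 + 1" for i
    using sum_squares_bound[of "\<bar>\<psi> i\<bar>" 1] by simp
  then have "\<bar>\<psi> i\<bar> * (norm (coef f i))\<^sup>2 \<le> ((\<psi> i)\<^sup>2 + 1) * (norm (coef f i))\<^sup>2" for i
    by (intro mult_right_mono) auto
  then show "\<bar>\<psi> i\<bar> * (norm (coef f i))\<^sup>2 \<le> (\<psi> i)\<^sup>2 * (norm (coef f i))\<^sup>2 + (norm (coef f i))\<^sup>2" for i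
    by (simp add: ring_distribs)
qed auto

lemma weighted_has_sum:
  assumes E: "diagonalizes E l" and \<phi> [measurable]: "\<phi> \<in> borel_measurable borel"
    and f: "f \<in> spectral_integral_dom M E \<phi>"
  shows "((\<lambda>i. \<phi> (l i) * (norm (coef f i))\<^sup>2) has_sum (\<integral>t. \<phi> t \<partial>scalar_spectral_measure M E f)) UNIV"
proof -
  have fL2: "f \<in> L2 M" and s: "(\<lambda>i. (\<phi> (l i))\<^sup>2 * (norm (coef f i))\<^sup>2) summable_on UNIV"
    using f by (auto simp: spectral_integral_dom_diagonal[OF E])
  have abs: "(\<lambda>i. norm (\<phi> (l i) * (norm (coef f i))\<^sup>2)) summable_on UNIV"
    using weighted_summable[OF fL2 s] by (simp add: abs_mult)
  then have int: "integrable (count_space UNIV) (\<lambda>i. \<phi> (l i) * (norm (coef f i))\<^sup>2)"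
    unfolding abs_summable_equivalent abs_summable_on_def .
  have "(\<integral>t. \<phi> t \<partial>scalar_spectral_measure M E f)
      = (\<integral>i. \<phi> (l i) \<partial>density (count_space UNIV) (\<lambda>i. ennreal ((norm (coef f i))\<^sup>2)))"
    unfolding scalar_spectral_measure_eq_weight[OF E fL2] weight_def
    by (rule integral_distr) auto
  also have "\<dots> = (\<integral>i. (norm (coef f i))\<^sup>2 *\<^sub>R \<phi> (l i) \<partial>count_space UNIV)"
    by (rule integral_density) auto
  also have "\<dots> = (\<Sum>\<^sub>\<infinity>i. \<phi> (l i) * (norm (coef f i))\<^sup>2)"
    using int by (simp add: integral_count_space_eq_infsum mult.commute)
  finally show ?thesis
    using has_sum_infsum[OF abs_summable_summable[OF abs]] by simp
qed

lemma spectral_integral_dom_add_cmult: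
  assumes E: "diagonalizes E l" and \<phi> [measurable]: "\<phi> \<in> borel_measurable borel"
    and "f \<in> spectral_integral_dom M E \<phi>" "u \<in> spectral_integral_dom M E \<phi>"
  shows "(\<lambda>x. f x + c * u x) \<in> spectral_integral_dom M E \<phi>"
proof -
  have L: "f \<in> L2 M" "u \<in> L2 M"
    and s: "(\<lambda>i. (\<phi> (l i))\<^sup>2 * (norm (coef f i))\<^sup>2) summable_on UNIV"
      "(\<lambda>i. (\<phi> (l i))\<^sup>2 * (norm (coef u i))\<^sup>2) summable_on UNIV"
    using assms by (auto simp: spectral_integral_dom_diagonal[OF E])
  have "(\<lambda>i. (\<phi> (l i))\<^sup>2 * (norm (coef f i + c * coef u i))\<^sup>2) summable_on UNIV"
  proof (rule summable_on_comparison_test)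
    show "(\<lambda>i. 2 * ((\<phi> (l i))\<^sup>2 * (norm (coef f i))\<^sup>2) + 2 * (norm c)\<^sup>2 * ((\<phi> (l i))\<^sup>2 * (norm (coef u i))\<^sup>2)) summable_on UNIV"
      by (intro summable_on_add summable_on_cmult_right s)
    fix i
    have "(norm (coef f i + c * coef u i))\<^sup>2 \<le> (norm (coef f i) + norm (c * coef u i))\<^sup>2"
      by (intro power_mono norm_triangle_ineq) auto
    also have "\<dots> \<le> 2 * (norm (coef f i))\<^sup>2 + 2 * (norm (c * coef u i))\<^sup>2"
      using sum_squares_bound[of "norm (coef f i)" "norm (c * coef u i)"] by (simp add: power2_sum)
    finally have "(\<phi> (l i))\<^sup>2 * (norm (coef f i + c * coef u i))\<^sup>2
        \<le> (\<phi> (l i))\<^sup>2 * (2 * (norm (coef f i))\<^sup>2 + 2 * (norm (c * coef u i))\<^sup>2)"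
      by (intro mult_left_mono) auto
    then show "(\<phi> (l i))\<^sup>2 * (norm (coef f i + c * coef u i))\<^sup>2
        \<le> 2 * ((\<phi> (l i))\<^sup>2 * (norm (coef f i))\<^sup>2) + 2 * (norm c)\<^sup>2 * ((\<phi> (l i))\<^sup>2 * (norm (coef u i))\<^sup>2)"
      by (simp add: norm_mult power_mult_distrib algebra_simps)
  qed auto
  then show ?thesis
    using L by (simp add: spectral_integral_dom_diagonal[OF E] L2_add L2_cmult coef_add coef_cmult)
qed

lemma polarized_spectral_integral:
  assumes E: "diagonalizes E l" and \<phi> [measurable]: "\<phi> \<in> borel_measurable borel"
    and f: "f \<in> spectral_integral_dom M E \<phi>" and u: "u \<in> spectral_integral_dom M E \<phi>"
  defines "I \<equiv> (\<lambda>c. complex_of_real (\<integral>t. \<phi> t \<partial>scalar_spectral_measure M E (\<lambda>x. f x + c * u x)))"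
  shows "((\<lambda>i. of_real (\<phi> (l i)) * coef f i * cnj (coef u i)) has_sum
            (I 1 - I (- 1) + \<i> * I \<i> - \<i> * I (- \<i>)) / 4) UNIV"
proof -
  have L: "f \<in> L2 M" "u \<in> L2 M"
    using f u by (auto simp: spectral_integral_dom_diagonal[OF E])
  have sums: "((\<lambda>i. complex_of_real (\<phi> (l i) * (norm (coef f i + c * coef u i))\<^sup>2)) has_sum I c) UNIV" for c
    unfolding I_def
    using has_sum_of_real[OF weighted_has_sum[OF E \<phi> spectral_integral_dom_add_cmult[OF E \<phi> f u, of c]],
        where ?'a = complex] L
    by (simp add: coef_add coef_cmult L2_cmult)
  let ?s = "\<lambda>i c. complex_of_real (\<phi> (l i) * (norm (coef f i + c * coef u i))\<^sup>2)"
  have "((\<lambda>i. (?s i 1 - ?s i (- 1) + \<i> * ?s i \<i> - \<i> * ?s i (- \<i>)) * (1 / 4)) has_sum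
          (I 1 - I (- 1) + \<i> * I \<i> - \<i> * I (- \<i>)) * (1 / 4)) UNIV"
    by (intro has_sum_cmult_left has_sum_cmult_right has_sum_add has_sum_diff sums)
  moreover have "(?s i 1 - ?s i (- 1) + \<i> * ?s i \<i> - \<i> * ?s i (- \<i>)) * (1 / 4)
      = of_real (\<phi> (l i)) * coef f i * cnj (coef u i)" for i
    unfolding mult.assoc complex_polarization[of "coef f i" "coef u i"]
    by (simp add: algebra_simps)
  ultimately show ?thesis
    by simp
qed

text \<open>
  The spectral integrals are sums over the basis (\<open>weighted_has_sum\<close>), and polarization turns the defining
  condition into \<open>\<langle>g, u\<rangle> = \<Sum>\<^sub>i \<phi>(l i) f\<^sub>i cnj u\<^sub>i\<close>. Basis vectors for \<open>u\<close> recover the coefficients of \<open>g\<close>.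
\<close>

lemma spectral_integral_diagonal:
  assumes E: "diagonalizes E l" and \<phi> [measurable]: "\<phi> \<in> borel_measurable borel"
  shows "spectral_integral M E \<phi> = diag_op (\<lambda>i. \<phi> (l i))"
proof (intro set_eqI iffI; safe)
  fix f g
  assume fg: "(f, g) \<in> spectral_integral M E \<phi>"
  then have f: "f \<in> spectral_integral_dom M E \<phi>" and g: "g \<in> L2 M"
    by (auto simp: spectral_integral_def)
  have fL2: "f \<in> L2 M"
    using f by (auto simp: spectral_integral_dom_diagonal[OF E])
  have "coef g i = of_real (\<phi> (l i)) * coef f i" for i
  proof -
    have ei: "e i \<in> spectral_integral_dom M E \<phi>"
      using has_sum_single[of i "\<lambda>k. (\<phi> (l k))\<^sup>2 * (norm (coef (e i) k))\<^sup>2"]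
      by (auto simp: spectral_integral_dom_diagonal[OF E] coef_basis intro: has_sum_imp_summable)
    have "((\<lambda>k. of_real (\<phi> (l k)) * coef f k * cnj (coef (e i) k)) has_sum coef g i) UNIV"
    proof -
      have "coef g i = (I 1 - I (- 1) + \<i> * I \<i> - \<i> * I (- \<i>)) / 4"
        if "I = (\<lambda>c. complex_of_real (\<integral>t. \<phi> t \<partial>scalar_spectral_measure M E (\<lambda>x. f x + c * e i x)))" for I
        using fg ei that by (simp only: spectral_integral_def Let_def mem_Collect_eq split)
      then show ?thesis
        using polarized_spectral_integral[OF E \<phi> f ei] by metis
    qed
    moreover have "((\<lambda>k. of_real (\<phi> (l k)) * coef f k * cnj (coef (e i) k)) has_sum
        of_real (\<phi> (l i)) * coef f i * cnj (coef (e i) i)) UNIV"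
      by (rule has_sum_single) (simp add: coef_basis)
    ultimately show ?thesis
      using has_sum_unique by (fastforce simp: coef_basis)
  qed
  then show "(f, g) \<in> diag_op (\<lambda>i. \<phi> (l i))"
    using fL2 g by (simp add: diag_op_def)
next
  fix f g
  assume "(f, g) \<in> diag_op (\<lambda>i. \<phi> (l i))"
  then have fL2: "f \<in> L2 M" and g: "g \<in> L2 M" and fg: "\<And>i. coef g i = of_real (\<phi> (l i)) * coef f i"
    by (auto simp: diag_op_def)
  have f: "f \<in> spectral_integral_dom M E \<phi>"
    using coef_summable[OF g] fL2
    by (simp add: spectral_integral_dom_diagonal[OF E] fg norm_mult power_mult_distrib)
  have "L2_inner M g u = (I 1 - I (- 1) + \<i> * I \<i> - \<i> * I (- \<i>)) / 4"
    if u: "u \<in> spectral_integral_dom M E \<phi>"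
      and I: "I = (\<lambda>c. complex_of_real (\<integral>t. \<phi> t \<partial>scalar_spectral_measure M E (\<lambda>x. f x + c * u x)))" for u I
  proof -
    have "u \<in> L2 M"
      using u by (simp add: spectral_integral_dom_diagonal[OF E])
    then have "((\<lambda>i. of_real (\<phi> (l i)) * coef f i * cnj (coef u i)) has_sum L2_inner M g u) UNIV"
      using Parseval[OF g, of u] by (simp add: fg)
    then show ?thesis
      using polarized_spectral_integral[OF E \<phi> f u] unfolding I by (rule has_sum_unique)
  qed
  then show "(f, g) \<in> spectral_integral M E \<phi>"
    using f g by (simp add: spectral_integral_def Let_def)
qed

lemma ex_projection_valued_measure:
  "\<exists>E. projection_valued_measure M E \<and> diagonalizes E l"
proof -
  define E where "E B f = (SOME g. g \<in> L2 M \<and> (\<forall>i. coef g i = (if l i \<in> B then coef f i else 0)))"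
    for B f
  have E: "E B f \<in> L2 M \<and> (\<forall>i. coef (E B f) i = (if l i \<in> B then coef f i else 0))"
    if "f \<in> L2 M" for B f
    unfolding E_def
  proof (rule someI_ex[of "\<lambda>g. g \<in> L2 M \<and> (\<forall>i. coef g i = (if l i \<in> B then coef f i else 0))"])
    have "(\<lambda>i. (norm (if l i \<in> B then coef f i else 0))\<^sup>2) summable_on UNIV"
      by (rule summable_on_comparison_test[OF coef_summable[OF that]]) auto
    from Riesz_Fischer[OF this]
    show "\<exists>g. g \<in> L2 M \<and> (\<forall>i. coef g i = (if l i \<in> B then coef f i else 0))"
      by blast
  qed
  then have E_L2: "f \<in> L2 M \<Longrightarrow> E B f \<in> L2 M"
    and E_coef: "f \<in> L2 M \<Longrightarrow> coef (E B f) i = (if l i \<in> B then coef f i else 0)" for f B i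
    by auto
  have diag: "diagonalizes E l"
    using E by (auto simp: diagonalizes_def)
  have "orthogonal_projector M (E B)" for B
    unfolding orthogonal_projector_def
  proof (intro conjI ballI allI)
    fix f g assume f: "f \<in> L2 M" and g: "g \<in> L2 M"
    have "((\<lambda>i. coef (E B f) i * cnj (coef g i)) has_sum L2_inner M (E B f) g) UNIV"
      by (intro Parseval E_L2 f g)
    moreover have "((\<lambda>i. coef f i * cnj (coef (E B g) i)) has_sum L2_inner M f (E B g)) UNIV"
      by (intro Parseval E_L2 f g)
    moreover have "(\<lambda>i. coef (E B f) i * cnj (coef g i)) = (\<lambda>i. coef f i * cnj (coef (E B g) i))"
      by (auto simp: E_coef f g)
    ultimately show "L2_inner M (E B f) g = L2_inner M f (E B g)"
      using has_sum_unique by fastforce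
  qed (auto intro!: eq_AE_if_coef_eq E_L2 L2_add L2_cmult
         simp: E_coef coef_add coef_cmult L2_add L2_cmult E_L2)
  moreover have "measure_space UNIV (sets borel) (\<lambda>B. ennreal (Re (L2_inner M (E B f) f)))"
    if f: "f \<in> L2 M" for f
  proof -
    have *: "emeasure (weight l f) B = ennreal (Re (L2_inner M (E B f) f))" if "B \<in> sets borel" for B
      by (rule emeasure_weight[OF diag f that])
    have "measure_space UNIV (sets borel) (emeasure (weight l f))"
      using measure_space[of "weight l f"] by simp
    then have "sigma_algebra (UNIV :: real set) (sets borel)" "positive (sets borel) (emeasure (weight l f))"
      "countably_additive (sets borel) (emeasure (weight l f))"
      by (auto simp: measure_space_def)
    moreover from this(2,3) have "positive (sets borel) (\<lambda>B. ennreal (Re (L2_inner M (E B f) f)))"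
      "countably_additive (sets borel) (\<lambda>B. ennreal (Re (L2_inner M (E B f) f)))"
      by (auto simp: positive_def countably_additive_def * subset_iff image_subset_iff simp flip: *)
    ultimately show ?thesis
      by (simp add: measure_space_def)
  qed
  ultimately have "projection_valued_measure M E"
    unfolding projection_valued_measure_def
    by (auto intro!: eq_AE_if_coef_eq E_L2 simp: E_coef E_L2)
  with diag show ?thesis by blast
qed

end

subsection \<open>Uniqueness of the spectral measure\<close>

context L2_basis
begin

lemma projector_commute:
  assumes "orthogonal_projector M P" "f \<in> L2 M" "g \<in> L2 M"
  shows "L2_inner M (P f) g = L2_inner M f (P g)"
  using assms by (auto simp: orthogonal_projector_def)

lemma projector_L2: "orthogonal_projector M P \<Longrightarrow> f \<in> L2 M \<Longrightarrow> P f \<in> L2 M"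
  by (auto simp: orthogonal_projector_def)

lemma projector_inner_add_cmult:
  assumes P: "orthogonal_projector M P" and f: "f \<in> L2 M" and g: "g \<in> L2 M" and u: "u \<in> L2 M"
  shows "L2_inner M (P (\<lambda>x. a * f x + c * g x)) u = a * L2_inner M (P f) u + c * L2_inner M (P g) u"
  using P f g u
  by (simp add: projector_commute L2_add L2_cmult L2_inner_add_left L2_inner_cmult_left projector_L2)

text \<open>
  Multiplying \<open>f\<close> by the projection onto \<open>B\<close> restricts its spectral measure to \<open>B\<close>; hence the measure of
  a combination of \<open>f\<close> and \<open>E B f\<close> has a density that is constant on \<open>B\<close> and on its complement.
\<close>

lemma scalar_spectral_measure_combination:
  assumes E: "projection_valued_measure M E" and f: "f \<in> L2 M" and B: "B \<in> sets borel"
  shows "scalar_spectral_measure M E (\<lambda>x. a * f x + c * E B f x)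
           = density (scalar_spectral_measure M E f)
               (\<lambda>t. ennreal (if t \<in> B then (norm (a + c))\<^sup>2 else (norm a)\<^sup>2))"
proof -
  have P: "orthogonal_projector M (E A)" if "A \<in> sets borel" for A
    using E that by (auto simp: projection_valued_measure_def)
  have EL: "E A u \<in> L2 M" if "A \<in> sets borel" "u \<in> L2 M" for A u
    using projector_L2[OF P] that .
  have inter: "L2_inner M (E A (E A' u)) w = L2_inner M (E (A \<inter> A') u) w"
    if "A \<in> sets borel" "A' \<in> sets borel" "u \<in> L2 M" "w \<in> L2 M" for A A' u w
  proof (rule L2_inner_cong_AE)
    have "AE x in M. E (A \<inter> A') u x = E A (E A' u) x"
      using E that by (auto simp: projection_valued_measure_def)
    then show "AE x in M. E A (E A' u) x = E (A \<inter> A') u x"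
      by eventually_elim simp
  qed (use that EL in \<open>auto intro!: L2_measurable\<close>)
  have ms: "measure_space UNIV (sets borel) (\<lambda>B. ennreal (Re (L2_inner M (E B u) u)))"
    if "u \<in> L2 M" for u
    using E that by (auto simp: projection_valued_measure_def)
  have em: "emeasure (scalar_spectral_measure M E u) A = ennreal (Re (L2_inner M (E A u) u))"
    if "u \<in> L2 M" "A \<in> sets borel" for u A
    using ms[OF that(1)] that(2) sets.sigma_sets_eq[of "borel :: real measure"]
    by (auto simp: scalar_spectral_measure_def measure_space_def emeasure_measure_of_sigma)
  let ?u = "\<lambda>x. a * f x + c * E B f x"
  have u: "?u \<in> L2 M"
    by (intro L2_add L2_cmult f EL B)
  define m where "m A = L2_inner M (E A f) f" for A
  have m_sq: "m A = of_real ((L2_norm M (E A f))\<^sup>2)" if "A \<in> sets borel" for A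
    using projector_commute[OF P[OF that] EL[OF that f] f] inter[OF that that f f]
    unfolding m_def L2_inner_self[symmetric] by simp
  have nonneg: "Re (m A) \<ge> 0" if "A \<in> sets borel" for A
    using m_sq[OF that] by simp
  have inner: "L2_inner M (E A ?u) ?u
      = a * cnj a * m A + (a * cnj c + cnj a * c + c * cnj c) * m (A \<inter> B)" if A: "A \<in> sets borel" for A
  proof -
    have AB: "A \<inter> B \<in> sets borel" and BA: "B \<inter> A \<in> sets borel" "B \<inter> (A \<inter> B) \<in> sets borel"
      using A B by auto
    have 1: "L2_inner M (E A f) (E B f) = m (A \<inter> B)"
      using projector_commute[OF P[OF B] EL[OF A f] f] inter[OF B A f f]
      by (simp add: m_def Int_commute)
    have 2: "L2_inner M (E A (E B f)) f = m (A \<inter> B)"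
      using inter[OF A B f f] by (simp add: m_def)
    have "L2_inner M (E (A \<inter> B) f) (E B f) = m (A \<inter> B)"
      using projector_commute[OF P[OF B] EL[OF AB f] f] inter[OF B AB f f]
      by (simp add: m_def Int_commute Int_left_commute)
    then have 3: "L2_inner M (E A (E B f)) (E B f) = m (A \<inter> B)"
      using inter[OF A B f EL[OF B f]] by simp
    show ?thesis
      unfolding projector_inner_add_cmult[OF P[OF A] f EL[OF B f] u]
      by (simp add: L2_inner_add_right L2_inner_cmult_right L2_cmult f EL A B 1 2 3 algebra_simps
            flip: m_def)
  qed
  show ?thesis
  proof (rule measure_eqI)
    fix A :: "real set"
    assume "A \<in> sets (scalar_spectral_measure M E ?u)"
    then have A: "A \<in> sets borel"
      using sets.sigma_sets_eq[of "borel :: real measure"]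
      by (simp add: scalar_spectral_measure_def)
    have AB: "A \<inter> B \<in> sets borel" "A - B \<in> sets borel"
      using A B by auto
    let ?\<mu> = "scalar_spectral_measure M E f"
    have sets: "sets ?\<mu> = sets borel"
      using sets.sigma_sets_eq[of "borel :: real measure"]
      by (simp add: scalar_spectral_measure_def)
    have "ennreal (Re (m A)) = ennreal (Re (m (A \<inter> B))) + ennreal (Re (m (A - B)))"
      using plus_emeasure[of "A \<inter> B" ?\<mu> "A - B"] AB A sets
      by (simp add: em f m_def Int_Diff_Un Int_Diff_disjoint)
    then have split: "Re (m A) = Re (m (A \<inter> B)) + Re (m (A - B))"
      using nonneg A AB by (simp flip: ennreal_plus)
    have imm: "Im (m A') = 0" if "A' \<in> sets borel" for A'
      using m_sq[OF that] by simp
    have "Re (L2_inner M (E A ?u) ?u) = (norm (a + c))\<^sup>2 * Re (m (A \<inter> B)) + (norm a)\<^sup>2 * Re (m (A - B))"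
    proof -
      have "Re (L2_inner M (E A ?u) ?u)
          = (norm a)\<^sup>2 * Re (m A) + ((norm (a + c))\<^sup>2 - (norm a)\<^sup>2) * Re (m (A \<inter> B))"
        unfolding inner[OF A] cmod_power2 using imm[OF A] imm[OF AB(1)]
        by (simp add: power2_eq_square algebra_simps)
      then show ?thesis
        unfolding split by (simp add: algebra_simps)
    qed
    then have "emeasure (scalar_spectral_measure M E ?u) A
        = ennreal ((norm (a + c))\<^sup>2) * emeasure ?\<mu> (A \<inter> B) + ennreal ((norm a)\<^sup>2) * emeasure ?\<mu> (A - B)"
      using nonneg[OF AB(1)] nonneg[OF AB(2)]
      by (simp add: em u f A AB ennreal_plus ennreal_mult flip: m_def)
    also have "\<dots> = (\<integral>\<^sup>+t. ennreal ((norm (a + c))\<^sup>2) * indicator (A \<inter> B) t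
          + ennreal ((norm a)\<^sup>2) * indicator (A - B) t \<partial>?\<mu>)"
      using AB sets by (subst nn_integral_add) (auto simp: nn_integral_cmult_indicator)
    also have "\<dots> = (\<integral>\<^sup>+t. ennreal (if t \<in> B then (norm (a + c))\<^sup>2 else (norm a)\<^sup>2) * indicator A t \<partial>?\<mu>)"
      by (rule nn_integral_cong) (auto simp: indicator_def)
    also have "\<dots> = emeasure (density ?\<mu> (\<lambda>t. ennreal (if t \<in> B then (norm (a + c))\<^sup>2 else (norm a)\<^sup>2))) A"
      using A B sets
      by (subst emeasure_density) (auto simp: measurable_cong_sets[OF sets refl])
    finally show "emeasure (scalar_spectral_measure M E ?u) A
        = emeasure (density ?\<mu> (\<lambda>t. ennreal (if t \<in> B then (norm (a + c))\<^sup>2 else (norm a)\<^sup>2))) A" .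
  qed (simp add: scalar_spectral_measure_def)
qed

text \<open>
  A basis vector \<open>e i\<close> is an eigenvector, so \<open>\<integral>\<^sub>B (t - l i) d\<langle>E(t) e i, e i\<rangle> = 0\<close> for every Borel set \<open>B\<close>. Taking
  \<open>B\<close> to be the two half lines on either side of \<open>l i\<close> shows that the measure is concentrated at \<open>l i\<close>.
  Thus the projections act on the basis as they must, and the spectral measure is unique.
\<close>

lemma spectral_measure_diagonalizes:
  assumes E: "projection_valued_measure M E"
    and T: "diag_op l = spectral_integral M E (\<lambda>t. t)"
  shows "diagonalizes E l"
proof -
  have P: "orthogonal_projector M (E A)" if "A \<in> sets borel" for A
    using E that by (auto simp: projection_valued_measure_def)
  have EL: "E A u \<in> L2 M" if "A \<in> sets borel" "u \<in> L2 M" for A u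
    using projector_L2[OF P] that .
  have eig: "coef (E A f) i = (if l i \<in> A then coef f i else 0)"
    if A: "A \<in> sets borel" and f: "f \<in> L2 M" for A f i
  proof -
    define \<mu> where "\<mu> = scalar_spectral_measure M E (e i)"
    have sets [measurable_cong]: "sets \<mu> = sets borel"
      using sets.sigma_sets_eq[of "borel :: real measure"]
      by (simp add: scalar_spectral_measure_def \<mu>_def)
    have ms: "measure_space UNIV (sets borel) (\<lambda>B. ennreal (Re (L2_inner M (E B (e i)) (e i))))"
      using E by (auto simp: projection_valued_measure_def)
    have em: "emeasure \<mu> B = ennreal (Re (L2_inner M (E B (e i)) (e i)))" if "B \<in> sets borel" for B
      using ms that sets.sigma_sets_eq[of "borel :: real measure"]
      by (auto simp: scalar_spectral_measure_def measure_space_def emeasure_measure_of_sigma \<mu>_def)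
    have sq: "L2_inner M (E B (e i)) (e i) = of_real ((L2_norm M (E B (e i)))\<^sup>2)"
      if B: "B \<in> sets borel" for B
    proof -
      have "L2_inner M (E B (E B (e i))) (e i) = L2_inner M (E B (e i)) (e i)"
      proof (rule L2_inner_cong_AE)
        have "AE x in M. E (B \<inter> B) (e i) x = E B (E B (e i)) x"
          using E B basis_L2 unfolding projection_valued_measure_def by blast
        then show "AE x in M. E B (E B (e i)) x = E B (e i) x"
          by eventually_elim simp
      qed (use B EL in \<open>auto intro!: L2_measurable\<close>)
      then show ?thesis
        using projector_commute[OF P[OF B] EL[OF B basis_L2] basis_L2]
        unfolding L2_inner_self[symmetric] by simp
    qed
    have "space \<mu> = UNIV"
      by (simp add: scalar_spectral_measure_def \<mu>_def)
    then interpret finite_measure \<mu>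
      by (intro finite_measureI) (simp add: em)
    have meas: "measure \<mu> B = (L2_norm M (E B (e i)))\<^sup>2" if "B \<in> sets borel" for B
      using em[OF that] sq[OF that] by (simp add: measure_def)
    have "(e i, \<lambda>x. of_real (l i) * e i x) \<in> diag_op l"
      by (auto simp: diag_op_def L2_cmult coef_cmult coef_basis)
    then have "(e i, \<lambda>x. of_real (l i) * e i x) \<in> spectral_integral M E (\<lambda>t. t)"
      using T by simp
    then have dom: "(\<integral>\<^sup>+t. ennreal (t\<^sup>2) \<partial>\<mu>) < \<infinity>"
      and inner: "\<And>u I. u \<in> spectral_integral_dom M E (\<lambda>t. t) \<Longrightarrow>
        I = (\<lambda>c. complex_of_real (\<integral>t. t \<partial>scalar_spectral_measure M E (\<lambda>x. e i x + c * u x))) \<Longrightarrow>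
        of_real (l i) * L2_inner M (e i) u = (I 1 - I (- 1) + \<i> * I \<i> - \<i> * I (- \<i>)) / 4"
      by (auto simp: spectral_integral_def spectral_integral_dom_def \<mu>_def L2_inner_cmult_left)
    have "integrable \<mu> (\<lambda>t. t\<^sup>2)"
      using dom by (intro integrableI_nonneg) auto
    then have int: "integrable \<mu> (\<lambda>t. t)"
      by (rule square_integrable_imp_integrable[rotated]) simp
    have main: "(\<integral>t. t * indicator B t \<partial>\<mu>) = l i * measure \<mu> B" if B: "B \<in> sets borel" for B
    proof -
      have "E B (e i) \<in> spectral_integral_dom M E (\<lambda>t. t)"
      proof -
        have "(\<integral>\<^sup>+t. ennreal (t\<^sup>2) \<partial>scalar_spectral_measure M E (\<lambda>x. 0 * e i x + 1 * E B (e i) x))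
            \<le> (\<integral>\<^sup>+t. ennreal (t\<^sup>2) \<partial>\<mu>)"
          unfolding scalar_spectral_measure_combination[OF E basis_L2 B] \<mu>_def[symmetric]
          using B by (subst nn_integral_density) (auto intro!: nn_integral_mono)
        then show ?thesis
          using dom EL[OF B basis_L2] by (auto simp: spectral_integral_dom_def intro: le_less_trans)
      qed
      from inner[OF this refl]
      have eq: "of_real (l i) * L2_inner M (e i) (E B (e i)) = (I 1 - I (- 1) + \<i> * I \<i> - \<i> * I (- \<i>)) / 4"
        if "I = (\<lambda>c. complex_of_real (\<integral>t. t \<partial>scalar_spectral_measure M E (\<lambda>x. 1 * e i x + c * E B (e i) x)))" for I
        using that by simp
      have I: "(\<integral>t. t \<partial>scalar_spectral_measure M E (\<lambda>x. 1 * e i x + c * E B (e i) x))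
          = (\<integral>t. t \<partial>\<mu>) + ((norm (1 + c))\<^sup>2 - 1) * (\<integral>t. t * indicator B t \<partial>\<mu>)" for c
      proof -
        have intB: "integrable \<mu> (\<lambda>t. t * indicator B t)"
          using int B by (intro integrable_real_mult_indicator) (auto simp: sets)
        have "(\<integral>t. t \<partial>scalar_spectral_measure M E (\<lambda>x. 1 * e i x + c * E B (e i) x))
            = (\<integral>t. (if t \<in> B then (norm (1 + c))\<^sup>2 else (norm (1 :: complex))\<^sup>2) *\<^sub>R t \<partial>\<mu>)"
          unfolding scalar_spectral_measure_combination[OF E basis_L2 B] \<mu>_def[symmetric]
          using B by (subst integral_density) auto
        also have "\<dots> = (\<integral>t. t + ((norm (1 + c))\<^sup>2 - 1) * (t * indicator B t) \<partial>\<mu>)"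
          by (rule Bochner_Integration.integral_cong) (auto simp: indicator_def algebra_simps)
        also have "\<dots> = (\<integral>t. t \<partial>\<mu>) + ((norm (1 + c))\<^sup>2 - 1) * (\<integral>t. t * indicator B t \<partial>\<mu>)"
          using int intB by (subst Bochner_Integration.integral_add) auto
        finally show ?thesis .
      qed
      have "L2_inner M (e i) (E B (e i)) = of_real (measure \<mu> B)"
        using projector_commute[OF P[OF B] basis_L2 basis_L2, of i i] sq[OF B] meas[OF B] by simp
      then have "complex_of_real (l i * measure \<mu> B) = of_real (\<integral>t. t * indicator B t \<partial>\<mu>)"
        using eq[OF refl] unfolding I by (simp add: cmod_power2)
      then show ?thesis
        by (simp only: of_real_eq_iff)
    qed
    have null: "measure \<mu> B = 0" if B: "B \<in> sets borel" and
      side: "(\<forall>t\<in>B. t > l i) \<or> (\<forall>t\<in>B. t < l i)" for B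
    proof -
      have intB: "integrable \<mu> (\<lambda>t. t * indicator B t)" "integrable \<mu> (\<lambda>t. indicator B t :: real)"
        using int B by (auto intro!: integrable_real_mult_indicator simp: sets emeasure_eq_measure)
      have "(\<integral>t. (t - l i) * indicator B t \<partial>\<mu>) = (\<integral>t. t * indicator B t - l i * indicator B t \<partial>\<mu>)"
        by (simp add: algebra_simps)
      also have "\<dots> = 0"
        using intB B main[OF B] \<open>space \<mu> = UNIV\<close> by (simp add: sets)
      finally have 0: "(\<integral>t. (t - l i) * indicator B t \<partial>\<mu>) = 0" .
      have int': "integrable \<mu> (\<lambda>t. (t - l i) * indicator B t)"
        using intB by (simp add: left_diff_distrib)
      have "AE t in \<mu>. (t - l i) * indicator B t = 0"
        using side
      proof
        assume "\<forall>t\<in>B. t > l i"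
        then show ?thesis
          using 0 integral_nonneg_eq_0_iff_AE[OF int'] by (auto simp: indicator_def less_imp_le)
      next
        assume "\<forall>t\<in>B. t < l i"
        then show ?thesis
          using 0 integral_nonneg_eq_0_iff_AE[of \<mu> "\<lambda>t. - ((t - l i) * indicator B t)"] int'
          by (auto simp: indicator_def less_imp_le)
      qed
      then have "AE t in \<mu>. t \<notin> B"
        by eventually_elim (use side in \<open>auto simp: indicator_def split: if_splits\<close>)
      then show ?thesis
        using B \<open>space \<mu> = UNIV\<close> by (simp add: AE_iff_measurable[OF _ refl] sets measure_def)
    qed
    have conc: "measure \<mu> (- {l i}) = 0"
    proof -
      have "measure \<mu> ({l i<..} \<union> {..<l i}) \<le> measure \<mu> {l i<..} + measure \<mu> {..<l i}"
        by (rule measure_Un_le) (auto simp: sets)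
      also have "\<dots> = 0"
        by (simp add: null)
      also have "{l i<..} \<union> {..<l i} = - {l i}"
        by auto
      finally show ?thesis
        by (simp add: measure_le_0_iff)
    qed
    have "L2_inner M (E A f) (e i) = L2_inner M f (E A (e i))"
      by (rule projector_commute[OF P[OF A] f basis_L2])
    also have "\<dots> = (if l i \<in> A then coef f i else 0)"
    proof (cases "l i \<in> A")
      case False
      then have "measure \<mu> A \<le> measure \<mu> (- {l i})"
        using A by (intro finite_measure_mono) (auto simp: sets)
      then have "(L2_norm M (E A (e i)))\<^sup>2 = 0"
        using conc meas[OF A] by simp
      from L2_norm_square_eq_0[OF EL[OF A basis_L2] this]
      have "L2_inner M f (E A (e i)) = L2_inner M f (\<lambda>x. 0)"
        by (intro L2_inner_cong_AE) (use f EL[OF A basis_L2] in \<open>auto intro!: L2_measurable\<close>)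
      then show ?thesis
        using False by (simp add: L2_inner_def)
    next
      case True
      have "measure \<mu> UNIV = measure \<mu> A + measure \<mu> (- A)"
        using finite_measure_compl[of A] A \<open>space \<mu> = UNIV\<close> by (simp add: sets Compl_eq_Diff_UNIV)
      moreover have "measure \<mu> (- A) \<le> measure \<mu> (- {l i})"
        using A True by (intro finite_measure_mono) (auto simp: sets)
      ultimately have "measure \<mu> A = measure \<mu> UNIV"
        using conc by (simp add: measure_le_0_iff antisym)
      moreover have "measure \<mu> UNIV = (L2_norm M (e i))\<^sup>2"
      proof -
        have "AE x in M. E UNIV (e i) x = e i x"
          using E basis_L2 unfolding projection_valued_measure_def by blast
        then have "L2_inner M (E UNIV (e i)) (e i) = L2_inner M (e i) (e i)"
          by (intro L2_inner_cong_AE) (use EL[of UNIV "e i"] in \<open>auto intro!: L2_measurable\<close>)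
        then have "complex_of_real ((L2_norm M (E UNIV (e i)))\<^sup>2) = of_real ((L2_norm M (e i))\<^sup>2)"
          using sq[of UNIV] by (simp only: L2_inner_self sets_UNIV sets.top space_borel) simp
        then show ?thesis
          using meas[of UNIV] by (simp only: of_real_eq_iff) simp
      qed
      ultimately have eqn: "(L2_norm M (E A (e i)))\<^sup>2 = (L2_norm M (e i))\<^sup>2"
        using meas[OF A] by simp
      have "L2_inner M (e i) (E A (e i)) = of_real ((L2_norm M (e i))\<^sup>2)"
        using projector_commute[OF P[OF A] basis_L2 basis_L2, of i i] sq[OF A] unfolding eqn by simp
      then have "Re (L2_inner M (e i) (E A (e i))) = (L2_norm M (e i))\<^sup>2"
        by (simp only: Re_complex_of_real)
      then have "(L2_norm M (\<lambda>x. e i x - E A (e i) x))\<^sup>2 = 0"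
        using L2_norm_square_diff[OF basis_L2 EL[OF A basis_L2], of i i] eqn by simp
      from L2_norm_square_eq_0[OF L2_diff[OF basis_L2 EL[OF A basis_L2]] this]
      have "L2_inner M f (E A (e i)) = L2_inner M f (e i)"
        by (intro L2_inner_cong_AE) (use f EL[OF A basis_L2, of i] in \<open>auto intro!: L2_measurable\<close>)
      then show ?thesis
        using True by simp
    qed
    finally show ?thesis .
  qed
  then show ?thesis
    using EL by (auto simp: diagonalizes_def)
qed

text \<open>
  The spectral measure is introduced by a choice operator. It exists by \<open>ex_projection_valued_measure\<close>, and
  whichever one is chosen, it diagonalizes.
\<close>

lemma coef_spectral_calculus:
  assumes \<phi>: "\<phi> \<in> borel_measurable borel" and f: "f \<in> L2 M"
    and s: "(\<lambda>i. (\<phi> (l i))\<^sup>2 * (norm (coef f i))\<^sup>2) summable_on UNIV"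
  shows "spectral_calculus M (diag_op l) \<phi> f \<in> L2 M"
    and "coef (spectral_calculus M (diag_op l) \<phi> f) i = of_real (\<phi> (l i)) * coef f i"
proof -
  obtain E0 where E0: "projection_valued_measure M E0" "diagonalizes E0 l"
    using ex_projection_valued_measure by blast
  define E where "E = spectral_measure M (diag_op l)"
  have "projection_valued_measure M E \<and> diag_op l = spectral_integral M E (\<lambda>t. t)"
    unfolding E_def spectral_measure_def
    by (rule someI[of _ E0]) (simp add: E0 spectral_integral_diagonal[OF E0(2), of "\<lambda>t. t"])
  then have "diagonalizes E l"
    by (blast intro: spectral_measure_diagonalizes)
  then have diag: "spectral_integral M E \<phi> = diag_op (\<lambda>i. \<phi> (l i))"
    by (rule spectral_integral_diagonal[OF _ \<phi>])
  have "(\<lambda>i. (norm (of_real (\<phi> (l i)) * coef f i))\<^sup>2) summable_on UNIV"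
    using s by (simp add: norm_mult power_mult_distrib)
  from Riesz_Fischer[OF this] obtain g where "g \<in> L2 M" "\<And>i. coef g i = of_real (\<phi> (l i)) * coef f i"
    by blast
  then have "(f, g) \<in> diag_op (\<lambda>i. \<phi> (l i))"
    using f by (simp add: diag_op_def)
  then have "(f, spectral_calculus M (diag_op l) \<phi> f) \<in> diag_op (\<lambda>i. \<phi> (l i))"
    unfolding spectral_calculus_def E_def[symmetric] diag by (rule someI[of "\<lambda>g. (f, g) \<in> diag_op (\<lambda>i. \<phi> (l i))"])
  then show "spectral_calculus M (diag_op l) \<phi> f \<in> L2 M"
    "coef (spectral_calculus M (diag_op l) \<phi> f) i = of_real (\<phi> (l i)) * coef f i"
    by (auto simp: diag_op_def)
qed

end

section \<open>Smooth functions\<close>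

lemma Ck_on_Suc_I:
  assumes "\<And>x. (f has_derivative f' x) (at x)" "\<And>v. Ck_on k UNIV (\<lambda>x. f' x v)"
  shows "Ck_on (Suc k) UNIV f"
proof -
  have "frechet_derivative f (at x) = f' x" for x
    using frechet_derivative_at[OF assms(1)] by simp
  then show ?thesis
    using assms by (auto simp: differentiable_on_def differentiable_def)
qed

lemma Ck_on_Suc_D:
  assumes "Ck_on (Suc k) UNIV f"
  shows "(f has_derivative frechet_derivative f (at x)) (at x)"
    and "Ck_on k UNIV (\<lambda>x. frechet_derivative f (at x) v)"
  using assms by (auto simp: differentiable_on_def frechet_derivative_works)

lemma Ck_on_Suc_imp: "Ck_on (Suc k) UNIV f \<Longrightarrow> Ck_on k UNIV f"
proof (induction k arbitrary: f)
  case 0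
  then show ?case
    by (simp add: differentiable_imp_continuous_on)
next
  case (Suc k)
  show ?case
    by (rule Ck_on_Suc_I[OF Ck_on_Suc_D(1)[OF Suc.prems] Suc.IH[OF Ck_on_Suc_D(2)[OF Suc.prems]]])
qed

lemma Ck_on_const: "Ck_on k UNIV (\<lambda>x. c)"
  by (induction k arbitrary: c) (simp, rule Ck_on_Suc_I[where f' = "\<lambda>x v. 0"], auto)

lemma Ck_on_bounded_linear:
  assumes "bounded_linear L"
  shows "Ck_on k UNIV L"
proof (cases k)
  case 0
  then show ?thesis
    using assms by (simp add: linear_continuous_on)
next
  case (Suc m)
  show ?thesis
    unfolding Suc
    by (rule Ck_on_Suc_I[where f' = "\<lambda>x. L"])
       (use assms in \<open>auto intro: bounded_linear_imp_has_derivative Ck_on_const\<close>)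
qed

lemma Ck_on_add:
  "Ck_on k UNIV f \<Longrightarrow> Ck_on k UNIV g \<Longrightarrow> Ck_on k UNIV (\<lambda>x. f x + g x)"
proof (induction k arbitrary: f g)
  case 0
  then show ?case by (simp add: continuous_on_add)
next
  case (Suc k)
  show ?case
    by (rule Ck_on_Suc_I[OF has_derivative_add[OF Ck_on_Suc_D(1)[OF Suc.prems(1)] Ck_on_Suc_D(1)[OF Suc.prems(2)]]
          Suc.IH[OF Ck_on_Suc_D(2)[OF Suc.prems(1)] Ck_on_Suc_D(2)[OF Suc.prems(2)]]])
qed

lemma Ck_on_bilinear:
  assumes bil: "bounded_bilinear B"
  shows "Ck_on k UNIV f \<Longrightarrow> Ck_on k UNIV g \<Longrightarrow> Ck_on k UNIV (\<lambda>x. B (f x) (g x))"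
proof (induction k arbitrary: f g)
  case 0
  then show ?case
    by (auto intro: bounded_bilinear.continuous_on[OF bil])
next
  case (Suc k)
  show ?case
  proof (rule Ck_on_Suc_I)
    show "((\<lambda>x. B (f x) (g x)) has_derivative
        (\<lambda>v. B (f x) (frechet_derivative g (at x) v) + B (frechet_derivative f (at x) v) (g x))) (at x)" for x
      by (intro bounded_bilinear.FDERIV[OF bil] Ck_on_Suc_D(1)[OF Suc.prems(1)] Ck_on_Suc_D(1)[OF Suc.prems(2)])
    show "Ck_on k UNIV (\<lambda>x. B (f x) (frechet_derivative g (at x) v) + B (frechet_derivative f (at x) v) (g x))" for v
      by (intro Ck_on_add Suc.IH Ck_on_Suc_D(2)[OF Suc.prems(1)] Ck_on_Suc_D(2)[OF Suc.prems(2)]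
          Ck_on_Suc_imp[OF Suc.prems(1)] Ck_on_Suc_imp[OF Suc.prems(2)])
  qed
qed

lemma Ck_on_mult:
  fixes f g :: "'a::real_normed_vector \<Rightarrow> 'b::real_normed_algebra"
  shows "Ck_on k UNIV f \<Longrightarrow> Ck_on k UNIV g \<Longrightarrow> Ck_on k UNIV (\<lambda>x. f x * g x)"
  by (rule Ck_on_bilinear[OF bounded_bilinear_mult])

lemma Ck_on_prod:
  fixes f :: "'i \<Rightarrow> 'a::real_normed_vector \<Rightarrow> 'b::real_normed_field"
  shows "(\<And>i. i \<in> I \<Longrightarrow> Ck_on k UNIV (f i)) \<Longrightarrow> Ck_on k UNIV (\<lambda>x. \<Prod>i\<in>I. f i x)"
  by (induction I rule: infinite_finite_induct) (auto intro!: Ck_on_const Ck_on_mult)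

text \<open>
  \<open>F j\<close> is the \<open>j\<close>-th derivative of \<open>F 0\<close>; the induction over the order of differentiation needs all of
  them at once.
\<close>

lemma Ck_on_compose_real:
  assumes F: "\<And>j t. (F j has_vector_derivative F (Suc j) t) (at t)"
  shows "Ck_on k UNIV g \<Longrightarrow> Ck_on k UNIV (\<lambda>x. F j (g x))"
proof (induction k arbitrary: j)
  case 0
  have "continuous_on UNIV (F j)"
    by (auto simp: continuous_on_eq_continuous_at intro: has_vector_derivative_continuous[OF F])
  with 0 show ?case
    by (auto intro: continuous_on_compose2)
next
  case (Suc k)
  show ?case
  proof (rule Ck_on_Suc_I)
    fix x
    show "((\<lambda>x. F j (g x)) has_derivative
        (\<lambda>v. frechet_derivative g (at x) v *\<^sub>R F (Suc j) (g x))) (at x)"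
      using diff_chain_at[OF Ck_on_Suc_D(1)[OF Suc.prems, of x] F[of j "g x", unfolded has_vector_derivative_def]]
      by (simp add: o_def)
    show "Ck_on k UNIV (\<lambda>x. frechet_derivative g (at x) v *\<^sub>R F (Suc j) (g x))" for v
      by (intro Ck_on_bilinear[OF bounded_bilinear_scaleR] Ck_on_Suc_D(2)[OF Suc.prems]
            Suc.IH Ck_on_Suc_imp[OF Suc.prems])
  qed
qed

lemma Ck_on_of_real:
  "Ck_on k UNIV f \<Longrightarrow> Ck_on k UNIV (\<lambda>x. of_real (f x) :: complex)"
  using Ck_on_bilinear[OF bounded_bilinear_scaleR, of k f "\<lambda>x. 1 :: complex"]
  by (simp add: Ck_on_const scaleR_conv_of_real)

lemma Ck_on_exp:
  fixes g :: "'a::real_normed_vector \<Rightarrow> real"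
  shows "Ck_on k UNIV g \<Longrightarrow> Ck_on k UNIV (\<lambda>x. exp (g x))"
  by (rule Ck_on_compose_real[where F = "\<lambda>j. exp"])
     (auto intro!: derivative_eq_intros simp flip: has_real_derivative_iff_has_vector_derivative)

lemma Ck_on_norm_square: "Ck_on k UNIV (\<lambda>x::'a::real_inner. (norm x)\<^sup>2)"
  unfolding power2_norm_eq_inner
  by (intro Ck_on_bilinear[OF bounded_bilinear_inner] Ck_on_bounded_linear bounded_linear_ident)

subsection \<open>The flat function \<open>exp (- 1 / t)\<close>\<close>

text \<open>
  The \<open>j\<close>-th derivative of \<open>exp (- 1 / t)\<close> is \<open>flat_poly j (1 / t) * exp (- 1 / t)\<close>; the recursion uses that the
  derivative of \<open>1 / t\<close> is \<open>- (1 / t)\<^sup>2\<close>.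
\<close>

primrec flat_poly :: "nat \<Rightarrow> real poly" where
  "flat_poly 0 = 1"
| "flat_poly (Suc j) = [:0, 0, 1:] * (flat_poly j - pderiv (flat_poly j))"

definition flat_deriv :: "nat \<Rightarrow> real \<Rightarrow> real" where
  "flat_deriv j t = (if t > 0 then poly (flat_poly j) (1 / t) * exp (- (1 / t)) else 0)"

abbreviation flat :: "real \<Rightarrow> real" where
  "flat \<equiv> flat_deriv 0"

lemma poly_times_exp_tendsto_0: "((\<lambda>x::real. poly p x * exp (- x)) \<longlongrightarrow> 0) at_top"
proof -
  have "((\<lambda>x. \<Sum>i\<le>degree p. coeff p i * (x ^ i / exp x)) \<longlongrightarrow> (\<Sum>i\<le>degree p. coeff p i * 0)) at_top"
    by (intro tendsto_intros tendsto_power_div_exp_0)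
  then show ?thesis
    by (simp add: poly_altdef sum_distrib_right exp_minus divide_inverse mult.assoc)
qed

lemma flat_deriv_has_derivative:
  "(flat_deriv j has_vector_derivative flat_deriv (Suc j) t) (at t)"
proof -
  have "(flat_deriv j has_field_derivative flat_deriv (Suc j) t) (at t)"
  proof (cases t "0::real" rule: linorder_cases)
    case greater
    have "((\<lambda>t. poly (flat_poly j) (1 / t) * exp (- (1 / t))) has_field_derivative flat_deriv (Suc j) t) (at t)"
      using greater
      by (auto intro!: derivative_eq_intros DERIV_chain2[OF poly_DERIV]
            simp: flat_deriv_def field_simps power2_eq_square)
    then show ?thesis
      by (rule has_field_derivative_transform_within_open[of _ _ _ "{0<..}"])
         (use greater in \<open>auto simp: flat_deriv_def\<close>)
  next
    case less
    have "((\<lambda>t. 0) has_field_derivative flat_deriv (Suc j) t) (at t)"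
      using less by (simp add: flat_deriv_def)
    then show ?thesis
      by (rule has_field_derivative_transform_within_open[of _ _ _ "{..<0}"])
         (use less in \<open>auto simp: flat_deriv_def\<close>)
  next
    case equal
    have "((\<lambda>y. (flat_deriv j y - flat_deriv j 0) / (y - 0)) \<longlongrightarrow> 0) (at 0)"
    proof (rule filterlim_split_at)
      show "((\<lambda>y. (flat_deriv j y - flat_deriv j 0) / (y - 0)) \<longlongrightarrow> 0) (at_left 0)"
        by (rule tendsto_eventually, rule eventually_at_leftI[of "-1"])
           (auto simp: flat_deriv_def)
      have "((\<lambda>x. poly ([:0, 1:] * flat_poly j) x * exp (- x)) \<longlongrightarrow> 0) at_top"
        by (rule poly_times_exp_tendsto_0)
      then have "((\<lambda>x. (flat_deriv j (inverse x) - flat_deriv j 0) / (inverse x - 0)) \<longlongrightarrow> 0) at_top"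
        by (rule Lim_transform_eventually)
           (use eventually_gt_at_top[of 0] in eventually_elim, auto simp: flat_deriv_def field_simps)
      then show "((\<lambda>y. (flat_deriv j y - flat_deriv j 0) / (y - 0)) \<longlongrightarrow> 0) (at_right 0)"
        by (simp only: filterlim_at_right_to_top)
    qed
    then show ?thesis
      by (simp add: has_field_derivative_iff equal flat_deriv_def)
  qed
  then show ?thesis
    by (simp add: has_real_derivative_iff_has_vector_derivative)
qed

lemma Ck_on_flat: "Ck_on k UNIV g \<Longrightarrow> Ck_on k UNIV (\<lambda>x. flat (g x))"
  by (rule Ck_on_compose_real[where F = flat_deriv]) (rule flat_deriv_has_derivative)

lemma flat_eq: "flat t = (if t > 0 then exp (- (1 / t)) else 0)"
  by (simp add: flat_deriv_def)

lemma flat_bounds: "0 \<le> flat t" "flat t \<le> 1"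
  by (auto simp: flat_eq)

lemma flat_deriv_1_bound: "\<bar>flat_deriv 1 t\<bar> \<le> 2"
proof (cases "t > 0")
  case True
  have "1 + 1 / t + (1 / t)\<^sup>2 / 2 \<le> exp (1 / t)"
    by (rule exp_lower_Taylor_quadratic) (use True in auto)
  moreover have "1 / t > 0"
    using True by simp
  ultimately have "(1 / t)\<^sup>2 \<le> 2 * exp (1 / t)"
    by linarith
  then have "(1 / t)\<^sup>2 * exp (- (1 / t)) \<le> 2 * exp (1 / t) * exp (- (1 / t))"
    by (rule mult_right_mono) simp
  also have "\<dots> = 2"
    by (simp add: exp_minus)
  finally have "(1 / t)\<^sup>2 * exp (- (1 / t)) \<le> 2" .
  then show ?thesis
    using True by (simp add: flat_deriv_def power2_eq_square abs_mult)
qed (simp add: flat_deriv_def)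

lemma flat_mult_tendsto:
  "(\<lambda>k. flat (real k * c)) \<longlonglongrightarrow> (if c > 0 then 1 else 0)"
proof (cases "c > 0")
  case True
  have "(\<lambda>k. exp (- (inverse (real k) * (1 / c)))) \<longlonglongrightarrow> exp (- (0 * (1 / c)))"
    by (intro tendsto_intros lim_inverse_n)
  then have "(\<lambda>k. exp (- (1 / (real k * c)))) \<longlonglongrightarrow> 1"
    by (simp add: field_simps)
  then have "(\<lambda>k. flat (real k * c)) \<longlonglongrightarrow> 1"
    by (rule Lim_transform_eventually)
       (use eventually_gt_at_top[of 0] in eventually_elim, use True in \<open>auto simp: flat_eq\<close>)
  then show ?thesis
    using True by simp
next
  case False
  then have "flat (real k * c) = 0" for k
    by (auto simp: flat_eq zero_less_mult_iff)
  then show ?thesis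
    using False by simp
qed

section \<open>Test functions and the fundamental lemma\<close>

lemma test_functions_I:
  assumes "\<And>k. Ck_on k UNIV f" "\<And>x. norm x > R \<Longrightarrow> f x = 0"
  shows "f \<in> test_functions (UNIV :: 'a::euclidean_space set)"
  using assms unfolding test_functions_def smooth_on_def
  by (auto intro!: exI[of _ "cball 0 R"] simp: dist_norm)

lemma test_functions_bounded_support:
  assumes "f \<in> test_functions UNIV"
  obtains R where "R > 0" "\<And>x. norm x \<ge> R \<Longrightarrow> f x = 0"
proof -
  obtain K where K: "compact K" "\<And>x. x \<notin> K \<Longrightarrow> f x = 0"
    using assms by (auto simp: test_functions_def)
  obtain R where "R > 0" "\<And>x. x \<in> K \<Longrightarrow> norm x < R"
    using compact_imp_bounded[OF K(1)] by (metis bounded_pos_less)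
  with K show ?thesis
    by (intro that[of R]) force+
qed

lemma test_functions_Ck: "f \<in> test_functions UNIV \<Longrightarrow> Ck_on k UNIV f"
  by (auto simp: test_functions_def smooth_on_def)

text \<open>Smooth functions that increase to the indicator of an open box.\<close>

definition box_bump :: "nat \<Rightarrow> 'a::euclidean_space \<Rightarrow> 'a \<Rightarrow> 'a \<Rightarrow> complex" where
  "box_bump k a b x =
     of_real (\<Prod>i\<in>Basis. flat (real k * (x \<bullet> i - a \<bullet> i)) * flat (real k * (b \<bullet> i - x \<bullet> i)))"

lemma box_bump_eq_0: "x \<notin> box a b \<Longrightarrow> box_bump k a b x = 0"
  by (auto simp: box_bump_def box_def flat_eq zero_less_mult_iff)

lemma box_bump_test: "box_bump k a b \<in> test_functions UNIV"
proof -
  obtain R where R: "\<And>x. x \<in> box a b \<Longrightarrow> norm x \<le> R"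
    using bounded_box[of a b] by (auto simp: bounded_iff)
  have aff: "Ck_on m UNIV (\<lambda>x. real k * (x \<bullet> i - a \<bullet> i))" "Ck_on m UNIV (\<lambda>x. real k * (b \<bullet> i - x \<bullet> i))"
    for m and i :: 'a
    using Ck_on_add[OF Ck_on_bounded_linear[of "\<lambda>x. real k * (x \<bullet> i)" m] Ck_on_const[of m "- real k * (a \<bullet> i)"]]
      Ck_on_add[OF Ck_on_bounded_linear[of "\<lambda>x. - real k * (x \<bullet> i)" m] Ck_on_const[of m "real k * (b \<bullet> i)"]]
    by (simp_all add: bounded_linear_mult_const bounded_linear_const_mult bounded_linear_inner_left
          bounded_linear_minus algebra_simps)
  show ?thesis
  proof (rule test_functions_I)
    show "Ck_on m UNIV (box_bump k a b)" for m
      unfolding box_bump_def by (intro Ck_on_of_real Ck_on_prod Ck_on_mult Ck_on_flat aff)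
    show "box_bump k a b x = 0" if "norm x > R" for x
      using R[of x] that by (intro box_bump_eq_0) auto
  qed
qed

lemma box_bump_tendsto: "(\<lambda>k. box_bump k a b x) \<longlonglongrightarrow> indicator (box a b) x"
proof -
  have "(\<lambda>k. box_bump k a b x) \<longlonglongrightarrow>
      of_real (\<Prod>i\<in>Basis. (if x \<bullet> i - a \<bullet> i > 0 then 1 else 0) * (if b \<bullet> i - x \<bullet> i > 0 then 1 else 0))"
    unfolding box_bump_def by (intro tendsto_intros flat_mult_tendsto)
  also have "of_real (\<Prod>i\<in>Basis. (if x \<bullet> i - a \<bullet> i > 0 then 1 else 0) * (if b \<bullet> i - x \<bullet> i > 0 then 1 else 0))
      = (indicator (box a b) x :: complex)"
    by (auto simp: indicator_def box_def)
  finally show ?thesis .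
qed

lemma box_bump_norm_le: "norm (box_bump k a b x) \<le> indicator (box a b) x"
proof (cases "x \<in> box a b")
  case True
  have "norm (box_bump k a b x) \<le> 1"
    unfolding box_bump_def norm_of_real abs_prod
    by (intro prod_le_1) (auto simp: abs_mult flat_bounds intro!: mult_le_one)
  then show ?thesis using True by simp
qed (simp add: box_bump_eq_0)

lemma locally_integrable_bounded:
  assumes "locally_integrable g"
  shows "set_integrable lborel (cball 0 R) g"
  using assms by (auto simp: locally_integrable_def)

lemma set_integrable_box:
  assumes "locally_integrable g"
  shows "set_integrable lborel (box a b) g"
  by (rule set_integrable_subset[of _ "cbox a b"])
     (use assms box_subset_cbox in \<open>auto simp: locally_integrable_def\<close>)

lemma integrable_times_bounded_support:
  fixes \<phi> :: "'a::euclidean_space \<Rightarrow> complex"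
  assumes g: "locally_integrable g" and \<phi>: "\<phi> \<in> borel_measurable borel"
    and "\<And>x. norm (\<phi> x) \<le> B" "\<And>x. norm x > R \<Longrightarrow> \<phi> x = 0"
  shows "integrable lborel (\<lambda>x. g x * \<phi> x)"
proof (rule Bochner_Integration.integrable_bound)
  show "integrable lborel (\<lambda>x. B * norm (indicator (cball 0 R) x *\<^sub>R g x))"
    using locally_integrable_bounded[OF g, of R] unfolding set_integrable_def
    by (intro Bochner_Integration.integrable_mult_right integrable_norm)
  have "norm (g x * \<phi> x) \<le> norm (B * norm (indicator (cball 0 R) x *\<^sub>R g x))" for x
  proof (cases "x \<in> cball 0 R")
    case True
    have "norm (g x) * norm (\<phi> x) \<le> norm (g x) * B"
      by (intro mult_left_mono assms) auto
    also have "\<dots> \<le> \<bar>B * norm (g x)\<bar>"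
      by (simp add: mult.commute)
    finally show ?thesis
      using True by (simp add: norm_mult)
  qed (use assms(4)[of x] in \<open>auto simp: dist_norm\<close>)
  then show "AE x in lborel. norm (g x * \<phi> x) \<le> norm (B * norm (indicator (cball 0 R) x *\<^sub>R g x))"
    by simp
qed (use g \<phi> in \<open>auto simp: locally_integrable_def\<close>)

text \<open>
  Testing against the bumps shows that the integral over every box vanishes. The boxes are an
  intersection-stable generator of the Borel sets.
\<close>

lemma fundamental_lemma:
  fixes g :: "'a::euclidean_space \<Rightarrow> complex"
  assumes g: "locally_integrable g"
    and zero: "\<And>\<phi>. \<phi> \<in> test_functions UNIV \<Longrightarrow> (\<integral>x. g x * \<phi> x \<partial>lborel) = 0"
  shows "AE x in lborel. g x = 0"
proof -
  have [measurable]: "g \<in> borel_measurable borel"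
    using g by (simp add: locally_integrable_def)
  have box0: "set_lebesgue_integral lborel (box a b) g = 0" for a b
  proof -
    have "(\<lambda>k. \<integral>x. g x * box_bump k a b x \<partial>lborel) \<longlonglongrightarrow> (\<integral>x. g x * indicator (box a b) x \<partial>lborel)"
    proof (rule integral_dominated_convergence)
      show "integrable lborel (\<lambda>x. norm (indicator (box a b) x *\<^sub>R g x))"
        using set_integrable_box[OF g, of a b] unfolding set_integrable_def by (rule integrable_norm)
      show "AE x in lborel. (\<lambda>k. g x * box_bump k a b x) \<longlonglongrightarrow> g x * indicator (box a b) x"
        by (intro AE_I2 tendsto_intros box_bump_tendsto)
      have "norm (g x * box_bump k a b x) \<le> norm (indicator (box a b) x *\<^sub>R g x)" for k x
        using mult_left_mono[OF box_bump_norm_le[of k a b x], of "norm (g x)"]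
        by (simp add: norm_mult mult.commute)
      then show "AE x in lborel. norm (g x * box_bump k a b x) \<le> norm (indicator (box a b) x *\<^sub>R g x)" for k
        by simp
      have "continuous_on UNIV (box_bump k a b)" for k
        using test_functions_Ck[OF box_bump_test, of 0 k a b] by simp
      then show "(\<lambda>x. g x * box_bump k a b x) \<in> borel_measurable lborel" for k
        using borel_measurable_continuous_onI[of "box_bump k a b"] by simp
    qed auto
    then have "(\<integral>x. g x * indicator (box a b) x \<partial>lborel) = 0"
      using zero[OF box_bump_test] by (simp add: LIMSEQ_const_iff)
    then show ?thesis
      by (simp add: set_lebesgue_integral_def scaleR_conv_of_real of_real_indicator mult.commute)
  qed
  have on_box: "AE x in lborel. indicator (box a b) x *\<^sub>R g x = 0" for a b
  proof (rule sigma_finite_measure.density_zero[OF sigma_finite_lborel])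
    let ?h = "\<lambda>x. indicator (box a b) x *\<^sub>R g x"
    show int: "integrable lborel ?h"
      using set_integrable_box[OF g, of a b] by (simp add: set_integrable_def)
    have sint: "set_integrable lborel A ?h" if "A \<in> sets borel" for A
      unfolding set_integrable_def by (rule integrable_mult_indicator) (use that int in auto)
    have UNIV: "set_lebesgue_integral lborel UNIV ?h = 0"
      using box0[of a b] by (simp add: set_lebesgue_integral_def)
    fix A :: "'a set"
    assume "A \<in> sets lborel"
    then have A: "A \<in> sigma_sets UNIV (range (\<lambda>(a, b). box a b))"
      by (simp add: borel_eq_box)
    have "Int_stable (range (\<lambda>(a, b). box a b :: 'a set))"
      by (auto simp: Int_stable_def box_Int_box)
    moreover have "range (\<lambda>(a, b). box a b :: 'a set) \<subseteq> Pow UNIV"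
      by simp
    ultimately show "set_lebesgue_integral lborel A ?h = 0"
      using A
    proof (induction rule: sigma_sets_induct_disjoint)
      case (basic A)
      then obtain c d where "A = box c d"
        by auto
      then show ?case
        using box0 by (simp add: set_lebesgue_integral_def box_Int_box mult.commute flip: indicator_inter_arith)
    next
      case empty
      then show ?case by (simp add: set_lebesgue_integral_def)
    next
      case (compl A)
      then have A: "A \<in> sets borel"
        by (simp add: borel_eq_box)
      have "set_lebesgue_integral lborel UNIV ?h
          = set_lebesgue_integral lborel A ?h + set_lebesgue_integral lborel (UNIV - A) ?h"
        using A set_integral_Un[of A "UNIV - A" lborel ?h] by (simp add: sint)
      then show ?case
        using compl UNIV by simp
    next
      case (union A)
      then have A: "A i \<in> sets borel" for i
        by (auto simp: borel_eq_box)
      then show ?case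
        using union
        by (subst lebesgue_integral_countable_add) (auto intro!: sint simp: disjoint_family_on_def)
    qed
  qed
  have "AE x in lborel. \<forall>N::nat. indicator (box (- real N *\<^sub>R One) (real N *\<^sub>R One)) x *\<^sub>R g x = 0"
    unfolding AE_all_countable by (intro allI on_box)
  then show ?thesis
  proof eventually_elim
    case (elim x)
    obtain N :: nat where N: "norm x < real N"
      using reals_Archimedean2 by blast
    have "x \<in> box (- real N *\<^sub>R One) (real N *\<^sub>R One)"
    proof -
      have "\<bar>x \<bullet> i\<bar> < real N" if "i \<in> Basis" for i
        using Basis_le_norm[OF that, of x] N by linarith
      then show ?thesis
        by (auto simp: box_def abs_less_iff minus_less_iff)
    qed
    then show ?case
      using elim by (metis indicator_simps(1) scaleR_one)
  qed
qed

section \<open>Integration by parts and weak derivatives\<close>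

text \<open>
  By translation invariance \<open>\<integral> (\<psi> (x + b) - \<psi> x) dx = 0\<close>, and the difference is the integral of \<open>D\<close>
  along a segment. Fubini turns this into \<open>\<integral> D = 0\<close>. The fundamental theorem of calculus for the gauge
  integral applies to every derivative \<open>D\<close>.
\<close>

lemma integral_directional_derivative_eq_0:
  fixes \<psi> D :: "'a::euclidean_space \<Rightarrow> complex"
  assumes \<psi>: "integrable lborel \<psi>" and D: "integrable lborel D"
    and der: "\<And>x. ((\<lambda>t. \<psi> (x + t *\<^sub>R b)) has_vector_derivative D x) (at 0)"
  shows "(\<integral>x. D x \<partial>lborel) = 0"
proof -
  have [measurable]: "\<psi> \<in> borel_measurable borel" "D \<in> borel_measurable borel"
    using \<psi> D by (auto dest: borel_measurable_integrable)
  have shift_int: "integrable lborel (\<lambda>x. F (x + c))"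
    and shift_eq: "(\<integral>x. F (x + c) \<partial>lborel) = (\<integral>x. F x \<partial>lborel)"
    if F: "integrable lborel F" for F :: "'a \<Rightarrow> 'c::{banach, second_countable_topology}" and c
  proof -
    have [measurable]: "F \<in> borel_measurable borel"
      using F by (auto dest: borel_measurable_integrable)
    have "integrable (distr lborel borel ((+) c)) F"
      using F by (simp add: lborel_distr_plus)
    then show "integrable lborel (\<lambda>x. F (x + c))"
      by (subst (asm) integrable_distr_eq) (auto simp: add.commute)
    have "(\<integral>x. F x \<partial>distr lborel borel ((+) c)) = (\<integral>x. F (c + x) \<partial>lborel)"
      by (rule integral_distr) auto
    then show "(\<integral>x. F (x + c) \<partial>lborel) = (\<integral>x. F x \<partial>lborel)"
      by (simp add: lborel_distr_plus add.commute)
  qed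
  define f where "f t x = indicator {0..1::real} t *\<^sub>R D (x + t *\<^sub>R b)" for t x
  have "integrable (lborel \<Otimes>\<^sub>M lborel) (case_prod f)"
  proof (rule lborel_pair.Fubini_integrable)
    show "case_prod f \<in> borel_measurable (lborel \<Otimes>\<^sub>M lborel)"
      unfolding f_def by measurable
    show "integrable lborel (\<lambda>t. \<integral>x. norm (case_prod f (t, x)) \<partial>lborel)"
    proof -
      have "(\<integral>x. norm (case_prod f (t, x)) \<partial>lborel) = indicator {0..1} t * (\<integral>x. norm (D x) \<partial>lborel)" for t
        using shift_eq[OF integrable_norm[OF D], of "t *\<^sub>R b"] by (simp add: f_def)
      moreover have "integrable lborel (\<lambda>t. indicator {0..1::real} t * (\<integral>x. norm (D x) \<partial>lborel))"
        by (intro integrable_mult_left) (auto simp: integrable_indicator_iff)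
      ultimately show ?thesis
        by (simp only:)
    qed
    show "AE t in lborel. integrable lborel (\<lambda>x. case_prod f (t, x))"
      by (auto simp: f_def intro!: shift_int D)
  qed
  then have F: "(\<integral>x. (\<integral>t. f t x \<partial>lborel) \<partial>lborel) = (\<integral>t. (\<integral>x. f t x \<partial>lborel) \<partial>lborel)"
    and ae: "AE x in lborel. integrable lborel (\<lambda>t. f t x)"
    using lborel_pair.Fubini_integral[of f] lborel_pair.AE_integrable_snd[of f] by auto
  have "(\<integral>t. f t x \<partial>lborel) = \<psi> (x + b) - \<psi> x" if int: "integrable lborel (\<lambda>t. f t x)" for x
  proof -
    have "((\<lambda>t. \<psi> (x + t *\<^sub>R b)) has_vector_derivative D (x + t *\<^sub>R b)) (at t within {0..1})" for t
    proof -
      have "((\<lambda>s. \<psi> (x + t *\<^sub>R b + s *\<^sub>R b)) \<circ> (\<lambda>s. s - t) has_vector_derivative 1 *\<^sub>R D (x + t *\<^sub>R b)) (at t)"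
        by (rule vector_diff_chain_at) (auto intro!: derivative_eq_intros der)
      then have "((\<lambda>s. \<psi> (x + s *\<^sub>R b)) has_vector_derivative D (x + t *\<^sub>R b)) (at t)"
        by (simp add: o_def algebra_simps)
      then show ?thesis
        by (rule has_vector_derivative_at_within)
    qed
    then have hk: "((\<lambda>t. D (x + t *\<^sub>R b)) has_integral \<psi> (x + 1 *\<^sub>R b) - \<psi> (x + 0 *\<^sub>R b)) {0..1}"
      by (intro fundamental_theorem_of_calculus) auto
    have "set_integrable lborel {0..1} (\<lambda>t. D (x + t *\<^sub>R b))"
      using int by (simp add: set_integrable_def f_def)
    from set_borel_integral_eq_integral(2)[OF this] show ?thesis
      using integral_unique[OF hk] by (simp add: set_lebesgue_integral_def f_def)
  qed
  from eventually_mono[OF ae this] have "AE x in lborel. (\<integral>t. f t x \<partial>lborel) = \<psi> (x + b) - \<psi> x" .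
  then have "(\<integral>x. (\<integral>t. f t x \<partial>lborel) \<partial>lborel) = (\<integral>x. \<psi> (x + b) - \<psi> x \<partial>lborel)"
    by (intro integral_cong_AE) (auto simp: f_def)
  also have "\<dots> = 0"
    using shift_int[OF \<psi>] shift_eq[OF \<psi>] \<psi> by simp
  finally have "0 = (\<integral>t. (\<integral>x. f t x \<partial>lborel) \<partial>lborel)"
    using F by simp
  also have "\<dots> = (\<integral>t. indicator {0..1::real} t *\<^sub>R (\<integral>x. D x \<partial>lborel) \<partial>lborel)"
    by (rule Bochner_Integration.integral_cong) (auto simp: f_def shift_eq[OF D])
  also have "\<dots> = (\<integral>x. D x \<partial>lborel)"
    by simp
  finally show ?thesis by simp
qed

lemma directional_derivative:
  assumes "(f has_derivative f') (at x)"
  shows "((\<lambda>t. f (x + t *\<^sub>R b)) has_vector_derivative f' b) (at 0)"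
proof -
  have "((\<lambda>t. f (x + t *\<^sub>R b)) has_derivative (\<lambda>t. f' (t *\<^sub>R b))) (at 0)"
    by (rule has_derivative_compose[of "\<lambda>t. x + t *\<^sub>R b" "\<lambda>t. t *\<^sub>R b", simplified])
       (auto intro!: derivative_eq_intros assms)
  then show ?thesis
    using linear_scale[OF has_derivative_linear[OF assms]] by (simp add: has_vector_derivative_def)
qed

lemma has_vector_derivative_complex_parts:
  assumes "(f has_vector_derivative D) F"
  shows "((\<lambda>t. Re (f t)) has_field_derivative Re D) F" "((\<lambda>t. Im (f t)) has_field_derivative Im D) F"
  using assms by (auto intro: has_field_derivative_Re has_field_derivative_Im)

text \<open>
  \<open>D\<close> is the pointwise limit of the difference quotients with increments \<open>1 / k\<close>.
\<close>

lemma borel_measurable_directional_derivative: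
  fixes f :: "'a::euclidean_space \<Rightarrow> complex"
  assumes der: "\<And>x. ((\<lambda>t. f (x + t *\<^sub>R b)) has_vector_derivative D x) (at 0)"
    and [measurable]: "f \<in> borel_measurable borel"
  shows "D \<in> borel_measurable borel"
proof (rule borel_measurable_LIMSEQ_metric)
  fix x
  have "((\<lambda>t. (1 / t) *\<^sub>R (f (x + t *\<^sub>R b) - f x)) \<longlongrightarrow> D x) (at 0)"
    using has_vector_derivative_complex_parts[OF der[of x]]
    by (simp add: tendsto_complex_iff has_field_derivative_iff)
  moreover have "filterlim (\<lambda>k. 1 / real (Suc k)) (at 0) sequentially"
    using LIMSEQ_inverse_real_of_nat by (auto simp: filterlim_at inverse_eq_divide)
  ultimately show "(\<lambda>k. (1 / (1 / real (Suc k))) *\<^sub>R (f (x + (1 / real (Suc k)) *\<^sub>R b) - f x)) \<longlonglongrightarrow> D x"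
    by (rule filterlim_compose)
qed measurable

lemma Ck_on_continuous: "Ck_on k UNIV f \<Longrightarrow> continuous_on UNIV f"
  by (induction k) (simp, blast dest: Ck_on_Suc_imp)

lemma bounded_image_cball:
  "bounded (f ` cball 0 R) \<Longrightarrow> \<exists>B. \<forall>x. norm x \<le> R \<longrightarrow> norm (f x) \<le> B"
  unfolding bounded_iff by (metis imageI mem_cball_0)

text \<open>
  This class covers \<open>C\<^sup>1\<close> functions and entire functions alike; for the latter, boundedness of the derivatives
  follows from Cauchy's estimate.
\<close>

definition loc_Lipschitz_diff :: "('a::euclidean_space \<Rightarrow> complex) \<Rightarrow> bool" where
  "loc_Lipschitz_diff u \<longleftrightarrow> (\<forall>x. u differentiable (at x)) \<and>
     (\<forall>v R. \<exists>B. \<forall>x. norm x \<le> R \<longrightarrow> norm (frechet_derivative u (at x) v) \<le> B)"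

lemma loc_Lipschitz_diff_Ck:
  assumes "Ck_on (Suc k) UNIV u"
  shows "loc_Lipschitz_diff u"
  unfolding loc_Lipschitz_diff_def
proof (intro conjI allI)
  show "u differentiable (at x)" for x
    using Ck_on_Suc_D(1)[OF assms] by (auto simp: differentiable_def)
  fix v R
  have "continuous_on UNIV (\<lambda>x. frechet_derivative u (at x) v)"
    by (rule Ck_on_continuous[OF Ck_on_Suc_D(2)[OF assms]])
  then have "continuous_on (cball 0 R) (\<lambda>x. frechet_derivative u (at x) v)"
    by (auto intro: continuous_on_subset)
  then have "bounded ((\<lambda>x. frechet_derivative u (at x) v) ` cball 0 R)"
    by (intro compact_imp_bounded compact_continuous_image) auto
  then show "\<exists>B. \<forall>x. norm x \<le> R \<longrightarrow> norm (frechet_derivative u (at x) v) \<le> B"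
    by (rule bounded_image_cball)
qed

lemma loc_Lipschitz_diff_continuous: "loc_Lipschitz_diff u \<Longrightarrow> continuous_on UNIV u"
  by (auto simp: loc_Lipschitz_diff_def continuous_on_eq_continuous_at
      intro: differentiable_imp_continuous_within)

lemma continuous_locally_integrable:
  fixes u :: "'a::euclidean_space \<Rightarrow> complex"
  assumes "continuous_on UNIV u"
  shows "locally_integrable u"
  unfolding locally_integrable_def set_integrable_def
  using assms by (auto intro!: borel_measurable_continuous_onI borel_integrable_compact
      intro: continuous_on_subset)

lemma integrable_bounded_support:
  fixes \<phi> :: "'a::euclidean_space \<Rightarrow> complex"
  assumes \<phi>: "\<phi> \<in> borel_measurable borel"
    and "\<And>x. norm x \<le> R \<Longrightarrow> norm (\<phi> x) \<le> B" "\<And>x. norm x > R \<Longrightarrow> \<phi> x = 0"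
  shows "integrable lborel \<phi>"
proof -
  have "norm (\<phi> x) \<le> max B 0" for x
    using assms(2)[of x] assms(3)[of x] by (cases "norm x \<le> R") auto
  then have "integrable lborel (\<lambda>x. 1 * \<phi> x)"
    by (intro integrable_times_bounded_support[of "\<lambda>x. 1"] continuous_locally_integrable assms) auto
  then show ?thesis by simp
qed

lemma loc_Lipschitz_diff_mult_test:
  fixes u \<phi> :: "'a::euclidean_space \<Rightarrow> complex"
  assumes u: "loc_Lipschitz_diff u" and \<phi>: "loc_Lipschitz_diff \<phi>"
    and supp: "\<And>x. norm x \<ge> R \<Longrightarrow> \<phi> x = 0"
  shows "integrable lborel (\<lambda>x. u x * frechet_derivative \<phi> (at x) v)"
    and "integrable lborel (\<lambda>x. frechet_derivative u (at x) v * \<phi> x)"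
    and "(\<integral>x. u x * frechet_derivative \<phi> (at x) v \<partial>lborel)
           = - (\<integral>x. frechet_derivative u (at x) v * \<phi> x \<partial>lborel)"
proof -
  have du: "(u has_derivative frechet_derivative u (at x)) (at x)"
    and d\<phi>: "(\<phi> has_derivative frechet_derivative \<phi> (at x)) (at x)" for x
    using u \<phi> by (auto simp: loc_Lipschitz_diff_def frechet_derivative_works)
  have cont: "continuous_on UNIV u" "continuous_on UNIV \<phi>"
    using u \<phi> by (auto intro: loc_Lipschitz_diff_continuous)
  then have [measurable]: "u \<in> borel_measurable borel" "\<phi> \<in> borel_measurable borel"
    by (auto intro: borel_measurable_continuous_onI)
  have [measurable]: "(\<lambda>x. frechet_derivative u (at x) v) \<in> borel_measurable borel"
    "(\<lambda>x. frechet_derivative \<phi> (at x) v) \<in> borel_measurable borel"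
    by (rule borel_measurable_directional_derivative[OF directional_derivative[OF du]]
         borel_measurable_directional_derivative[OF directional_derivative[OF d\<phi>]]; measurable)+
  have supp': "frechet_derivative \<phi> (at x) v = 0" if "norm x > R" for x
  proof -
    have "((\<lambda>x. 0) has_derivative (\<lambda>v. 0)) (at x)"
      by simp
    then have "(\<phi> has_derivative (\<lambda>v. 0)) (at x)"
      by (rule has_derivative_transform_within_open[of _ _ _ _ "- cball 0 R"])
         (use that supp in \<open>auto simp: dist_norm\<close>)
    from fun_cong[OF frechet_derivative_at[OF this], of v] show ?thesis
      by simp
  qed
  have bdd: "\<exists>B. \<forall>x. norm x \<le> R \<longrightarrow> norm (f x) \<le> B" if "continuous_on UNIV f" for f :: "'a \<Rightarrow> complex"
  proof -
    have "bounded (f ` cball 0 R)"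
      using that by (intro compact_imp_bounded compact_continuous_image continuous_on_subset[OF that]) auto
    then show ?thesis
      by (rule bounded_image_cball)
  qed
  obtain B1 B2 B3 B4 where B:
    "\<And>x. norm x \<le> R \<Longrightarrow> norm (u x) \<le> B1" "\<And>x. norm x \<le> R \<Longrightarrow> norm (\<phi> x) \<le> B2"
    "\<And>x. norm x \<le> R \<Longrightarrow> norm (frechet_derivative u (at x) v) \<le> B3"
    "\<And>x. norm x \<le> R \<Longrightarrow> norm (frechet_derivative \<phi> (at x) v) \<le> B4"
    using bdd[OF cont(1)] bdd[OF cont(2)] u \<phi> unfolding loc_Lipschitz_diff_def by metis
  have prod: "norm (a * b) \<le> A * B" if "norm a \<le> A" "norm b \<le> B" for a b :: complex and A B
    using that by (simp add: norm_mult mult_mono' order_trans[OF norm_ge_zero])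
  show int1: "integrable lborel (\<lambda>x. u x * frechet_derivative \<phi> (at x) v)"
    by (rule integrable_bounded_support[of _ R "B1 * B4"]) (use B supp' in \<open>auto intro!: prod\<close>)
  show int2: "integrable lborel (\<lambda>x. frechet_derivative u (at x) v * \<phi> x)"
    by (rule integrable_bounded_support[of _ R "B3 * B2"]) (use B supp in \<open>auto intro!: prod\<close>)
  have "(\<integral>x. u x * frechet_derivative \<phi> (at x) v + frechet_derivative u (at x) v * \<phi> x \<partial>lborel) = 0"
  proof (rule integral_directional_derivative_eq_0)
    show "integrable lborel (\<lambda>x. u x * \<phi> x)"
      by (rule integrable_bounded_support[of _ R "B1 * B2"]) (use B supp in \<open>auto intro!: prod\<close>)
    show "integrable lborel (\<lambda>x. u x * frechet_derivative \<phi> (at x) v + frechet_derivative u (at x) v * \<phi> x)"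
      by (intro Bochner_Integration.integrable_add int1 int2)
    show "((\<lambda>t. u (x + t *\<^sub>R v) * \<phi> (x + t *\<^sub>R v)) has_vector_derivative
        u x * frechet_derivative \<phi> (at x) v + frechet_derivative u (at x) v * \<phi> x) (at 0)" for x
      by (rule directional_derivative[OF has_derivative_mult[OF du d\<phi>]])
  qed
  then show "(\<integral>x. u x * frechet_derivative \<phi> (at x) v \<partial>lborel)
           = - (\<integral>x. frechet_derivative u (at x) v * \<phi> x \<partial>lborel)"
    using int1 int2 by (simp add: add_eq_0_iff2)
qed

lemma loc_Lipschitz_diff_weak_dbar:
  assumes u: "loc_Lipschitz_diff u"
  shows "has_weak_dbar j u (dbar j u)"
  unfolding has_weak_dbar_def
proof (intro conjI ballI)
  have du: "(u has_derivative frechet_derivative u (at x)) (at x)" for x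
    using u by (auto simp: loc_Lipschitz_diff_def frechet_derivative_works)
  have cont: "continuous_on UNIV u"
    using u by (rule loc_Lipschitz_diff_continuous)
  then have [measurable]: "u \<in> borel_measurable borel"
    by (auto intro: borel_measurable_continuous_onI)
  show "locally_integrable u"
    by (rule continuous_locally_integrable[OF cont])
  have [measurable]: "(\<lambda>x. frechet_derivative u (at x) v) \<in> borel_measurable borel" for v
    by (rule borel_measurable_directional_derivative[OF directional_derivative[OF du]]) measurable
  show "locally_integrable (dbar j u)"
    unfolding locally_integrable_def
  proof (intro conjI allI impI)
    show [measurable]: "dbar j u \<in> borel_measurable borel"
      unfolding dbar_def by measurable
    fix K :: "(complex^'a) set"
    assume K: "compact K"
    obtain R where R: "\<And>x. x \<in> K \<Longrightarrow> norm x \<le> R"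
      using compact_imp_bounded[OF K] by (auto simp: bounded_iff)
    obtain B1 B2 where B: "\<And>x. norm x \<le> R \<Longrightarrow> norm (frechet_derivative u (at x) (axis j 1)) \<le> B1"
      "\<And>x. norm x \<le> R \<Longrightarrow> norm (frechet_derivative u (at x) (axis j \<i>)) \<le> B2"
      using u unfolding loc_Lipschitz_diff_def by metis
    have "norm (dbar j u x) \<le> B1 + B2" if "norm x \<le> R" for x
    proof -
      have "norm (dbar j u x) \<le> (B1 + B2) / 2"
        unfolding dbar_def norm_divide
        using norm_triangle_mono[OF B(1)[OF that], of "\<i> * frechet_derivative u (at x) (axis j \<i>)" B2] B(2)[OF that]
        by (simp add: norm_mult)
      moreover have "0 \<le> B1 + B2"
        using order_trans[OF norm_ge_zero B(1)[OF that]] order_trans[OF norm_ge_zero B(2)[OF that]]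
        by linarith
      ultimately show ?thesis by (simp add: field_simps)
    qed
    then show "set_integrable lborel K (dbar j u)"
      unfolding set_integrable_def
    proof (intro integrable_bounded_support[of _ R "B1 + B2"])
      have [measurable]: "K \<in> sets borel"
        using K by (rule borel_compact)
      show "(\<lambda>x. indicator K x *\<^sub>R dbar j u x) \<in> borel_measurable borel"
        by measurable
    next
      fix x :: "complex^'a"
      assume "norm x \<le> R" "\<And>x. norm x \<le> R \<Longrightarrow> norm (dbar j u x) \<le> B1 + B2"
      then show "norm (indicator K x *\<^sub>R dbar j u x) \<le> B1 + B2"
        using order_trans[OF norm_ge_zero, of "dbar j u x" "B1 + B2"] by (auto simp: indicator_def)
    next
      fix x :: "complex^'a"
      assume "norm x > R"
      then show "indicator K x *\<^sub>R dbar j u x = 0"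
        using R[of x] by (auto simp: indicator_def)
    qed
  qed
  fix \<phi> :: "complex^'a \<Rightarrow> complex"
  assume \<phi>: "\<phi> \<in> test_functions UNIV"
  obtain R where R: "\<And>x. norm x \<ge> R \<Longrightarrow> \<phi> x = 0"
    using test_functions_bounded_support[OF \<phi>] by metis
  note ibp = loc_Lipschitz_diff_mult_test[OF u loc_Lipschitz_diff_Ck[OF test_functions_Ck[OF \<phi>, of "Suc 0"]],
      of R, OF R, simplified]
  have "(\<integral>z. u z * dbar j \<phi> z \<partial>lborel)
      = (\<integral>z. (u z * frechet_derivative \<phi> (at z) (axis j 1) + \<i> * (u z * frechet_derivative \<phi> (at z) (axis j \<i>))) / 2 \<partial>lborel)"
    by (simp add: dbar_def algebra_simps)
  also have "\<dots> = - ((\<integral>z. (frechet_derivative u (at z) (axis j 1) * \<phi> z + \<i> * (frechet_derivative u (at z) (axis j \<i>) * \<phi> z)) / 2 \<partial>lborel))"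
    using ibp by (simp add: field_simps)
  also have "\<dots> = - (\<integral>z. dbar j u z * \<phi> z \<partial>lborel)"
    by (simp add: dbar_def algebra_simps add_divide_distrib)
  finally show "(\<integral>z. u z * dbar j \<phi> z \<partial>lborel) = - (\<integral>z. dbar j u z * \<phi> z \<partial>lborel)" .
qed

lemma locally_integrable_diff:
  "locally_integrable f \<Longrightarrow> locally_integrable g \<Longrightarrow> locally_integrable (\<lambda>x. f x - g x)"
  by (auto simp: locally_integrable_def intro: set_integral_diff)

lemma integrable_times_test:
  assumes "locally_integrable g" "\<phi> \<in> test_functions UNIV"
  shows "integrable lborel (\<lambda>x. g x * \<phi> x)"
proof -
  obtain R where R: "\<And>x. norm x \<ge> R \<Longrightarrow> \<phi> x = 0"
    using test_functions_bounded_support[OF assms(2)] by metis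
  have cont: "continuous_on UNIV \<phi>"
    using test_functions_Ck[OF assms(2), of 0] by simp
  have "bounded (\<phi> ` cball 0 R)"
    by (intro compact_imp_bounded compact_continuous_image continuous_on_subset[OF cont]) auto
  then have "\<exists>B. \<forall>x. norm x \<le> R \<longrightarrow> norm (\<phi> x) \<le> B"
    by (rule bounded_image_cball)
  then obtain B where "\<And>x. norm x \<le> R \<Longrightarrow> norm (\<phi> x) \<le> B"
    by blast
  then have "norm (\<phi> x) \<le> max B 0" for x
    using R[of x] by (cases "norm x \<le> R") (auto simp: max.coboundedI1)
  then show ?thesis
    using R cont
    by (intro integrable_times_bounded_support[OF assms(1), of \<phi> "max B 0" R])
       (auto intro: borel_measurable_continuous_onI)
qed

lemma has_weak_dbar_unique:
  assumes g: "has_weak_dbar j u g" and g': "has_weak_dbar j u g'"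
  shows "AE z in lborel. g z = g' z"
proof -
  have L: "locally_integrable g" "locally_integrable g'"
    using g g' by (auto simp: has_weak_dbar_def)
  have "AE z in lborel. g z - g' z = 0"
  proof (rule fundamental_lemma)
    show "locally_integrable (\<lambda>z. g z - g' z)"
      by (rule locally_integrable_diff[OF L])
    fix \<phi> :: "complex^'a \<Rightarrow> complex"
    assume \<phi>: "\<phi> \<in> test_functions UNIV"
    have "- (\<integral>z. g z * \<phi> z \<partial>lborel) = - (\<integral>z. g' z * \<phi> z \<partial>lborel)"
    proof -
      have "(\<integral>z. u z * dbar j \<phi> z \<partial>lborel) = - (\<integral>z. g z * \<phi> z \<partial>lborel)"
        using g \<phi> by (simp add: has_weak_dbar_def)
      moreover have "(\<integral>z. u z * dbar j \<phi> z \<partial>lborel) = - (\<integral>z. g' z * \<phi> z \<partial>lborel)"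
        using g' \<phi> by (simp add: has_weak_dbar_def)
      ultimately show ?thesis by simp
    qed
    then show "(\<integral>z. (g z - g' z) * \<phi> z \<partial>lborel) = 0"
      using L \<phi> by (simp add: left_diff_distrib integrable_times_test)
  qed
  then show ?thesis by simp
qed

lemma weak_dbar:
  assumes "has_weak_dbar j u g"
  shows "has_weak_dbar j u (weak_dbar j u)" "AE z in lborel. weak_dbar j u z = g z"
proof -
  show *: "has_weak_dbar j u (weak_dbar j u)"
    unfolding weak_dbar_def using assms by (rule someI[of "has_weak_dbar j u"])
  show "AE z in lborel. weak_dbar j u z = g z"
    by (rule has_weak_dbar_unique[OF * assms])
qed

section \<open>Functions of slow growth and the Gaussian measure\<close>

text \<open>
  This class contains all polynomials, is closed under products, and embeds into the Gaussian
  \<open>L\<^sup>2\<close> space.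
\<close>

definition slow_growth :: "('a::euclidean_space \<Rightarrow> complex) \<Rightarrow> bool" where
  "slow_growth p \<longleftrightarrow> continuous_on UNIV p \<and> (\<forall>d>0. \<exists>C\<ge>0. \<forall>x. norm (p x) \<le> C * exp (d * (norm x)\<^sup>2))"

lemma slow_growth_const: "slow_growth (\<lambda>x. c)"
  unfolding slow_growth_def
proof (intro conjI allI impI)
  fix d :: real
  assume "d > 0"
  then have "norm c * 1 \<le> norm c * exp (d * (norm x)\<^sup>2)" for x :: 'a
    by (intro mult_left_mono) auto
  then show "\<exists>C\<ge>0. \<forall>x::'a. norm c \<le> C * exp (d * (norm x)\<^sup>2)"
    by (auto intro!: exI[of _ "norm c"])
qed simp

lemma slow_growth_add:
  assumes p: "slow_growth p" and q: "slow_growth q"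
  shows "slow_growth (\<lambda>x. p x + q x)"
  unfolding slow_growth_def
proof (intro conjI allI impI)
  show "continuous_on UNIV (\<lambda>x. p x + q x)"
    using p q by (auto simp: slow_growth_def intro: continuous_intros)
  fix d :: real
  assume "d > 0"
  then obtain C D where C: "C \<ge> 0" "\<And>x. norm (p x) \<le> C * exp (d * (norm x)\<^sup>2)"
    and D: "D \<ge> 0" "\<And>x. norm (q x) \<le> D * exp (d * (norm x)\<^sup>2)"
    using p q unfolding slow_growth_def by blast
  have "norm (p x + q x) \<le> (C + D) * exp (d * (norm x)\<^sup>2)" for x
    using norm_triangle_mono[OF C(2) D(2)] by (simp add: ring_distribs)
  then show "\<exists>C\<ge>0. \<forall>x. norm (p x + q x) \<le> C * exp (d * (norm x)\<^sup>2)"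
    using C(1) D(1) by (auto intro!: exI[of _ "C + D"])
qed

lemma slow_growth_mult:
  assumes p: "slow_growth p" and q: "slow_growth q"
  shows "slow_growth (\<lambda>x. p x * q x)"
  unfolding slow_growth_def
proof (intro conjI allI impI)
  show "continuous_on UNIV (\<lambda>x. p x * q x)"
    using p q by (auto simp: slow_growth_def intro: continuous_intros)
  fix d :: real
  assume "d > 0"
  then have "d / 2 > 0" by simp
  then obtain C D where C: "C \<ge> 0" "\<And>x. norm (p x) \<le> C * exp (d / 2 * (norm x)\<^sup>2)"
    and D: "D \<ge> 0" "\<And>x. norm (q x) \<le> D * exp (d / 2 * (norm x)\<^sup>2)"
    using p q unfolding slow_growth_def by blast
  have "norm (p x * q x) \<le> (C * D) * exp (d * (norm x)\<^sup>2)" for x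
  proof -
    have "norm (p x * q x) \<le> (C * exp (d / 2 * (norm x)\<^sup>2)) * (D * exp (d / 2 * (norm x)\<^sup>2))"
      unfolding norm_mult using C D by (intro mult_mono) auto
    also have "\<dots> = (C * D) * (exp (d / 2 * (norm x)\<^sup>2) * exp (d / 2 * (norm x)\<^sup>2))"
      by (simp add: mult_ac)
    also have "exp (d / 2 * (norm x)\<^sup>2) * exp (d / 2 * (norm x)\<^sup>2) = exp (d * (norm x)\<^sup>2)"
      by (simp flip: exp_add)
    finally show ?thesis .
  qed
  then show "\<exists>C\<ge>0. \<forall>x. norm (p x * q x) \<le> C * exp (d * (norm x)\<^sup>2)"
    using C(1) D(1) by (auto intro!: exI[of _ "C * D"])
qed

lemma slow_growth_linear_bound:
  assumes "continuous_on UNIV p" "\<And>x. norm (p x) \<le> B * norm x" "B \<ge> 0"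
  shows "slow_growth p"
  unfolding slow_growth_def
proof (intro conjI allI impI assms)
  fix d :: real
  assume d: "d > 0"
  have "norm (p x) \<le> (B / d + B) * exp (d * (norm x)\<^sup>2)" for x
  proof -
    have "norm x \<le> (norm x)\<^sup>2 + 1"
      using sum_squares_bound[of "norm x" 1] norm_ge_zero[of x] unfolding power_one mult_1_right by linarith
    moreover have "1 + d * (norm x)\<^sup>2 \<le> exp (d * (norm x)\<^sup>2)"
      by (rule exp_ge_add_one_self)
    then have "(norm x)\<^sup>2 + 1 \<le> (1 / d + 1) * exp (d * (norm x)\<^sup>2)"
    proof -
      assume *: "1 + d * (norm x)\<^sup>2 \<le> exp (d * (norm x)\<^sup>2)"
      have "(norm x)\<^sup>2 = 1 / d * (d * (norm x)\<^sup>2)"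
        using d by simp
      also have "\<dots> \<le> 1 / d * exp (d * (norm x)\<^sup>2)"
      proof (rule mult_left_mono)
        show "d * (norm x)\<^sup>2 \<le> exp (d * (norm x)\<^sup>2)"
          using * by linarith
      qed (use d in auto)
      finally have "(norm x)\<^sup>2 \<le> 1 / d * exp (d * (norm x)\<^sup>2)" .
      moreover have "1 \<le> exp (d * (norm x)\<^sup>2)"
        using d by simp
      ultimately show ?thesis
        unfolding distrib_right mult_1 by linarith
    qed
    ultimately have "norm x \<le> (1 / d + 1) * exp (d * (norm x)\<^sup>2)"
      by (rule order_trans)
    from mult_left_mono[OF this \<open>B \<ge> 0\<close>] show ?thesis
      using assms(2)[of x] by (simp add: algebra_simps)
  qed
  then show "\<exists>C\<ge>0. \<forall>x. norm (p x) \<le> C * exp (d * (norm x)\<^sup>2)"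
    using assms(3) d by (auto intro!: exI[of _ "B / d + B"])
qed

lemma slow_growth_bounded_linear:
  assumes "bounded_linear L"
  shows "slow_growth L"
proof -
  obtain B where "B > 0" "\<And>x. norm (L x) \<le> norm x * B"
    using bounded_linear.pos_bounded[OF assms] by blast
  then show ?thesis
    by (intro slow_growth_linear_bound[of _ B] linear_continuous_on assms) (auto simp: mult.commute)
qed

lemma slow_growth_sum: "(\<And>i. i \<in> I \<Longrightarrow> slow_growth (p i)) \<Longrightarrow> slow_growth (\<lambda>x. \<Sum>i\<in>I. p i x)"
  by (induction I rule: infinite_finite_induct) (auto intro!: slow_growth_const slow_growth_add)

lemma slow_growth_prod: "(\<And>i. i \<in> I \<Longrightarrow> slow_growth (p i)) \<Longrightarrow> slow_growth (\<lambda>x. \<Prod>i\<in>I. p i x)"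
  by (induction I rule: infinite_finite_induct) (auto intro!: slow_growth_const slow_growth_mult)

lemma slow_growth_cmult: "slow_growth p \<Longrightarrow> slow_growth (\<lambda>x. c * p x)"
  by (intro slow_growth_mult slow_growth_const)

lemma slow_growth_diff: "slow_growth p \<Longrightarrow> slow_growth q \<Longrightarrow> slow_growth (\<lambda>x. p x - q x)"
  using slow_growth_add[of p "\<lambda>x. - 1 * q x"] slow_growth_cmult[of q "- 1"] by simp

lemma slow_growth_coord: "slow_growth (\<lambda>z::complex^'n. z $ j)"
  by (intro slow_growth_bounded_linear bounded_linear_vec_nth)

lemma slow_growth_cnj: "slow_growth p \<Longrightarrow> slow_growth (\<lambda>x. cnj (p x))"
  by (auto simp: slow_growth_def intro: continuous_intros)

lemma slow_growth_continuous: "slow_growth p \<Longrightarrow> continuous_on UNIV p"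
  by (simp add: slow_growth_def)

lemma slow_growth_measurable: "slow_growth p \<Longrightarrow> p \<in> borel_measurable borel"
  by (intro borel_measurable_continuous_onI slow_growth_continuous)

lemma nn_integral_gaussian_real:
  assumes a: "a > 0"
  shows "(\<integral>\<^sup>+x. ennreal (exp (- a * x\<^sup>2)) \<partial>lborel) < \<infinity>"
proof -
  define K where "K = exp (1 / (4 * a))"
  have "((\<lambda>x. - exp (- x :: real)) \<longlongrightarrow> - 0) at_top"
    by (intro tendsto_minus filterlim_compose[OF exp_at_bot] filterlim_uminus_at_bot_at_top)
  then have "(\<integral>\<^sup>+x. ennreal (exp (- x)) * indicator {0..} x \<partial>lborel) = ennreal (0 - (- exp (- 0)))"
    by (intro nn_integral_FTC_atLeast) (auto intro!: derivative_eq_intros)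
  then have half: "(\<integral>\<^sup>+x. ennreal (exp (- x)) * indicator {0..} x \<partial>lborel) = 1"
    by simp
  have half': "(\<integral>\<^sup>+x. ennreal (exp (- (- x))) * indicator {0..} (- x) \<partial>lborel) = 1"
    using half nn_integral_real_affine[of "\<lambda>x. ennreal (exp (- x)) * indicator {0..} x" "- 1" 0] by simp
  have le: "exp (- a * x\<^sup>2) \<le> K * exp (- y)" if "y = x \<or> y = - x" for x y :: real
  proof -
    have "0 \<le> a * (y - 1 / (2 * a))\<^sup>2"
      using a by simp
    also have "\<dots> = a * y\<^sup>2 - y + 1 / (4 * a)"
      using a by (simp add: field_simps power2_eq_square)
    finally have "- a * x\<^sup>2 \<le> 1 / (4 * a) + - y"
      using that by auto
    then have "exp (- a * x\<^sup>2) \<le> exp (1 / (4 * a) + - y)"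
      by simp
    then show ?thesis
      by (simp only: K_def exp_add)
  qed
  have "(\<integral>\<^sup>+x. ennreal (exp (- a * x\<^sup>2)) \<partial>lborel)
      \<le> (\<integral>\<^sup>+x. ennreal K * (ennreal (exp (- x)) * indicator {0..} x)
            + ennreal K * (ennreal (exp (- (- x))) * indicator {0..} (- x)) \<partial>lborel)"
  proof (rule nn_integral_mono)
    fix x :: real
    show "ennreal (exp (- a * x\<^sup>2)) \<le> ennreal K * (ennreal (exp (- x)) * indicator {0..} x)
            + ennreal K * (ennreal (exp (- (- x))) * indicator {0..} (- x))"
    proof (cases "x \<ge> 0")
      case True
      then have "ennreal (exp (- a * x\<^sup>2)) \<le> ennreal K * (ennreal (exp (- x)) * indicator {0..} x)"
        using le[of x x] by (simp add: K_def flip: ennreal_mult)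
      then show ?thesis by (rule order_trans) simp
    next
      case False
      then have "ennreal (exp (- a * x\<^sup>2)) \<le> ennreal K * (ennreal (exp (- (- x))) * indicator {0..} (- x))"
        using le[of "- x" x] by (simp add: K_def flip: ennreal_mult)
      then show ?thesis by (rule order_trans) simp
    qed
  qed
  also have "\<dots> = ennreal K * 1 + ennreal K * 1"
    using half half' by (simp add: nn_integral_add nn_integral_cmult)
  also have "\<dots> < \<infinity>"
    by (simp flip: ennreal_plus)
  finally show ?thesis .
qed

lemma integrable_gaussian:
  assumes a: "a > 0"
  shows "integrable lborel (\<lambda>x::'a::euclidean_space. exp (- a * (norm x)\<^sup>2))"
proof (rule integrableI_nonneg)
  have "(\<integral>\<^sup>+x. ennreal (exp (- a * (norm (x :: 'a))\<^sup>2)) \<partial>lborel)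
      = (\<integral>\<^sup>+x. (\<Prod>b\<in>Basis. ennreal (exp (- a * ((x :: 'a) \<bullet> b)\<^sup>2))) \<partial>lborel)"
  proof (rule nn_integral_cong)
    fix x :: 'a
    have "exp (- a * (norm x)\<^sup>2) = (\<Prod>b\<in>Basis. exp (- a * (x \<bullet> b)\<^sup>2))"
    proof -
      have "(norm x)\<^sup>2 = (\<Sum>b\<in>Basis. (x \<bullet> b)\<^sup>2)"
        unfolding power2_norm_eq_inner by (subst euclidean_inner) (simp add: power2_eq_square)
      then show ?thesis
        by (simp add: sum_distrib_left exp_sum)
    qed
    then show "ennreal (exp (- a * (norm x)\<^sup>2)) = (\<Prod>b\<in>Basis. ennreal (exp (- a * (x \<bullet> b)\<^sup>2)))"
      by (simp add: prod_ennreal)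
  qed
  also have "\<dots> = (\<Prod>b\<in>(Basis::'a set). \<integral>\<^sup>+t. ennreal (exp (- a * t\<^sup>2)) \<partial>lborel)"
    by (rule nn_integral_lborel_prod) auto
  also have "\<dots> < \<infinity>"
    using nn_integral_gaussian_real[OF a] by (simp add: ennreal_prod_eq_top power_less_top_ennreal less_top)
  finally show "(\<integral>\<^sup>+x. ennreal (exp (- a * (norm (x :: 'a))\<^sup>2)) \<partial>lborel) < \<infinity>" .
qed auto

lemma integrable_slow_growth_gaussian:
  assumes p: "slow_growth p" and a: "a > 0"
  shows "integrable lborel (\<lambda>x. p x * exp (- a * (norm x)\<^sup>2))"
proof -
  have "a / 2 > 0"
    using a by simp
  then obtain C where C: "C \<ge> 0" "\<And>x. norm (p x) \<le> C * exp (a / 2 * (norm x)\<^sup>2)"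
    using p unfolding slow_growth_def by blast
  show ?thesis
  proof (rule Bochner_Integration.integrable_bound)
    show "integrable lborel (\<lambda>x::'a. C * exp (- (a / 2) * (norm x)\<^sup>2))"
      using integrable_gaussian[OF \<open>a / 2 > 0\<close>, where 'a = 'a] by simp
    show "(\<lambda>x. p x * exp (- a * (norm x)\<^sup>2)) \<in> borel_measurable lborel"
      using slow_growth_measurable[OF p] by simp
    have "norm (p x * exp (- a * (norm x)\<^sup>2)) \<le> norm (C * exp (- (a / 2) * (norm x)\<^sup>2))" for x
    proof -
      have "norm (p x * exp (- a * (norm x)\<^sup>2)) = norm (p x) * exp (- a * (norm x)\<^sup>2)"
        by (simp add: norm_mult)
      also have "\<dots> \<le> (C * exp (a / 2 * (norm x)\<^sup>2)) * exp (- a * (norm x)\<^sup>2)"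
        by (intro mult_right_mono C) auto
      also have "\<dots> = C * exp (- (a / 2) * (norm x)\<^sup>2)"
        by (simp flip: exp_add)
      finally show ?thesis
        using C by simp
    qed
    then show "AE x in lborel. norm (p x * exp (- a * (norm x)\<^sup>2)) \<le> norm (C * exp (- (a / 2) * (norm x)\<^sup>2))"
      by simp
  qed
qed

abbreviation gdens :: "complex^'n::finite \<Rightarrow> real" where
  "gdens z \<equiv> (real CARD('n) / pi) ^ CARD('n) * exp (- real CARD('n) * (norm z)\<^sup>2)"

lemma sets_gauss [simp, measurable_cong]: "sets gauss = sets borel"
  and space_gauss [simp]: "space gauss = UNIV"
  by (simp_all add: gauss_def)

lemma measurable_gauss [simp]: "borel_measurable gauss = borel_measurable borel"
  by (rule measurable_cong_sets) simp_all

lemma AE_gauss: "(AE z in gauss. P z) \<longleftrightarrow> (AE z in lborel. P z)"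
  unfolding gauss_def by (subst AE_density) auto

lemma integral_gauss:
  fixes f :: "complex^'n::finite \<Rightarrow> 'b::{banach, second_countable_topology}"
  assumes "f \<in> borel_measurable borel"
  shows "(\<integral>z. f z \<partial>gauss) = (\<integral>z. gdens z *\<^sub>R f z \<partial>lborel)"
  unfolding gauss_def by (subst integral_density) (use assms in auto)

lemma integrable_gauss:
  fixes f :: "complex^'n::finite \<Rightarrow> 'b::{banach, second_countable_topology}"
  assumes "f \<in> borel_measurable borel"
  shows "integrable gauss f \<longleftrightarrow> integrable lborel (\<lambda>z. gdens z *\<^sub>R f z)"
  unfolding gauss_def by (subst integrable_density) (use assms in auto)

lemma slow_growth_integrable_gdens:
  fixes p :: "complex^'n::finite \<Rightarrow> complex"
  assumes "slow_growth p"
  shows "integrable lborel (\<lambda>z. p z * gdens z)"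
  using integrable_slow_growth_gaussian[OF slow_growth_cmult[OF assms, of "(real CARD('n) / pi) ^ CARD('n)"], of "real CARD('n)"]
  by (simp add: mult_ac)

lemma slow_growth_integrable:
  fixes p :: "complex^'n::finite \<Rightarrow> complex"
  assumes "slow_growth p"
  shows "integrable gauss p"
  using slow_growth_integrable_gdens[OF assms] slow_growth_measurable[OF assms]
  by (simp add: integrable_gauss scaleR_conv_of_real mult_ac)

lemma slow_growth_L2:
  fixes p :: "complex^'n::finite \<Rightarrow> complex"
  assumes "slow_growth p"
  shows "p \<in> L2 gauss"
proof (rule L2_I)
  have "integrable gauss (\<lambda>z. Re (p z * cnj (p z)))"
    by (intro integrable_Re slow_growth_integrable slow_growth_mult slow_growth_cnj assms)
  then show "integrable gauss (\<lambda>z. (norm (p z))\<^sup>2)"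
    by (simp add: complex_norm_square[symmetric] flip: of_real_power)
qed (use slow_growth_measurable[OF assms] in simp)

section \<open>Complex Hermite polynomials\<close>

text \<open>
  The polynomials \<open>(- \<partial>bar + c z)\<^sup>a (- \<partial> + c cnj z)\<^sup>b 1\<close> in one variable.
\<close>

primrec herm :: "real \<Rightarrow> nat \<Rightarrow> nat \<Rightarrow> complex \<Rightarrow> complex" where
  "herm c 0 b z = (of_real c * cnj z) ^ b"
| "herm c (Suc a) b z = of_real c * z * herm c a b z - of_real c * of_nat b * herm c a (b - 1) z"

lemma herm_Suc_right:
  "herm c a (Suc b) z = of_real c * cnj z * herm c a b z - of_real c * of_nat a * herm c (a - 1) b z"
proof (induction a arbitrary: b)
  case 0
  then show ?case by simp
next
  case (Suc a)
  have 1: "of_nat a * herm c a b z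
      = of_real c * z * (of_nat a * herm c (a - 1) b z) - of_real c * of_nat b * (of_nat a * herm c (a - 1) (b - 1) z)"
    by (cases a) (simp_all add: algebra_simps)
  have 2: "of_nat b * herm c a b z
      = of_real c * cnj z * (of_nat b * herm c a (b - 1) z) - of_real c * of_nat b * (of_nat a * herm c (a - 1) (b - 1) z)"
    by (cases b) (simp_all add: Suc.IH algebra_simps)
  have "herm c (Suc a) (Suc b) z - (of_real c * cnj z * herm c (Suc a) b z - of_real c * of_nat (Suc a) * herm c a b z)
      = of_real c * (of_nat a * herm c a b z - of_real c * z * (of_nat a * herm c (a - 1) b z))
        - of_real c * (of_nat b * herm c a b z - of_real c * cnj z * (of_nat b * herm c a (b - 1) z))"
    by (simp add: Suc.IH algebra_simps)
  also have "\<dots> = 0"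
    unfolding 1 2 by (simp add: algebra_simps)
  finally show ?case by simp
qed

lemma cnj_herm: "cnj (herm c a b z) = herm c b a z"
proof (induction a arbitrary: b)
  case 0
  show ?case by (induction b) (simp_all add: mult_ac)
next
  case (Suc a)
  then show ?case by (simp add: herm_Suc_right)
qed

declare herm.simps [simp del]

lemma herm_0_0 [simp]: "herm c 0 0 z = 1"
  by (simp add: herm.simps)

lemma herm_left_0: "herm c a 0 z = (of_real c * z) ^ a"
  by (induction a) (simp_all add: herm.simps)

lemma herm_has_derivative:
  "(herm c a b has_derivative
     (\<lambda>v. of_real c * of_nat a * herm c (a - 1) b z * v + of_real c * of_nat b * herm c a (b - 1) z * cnj v)) (at z)"
proof (induction a arbitrary: b)
  case 0
  have cnj: "(cnj has_derivative cnj) (at z)"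
    by (intro bounded_linear_imp_has_derivative bounded_linear_cnj)
  have "((\<lambda>z. (of_real c * cnj z) ^ b) has_derivative
      (\<lambda>v. of_nat b * (of_real c * cnj v) * (of_real c * cnj z) ^ (b - 1))) (at z)"
    by (rule has_derivative_power) (intro has_derivative_mult_right cnj)
  then show ?case
    by (simp add: herm.simps(1)[abs_def] mult_ac)
next
  case (Suc a)
  have "((\<lambda>z. of_real c * z * herm c a b z - of_real c * of_nat b * herm c a (b - 1) z) has_derivative
     (\<lambda>v. (of_real c * z * (of_real c * of_nat a * herm c (a - 1) b z * v + of_real c * of_nat b * herm c a (b - 1) z * cnj v)
          + of_real c * v * herm c a b z)
        - of_real c * of_nat b * (of_real c * of_nat a * herm c (a - 1) (b - 1) z * v
            + of_real c * of_nat (b - 1) * herm c a (b - 1 - 1) z * cnj v))) (at z)"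
    by (intro has_derivative_diff has_derivative_mult has_derivative_mult_right has_derivative_ident Suc.IH)
  moreover have "(of_real c * z * (of_real c * of_nat a * herm c (a - 1) b z * v + of_real c * of_nat b * herm c a (b - 1) z * cnj v)
          + of_real c * v * herm c a b z)
        - of_real c * of_nat b * (of_real c * of_nat a * herm c (a - 1) (b - 1) z * v
            + of_real c * of_nat (b - 1) * herm c a (b - 1 - 1) z * cnj v)
      = of_real c * of_nat (Suc a) * herm c (Suc a - 1) b z * v
          + of_real c * of_nat b * herm c (Suc a) (b - 1) z * cnj v" for v
    by (cases a) (simp_all add: herm.simps(2) algebra_simps)
  ultimately show ?case
    by (simp add: herm.simps(2)[abs_def])
qed

subsection \<open>Several variables\<close>

definition up :: "'n \<Rightarrow> ('n \<Rightarrow> nat) \<Rightarrow> 'n \<Rightarrow> nat" where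
  "up j a = a(j := Suc (a j))"

definition down :: "'n \<Rightarrow> ('n \<Rightarrow> nat) \<Rightarrow> 'n \<Rightarrow> nat" where
  "down j a = a(j := a j - 1)"

lemma down_up [simp]: "down j (up j a) = a"
  and up_down: "a j > 0 \<Longrightarrow> up j (down j a) = a"
  and up_same [simp]: "up j a j = Suc (a j)"
  and up_other: "k \<noteq> j \<Longrightarrow> up j a k = a k"
  and down_same: "down j a j = a j - 1"
  and down_other: "k \<noteq> j \<Longrightarrow> down j a k = a k"
  by (auto simp: up_def down_def)

lemma inj_up: "inj (up j)"
  by (metis down_up injI)

lemma sum_up:
  fixes a :: "'n::finite \<Rightarrow> nat"
  shows "(\<Sum>k\<in>UNIV. up j a k) = Suc (\<Sum>k\<in>UNIV. a k)"
  by (simp add: sum.remove[of UNIV j] up_other)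

definition Herm :: "('n \<Rightarrow> nat) \<Rightarrow> ('n \<Rightarrow> nat) \<Rightarrow> complex^'n::finite \<Rightarrow> complex" where
  "Herm a b z = (\<Prod>j\<in>UNIV. herm (real CARD('n)) (a j) (b j) (z $ j))"

lemma Herm_split:
  "Herm a b (z :: complex^'n::finite) = herm (real CARD('n)) (a j) (b j) (z $ j)
     * (\<Prod>k\<in>UNIV - {j}. herm (real CARD('n)) (a k) (b k) (z $ k))"
  by (simp add: Herm_def prod.remove)

lemma Herm_0_0 [simp]: "Herm (\<lambda>_. 0) (\<lambda>_. 0) z = 1"
  by (simp add: Herm_def)

lemma cnj_Herm: "cnj (Herm a b z) = Herm b a z"
  by (simp add: Herm_def cnj_herm)

lemma Herm_up_right:
  "Herm a (up j b) (z :: complex^'n::finite)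
     = of_nat CARD('n) * cnj (z $ j) * Herm a b z - of_nat CARD('n) * of_nat (a j) * Herm (down j a) b z"
  unfolding Herm_split[where j = j]
  by (simp add: up_other down_same down_other herm_Suc_right algebra_simps)

lemma Herm_up_left:
  "Herm (up j a) b (z :: complex^'n::finite)
     = of_nat CARD('n) * z $ j * Herm a b z - of_nat CARD('n) * of_nat (b j) * Herm a (down j b) z"
  unfolding Herm_split[where j = j]
  by (simp add: up_other down_same down_other herm.simps algebra_simps)

definition Herm_deriv :: "('n \<Rightarrow> nat) \<Rightarrow> ('n \<Rightarrow> nat) \<Rightarrow> complex^'n::finite \<Rightarrow> complex^'n \<Rightarrow> complex" where
  "Herm_deriv a b z v = of_nat CARD('n) * (\<Sum>j\<in>UNIV. of_nat (a j) * Herm (down j a) b z * v $ j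
      + of_nat (b j) * Herm a (down j b) z * cnj (v $ j))"

lemma Herm_has_derivative:
  "(Herm a b has_derivative Herm_deriv a b z) (at (z :: complex^'n::finite))"
proof -
  let ?n = "real CARD('n)"
  have "((\<lambda>z::complex^'n. herm ?n (a j) (b j) (z $ j)) has_derivative
      (\<lambda>v. of_real ?n * of_nat (a j) * herm ?n (a j - 1) (b j) (z $ j) * v $ j
         + of_real ?n * of_nat (b j) * herm ?n (a j) (b j - 1) (z $ j) * cnj (v $ j))) (at z)" for j
    by (rule has_derivative_compose[OF bounded_linear_imp_has_derivative[OF bounded_linear_vec_nth] herm_has_derivative])
  then have "((\<lambda>z. \<Prod>j\<in>UNIV. herm ?n (a j) (b j) (z $ j)) has_derivative
      (\<lambda>v. \<Sum>j\<in>UNIV. (of_real ?n * of_nat (a j) * herm ?n (a j - 1) (b j) (z $ j) * v $ j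
         + of_real ?n * of_nat (b j) * herm ?n (a j) (b j - 1) (z $ j) * cnj (v $ j))
         * (\<Prod>k\<in>UNIV - {j}. herm ?n (a k) (b k) (z $ k)))) (at z)"
    by (rule has_derivative_prod)
  moreover have "(\<Sum>j\<in>UNIV. (of_real ?n * of_nat (a j) * herm ?n (a j - 1) (b j) (z $ j) * v $ j
         + of_real ?n * of_nat (b j) * herm ?n (a j) (b j - 1) (z $ j) * cnj (v $ j))
         * (\<Prod>k\<in>UNIV - {j}. herm ?n (a k) (b k) (z $ k))) = Herm_deriv a b z v" for v
    unfolding Herm_deriv_def sum_distrib_left
  proof (rule sum.cong[OF refl])
    fix j
    show "(of_real ?n * of_nat (a j) * herm ?n (a j - 1) (b j) (z $ j) * v $ j
         + of_real ?n * of_nat (b j) * herm ?n (a j) (b j - 1) (z $ j) * cnj (v $ j))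
         * (\<Prod>k\<in>UNIV - {j}. herm ?n (a k) (b k) (z $ k))
       = of_nat CARD('n) * (of_nat (a j) * Herm (down j a) b z * v $ j
           + of_nat (b j) * Herm a (down j b) z * cnj (v $ j))"
      by (simp add: Herm_split[where j = j] down_same down_other algebra_simps)
  qed
  ultimately show ?thesis
    by (simp add: Herm_def[abs_def])
qed

lemma Herm_deriv_axis:
  "Herm_deriv a b z (axis j w) = of_nat CARD('n) * (of_nat (a j) * Herm (down j a) b (z :: complex^'n::finite) * w
      + of_nat (b j) * Herm a (down j b) z * cnj w)"
proof -
  have "(\<Sum>k\<in>UNIV. of_nat (a k) * Herm (down k a) b z * axis j w $ k
      + of_nat (b k) * Herm a (down k b) z * cnj (axis j w $ k))
    = (\<Sum>k\<in>{j}. of_nat (a k) * Herm (down k a) b z * axis j w $ k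
      + of_nat (b k) * Herm a (down k b) z * cnj (axis j w $ k))"
    by (rule sum.mono_neutral_right) (auto simp: axis_def)
  then show ?thesis
    by (simp add: Herm_deriv_def)
qed

lemma slow_growth_herm: "slow_growth (\<lambda>z::complex^'n. herm c a b (z $ j))"
proof (induction a arbitrary: b)
  case 0
  have "slow_growth (\<lambda>z::complex^'n. \<Prod>i<b. of_real c * cnj (z $ j))"
    by (intro slow_growth_prod slow_growth_cmult slow_growth_cnj slow_growth_coord)
  then show ?case by (simp add: herm.simps)
next
  case (Suc a)
  then show ?case
    unfolding herm.simps
    by (intro slow_growth_diff slow_growth_mult slow_growth_const slow_growth_coord)
qed

lemma slow_growth_Herm: "slow_growth (Herm a b)"
  unfolding Herm_def[abs_def] by (intro slow_growth_prod slow_growth_herm)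

lemma slow_growth_Herm_deriv: "slow_growth (\<lambda>z. Herm_deriv a b z v)"
  unfolding Herm_deriv_def
  by (intro slow_growth_cmult slow_growth_sum slow_growth_add slow_growth_mult slow_growth_const slow_growth_Herm)

lemma Ck_on_Herm: "Ck_on k UNIV (Herm a b)"
proof -
  have cn: "Ck_on k UNIV (\<lambda>z::complex^'a. z $ j)" "Ck_on k UNIV (\<lambda>z::complex^'a. cnj (z $ j))" for j
    by (intro Ck_on_bounded_linear bounded_linear_vec_nth bounded_linear_compose[OF bounded_linear_cnj])+
  have "Ck_on k UNIV (\<lambda>z::complex^'a. herm c m l (z $ j))" for c m l j
  proof (induction m arbitrary: l)
    case 0
    have "Ck_on k UNIV (\<lambda>z::complex^'a. \<Prod>i<l. of_real c * cnj (z $ j))"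
      by (intro Ck_on_prod Ck_on_mult Ck_on_const cn)
    then show ?case by (simp add: herm.simps)
  next
    case (Suc m)
    have "Ck_on k UNIV (\<lambda>z::complex^'a. of_real c * z $ j * herm c m l (z $ j)
        + (- (of_real c * of_nat l)) * herm c m (l - 1) (z $ j))"
      by (intro Ck_on_add Ck_on_mult Ck_on_const cn Suc)
    then show ?case by (simp add: herm.simps)
  qed
  then show ?thesis
    unfolding Herm_def[abs_def] by (intro Ck_on_prod)
qed

lemma gdens_has_derivative:
  "((\<lambda>z::complex^'n::finite. complex_of_real (gdens z)) has_derivative
      (\<lambda>v. of_real (- 2 * real CARD('n) * (z \<bullet> v) * gdens z))) (at z)"
proof -
  have "((\<lambda>z::complex^'n. gdens z) has_derivative (\<lambda>v. - 2 * real CARD('n) * (z \<bullet> v) * gdens z)) (at z)"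
    unfolding power2_norm_eq_inner
    by (auto intro!: derivative_eq_intros simp: inner_commute algebra_simps)
  from has_derivative_of_real[OF this, where 'a = complex] show ?thesis
    by simp
qed

lemma inner_axis_complex:
  "z \<bullet> axis j 1 = Re (z $ j)" "z \<bullet> axis j \<i> = Im (z $ j)"
  by (simp_all add: inner_axis inner_complex_def)

text \<open>The Gaussian density \<open>\<rho>\<close> satisfies \<open>\<partial>bar\<^sub>j \<rho> = - n z\<^sub>j \<rho>\<close>.\<close>

lemma gauss_integration_by_parts:
  fixes p :: "complex^'n::finite \<Rightarrow> complex"
  assumes p: "\<And>z. (p has_derivative p' z) (at z)" "slow_growth p" "\<And>v. slow_growth (\<lambda>z. p' z v)"
  shows "(\<integral>z. (p' z (axis j 1) + \<i> * p' z (axis j \<i>)) / 2 * gdens z \<partial>lborel)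
           = (\<integral>z. of_nat CARD('n) * z $ j * p z * gdens z \<partial>lborel)"
proof -
  let ?n = "real CARD('n)"
  have inner: "slow_growth (\<lambda>z::complex^'n. of_real (z \<bullet> v))" for v
    by (intro slow_growth_bounded_linear bounded_linear_compose[OF bounded_linear_of_real] bounded_linear_inner_left)
  have eq: "(\<integral>z. p' z v * gdens z - 2 * ?n * (z \<bullet> v) * p z * gdens z \<partial>lborel) = 0" (is "?I = 0")
    and int: "integrable lborel (\<lambda>z. p' z v * gdens z)"
      "integrable lborel (\<lambda>z. 2 * ?n * (z \<bullet> v) * p z * gdens z)" for v
  proof -
    show int: "integrable lborel (\<lambda>z. p' z v * gdens z)"
      "integrable lborel (\<lambda>z. 2 * ?n * (z \<bullet> v) * p z * gdens z)"
      by (intro slow_growth_integrable_gdens p slow_growth_mult slow_growth_cmult slow_growth_const inner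
          inner[unfolded of_real_mult] | simp only: of_real_mult)+
    show "(\<integral>z. p' z v * gdens z - 2 * ?n * (z \<bullet> v) * p z * gdens z \<partial>lborel) = 0"
    proof (rule integral_directional_derivative_eq_0)
      show "integrable lborel (\<lambda>z. p z * gdens z)"
        by (rule slow_growth_integrable_gdens[OF p(2)])
      show "integrable lborel (\<lambda>z. p' z v * gdens z - 2 * ?n * (z \<bullet> v) * p z * gdens z)"
        by (intro Bochner_Integration.integrable_diff int)
      fix x
      show "((\<lambda>t. p (x + t *\<^sub>R v) * gdens (x + t *\<^sub>R v)) has_vector_derivative
          p' x v * gdens x - 2 * ?n * (x \<bullet> v) * p x * gdens x) (at 0)"
        using directional_derivative[OF has_derivative_mult[OF p(1) gdens_has_derivative], of x v]
        by (simp add: algebra_simps)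
    qed
  qed
  have "(\<integral>z. p' z v * gdens z \<partial>lborel) = (\<integral>z. 2 * ?n * (z \<bullet> v) * p z * gdens z \<partial>lborel)" for v
    using eq[of v] int[of v] by (subst (asm) Bochner_Integration.integral_diff) auto
  note ibp = this
  have "(\<integral>z. (p' z (axis j 1) + \<i> * p' z (axis j \<i>)) / 2 * gdens z \<partial>lborel)
      = (\<integral>z. (1 / 2) * (p' z (axis j 1) * gdens z) + (\<i> / 2) * (p' z (axis j \<i>) * gdens z) \<partial>lborel)"
    by (simp add: field_simps)
  also have "\<dots> = (1 / 2) * (\<integral>z. p' z (axis j 1) * gdens z \<partial>lborel) + (\<i> / 2) * (\<integral>z. p' z (axis j \<i>) * gdens z \<partial>lborel)"
    by (subst Bochner_Integration.integral_add)
       (simp_all only: integral_mult_right_zero integrable_mult_right int)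
  also have "\<dots> = (\<integral>z. (1 / 2) * (2 * ?n * (z \<bullet> axis j 1) * p z * gdens z)
      + (\<i> / 2) * (2 * ?n * (z \<bullet> axis j \<i>) * p z * gdens z) \<partial>lborel)"
    unfolding ibp
    by (subst Bochner_Integration.integral_add)
       (simp_all only: integral_mult_right_zero integrable_mult_right int)
  also have "\<dots> = (\<integral>z. of_nat CARD('n) * z $ j * p z * gdens z \<partial>lborel)"
  proof (rule Bochner_Integration.integral_cong[OF refl])
    fix z :: "complex^'n"
    have "(1 / 2) * (2 * ?n * (z \<bullet> axis j 1) * p z * gdens z) + (\<i> / 2) * (2 * ?n * (z \<bullet> axis j \<i>) * p z * gdens z)
      = of_nat CARD('n) * (of_real (Re (z $ j)) + \<i> * of_real (Im (z $ j))) * p z * gdens z"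
      unfolding inner_axis_complex by (simp add: algebra_simps)
    also have "of_real (Re (z $ j)) + \<i> * of_real (Im (z $ j)) = z $ j"
      by (rule complex_eq[symmetric])
    finally show "(1 / 2) * (2 * ?n * (z \<bullet> axis j 1) * p z * gdens z) + (\<i> / 2) * (2 * ?n * (z \<bullet> axis j \<i>) * p z * gdens z)
      = of_nat CARD('n) * z $ j * p z * gdens z" .
  qed
  finally show ?thesis .
qed

lemma L2_inner_gauss:
  fixes f g :: "complex^'n::finite \<Rightarrow> complex"
  assumes "f \<in> borel_measurable borel" "g \<in> borel_measurable borel"
  shows "L2_inner gauss f g = (\<integral>z. f z * cnj (g z) * gdens z \<partial>lborel)"
proof -
  have "(\<lambda>z. f z * cnj (g z)) \<in> borel_measurable borel"
    using assms by (auto intro!: borel_measurable_times measurable_compose[OF _ borel_measurable_cnj])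
  then show ?thesis
    unfolding L2_inner_def by (simp add: integral_gauss scaleR_conv_of_real mult_ac)
qed

text \<open>
  By \<open>gauss_integration_by_parts\<close>, raising \<open>b\<^sub>j\<close> is adjoint to \<open>\<partial>bar\<^sub>j\<close>, which lowers \<open>b'\<^sub>j\<close>.
\<close>

lemma Herm_ladder:
  "L2_inner gauss (Herm a' b') (Herm a (up j b) :: complex^'n::finite \<Rightarrow> complex)
     = of_nat CARD('n) * of_nat (b' j) * L2_inner gauss (Herm a' (down j b')) (Herm a b)"
proof -
  let ?p = "\<lambda>z::complex^'n. Herm a' b' z * Herm b a z"
  let ?p' = "\<lambda>z v. Herm a' b' z * Herm_deriv b a z v + Herm_deriv a' b' z v * Herm b a z"
  have meas: "Herm a b \<in> borel_measurable borel" for a b :: "'n \<Rightarrow> nat"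
    by (rule slow_growth_measurable[OF slow_growth_Herm])
  have int: "integrable lborel (\<lambda>z. Herm a' b' z * Herm b a z * gdens z)" for a b a' b' :: "'n \<Rightarrow> nat"
    by (intro slow_growth_integrable_gdens slow_growth_mult slow_growth_Herm)
  have ibp: "(\<integral>z. (?p' z (axis j 1) + \<i> * ?p' z (axis j \<i>)) / 2 * gdens z \<partial>lborel)
           = (\<integral>z. of_nat CARD('n) * z $ j * ?p z * gdens z \<partial>lborel)"
    by (rule gauss_integration_by_parts)
       (intro has_derivative_mult Herm_has_derivative slow_growth_mult slow_growth_add slow_growth_Herm
          slow_growth_Herm_deriv)+
  have "(?p' z (axis j 1) + \<i> * ?p' z (axis j \<i>)) / 2 * gdens z
      = of_nat CARD('n) * of_nat (a j) * (Herm a' b' z * Herm b (down j a) z * gdens z)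
        + of_nat CARD('n) * of_nat (b' j) * (Herm a' (down j b') z * Herm b a z * gdens z)" for z :: "complex^'n"
    unfolding Herm_deriv_axis by (simp add: field_simps)
  then have lhs: "(\<integral>z. (?p' z (axis j 1) + \<i> * ?p' z (axis j \<i>)) / 2 * gdens z \<partial>lborel)
      = of_nat CARD('n) * of_nat (a j) * (\<integral>z. Herm a' b' z * Herm b (down j a) z * gdens z \<partial>lborel)
        + of_nat CARD('n) * of_nat (b' j) * (\<integral>z. Herm a' (down j b') z * Herm b a z * gdens z \<partial>lborel)"
    using int by simp
  have "of_nat CARD('n) * z $ j * ?p z * gdens z
      = Herm a' b' z * Herm (up j b) a z * gdens z
        + of_nat CARD('n) * of_nat (a j) * (Herm a' b' z * Herm b (down j a) z * gdens z)" for z :: "complex^'n"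
    unfolding Herm_up_left by (simp add: algebra_simps)
  then have rhs: "(\<integral>z. of_nat CARD('n) * z $ j * ?p z * gdens z \<partial>lborel)
      = (\<integral>z. Herm a' b' z * Herm (up j b) a z * gdens z \<partial>lborel)
        + of_nat CARD('n) * of_nat (a j) * (\<integral>z. Herm a' b' z * Herm b (down j a) z * gdens z \<partial>lborel)"
    using int by simp
  show ?thesis
    using ibp unfolding lhs rhs by (simp add: L2_inner_gauss meas cnj_Herm)
qed

definition mfact :: "('n::finite \<Rightarrow> nat) \<Rightarrow> real" where
  "mfact a = (\<Prod>j\<in>UNIV. real CARD('n) ^ a j * fact (a j))"

lemma mfact_pos: "mfact a > 0"
  unfolding mfact_def by (intro prod_pos) simp

lemma mfact_0 [simp]: "mfact (\<lambda>_. 0) = 1"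
  by (simp add: mfact_def)

lemma mfact_up: "mfact (up j a) = real CARD('n) * real (Suc (a j)) * mfact (a :: 'n::finite \<Rightarrow> nat)"
proof -
  have "mfact (up j a) = (real CARD('n) ^ Suc (a j) * fact (Suc (a j)))
      * (\<Prod>k\<in>UNIV - {j}. real CARD('n) ^ a k * fact (a k))"
    unfolding mfact_def by (subst prod.remove[of UNIV j]) (auto simp: up_other)
  moreover have "mfact a = (real CARD('n) ^ a j * fact (a j))
      * (\<Prod>k\<in>UNIV - {j}. real CARD('n) ^ a k * fact (a k))"
    unfolding mfact_def by (subst prod.remove[of UNIV j]) auto
  ultimately show ?thesis
    by (simp add: algebra_simps)
qed

text \<open>
  The total mass of the Gaussian measure, a common factor of all inner products of Hermite polynomials.
\<close>

definition gmass :: "'n::finite itself \<Rightarrow> real" where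
  "gmass _ = (\<integral>z. gdens (z :: complex^'n) \<partial>lborel)"

lemma gmass_pos: "gmass TYPE('n::finite) > 0"
proof -
  have int: "integrable lborel (\<lambda>z::complex^'n. gdens z)"
    using integrable_gaussian[of "real CARD('n)", where 'a = "complex^'n"] by simp
  have "gmass TYPE('n) \<noteq> 0"
  proof
    assume "gmass TYPE('n) = 0"
    then have "AE z in lborel. gdens (z :: complex^'n) = 0"
      unfolding gmass_def by (subst (asm) integral_nonneg_eq_0_iff_AE[OF int]) auto
    then have "AE z in (lborel :: (complex^'n) measure). False"
      by eventually_elim simp
    then show False
      by (simp add: AE_iff_measurable[of UNIV lborel] )
  qed
  moreover have "gmass TYPE('n) \<ge> 0"
    unfolding gmass_def by simp
  ultimately show ?thesis by simp
qed

lemma multi_index_induct [case_names zero up]: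
  fixes a :: "'n::finite \<Rightarrow> nat"
  assumes "P (\<lambda>_. 0)" "\<And>j a. P a \<Longrightarrow> P (up j a)"
  shows "P a"
proof (induction "\<Sum>k\<in>UNIV. a k" arbitrary: a)
  case 0
  then have "a = (\<lambda>_. 0)" by auto
  then show ?case using assms(1) by simp
next
  case (Suc m)
  then obtain j where j: "a j > 0"
    by (metis Suc_neq_Zero neq0_conv sum.neutral)
  then have "(\<Sum>k\<in>UNIV. down j a k) = m"
    using Suc(2) sum_up[of j "down j a"] by (simp add: up_down)
  then show ?case
    using assms(2)[OF Suc(1)[of "down j a"], of j] j by (simp add: up_down)
qed

text \<open>
  The ladder relation removes one step from both indices at a time, until one of them is zero.
\<close>

lemma Herm_inner_right_degree:
  "L2_inner gauss (Herm a' b') (Herm a b :: complex^'n::finite \<Rightarrow> complex)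
     = (if b' = b then of_real (mfact b) * L2_inner gauss (Herm a' (\<lambda>_. 0)) (Herm a (\<lambda>_. 0)) else 0)"
proof (induction b arbitrary: b' rule: multi_index_induct)
  case zero
  show ?case
  proof (cases "b' = (\<lambda>_. 0)")
    case False
    then obtain j where j: "b' j > 0" by auto
    have "L2_inner gauss (Herm a (\<lambda>_. 0)) (Herm a' (up j (down j b')) :: complex^'n \<Rightarrow> complex) = 0"
      by (simp add: Herm_ladder)
    then show ?thesis
      using False j by (simp add: up_down L2_inner_commute[of _ "Herm a' b'"])
  qed simp
next
  case (up j b)
  have "b' j > 0 \<and> down j b' = b \<longleftrightarrow> b' = up j b"
    using up_down[of b' j] by auto
  then show ?case
    by (cases "b' j = 0") (auto simp: Herm_ladder up.IH mfact_up up_down)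
qed

text \<open>
  Complex conjugation exchanges the two indices, so \<open>Herm_inner_right_degree\<close> can be applied to each of them.
\<close>

lemma Herm_inner:
  "L2_inner gauss (Herm a' b') (Herm a b :: complex^'n::finite \<Rightarrow> complex)
     = (if a' = a \<and> b' = b then of_real (mfact a * mfact b * gmass TYPE('n)) else 0)"
proof -
  have meas: "Herm a b \<in> borel_measurable borel" for a b :: "'n \<Rightarrow> nat"
    by (rule slow_growth_measurable[OF slow_growth_Herm])
  have "L2_inner gauss (Herm a' (\<lambda>_. 0)) (Herm a (\<lambda>_. 0) :: complex^'n \<Rightarrow> complex)
      = L2_inner gauss (Herm (\<lambda>_. 0) a) (Herm (\<lambda>_. 0) a' :: complex^'n \<Rightarrow> complex)"
    by (simp add: L2_inner_gauss meas cnj_Herm mult_ac)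
  also have "\<dots> = (if a = a' then of_real (mfact a') * L2_inner gauss (Herm (\<lambda>_. 0) (\<lambda>_. 0)) (Herm (\<lambda>_. 0) (\<lambda>_. 0) :: complex^'n \<Rightarrow> complex) else 0)"
    by (rule Herm_inner_right_degree)
  also have "L2_inner gauss (Herm (\<lambda>_. 0) (\<lambda>_. 0)) (Herm (\<lambda>_. 0) (\<lambda>_. 0) :: complex^'n \<Rightarrow> complex) = of_real (gmass TYPE('n))"
    by (subst L2_inner_gauss) (auto simp: meas gmass_def simp flip: of_real_mult of_real_power)
  finally show ?thesis
    by (subst Herm_inner_right_degree) (auto simp: mult_ac)
qed

section \<open>Completeness of the Hermite polynomials\<close>

subsection \<open>Gaussian convolutions determine an integrable function\<close>

lemma lborel_integral_scale:
  fixes F :: "'a::euclidean_space \<Rightarrow> complex"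
  assumes c: "c > 0" and F: "F \<in> borel_measurable borel"
  shows "(\<integral>x. F x \<partial>lborel) = c ^ DIM('a) * (\<integral>t. F (x + c *\<^sub>R t) \<partial>lborel)"
proof -
  have "(\<integral>x. F x \<partial>lborel) = (\<integral>x. F x \<partial>density (distr lborel borel (\<lambda>t. x + c *\<^sub>R t)) (\<lambda>_. ennreal (\<bar>c\<bar> ^ DIM('a))))"
    using c by (subst lborel_affine[of c x]) auto
  also have "\<dots> = (\<integral>y. \<bar>c\<bar> ^ DIM('a) *\<^sub>R F y \<partial>distr lborel borel (\<lambda>t. x + c *\<^sub>R t))"
    using F by (subst integral_density) auto
  also have "\<dots> = (\<integral>t. \<bar>c\<bar> ^ DIM('a) *\<^sub>R F (x + c *\<^sub>R t) \<partial>lborel)"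
    using F by (subst integral_distr) auto
  finally show ?thesis
    using c by (simp add: scaleR_conv_of_real)
qed

lemma integrable_product:
  fixes f g :: "'a::euclidean_space \<Rightarrow> complex"
  assumes f: "integrable lborel f" and g: "integrable lborel g"
  shows "integrable (lborel \<Otimes>\<^sub>M lborel) (\<lambda>(x, y). f x * g y)"
proof (rule lborel_pair.Fubini_integrable)
  have [measurable]: "f \<in> borel_measurable borel" "g \<in> borel_measurable borel"
    using f g by (auto dest: borel_measurable_integrable)
  show "(\<lambda>(x, y). f x * g y) \<in> borel_measurable (lborel \<Otimes>\<^sub>M lborel)"
    by measurable
  show "integrable lborel (\<lambda>x. \<integral>y. norm (case (x, y) of (x, y) \<Rightarrow> f x * g y) \<partial>lborel)"
    using integrable_norm[OF f] by (simp add: norm_mult)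
  show "AE x in lborel. integrable lborel (\<lambda>y. case (x, y) of (x, y) \<Rightarrow> f x * g y)"
    using g by simp
qed

text \<open>
  If all Gaussian convolutions of \<open>g\<close> with widths tending to zero vanish, then so does \<open>\<integral> g \<phi>\<close> for
  every test function \<open>\<phi>\<close>, because the convolutions of \<open>\<phi>\<close> approximate a multiple of \<open>\<phi>\<close>.
\<close>

lemma gaussian_convolution_zero:
  fixes g :: "'a::euclidean_space \<Rightarrow> complex"
  assumes g: "integrable lborel g" and a: "\<And>k. a k > 0" "filterlim a at_top sequentially"
    and zero: "\<And>k y. (\<integral>x. g x * exp (- a k * (norm (x - y))\<^sup>2) \<partial>lborel) = 0"
  shows "AE x in lborel. g x = 0"
proof (rule fundamental_lemma)
  have [measurable]: "g \<in> borel_measurable borel"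
    using g by (auto dest: borel_measurable_integrable)
  show "locally_integrable g"
    unfolding locally_integrable_def set_integrable_def
    by (auto intro!: integrable_mult_indicator g borel_compact)
  fix \<phi> :: "'a \<Rightarrow> complex"
  assume \<phi>: "\<phi> \<in> test_functions UNIV"
  have cont: "continuous_on UNIV \<phi>"
    using test_functions_Ck[OF \<phi>, of 0] by simp
  then have [measurable]: "\<phi> \<in> borel_measurable borel"
    by (rule borel_measurable_continuous_onI)
  obtain R where R: "\<And>x. norm x \<ge> R \<Longrightarrow> \<phi> x = 0"
    using test_functions_bounded_support[OF \<phi>] by metis
  have "bounded (\<phi> ` cball 0 R)"
    by (intro compact_imp_bounded compact_continuous_image continuous_on_subset[OF cont]) auto
  then obtain B0 where B0: "\<And>x. norm x \<le> R \<Longrightarrow> norm (\<phi> x) \<le> B0"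
    using bounded_image_cball by metis
  define B where "B = max B0 0"
  have B: "norm (\<phi> x) \<le> B" "B \<ge> 0" for x
    using R[of x] B0[of x] by (cases "norm x \<le> R", auto simp: B_def)+
  have int\<phi>: "integrable lborel \<phi>"
    by (rule integrable_bounded_support[of _ R B]) (use B R in auto)
  define G where "G t = complex_of_real (exp (- 1 * (norm (t :: 'a))\<^sup>2))" for t
  have G: "integrable lborel G"
    unfolding G_def by (intro integrable_of_real integrable_gaussian) simp
  have [measurable]: "G \<in> borel_measurable borel"
    using G by (auto dest: borel_measurable_integrable)
  define c where "c k = 1 / sqrt (a k)" for k
  have c: "c k > 0" "a k = 1 / (c k)\<^sup>2" for k
    using a(1)[of k] by (simp_all add: c_def power_divide)
  have c0: "c \<longlonglongrightarrow> 0"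
    unfolding c_def
    by (intro tendsto_divide_0[OF tendsto_const] filterlim_at_top_imp_at_infinity
          filterlim_compose[OF sqrt_at_top a(2)])
  \<comment> \<open>The substitution \<open>y = x + c k t\<close> turns the convolution with the \<open>k\<close>-th Gaussian into one with a fixed Gaussian.\<close>
  define F where "F k = (\<lambda>(x, t). g x * \<phi> (x + c k *\<^sub>R t) * G t)" for k
  have meas: "F k \<in> borel_measurable (lborel \<Otimes>\<^sub>M lborel)" for k
    unfolding F_def by measurable
  have dom: "integrable (lborel \<Otimes>\<^sub>M lborel) (\<lambda>p. B * norm (case p of (x, t) \<Rightarrow> g x * G t))"
    using integrable_product[OF g G] by (intro Bochner_Integration.integrable_mult_right integrable_norm)
  have bound: "norm (F k p) \<le> B * norm (case p of (x, t) \<Rightarrow> g x * G t)" for k p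
    using mult_left_mono[OF B(1)[of "fst p + c k *\<^sub>R snd p"], of "norm (g (fst p)) * norm (G (snd p))"]
    by (auto simp: F_def norm_mult split: prod.split) (simp add: mult_ac)
  have intF: "integrable (lborel \<Otimes>\<^sub>M lborel) (F k)" for k
    by (rule Bochner_Integration.integrable_bound[OF dom meas]) (use bound B in \<open>auto simp: abs_mult\<close>)
  have zeroF: "integral\<^sup>L (lborel \<Otimes>\<^sub>M lborel) (F k) = 0" for k
  proof -
    define E where "E x y = g x * (\<phi> y * complex_of_real (exp (- a k * (norm (x - y))\<^sup>2)))" for x y
    have intE: "integrable (lborel \<Otimes>\<^sub>M lborel) (case_prod E)"
    proof (rule Bochner_Integration.integrable_bound)
      show "integrable (lborel \<Otimes>\<^sub>M lborel) (\<lambda>(x, y). g x * \<phi> y)"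
        by (rule integrable_product[OF g int\<phi>])
      show "case_prod E \<in> borel_measurable (lborel \<Otimes>\<^sub>M lborel)"
        unfolding E_def by measurable
      have "norm (E x y) \<le> norm (g x * \<phi> y)" for x y
      proof -
        have "norm (\<phi> y) * exp (- a k * (norm (x - y))\<^sup>2) \<le> norm (\<phi> y) * 1"
          using a(1)[of k] by (intro mult_left_mono) auto
        then show ?thesis
          by (simp add: E_def norm_mult mult_left_mono)
      qed
      then show "AE p in lborel \<Otimes>\<^sub>M lborel. norm (case_prod E p) \<le> norm (case p of (x, y) \<Rightarrow> g x * \<phi> y)"
        by (auto split: prod.split)
    qed
    have "integral\<^sup>L (lborel \<Otimes>\<^sub>M lborel) (F k) = (\<integral>x. (\<integral>t. F k (x, t) \<partial>lborel) \<partial>lborel)"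
      by (rule lborel_pair.integral_fst'[OF intF, symmetric])
    also have "\<dots> = (\<integral>x. of_real (1 / c k ^ DIM('a)) * (\<integral>y. E x y \<partial>lborel) \<partial>lborel)"
    proof (rule Bochner_Integration.integral_cong[OF refl])
      fix x
      have "E x \<in> borel_measurable borel"
        unfolding E_def by measurable
      from lborel_integral_scale[OF c(1) this, of k x]
      have "(\<integral>y. E x y \<partial>lborel) = of_real (c k ^ DIM('a)) * (\<integral>t. E x (x + c k *\<^sub>R t) \<partial>lborel)"
        by simp
      also have "(\<lambda>t. E x (x + c k *\<^sub>R t)) = (\<lambda>t. F k (x, t))"
        using c(1)[of k] by (auto simp: E_def F_def G_def c(2)[of k] power_mult_distrib)
      finally show "(\<integral>t. F k (x, t) \<partial>lborel) = of_real (1 / c k ^ DIM('a)) * (\<integral>y. E x y \<partial>lborel)"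
        using c(1)[of k] by simp
    qed
    also have "\<dots> = of_real (1 / c k ^ DIM('a)) * (\<integral>x. (\<integral>y. E x y \<partial>lborel) \<partial>lborel)"
      by simp
    also have "(\<integral>x. (\<integral>y. E x y \<partial>lborel) \<partial>lborel) = (\<integral>y. (\<integral>x. E x y \<partial>lborel) \<partial>lborel)"
      by (rule lborel_pair.Fubini_integral[OF intE, symmetric])
    also have "\<dots> = (\<integral>y. \<phi> y * (\<integral>x. g x * exp (- a k * (norm (x - y))\<^sup>2) \<partial>lborel) \<partial>lborel)"
      by (rule Bochner_Integration.integral_cong[OF refl])
         (simp add: E_def mult_ac flip: integral_mult_right_zero)
    also have "\<dots> = 0"
      by (simp only: zero) simp
    finally show ?thesis by simp
  qed
  have "(\<lambda>k. integral\<^sup>L (lborel \<Otimes>\<^sub>M lborel) (F k))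
      \<longlonglongrightarrow> integral\<^sup>L (lborel \<Otimes>\<^sub>M lborel) (\<lambda>(x, t). g x * \<phi> x * G t)"
  proof (rule integral_dominated_convergence[OF _ _ dom])
    show "(\<lambda>(x, t). g x * \<phi> x * G t) \<in> borel_measurable (lborel \<Otimes>\<^sub>M lborel)"
      by measurable
    show "AE p in lborel \<Otimes>\<^sub>M lborel. (\<lambda>k. F k p) \<longlonglongrightarrow> (case p of (x, t) \<Rightarrow> g x * \<phi> x * G t)"
    proof (intro AE_I2)
      fix p :: "'a \<times> 'a"
      obtain x t where p: "p = (x, t)" by fastforce
      have "(\<lambda>k. x + c k *\<^sub>R t) \<longlonglongrightarrow> x + 0 *\<^sub>R t"
        by (intro tendsto_intros c0)
      then have "(\<lambda>k. \<phi> (x + c k *\<^sub>R t)) \<longlonglongrightarrow> \<phi> x"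
        using continuous_on_tendsto_compose[OF cont, of "\<lambda>k. x + c k *\<^sub>R t" x] by simp
      then show "(\<lambda>k. F k p) \<longlonglongrightarrow> (case p of (x, t) \<Rightarrow> g x * \<phi> x * G t)"
        unfolding F_def p by (auto intro!: tendsto_intros)
    qed
  qed (use meas bound in auto)
  then have "integral\<^sup>L (lborel \<Otimes>\<^sub>M lborel) (\<lambda>(x, t). g x * \<phi> x * G t) = 0"
    by (simp add: zeroF LIMSEQ_const_iff)
  moreover have "integrable lborel (\<lambda>x. g x * \<phi> x)"
    by (rule integrable_times_bounded_support[of _ _ B R]) (use \<open>locally_integrable g\<close> B R in auto)
  then have "integral\<^sup>L (lborel \<Otimes>\<^sub>M lborel) (\<lambda>(x, t). g x * \<phi> x * G t)
      = (\<integral>x. (\<integral>t. g x * \<phi> x * G t \<partial>lborel) \<partial>lborel)"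
    using lborel_pair.integral_fst'[OF integrable_product[OF _ G]] by simp
  moreover have "\<dots> = (\<integral>x. g x * \<phi> x \<partial>lborel) * (\<integral>t. G t \<partial>lborel)"
    by simp
  moreover have "(\<integral>t. G t \<partial>lborel) \<noteq> 0"
  proof
    assume "(\<integral>t. G t \<partial>lborel) = 0"
    then have "(\<integral>t. exp (- 1 * (norm (t :: 'a))\<^sup>2) \<partial>lborel) = 0"
      unfolding G_def integral_complex_of_real by simp
    then have "AE t in lborel. exp (- 1 * (norm (t :: 'a))\<^sup>2) = 0"
      by (subst (asm) integral_nonneg_eq_0_iff_AE) (auto intro!: integrable_gaussian[of 1, simplified])
    then have "AE t in (lborel :: 'a measure). False"
      by eventually_elim simp
    then show False
      by (simp add: AE_iff_measurable[of UNIV lborel])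
  qed
  ultimately show "(\<integral>x. g x * \<phi> x \<partial>lborel) = 0"
    by simp
qed

subsection \<open>Totality\<close>

lemma L2_gauss_growth_bound:
  fixes q :: "complex^'n::finite \<Rightarrow> complex"
  assumes [measurable]: "q \<in> borel_measurable borel" and q: "\<And>z. norm (q z) \<le> K * exp (d * (norm z)\<^sup>2)"
    and d: "2 * d < real CARD('n)"
  shows "q \<in> L2 gauss"
proof (rule L2_bound)
  show "integrable gauss (\<lambda>z::complex^'n. K\<^sup>2 * exp (2 * d * (norm z)\<^sup>2))"
  proof (subst integrable_gauss)
    have "integrable lborel (\<lambda>z::complex^'n. ((real CARD('n) / pi) ^ CARD('n) * K\<^sup>2) * exp (- (real CARD('n) - 2 * d) * (norm z)\<^sup>2))"
      using d by (intro Bochner_Integration.integrable_mult_right integrable_gaussian) auto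
    then show "integrable lborel (\<lambda>z::complex^'n. gdens z *\<^sub>R (K\<^sup>2 * exp (2 * d * (norm z)\<^sup>2)))"
      by (simp add: algebra_simps flip: exp_add)
  qed auto
  have "(norm (q z))\<^sup>2 \<le> K\<^sup>2 * exp (2 * d * (norm z)\<^sup>2)" for z
  proof -
    have "(norm (q z))\<^sup>2 \<le> (K * exp (d * (norm z)\<^sup>2))\<^sup>2"
      by (intro power_mono q) auto
    also have "\<dots> = K\<^sup>2 * exp (2 * d * (norm z)\<^sup>2)"
      by (simp add: power_mult_distrib flip: exp_of_nat_mult)
    finally show ?thesis .
  qed
  then show "AE z in gauss. (norm (q z))\<^sup>2 \<le> K\<^sup>2 * exp (2 * d * (norm z)\<^sup>2)"
    by simp
qed simp

text \<open>
  Orthogonality to \<open>p\<close> times every Hermite polynomial; in contrast to orthogonality to \<open>p\<close> alone, it is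
  preserved when \<open>p\<close> is multiplied by a coordinate.
\<close>

definition annihilates :: "(complex^'n::finite \<Rightarrow> complex) \<Rightarrow> (complex^'n \<Rightarrow> complex) \<Rightarrow> bool" where
  "annihilates u p \<longleftrightarrow> slow_growth p \<and> (\<forall>a b. (\<integral>z. u z * (p z * Herm a b z) \<partial>gauss) = 0)"

lemma annihilates_integrable:
  assumes "u \<in> L2 gauss" "slow_growth p"
  shows "integrable gauss (\<lambda>z. u z * (p z * Herm a b z))"
  by (intro L2_integrable_mult assms slow_growth_L2 slow_growth_mult slow_growth_Herm)

lemma annihilates_add:
  "u \<in> L2 gauss \<Longrightarrow> annihilates u p \<Longrightarrow> annihilates u q \<Longrightarrow> annihilates u (\<lambda>z. p z + q z)"
  unfolding annihilates_def
  by (auto simp: ring_distribs slow_growth_add annihilates_integrable)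

lemma annihilates_cmult: "annihilates u p \<Longrightarrow> annihilates u (\<lambda>z. c * p z)"
proof -
  have "(\<integral>z. u z * (c * p z * Herm a b z) \<partial>gauss) = c * (\<integral>z. u z * (p z * Herm a b z) \<partial>gauss)" for a b
    by (simp add: mult_ac flip: integral_mult_right_zero)
  then show "annihilates u p \<Longrightarrow> annihilates u (\<lambda>z. c * p z)"
    by (auto simp: annihilates_def intro: slow_growth_cmult)
qed

lemma annihilates_sum:
  assumes "u \<in> L2 gauss"
  shows "(\<And>i. i \<in> I \<Longrightarrow> annihilates u (p i)) \<Longrightarrow> annihilates u (\<lambda>z. \<Sum>i\<in>I. p i z)"
proof (induction I rule: infinite_finite_induct)
  case (insert i I)
  then show ?case by (simp add: annihilates_add[OF assms])
qed (auto simp: annihilates_def slow_growth_const)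

text \<open>The recurrences express multiplication by a coordinate through the Hermite polynomials.\<close>

lemma annihilates_coord:
  fixes u :: "complex^'n::finite \<Rightarrow> complex"
  assumes u: "u \<in> L2 gauss" and p: "annihilates u p"
  shows "annihilates u (\<lambda>z. z $ j * p z)" and "annihilates u (\<lambda>z. cnj (z $ j) * p z)"
proof -
  have sg: "slow_growth p" and 0: "\<And>a b. (\<integral>z. u z * (p z * Herm a b z) \<partial>gauss) = 0"
    using p by (auto simp: annihilates_def)
  note int = annihilates_integrable[OF u sg]
  have n: "(of_nat CARD('n) :: complex) \<noteq> 0"
    by simp
  have "u z * (z $ j * p z * Herm a b z) = (u z * (p z * Herm (up j a) b z)
      + of_nat CARD('n) * of_nat (b j) * (u z * (p z * Herm a (down j b) z))) * (1 / of_nat CARD('n))" for a b z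
    unfolding Herm_up_left by (simp add: field_simps)
  then have "(\<integral>z. u z * (z $ j * p z * Herm a b z) \<partial>gauss) = 0" for a b
    by (simp add: int 0 del: times_divide_eq_right mult_1_right)
  then show "annihilates u (\<lambda>z. z $ j * p z)"
    by (auto simp: annihilates_def intro: slow_growth_mult slow_growth_coord sg)
  have "u z * (cnj (z $ j) * p z * Herm a b z) = (u z * (p z * Herm a (up j b) z)
      + of_nat CARD('n) * of_nat (a j) * (u z * (p z * Herm (down j a) b z))) * (1 / of_nat CARD('n))" for a b z
    unfolding Herm_up_right by (simp add: field_simps)
  then have "(\<integral>z. u z * (cnj (z $ j) * p z * Herm a b z) \<partial>gauss) = 0" for a b
    by (simp add: int 0 del: times_divide_eq_right mult_1_right)
  then show "annihilates u (\<lambda>z. cnj (z $ j) * p z)"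
    using slow_growth_mult[OF slow_growth_cnj[OF slow_growth_coord] sg] by (simp add: annihilates_def)
qed

lemma quadratic_form_complex:
  "complex_of_real (- s * (norm z)\<^sup>2 + z \<bullet> y)
     = (\<Sum>j\<in>UNIV. - of_real s * (z $ j * cnj (z $ j)) + (cnj (y $ j) / 2 * z $ j + y $ j / 2 * cnj (z $ j)))"
proof -
  have "complex_of_real (- s * (x \<bullet> x) + x \<bullet> w) = - of_real s * (x * cnj x) + (cnj w / 2 * x + w / 2 * cnj x)"
    for x w :: complex
    by (simp add: complex_eq_iff inner_complex_def power2_eq_square field_simps)
  then have "(\<Sum>j\<in>UNIV. - of_real s * (z $ j * cnj (z $ j)) + (cnj (y $ j) / 2 * z $ j + y $ j / 2 * cnj (z $ j)))
      = (\<Sum>j\<in>UNIV. complex_of_real (- s * (z $ j \<bullet> z $ j) + z $ j \<bullet> y $ j))"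
    by simp
  also have "\<dots> = complex_of_real (- s * (norm z)\<^sup>2 + z \<bullet> y)"
    by (simp add: power2_norm_eq_inner inner_vec_def sum.distrib sum_subtractf sum_distrib_left sum_negf)
  finally show ?thesis by simp
qed

lemma annihilates_quadratic:
  assumes u: "u \<in> L2 gauss" and p: "annihilates u p"
  shows "annihilates u (\<lambda>z. complex_of_real (- s * (norm z)\<^sup>2 + z \<bullet> y) * p z)"
proof -
  have "annihilates u (\<lambda>z. \<Sum>j\<in>UNIV. - of_real s * (z $ j * (cnj (z $ j) * p z))
      + (cnj (y $ j) / 2 * (z $ j * p z) + y $ j / 2 * (cnj (z $ j) * p z)))"
    by (intro annihilates_sum annihilates_add annihilates_cmult annihilates_coord u p)
  then show ?thesis
    unfolding quadratic_form_complex sum_distrib_right by (simp add: ring_distribs mult_ac)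
qed

lemma annihilates_power:
  assumes u: "u \<in> L2 gauss" and one: "annihilates u (\<lambda>z. 1)"
  shows "annihilates u (\<lambda>z. complex_of_real (- s * (norm z)\<^sup>2 + z \<bullet> y) ^ m)"
  by (induction m) (simp_all only: power_0 one power_Suc annihilates_quadratic[OF u])

lemma norm_exp_partial_sum: "norm (\<Sum>m<M. x ^ m / fact m) \<le> exp (norm (x :: complex))"
proof -
  have "norm (\<Sum>m<M. x ^ m / fact m) \<le> (\<Sum>m<M. norm x ^ m / fact m)"
    by (rule order_trans[OF norm_sum]) (simp add: norm_divide norm_power)
  also have "\<dots> \<le> (\<Sum>m. norm x ^ m / fact m)"
    using summable_exp_generic[of "norm x"]
    by (intro sum_le_suminf) (auto simp: divide_inverse mult.commute)
  also have "\<dots> = exp (norm x)"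
    by (simp add: exp_def divide_inverse mult.commute)
  finally show ?thesis .
qed

text \<open>
  Orthogonality to polynomials passes to Gaussians by expanding the exponential series. For the exponent \<open>n / 4\<close> the
  series of absolute values grows like \<open>exp (5 n \<bar>z\<bar>\<^sup>2 / 16)\<close>, and a polynomial raises this at most to
  \<open>exp (3 n \<bar>z\<bar>\<^sup>2 / 8)\<close>, which is still square integrable against \<open>exp (- n \<bar>z\<bar>\<^sup>2)\<close>.
\<close>

lemma annihilates_exp:
  fixes u :: "complex^'n::finite \<Rightarrow> complex"
  assumes u: "u \<in> L2 gauss" and one: "annihilates u (\<lambda>z. 1)"
  shows "(\<integral>z. u z * (complex_of_real (exp (- (real CARD('n) / 4) * (norm z)\<^sup>2 + z \<bullet> y)) * Herm a b z) \<partial>gauss) = 0"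
proof -
  define n where "n = real CARD('n)"
  have n: "n > 0" by (simp add: n_def)
  define F where "F z = complex_of_real (- (n / 4) * (norm z)\<^sup>2 + z \<bullet> y)" for z
  have contF: "continuous_on UNIV F"
    unfolding F_def by (intro continuous_intros)
  have [measurable]: "F \<in> borel_measurable borel" "u \<in> borel_measurable borel" "Herm a b \<in> borel_measurable borel"
    using contF L2_measurable[OF u] slow_growth_measurable[OF slow_growth_Herm, of a b]
    by (auto intro: borel_measurable_continuous_onI)
  have q: "(\<lambda>z. complex_of_real (exp (norm (F z)) * norm (Herm a b z))) \<in> L2 gauss"
  proof -
    have "\<exists>C\<ge>0. \<forall>z. norm (Herm a b z) \<le> C * exp (n / 16 * (norm z)\<^sup>2)"
    proof -
      have "n / 16 > 0"
        using n by simp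
      then show ?thesis
        using slow_growth_Herm[of a b] unfolding slow_growth_def by blast
    qed
    then obtain C where C: "C \<ge> 0" "\<And>z. norm (Herm a b z) \<le> C * exp (n / 16 * (norm z)\<^sup>2)"
      by blast
    show ?thesis
    proof (rule L2_gauss_growth_bound[of _ "exp ((norm y)\<^sup>2 * (4 / n)) * C" "3 * n / 8"])
      fix z
      have "norm (F z) \<le> n / 4 * (norm z)\<^sup>2 + \<bar>z \<bullet> y\<bar>"
        unfolding F_def norm_of_real using n by (intro order_trans[OF abs_triangle_ineq]) (simp add: abs_mult)
      also have "\<bar>z \<bullet> y\<bar> \<le> norm z * norm y"
        by (rule Cauchy_Schwarz_ineq2)
      also have "\<dots> \<le> n / 16 * (norm z)\<^sup>2 + (norm y)\<^sup>2 * (4 / n)"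
      proof -
        have "0 \<le> (n / 16) * (norm z - 8 / n * norm y)\<^sup>2"
          using n by simp
        also have "\<dots> = n / 16 * (norm z)\<^sup>2 - norm z * norm y + (norm y)\<^sup>2 * (4 / n)"
          using n by (simp add: power2_eq_square field_simps)
        finally show ?thesis by simp
      qed
      finally have "norm (F z) \<le> 5 * n / 16 * (norm z)\<^sup>2 + (norm y)\<^sup>2 * (4 / n)"
        by (simp add: field_simps)
      then have "exp (norm (F z)) * norm (Herm a b z)
          \<le> exp (5 * n / 16 * (norm z)\<^sup>2 + (norm y)\<^sup>2 * (4 / n)) * (C * exp (n / 16 * (norm z)\<^sup>2))"
        using C by (intro mult_mono) auto
      also have "\<dots> = exp ((norm y)\<^sup>2 * (4 / n)) * C * exp (3 * n / 8 * (norm z)\<^sup>2)"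
        by (simp add: field_simps flip: exp_add)
      finally show "norm (complex_of_real (exp (norm (F z)) * norm (Herm a b z)))
          \<le> exp ((norm y)\<^sup>2 * (4 / n)) * C * exp (3 * n / 8 * (norm z)\<^sup>2)"
        by (simp add: norm_mult)
    qed (use n in \<open>auto simp: n_def[symmetric]\<close>)
  qed
  have dom: "integrable gauss (\<lambda>z. norm (u z * complex_of_real (exp (norm (F z)) * norm (Herm a b z))))"
    by (intro integrable_norm L2_integrable_mult u q)
  have "(\<lambda>M. \<integral>z. u z * ((\<Sum>m<M. F z ^ m / fact m) * Herm a b z) \<partial>gauss)
      \<longlonglongrightarrow> (\<integral>z. u z * (exp (F z) * Herm a b z) \<partial>gauss)"
  proof (rule integral_dominated_convergence[OF _ _ dom])
    show "AE z in gauss. (\<lambda>M. u z * ((\<Sum>m<M. F z ^ m / fact m) * Herm a b z)) \<longlonglongrightarrow> u z * (exp (F z) * Herm a b z)"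
    proof (intro AE_I2 tendsto_intros)
      fix z
      show "(\<lambda>M. \<Sum>m<M. F z ^ m / fact m) \<longlonglongrightarrow> exp (F z)"
        using exp_converges[of "F z"] by (simp add: sums_def scaleR_conv_of_real divide_inverse mult.commute)
    qed
    show "AE z in gauss. norm (u z * ((\<Sum>m<M. F z ^ m / fact m) * Herm a b z))
        \<le> norm (u z * complex_of_real (exp (norm (F z)) * norm (Herm a b z)))" for M
      by (auto simp: norm_mult intro!: mult_left_mono mult_right_mono norm_exp_partial_sum)
  qed (simp_all, measurable)
  moreover have "(\<integral>z. u z * ((\<Sum>m<M. F z ^ m / fact m) * Herm a b z) \<partial>gauss) = 0" for M
  proof -
    have "annihilates u (\<lambda>z. \<Sum>m<M. (1 / fact m) * F z ^ m)"
      unfolding F_def by (intro annihilates_sum annihilates_cmult annihilates_power u one)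
    then show ?thesis
      by (simp add: annihilates_def)
  qed
  ultimately have "(\<integral>z. u z * (exp (F z) * Herm a b z) \<partial>gauss) = 0"
    by (simp add: LIMSEQ_const_iff)
  moreover have "exp (F z) = complex_of_real (exp (- (real CARD('n) / 4) * (norm z)\<^sup>2 + z \<bullet> y))" for z
    unfolding F_def n_def by (rule exp_of_real)
  ultimately show ?thesis
    by (simp only:)
qed

text \<open>
  The hypothesis is inherited by \<open>u\<close> times a Gaussian, which allows \<open>annihilates_exp\<close> to be iterated.
\<close>

lemma annihilates_damped:
  fixes u :: "complex^'n::finite \<Rightarrow> complex"
  assumes u: "u \<in> L2 gauss" and one: "annihilates u (\<lambda>z. 1)"
  defines "u' \<equiv> (\<lambda>z. u z * complex_of_real (exp (- (real CARD('n) / 4) * (norm z)\<^sup>2)))"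
  shows "u' \<in> L2 gauss" "annihilates u' (\<lambda>z. 1)"
proof -
  have [measurable]: "u \<in> borel_measurable borel"
    using L2_measurable[OF u] by simp
  have "norm (u' z) \<le> norm (u z)" for z
    by (simp add: u'_def norm_mult mult_left_le)
  then have "(norm (u' z))\<^sup>2 \<le> (norm (u z))\<^sup>2" for z
    by (intro power_mono) auto
  then show "u' \<in> L2 gauss"
    by (intro L2_bound[OF _ L2_integrable_square[OF u]]) (auto simp: u'_def)
  show "annihilates u' (\<lambda>z. 1)"
    using annihilates_exp[OF u one, of 0]
    by (simp add: annihilates_def u'_def slow_growth_const mult_ac)
qed

text \<open>
  A single application of \<open>annihilates_exp\<close> only reaches the exponent \<open>s = n / 4\<close>. Iterating the damping
  gives the exponents \<open>k s\<close>, so the convolutions of \<open>u\<close> times the Gaussian density with arbitrarily narrow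
  Gaussians vanish.
\<close>

theorem Hermite_total:
  fixes u :: "complex^'n::finite \<Rightarrow> complex"
  assumes u: "u \<in> L2 gauss" and orth: "\<And>a b. L2_inner gauss u (Herm a b) = 0"
  shows "AE z in gauss. u z = 0"
proof -
  define s where "s = real CARD('n) / 4"
  have s: "s > 0" by (simp add: s_def)
  have one: "annihilates u (\<lambda>z. 1)"
    using orth[unfolded L2_inner_def cnj_Herm] by (simp add: annihilates_def slow_growth_const)
  define u' where "u' k z = u z * complex_of_real (exp (- (real k * s) * (norm z)\<^sup>2))" for k :: nat and z
  have step: "u' (Suc k) = (\<lambda>z. u' k z * complex_of_real (exp (- (real CARD('n) / 4) * (norm z)\<^sup>2)))" for k
    by (rule ext) (simp add: u'_def s_def algebra_simps flip: exp_add of_real_mult)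
  have u': "u' k \<in> L2 gauss \<and> annihilates (u' k) (\<lambda>z. 1)" for k
  proof (induction k)
    case 0
    then show ?case using u one by (simp add: u'_def[abs_def])
  next
    case (Suc k)
    then show ?case
      unfolding step using annihilates_damped by blast
  qed
  have u_meas [measurable]: "u \<in> borel_measurable borel"
    using L2_measurable[OF u] by simp
  define g where "g z = u z * complex_of_real (gdens z)" for z
  have "integrable gauss u"
    using L2_integrable_mult[OF u slow_growth_L2[OF slow_growth_const[of 1]]] by simp
  then have g: "integrable lborel g"
    by (simp add: integrable_gauss g_def[abs_def] scaleR_conv_of_real mult_ac)
  have "AE z in lborel. g z = 0"
  proof (rule gaussian_convolution_zero[OF g])
    show "real (Suc k) * s > 0" for k
      using s by simp
    show "filterlim (\<lambda>k. real (Suc k) * s) at_top sequentially"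
      by (rule filterlim_at_top_mult_tendsto_pos[OF tendsto_const s])
         (rule filterlim_compose[OF filterlim_real_sequentially filterlim_Suc])
    fix k :: nat and y :: "complex^'n"
    define a where "a = real (Suc k) * s"
    have "(\<integral>z. u' k z * (complex_of_real (exp (- s * (norm z)\<^sup>2 + z \<bullet> ((2 * a) *\<^sub>R y))) * Herm (\<lambda>_. 0) (\<lambda>_. 0) z) \<partial>gauss) = 0"
      unfolding s_def using u' by (intro annihilates_exp) auto
    then have "(\<integral>z. gdens z *\<^sub>R (u' k z * complex_of_real (exp (- s * (norm z)\<^sup>2 + z \<bullet> ((2 * a) *\<^sub>R y)))) \<partial>lborel) = 0"
      by (subst (asm) integral_gauss) (auto simp: u'_def[abs_def])
    moreover have "g z * exp (- a * (norm (z - y))\<^sup>2)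
        = complex_of_real (exp (- a * (norm y)\<^sup>2)) * (gdens z *\<^sub>R (u' k z * complex_of_real (exp (- s * (norm z)\<^sup>2 + z \<bullet> ((2 * a) *\<^sub>R y)))))" for z
    proof -
      have "(norm (z - y))\<^sup>2 = (norm z)\<^sup>2 - 2 * (z \<bullet> y) + (norm y)\<^sup>2"
        unfolding power2_norm_eq_inner by (simp add: inner_diff_left inner_diff_right inner_commute)
      then have "- a * (norm (z - y))\<^sup>2
          = - a * (norm y)\<^sup>2 + (- (real k * s) * (norm z)\<^sup>2 + (- s * (norm z)\<^sup>2 + z \<bullet> ((2 * a) *\<^sub>R y)))"
        by (simp only:) (simp add: a_def algebra_simps)
      then have "exp (- a * (norm (z - y))\<^sup>2)
          = exp (- a * (norm y)\<^sup>2) * (exp (- (real k * s) * (norm z)\<^sup>2) * exp (- s * (norm z)\<^sup>2 + z \<bullet> ((2 * a) *\<^sub>R y)))"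
        by (simp only: exp_add)
      then show ?thesis
        by (simp only: g_def u'_def of_real_mult scaleR_conv_of_real mult_ac)
    qed
    ultimately show "(\<integral>z. g z * exp (- (real (Suc k) * s) * (norm (z - y))\<^sup>2) \<partial>lborel) = 0"
      unfolding a_def[symmetric] by (simp only: integral_mult_right_zero) simp
  qed
  then have "AE z in lborel. u z = 0"
    by eventually_elim (simp add: g_def)
  then show ?thesis
    by (simp add: AE_gauss)
qed

definition hbasis :: "('n \<Rightarrow> nat) \<times> ('n \<Rightarrow> nat) \<Rightarrow> complex^'n::finite \<Rightarrow> complex" where
  "hbasis i z = complex_of_real (1 / sqrt (mfact (fst i) * mfact (snd i) * gmass TYPE('n))) * Herm (fst i) (snd i) z"

lemma slow_growth_hbasis: "slow_growth (hbasis i)"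
  unfolding hbasis_def[abs_def] by (intro slow_growth_cmult slow_growth_Herm)

lemma inner_hbasis:
  "L2_inner gauss u (hbasis (a, b) :: complex^'n::finite \<Rightarrow> complex)
     = of_real (1 / sqrt (mfact a * mfact b * gmass TYPE('n))) * L2_inner gauss u (Herm a b)"
  unfolding hbasis_def[abs_def]
  by (simp only: fst_conv snd_conv L2_inner_cmult_right complex_cnj_complex_of_real)

interpretation Hermite: L2_basis "gauss :: (complex^'n::finite) measure" hbasis
proof
  show "hbasis i \<in> L2 gauss" for i :: "('n \<Rightarrow> nat) \<times> ('n \<Rightarrow> nat)"
    by (rule slow_growth_L2[OF slow_growth_hbasis])
  fix i j :: "('n \<Rightarrow> nat) \<times> ('n \<Rightarrow> nat)"
  obtain a b a' b' where i: "i = (a', b')" and j: "j = (a, b)" by fastforce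
  define r where "r = mfact a * mfact b * gmass TYPE('n)"
  have r: "r > 0"
    using mfact_pos[of a] mfact_pos[of b] gmass_pos[where 'n = 'n] by (simp add: r_def)
  have "L2_inner gauss (hbasis i) (hbasis j :: complex^'n \<Rightarrow> complex)
      = of_real (1 / sqrt r) * (of_real (1 / sqrt (mfact a' * mfact b' * gmass TYPE('n))) *
          L2_inner gauss (Herm a' b') (Herm a b :: complex^'n \<Rightarrow> complex))"
    unfolding i j inner_hbasis r_def
    by (simp only: hbasis_def[abs_def] fst_conv snd_conv L2_inner_cmult_left)
  also have "\<dots> = (if i = j then of_real (1 / sqrt r * (1 / sqrt r * r)) else 0)"
  proof (cases "i = j")
    case True
    then show ?thesis
      using r unfolding Herm_inner by (simp only: i j r_def prod.inject if_True simp_thms of_real_mult)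
  qed (auto simp: Herm_inner i j)
  also have "1 / sqrt r * (1 / sqrt r * r) = 1"
    using r by simp
  finally show "L2_inner gauss (hbasis i) (hbasis j :: complex^'n \<Rightarrow> complex) = (if i = j then 1 else 0)"
    by simp
next
  fix u :: "complex^'n \<Rightarrow> complex"
  assume u: "u \<in> L2 gauss" and 0: "\<And>i. L2_inner gauss u (hbasis i) = 0"
  have "L2_inner gauss u (Herm a b) = 0" for a b
    using 0[of "(a, b)"] mfact_pos[of a] mfact_pos[of b] gmass_pos[where 'n = 'n]
    unfolding inner_hbasis by (simp add: less_imp_neq[symmetric])
  then show "AE z in gauss. u z = 0"
    by (rule Hermite_total[OF u])
qed

section \<open>The d-bar operator in the Hermite basis\<close>

abbreviation hcoef :: "(complex^'n::finite \<Rightarrow> complex) \<Rightarrow> ('n \<Rightarrow> nat) \<times> ('n \<Rightarrow> nat) \<Rightarrow> complex" where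
  "hcoef u i \<equiv> L2_inner gauss u (hbasis i)"

text \<open>
  The index whose coefficient \<open>\<partial>bar\<^sub>j\<close> moves to position \<open>i\<close>.
\<close>

definition raise :: "'n \<Rightarrow> ('n \<Rightarrow> nat) \<times> ('n \<Rightarrow> nat) \<Rightarrow> ('n \<Rightarrow> nat) \<times> ('n \<Rightarrow> nat)" where
  "raise j i = (fst i, up j (snd i))"

lemma fst_raise [simp]: "fst (raise j i) = fst i"
  and snd_raise [simp]: "snd (raise j i) = up j (snd i)"
  by (simp_all add: raise_def)

lemma inj_raise: "inj (raise j)"
  by (rule injI) (auto simp: raise_def prod_eq_iff dest: injD[OF inj_up])

lemma range_raise: "i \<in> range (raise j) \<longleftrightarrow> snd i j > 0"
proof
  assume "snd i j > 0"
  then have "i = raise j (fst i, down j (snd i))"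
    by (simp add: raise_def up_down)
  then show "i \<in> range (raise j)" by blast
qed auto

lemma has_sum_raise:
  assumes "\<And>i. snd i j = 0 \<Longrightarrow> F i = 0"
  shows "((\<lambda>i. F (raise j i)) has_sum S) UNIV \<longleftrightarrow> (F has_sum S) UNIV"
proof -
  have "((\<lambda>i. F (raise j i)) has_sum S) UNIV \<longleftrightarrow> (F has_sum S) (range (raise j))"
    by (simp add: has_sum_reindex[OF inj_raise] o_def)
  also have "\<dots> \<longleftrightarrow> (F has_sum S) UNIV"
    by (rule has_sum_cong_neutral) (auto simp: range_raise intro: assms)
  finally show ?thesis .
qed

lemma summable_on_raise:
  assumes "\<And>i. snd i j = 0 \<Longrightarrow> F i = 0"
  shows "(\<lambda>i. F (raise j i)) summable_on UNIV \<longleftrightarrow> F summable_on UNIV"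
  using has_sum_raise[of j F, OF assms] by (simp add: summable_on_def)

text \<open>
  The factor is the quotient of the norms of \<open>H\<^sub>a\<^sub>b\<close> with \<open>b\<^sub>j\<close> raised and of \<open>H\<^sub>a\<^sub>b\<close>.
\<close>

lemma hcoef_Herm_raise:
  fixes u g :: "complex^'n::finite \<Rightarrow> complex"
  shows "L2_inner gauss g (Herm (fst i) (snd i)) = L2_inner gauss u (Herm (fst i) (up j (snd i)))
    \<longleftrightarrow> hcoef g i = of_real (sqrt (real CARD('n) * real (Suc (snd i j)))) * hcoef u (raise j i)"
proof -
  obtain a b where i: "i = (a, b)" by fastforce
  define r where "r = mfact a * mfact b * gmass TYPE('n)"
  define m where "m = real CARD('n) * real (Suc (b j))"
  have r: "r > 0"
    using mfact_pos[of a] mfact_pos[of b] gmass_pos[where 'n = 'n] by (simp add: r_def)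
  have m: "m > 0"
    by (simp add: m_def)
  have "mfact a * mfact (up j b) * gmass TYPE('n) = m * r"
    by (simp add: mfact_up m_def r_def)
  then have u: "hcoef u (raise j i) = of_real (1 / sqrt (m * r)) * L2_inner gauss u (Herm a (up j b))"
    unfolding i raise_def fst_conv snd_conv inner_hbasis by (simp only:)
  have g: "hcoef g i = of_real (1 / sqrt r) * L2_inner gauss g (Herm a b)"
    unfolding i inner_hbasis r_def by (simp only:)
  have "of_real (sqrt m) * hcoef u (raise j i) = of_real (sqrt m * (1 / sqrt (m * r))) * L2_inner gauss u (Herm a (up j b))"
    unfolding u by (simp only: of_real_mult mult.assoc)
  also have "sqrt m * (1 / sqrt (m * r)) = 1 / sqrt r"
    using m r by (simp add: real_sqrt_mult)
  finally show ?thesis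
    unfolding g using r by (simp add: i m_def)
qed

lemma dbar_eq:
  assumes "(f has_derivative D) (at z)"
  shows "dbar j f z = (D (axis j 1) + \<i> * D (axis j \<i>)) / 2"
  unfolding dbar_def frechet_derivative_at[OF assms, symmetric] ..

lemma dbar_Herm:
  "dbar j (Herm a b) (z :: complex^'n::finite) = of_nat CARD('n) * of_nat (b j) * Herm a (down j b) z"
  unfolding dbar_eq[OF Herm_has_derivative] Herm_deriv_axis by (simp add: field_simps)

text \<open>
  The weak derivative may be tested against \<open>cnj H\<^sub>a\<^sub>b exp (- n \<bar>z\<bar>\<^sup>2)\<close>, which is approximated by
  cutting it off with \<open>flat (k - \<bar>z\<bar>\<^sup>2 / k)\<close>. This cutoff tends to \<open>1\<close>, and its derivatives are bounded and tend
  to \<open>0\<close>.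
\<close>

lemma weak_dbar_Herm:
  fixes u g :: "complex^'n::finite \<Rightarrow> complex"
  assumes wd: "has_weak_dbar j u g" and u: "u \<in> L2 gauss" and g: "g \<in> L2 gauss"
  shows "L2_inner gauss g (Herm a b) = L2_inner gauss u (Herm a (up j b))"
proof -
  let ?n = "real CARD('n)"
  have [measurable]: "u \<in> borel_measurable borel" "g \<in> borel_measurable borel"
    "\<And>a b. Herm a b \<in> borel_measurable (borel :: (complex^'n) measure)"
    using L2_measurable[OF u] L2_measurable[OF g] slow_growth_measurable[OF slow_growth_Herm] by auto
  define t where "t k z = real (Suc k) + (- (1 / real (Suc k))) * (norm z)\<^sup>2" for k and z :: "complex^'n"
  define \<theta> where "\<theta> k z = complex_of_real (flat (t k z))" for k z
  define \<theta>' where "\<theta>' k z v = complex_of_real (flat_deriv 1 (t k z) * (- 2 * (z \<bullet> v) / real (Suc k)))" for k z v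
  have \<theta>_der: "(\<theta> k has_derivative \<theta>' k z) (at z)" for k z
  proof -
    have "(t k has_derivative (\<lambda>v. 0 + (- (1 / real (Suc k))) * (z \<bullet> v + v \<bullet> z))) (at z)"
      unfolding t_def power2_norm_eq_inner
      by (intro has_derivative_add has_derivative_const has_derivative_mult_right has_derivative_inner
            has_derivative_ident)
    then have "(t k has_derivative (\<lambda>v. - 2 * (z \<bullet> v) / real (Suc k))) (at z)"
      by (simp add: inner_commute)
    from diff_chain_at[OF this flat_deriv_has_derivative[of 0, unfolded has_vector_derivative_def]]
    have "((\<lambda>z. flat (t k z)) has_derivative (\<lambda>v. flat_deriv 1 (t k z) * (- 2 * (z \<bullet> v) / real (Suc k)))) (at z)"
      by (simp add: o_def mult.commute)
    from has_derivative_of_real[OF this, where 'a = complex] show ?thesis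
      unfolding \<theta>_def \<theta>'_def .
  qed
  have \<theta>'_bound: "norm (\<theta>' k z v) \<le> 4 * norm v \<and> norm (\<theta>' k z v) \<le> 4 * norm z * norm v / real (Suc k)" for k z v
  proof -
    have "norm (\<theta>' k z v) = \<bar>flat_deriv 1 (t k z)\<bar> * (2 * \<bar>z \<bullet> v\<bar> / real (Suc k))"
      unfolding \<theta>'_def norm_of_real by (simp add: abs_mult)
    also have "\<dots> \<le> 2 * (2 * (norm z * norm v) / real (Suc k))"
      by (intro mult_mono flat_deriv_1_bound divide_right_mono mult_left_mono Cauchy_Schwarz_ineq2) auto
    finally have 2: "norm (\<theta>' k z v) \<le> 4 * norm z * norm v / real (Suc k)"
      by simp
    show ?thesis
    proof (cases "norm z \<le> real (Suc k)")
      case True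
      then have "norm z * norm v / real (Suc k) \<le> norm v"
        using mult_left_mono[of "norm z" "real (Suc k)" "norm v"] by (simp add: divide_le_eq mult.commute)
      with 2 show ?thesis by simp
    next
      case False
      then have "real (Suc k) * real (Suc k) < norm z * norm z"
        by (intro mult_strict_mono) auto
      then have "t k z < 0"
        by (simp add: t_def power2_eq_square field_simps)
      then have "\<theta>' k z v = 0"
        by (simp add: \<theta>'_def flat_deriv_def)
      with 2 show ?thesis by simp
    qed
  qed
  have \<theta>_bound: "norm (\<theta> k z) \<le> 1" for k z
    using flat_bounds[of "t k z"] by (simp add: \<theta>_def)
  have inv: "(\<lambda>k. 1 / real (Suc k)) \<longlonglongrightarrow> 0"
    using LIMSEQ_inverse_real_of_nat by (simp add: inverse_eq_divide)
  have \<theta>_lim: "(\<lambda>k. \<theta> k z) \<longlonglongrightarrow> 1" for z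
  proof -
    have "filterlim (\<lambda>k. - (norm z)\<^sup>2 * (1 / real (Suc k)) + real (Suc k)) at_top sequentially"
      by (rule filterlim_tendsto_add_at_top[OF tendsto_mult[OF tendsto_const inv]])
         (rule filterlim_compose[OF filterlim_real_sequentially filterlim_Suc])
    then have t: "filterlim (\<lambda>k. t k z) at_top sequentially"
      by (simp add: t_def add.commute mult.commute)
    have "((\<lambda>s::real. exp (- (1 / s))) \<longlongrightarrow> exp (- 0)) at_top"
      by (intro tendsto_intros tendsto_divide_0[OF tendsto_const] filterlim_at_top_imp_at_infinity filterlim_ident)
    then have "((\<lambda>s::real. exp (- (1 / s))) \<longlongrightarrow> 1) at_top"
      by simp
    then have "(flat \<longlongrightarrow> 1) at_top"
      by (rule Lim_transform_eventually)
         (use eventually_gt_at_top[of 0] in eventually_elim, simp add: flat_eq)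
    from filterlim_compose[OF this t] show ?thesis
      unfolding \<theta>_def by (intro tendsto_eq_intros) auto
  qed
  define \<kappa> where "\<kappa> k z = (\<theta>' k z (axis j 1) + \<i> * \<theta>' k z (axis j \<i>)) / 2" for k z
  have \<kappa>_sum: "norm (\<kappa> k z) \<le> (norm (\<theta>' k z (axis j 1)) + norm (\<theta>' k z (axis j \<i>))) / 2" for k z
    unfolding \<kappa>_def norm_divide using norm_triangle_ineq[of "\<theta>' k z (axis j 1)" "\<i> * \<theta>' k z (axis j \<i>)"]
    by (simp add: norm_mult)
  have ax: "norm (axis j (1 :: complex)) = 1" "norm (axis j \<i>) = 1"
    by (simp_all add: norm_eq_sqrt_inner inner_axis_axis)
  have \<kappa>_bound: "norm (\<kappa> k z) \<le> 4" for k z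
    using \<kappa>_sum[of k z] \<theta>'_bound[of k z "axis j 1"] \<theta>'_bound[of k z "axis j \<i>"] unfolding ax by simp
  have \<kappa>_lim: "(\<lambda>k. \<kappa> k z) \<longlonglongrightarrow> 0" for z
  proof (rule Lim_null_comparison)
    have "norm (\<kappa> k z) \<le> 4 * norm z * (1 / real (Suc k))" for k
      using \<kappa>_sum[of k z] \<theta>'_bound[of k z "axis j 1"] \<theta>'_bound[of k z "axis j \<i>"] unfolding ax by simp
    then show "\<forall>\<^sub>F k in sequentially. norm (\<kappa> k z) \<le> 4 * norm z * (1 / real (Suc k))"
      by simp
    show "(\<lambda>k. 4 * norm z * (1 / real (Suc k))) \<longlonglongrightarrow> 0"
      using tendsto_mult[OF tendsto_const[of "4 * norm z"] inv] by simp
  qed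
  define \<phi> where "\<phi> k z = \<theta> k z * (Herm b a z * complex_of_real (gdens z))" for k z
  have t_Ck: "Ck_on m UNIV (t k)" for m k
    unfolding t_def by (intro Ck_on_add Ck_on_mult Ck_on_const Ck_on_norm_square)
  have gd_Ck: "Ck_on m UNIV (\<lambda>z::complex^'n. complex_of_real (gdens z))" for m
    by (intro Ck_on_of_real Ck_on_mult Ck_on_const Ck_on_exp Ck_on_norm_square)
  have \<phi>_test: "\<phi> k \<in> test_functions UNIV" for k
  proof (rule test_functions_I[of _ "real (Suc k)"])
    show "Ck_on m UNIV (\<phi> k)" for m
      unfolding \<phi>_def \<theta>_def
      by (intro Ck_on_mult Ck_on_of_real[OF Ck_on_flat[OF t_Ck]] Ck_on_Herm gd_Ck)
    fix z :: "complex^'n"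
    assume "norm z > real (Suc k)"
    then have "real (Suc k) * real (Suc k) < norm z * norm z"
      by (intro mult_strict_mono) auto
    then have "t k z < 0"
      by (simp add: t_def power2_eq_square field_simps)
    then show "\<phi> k z = 0"
      by (simp add: \<phi>_def \<theta>_def flat_eq)
  qed
  have dbar_\<phi>: "dbar j (\<phi> k) z = - (\<theta> k z * (Herm (up j b) a z * gdens z)) + \<kappa> k z * (Herm b a z * gdens z)" for k z
  proof -
    have "dbar j (\<phi> k) z = ((\<theta> k z * (Herm b a z * of_real (- 2 * ?n * (z \<bullet> axis j 1) * gdens z) + Herm_deriv b a z (axis j 1) * gdens z)
            + \<theta>' k z (axis j 1) * (Herm b a z * gdens z))
         + \<i> * (\<theta> k z * (Herm b a z * of_real (- 2 * ?n * (z \<bullet> axis j \<i>) * gdens z) + Herm_deriv b a z (axis j \<i>) * gdens z)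
            + \<theta>' k z (axis j \<i>) * (Herm b a z * gdens z))) / 2"
      unfolding \<phi>_def
      by (rule dbar_eq) (intro has_derivative_mult \<theta>_der Herm_has_derivative gdens_has_derivative)
    also have "\<dots> = \<kappa> k z * (Herm b a z * gdens z) + \<theta> k z * gdens z * (dbar j (Herm b a) z
        - of_nat CARD('n) * (of_real (Re (z $ j)) + \<i> * of_real (Im (z $ j))) * Herm b a z)"
      unfolding inner_axis_complex \<kappa>_def dbar_eq[OF Herm_has_derivative] by (simp add: field_simps)
    also have "of_real (Re (z $ j)) + \<i> * of_real (Im (z $ j)) = z $ j"
      by (rule complex_eq[symmetric])
    finally show ?thesis
      unfolding dbar_Herm Herm_up_left by (simp add: algebra_simps)
  qed
  have int: "integrable lborel (\<lambda>z. f z * Herm b a z * gdens z)" if "f \<in> L2 gauss" for f and a b :: "'n \<Rightarrow> nat"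
  proof -
    have "f \<in> borel_measurable borel"
      using L2_measurable[OF that] by simp
    then show ?thesis
      using L2_integrable_mult[OF that slow_growth_L2[OF slow_growth_Herm]]
      by (simp add: integrable_gauss scaleR_conv_of_real mult_ac)
  qed
  have [measurable]: "\<phi> k \<in> borel_measurable borel" for k
    using test_functions_Ck[OF \<phi>_test, of 0 k] by (auto intro: borel_measurable_continuous_onI)
  have [measurable]: "dbar j (\<phi> k) \<in> borel_measurable borel" for k
    using Ck_on_continuous[OF Ck_on_Suc_D(2)[OF test_functions_Ck[OF \<phi>_test, of "Suc 0" k]]]
    unfolding dbar_def by (auto intro!: borel_measurable_continuous_onI continuous_intros)
  have lim_u: "(\<lambda>k. \<integral>z. u z * dbar j (\<phi> k) z \<partial>lborel) \<longlonglongrightarrow> (\<integral>z. - (u z * Herm (up j b) a z * gdens z) \<partial>lborel)"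
  proof (rule integral_dominated_convergence)
    show "integrable lborel (\<lambda>z. norm (u z * Herm (up j b) a z * gdens z) + 4 * norm (u z * Herm b a z * gdens z))"
      by (intro Bochner_Integration.integrable_add Bochner_Integration.integrable_mult_right integrable_norm int u)
    show "AE z in lborel. (\<lambda>k. u z * dbar j (\<phi> k) z) \<longlonglongrightarrow> - (u z * Herm (up j b) a z * gdens z)"
    proof (rule AE_I2)
      fix z
      have "(\<lambda>k. u z * dbar j (\<phi> k) z)
          \<longlonglongrightarrow> u z * (- (1 * (Herm (up j b) a z * gdens z)) + 0 * (Herm b a z * gdens z))"
        unfolding dbar_\<phi> by (intro tendsto_intros \<theta>_lim \<kappa>_lim)
      then show "(\<lambda>k. u z * dbar j (\<phi> k) z) \<longlonglongrightarrow> - (u z * Herm (up j b) a z * gdens z)"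
        by (simp add: mult.assoc)
    qed
    have "norm (u z * dbar j (\<phi> k) z)
        \<le> norm (u z * Herm (up j b) a z * gdens z) + 4 * norm (u z * Herm b a z * gdens z)" for k z
    proof -
      have "norm (dbar j (\<phi> k) z) \<le> norm (\<theta> k z * (Herm (up j b) a z * gdens z)) + norm (\<kappa> k z * (Herm b a z * gdens z))"
        unfolding dbar_\<phi> by (rule order_trans[OF norm_triangle_ineq]) simp
      also have "\<dots> \<le> 1 * norm (Herm (up j b) a z * gdens z) + 4 * norm (Herm b a z * gdens z)"
        unfolding norm_mult[of "\<theta> k z"] norm_mult[of "\<kappa> k z"]
        by (intro add_mono mult_right_mono \<theta>_bound \<kappa>_bound) auto
      finally show ?thesis
        using mult_left_mono[of _ _ "norm (u z)"] by (fastforce simp: norm_mult ring_distribs mult_ac)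
    qed
    then show "AE z in lborel. norm (u z * dbar j (\<phi> k) z)
        \<le> norm (u z * Herm (up j b) a z * gdens z) + 4 * norm (u z * Herm b a z * gdens z)" for k
      by simp
  qed measurable
  have lim_g: "(\<lambda>k. \<integral>z. g z * \<phi> k z \<partial>lborel) \<longlonglongrightarrow> (\<integral>z. g z * Herm b a z * gdens z \<partial>lborel)"
  proof (rule integral_dominated_convergence)
    show "integrable lborel (\<lambda>z. norm (g z * Herm b a z * gdens z))"
      by (intro integrable_norm int g)
    show "AE z in lborel. (\<lambda>k. g z * \<phi> k z) \<longlonglongrightarrow> g z * Herm b a z * gdens z"
    proof (rule AE_I2)
      fix z
      have "(\<lambda>k. g z * \<phi> k z) \<longlonglongrightarrow> g z * (1 * (Herm b a z * gdens z))"
        unfolding \<phi>_def by (intro tendsto_intros \<theta>_lim)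
      then show "(\<lambda>k. g z * \<phi> k z) \<longlonglongrightarrow> g z * Herm b a z * gdens z"
        by (simp add: mult.assoc)
    qed
    have "norm (g z * \<phi> k z) \<le> norm (g z * Herm b a z * gdens z)" for k z
      using mult_right_mono[OF \<theta>_bound[of k z], of "norm (g z * Herm b a z * gdens z)"]
      by (simp add: \<phi>_def norm_mult mult_ac)
    then show "AE z in lborel. norm (g z * \<phi> k z) \<le> norm (g z * Herm b a z * gdens z)" for k
      by simp
  qed measurable
  have "(\<integral>z. u z * dbar j (\<phi> k) z \<partial>lborel) = - (\<integral>z. g z * \<phi> k z \<partial>lborel)" for k
    using wd \<phi>_test by (simp add: has_weak_dbar_def)
  then have "(\<integral>z. - (u z * Herm (up j b) a z * gdens z) \<partial>lborel) = - (\<integral>z. g z * Herm b a z * gdens z \<partial>lborel)"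
    using LIMSEQ_unique[OF lim_u] tendsto_minus[OF lim_g] by simp
  then show ?thesis
    by (simp add: L2_inner_gauss cnj_Herm)
qed

lemma weak_dbar_hcoef:
  fixes u g :: "complex^'n::finite \<Rightarrow> complex"
  assumes "has_weak_dbar j u g" "u \<in> L2 gauss" "g \<in> L2 gauss"
  shows "hcoef g i = of_real (sqrt (real CARD('n) * real (Suc (snd i j)))) * hcoef u (raise j i)"
  using weak_dbar_Herm[OF assms] hcoef_Herm_raise by blast

lemma L2_gauss_locally_integrable:
  fixes u :: "complex^'n::finite \<Rightarrow> complex"
  assumes u: "u \<in> L2 gauss"
  shows "locally_integrable u"
  unfolding locally_integrable_def
proof (intro conjI allI impI)
  show [measurable]: "u \<in> borel_measurable borel"
    using L2_measurable[OF u] by simp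
  fix K :: "(complex^'n) set"
  assume K: "compact K"
  then have [measurable]: "K \<in> sets borel"
    by (rule borel_compact)
  obtain R where R: "\<And>x. x \<in> K \<Longrightarrow> norm x \<le> R"
    using compact_imp_bounded[OF K] by (auto simp: bounded_iff)
  define C where "C = (real CARD('n) / pi) ^ CARD('n) * exp (- real CARD('n) * R\<^sup>2)"
  have C: "C > 0" "\<And>z. z \<in> K \<Longrightarrow> C \<le> gdens z"
    unfolding C_def using R by (auto intro!: mult_left_mono power_mono)
  have "integrable gauss u"
    using L2_integrable_mult[OF u slow_growth_L2[OF slow_growth_const[of 1]]] by simp
  then have "integrable lborel (\<lambda>z. 1 / C * norm (gdens z *\<^sub>R u z))"
    by (intro Bochner_Integration.integrable_mult_right integrable_norm) (simp add: integrable_gauss)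
  then show "set_integrable lborel K u"
    unfolding set_integrable_def
  proof (rule Bochner_Integration.integrable_bound)
    have "norm (indicator K z *\<^sub>R u z) \<le> norm (1 / C * norm (gdens z *\<^sub>R u z))" for z
    proof (cases "z \<in> K")
      case True
      have "C * norm (u z) \<le> gdens z * norm (u z)"
        using C(2)[OF True] by (rule mult_right_mono) simp
      then show ?thesis
        using True C(1) by (simp add: field_simps)
    qed simp
    then show "AE z in lborel. norm (indicator K z *\<^sub>R u z) \<le> norm (1 / C * norm (gdens z *\<^sub>R u z))"
      by simp
  qed measurable
qed

text \<open>
  Conversely, for a test function \<open>\<phi>\<close> put \<open>\<psi> = cnj \<phi> / \<rho>\<close> with the Gaussian density \<open>\<rho>\<close>. The coefficients of
  \<open>- cnj (\<partial>bar\<^sub>j \<phi>) / \<rho>\<close> are those of \<open>\<psi>\<close> shifted up, so by Parseval's identity the pairing of \<open>u\<close> with it equals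
  the pairing of \<open>g\<close> with \<open>\<psi>\<close>.
\<close>

lemma has_weak_dbar_if_hcoef:
  fixes u g :: "complex^'n::finite \<Rightarrow> complex"
  assumes u: "u \<in> L2 gauss" and g: "g \<in> L2 gauss"
    and coef: "\<And>i. hcoef g i = of_real (sqrt (real CARD('n) * real (Suc (snd i j)))) * hcoef u (raise j i)"
  shows "has_weak_dbar j u g"
  unfolding has_weak_dbar_def
proof (intro conjI ballI)
  show "locally_integrable u" "locally_integrable g"
    using u g by (auto intro: L2_gauss_locally_integrable)
  have [measurable]: "u \<in> borel_measurable borel" "g \<in> borel_measurable borel"
    "\<And>a b. Herm a b \<in> borel_measurable (borel :: (complex^'n) measure)"
    using L2_measurable[OF u] L2_measurable[OF g] slow_growth_measurable[OF slow_growth_Herm] by auto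
  fix \<phi> :: "complex^'n \<Rightarrow> complex"
  assume \<phi>: "\<phi> \<in> test_functions UNIV"
  obtain R where R: "R > 0" "\<And>x. norm x \<ge> R \<Longrightarrow> \<phi> x = 0"
    using test_functions_bounded_support[OF \<phi>] by metis
  have cont: "continuous_on UNIV \<phi>"
    using test_functions_Ck[OF \<phi>, of 0] by simp
  have cont': "continuous_on UNIV (dbar j \<phi>)"
    using Ck_on_continuous[OF Ck_on_Suc_D(2)[OF test_functions_Ck[OF \<phi>, of "Suc 0"]]]
    unfolding dbar_def by (auto intro!: continuous_intros)
  have [measurable]: "\<phi> \<in> borel_measurable borel" "dbar j \<phi> \<in> borel_measurable borel"
    using cont cont' by (auto intro: borel_measurable_continuous_onI)
  have supp: "dbar j \<phi> x = 0" if "norm x > R" for x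
  proof -
    have "((\<lambda>x. 0) has_derivative (\<lambda>v. 0)) (at x)"
      by simp
    then have "(\<phi> has_derivative (\<lambda>v. 0)) (at x)"
      by (rule has_derivative_transform_within_open[of _ _ _ _ "- cball 0 R"])
         (use that R in \<open>auto simp: dist_norm\<close>)
    then show ?thesis
      by (simp add: dbar_eq)
  qed
  define lift where "lift q z = cnj (q z) * complex_of_real (1 / gdens z)" for q and z :: "complex^'n"
  have lift_L2: "lift q \<in> L2 gauss"
    if q: "continuous_on UNIV q" "\<And>x. norm x > R \<Longrightarrow> q x = 0" for q
  proof -
    have c: "continuous_on UNIV (lift q)"
      unfolding lift_def by (intro continuous_intros q) auto
    have "bounded (lift q ` cball 0 R)"
      by (intro compact_imp_bounded compact_continuous_image continuous_on_subset[OF c]) auto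
    then obtain B where B: "\<And>x. norm x \<le> R \<Longrightarrow> norm (lift q x) \<le> B"
      using bounded_image_cball by metis
    show ?thesis
    proof (rule L2_gauss_growth_bound[of _ B 0])
      fix z :: "complex^'n"
      have "0 \<le> B"
        using order_trans[OF norm_ge_zero B[of 0]] R(1) by simp
      then show "norm (lift q z) \<le> B * exp (0 * (norm z)\<^sup>2)"
        using B[of z] q(2)[of z] by (cases "norm z \<le> R") (auto simp: lift_def)
    qed (use c in \<open>auto intro: borel_measurable_continuous_onI\<close>)
  qed
  have lift_inner: "L2_inner gauss f (lift q) = (\<integral>z. f z * q z \<partial>lborel)"
    if [measurable]: "f \<in> borel_measurable borel" "q \<in> borel_measurable borel" for f q
  proof -
    have "lift q \<in> borel_measurable borel"
      unfolding lift_def using measurable_compose[OF that(2) borel_measurable_cnj] by measurable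
    then have "L2_inner gauss f (lift q) = (\<integral>z. f z * cnj (lift q z) * gdens z \<partial>lborel)"
      by (rule L2_inner_gauss[OF that(1)])
    also have "\<dots> = (\<integral>z. f z * q z \<partial>lborel)"
      by (rule Bochner_Integration.integral_cong) (auto simp: lift_def simp flip: of_real_mult of_real_power)
    finally show ?thesis .
  qed
  define \<psi> \<eta> where "\<psi> = lift \<phi>" and "\<eta> = lift (\<lambda>z. - dbar j \<phi> z)"
  have L: "\<psi> \<in> L2 gauss" "\<eta> \<in> L2 gauss"
    unfolding \<psi>_def \<eta>_def using cont cont' R supp by (auto intro!: lift_L2 continuous_intros)
  have Herm_eq: "L2_inner gauss \<eta> (Herm a b) = of_nat CARD('n) * of_nat (b j) * L2_inner gauss \<psi> (Herm a (down j b))" for a b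
  proof -
    have "has_weak_dbar j (Herm a b) (dbar j (Herm a b))"
      by (rule loc_Lipschitz_diff_weak_dbar[OF loc_Lipschitz_diff_Ck[OF Ck_on_Herm[of "Suc 0"]]])
    then have "(\<integral>z. Herm a b z * - dbar j \<phi> z \<partial>lborel) = (\<integral>z. dbar j (Herm a b) z * \<phi> z \<partial>lborel)"
      using \<phi> by (simp add: has_weak_dbar_def)
    also have "\<dots> = of_nat CARD('n) * of_nat (b j) * (\<integral>z. Herm a (down j b) z * \<phi> z \<partial>lborel)"
      by (simp add: dbar_Herm mult.assoc)
    finally have "L2_inner gauss (Herm a b) \<eta> = of_nat CARD('n) * of_nat (b j) * L2_inner gauss (Herm a (down j b)) \<psi>"
      unfolding \<eta>_def \<psi>_def by (simp add: lift_inner)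
    then show ?thesis
      by (simp add: L2_inner_commute[of gauss \<eta>] L2_inner_commute[of gauss \<psi>])
  qed
  have zero: "hcoef \<eta> i = 0" if "snd i j = 0" for i
    using that Herm_eq[of "fst i" "snd i"] inner_hbasis[of \<eta> "fst i" "snd i"] by simp
  have raise: "hcoef \<eta> (raise j i) = of_real (sqrt (real CARD('n) * real (Suc (snd i j)))) * hcoef \<psi> i" for i
  proof -
    obtain a b where i: "i = (a, b)" by fastforce
    define r where "r = mfact a * mfact b * gmass TYPE('n)"
    define m where "m = real CARD('n) * real (Suc (b j))"
    have r: "r > 0"
      using mfact_pos[of a] mfact_pos[of b] gmass_pos[where 'n = 'n] by (simp add: r_def)
    have m: "m > 0"
      by (simp add: m_def)
    have mr: "mfact a * mfact (up j b) * gmass TYPE('n) = m * r"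
      by (simp add: mfact_up m_def r_def)
    have "hcoef \<eta> (raise j i) = of_real (1 / sqrt (m * r)) * L2_inner gauss \<eta> (Herm a (up j b))"
      unfolding i raise_def fst_conv snd_conv inner_hbasis mr ..
    also have "\<dots> = of_real (1 / sqrt (m * r)) * (of_real m * L2_inner gauss \<psi> (Herm a b))"
      unfolding Herm_eq by (simp add: m_def)
    also have "\<dots> = of_real (sqrt m * (1 / sqrt r)) * L2_inner gauss \<psi> (Herm a b)"
    proof -
      have "1 / sqrt (m * r) * m = sqrt m * (1 / sqrt r)"
        using m r by (simp add: real_sqrt_mult field_simps)
      then show ?thesis
        unfolding mult.assoc[symmetric] of_real_mult[symmetric] by (simp only:)
    qed
    also have "\<dots> = of_real (sqrt m) * hcoef \<psi> i"
      unfolding i inner_hbasis r_def by (simp only: of_real_mult mult.assoc)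
    finally show ?thesis
      by (simp add: m_def i)
  qed
  have "((\<lambda>i. hcoef u i * cnj (hcoef \<eta> i)) has_sum L2_inner gauss u \<eta>) UNIV"
    by (rule Hermite.Parseval[OF u L(2)])
  then have "((\<lambda>i. hcoef u (raise j i) * cnj (hcoef \<eta> (raise j i))) has_sum L2_inner gauss u \<eta>) UNIV"
    by (subst has_sum_raise[of j "\<lambda>i. hcoef u i * cnj (hcoef \<eta> i)"]) (auto simp: zero)
  moreover have "hcoef u (raise j i) * cnj (hcoef \<eta> (raise j i)) = hcoef g i * cnj (hcoef \<psi> i)" for i
    unfolding raise coef by (simp add: mult_ac)
  ultimately have "((\<lambda>i. hcoef g i * cnj (hcoef \<psi> i)) has_sum L2_inner gauss u \<eta>) UNIV"
    by simp
  with Hermite.Parseval[OF g L(1)] have "L2_inner gauss g \<psi> = L2_inner gauss u \<eta>"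
    by (rule has_sum_unique)
  then show "(\<integral>z. u z * dbar j \<phi> z \<partial>lborel) = - (\<integral>z. g z * \<phi> z \<partial>lborel)"
    unfolding \<psi>_def \<eta>_def by (simp add: lift_inner)
qed

text \<open>The eigenvalue of the operator at the basis vector with index \<open>i\<close>.\<close>

definition level :: "('n::finite \<Rightarrow> nat) \<times> ('n \<Rightarrow> nat) \<Rightarrow> real" where
  "level i = real CARD('n) * (\<Sum>j\<in>UNIV. real (snd i j))"

lemma level_nonneg: "level i \<ge> 0"
  by (simp add: level_def sum_nonneg)

lemma dbar_form_domD:
  fixes u :: "complex^'n::finite \<Rightarrow> complex"
  assumes "u \<in> dbar_form_dom"
  shows "u \<in> L2 gauss" and "has_weak_dbar j u (weak_dbar j u)" and "weak_dbar j u \<in> L2 gauss"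
    and "hcoef (weak_dbar j u) i = of_real (sqrt (real CARD('n) * real (Suc (snd i j)))) * hcoef u (raise j i)"
proof -
  show u: "u \<in> L2 gauss"
    using assms by (simp add: dbar_form_dom_def)
  obtain g where g: "g \<in> L2 gauss" "has_weak_dbar j u g"
    using assms by (auto simp: dbar_form_dom_def)
  show wd: "has_weak_dbar j u (weak_dbar j u)"
    by (rule weak_dbar(1)[OF g(2)])
  show L: "weak_dbar j u \<in> L2 gauss"
  proof (rule L2_cong_AE[OF g(1)])
    show "weak_dbar j u \<in> borel_measurable gauss"
      using wd by (simp add: has_weak_dbar_def locally_integrable_def)
    have "AE z in lborel. g z = weak_dbar j u z"
      using weak_dbar(2)[OF g(2)] by eventually_elim simp
    then show "AE z in gauss. g z = weak_dbar j u z"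
      by (simp add: AE_gauss)
  qed
  show "hcoef (weak_dbar j u) i = of_real (sqrt (real CARD('n) * real (Suc (snd i j)))) * hcoef u (raise j i)"
    by (rule weak_dbar_hcoef[OF wd u L])
qed

lemma weak_dbar_inner:
  fixes u w :: "complex^'n::finite \<Rightarrow> complex"
  assumes u: "u \<in> dbar_form_dom" and w: "w \<in> dbar_form_dom"
  shows "((\<lambda>i. of_real (real CARD('n) * real (snd i j)) * hcoef u i * cnj (hcoef w i))
           has_sum L2_inner gauss (weak_dbar j u) (weak_dbar j w)) UNIV"
proof -
  have "((\<lambda>i. hcoef (weak_dbar j u) i * cnj (hcoef (weak_dbar j w) i))
           has_sum L2_inner gauss (weak_dbar j u) (weak_dbar j w)) UNIV"
    by (rule Hermite.Parseval[OF dbar_form_domD(3)[OF u] dbar_form_domD(3)[OF w]])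
  moreover have "hcoef (weak_dbar j u) i * cnj (hcoef (weak_dbar j w) i)
      = of_real (real CARD('n) * real (snd (raise j i) j)) * hcoef u (raise j i) * cnj (hcoef w (raise j i))" for i
  proof -
    define m where "m = real CARD('n) * real (Suc (snd i j))"
    have "hcoef (weak_dbar j u) i * cnj (hcoef (weak_dbar j w) i)
        = of_real (sqrt m * sqrt m) * (hcoef u (raise j i) * cnj (hcoef w (raise j i)))"
      unfolding dbar_form_domD(4)[OF u] dbar_form_domD(4)[OF w] m_def[symmetric]
      by (simp only: of_real_mult complex_cnj_mult complex_cnj_complex_of_real mult_ac)
    also have "sqrt m * sqrt m = m"
      by (simp add: m_def)
    finally show ?thesis
      by (simp add: m_def mult.assoc)
  qed
  ultimately have "((\<lambda>i. of_real (real CARD('n) * real (snd (raise j i) j)) * hcoef u (raise j i) * cnj (hcoef w (raise j i)))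
      has_sum L2_inner gauss (weak_dbar j u) (weak_dbar j w)) UNIV"
    by simp
  then show ?thesis
    by (subst (asm) has_sum_raise[of j "\<lambda>i. of_real (real CARD('n) * real (snd i j)) * hcoef u i * cnj (hcoef w i)"]) auto
qed

lemma has_sum_finite_sum:
  fixes f :: "'j \<Rightarrow> 'i \<Rightarrow> 'b::{comm_monoid_add, topological_comm_monoid_add}"
  shows "(\<And>j. j \<in> J \<Longrightarrow> (f j has_sum S j) A) \<Longrightarrow> ((\<lambda>i. \<Sum>j\<in>J. f j i) has_sum (\<Sum>j\<in>J. S j)) A"
  by (induction J rule: infinite_finite_induct) (auto intro!: has_sum_add)

lemma dbar_form_has_sum:
  fixes u w :: "complex^'n::finite \<Rightarrow> complex"
  assumes u: "u \<in> dbar_form_dom" and w: "w \<in> dbar_form_dom"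
  shows "((\<lambda>i. of_real (level i) * hcoef u i * cnj (hcoef w i)) has_sum dbar_form u w) UNIV"
proof -
  have "((\<lambda>i. \<Sum>j\<in>UNIV. of_real (real CARD('n) * real (snd i j)) * hcoef u i * cnj (hcoef w i))
      has_sum (\<Sum>j\<in>UNIV. L2_inner gauss (weak_dbar j u) (weak_dbar j w))) UNIV"
    by (intro has_sum_finite_sum weak_dbar_inner u w)
  then show ?thesis
    by (simp add: dbar_form_def level_def sum_distrib_left sum_distrib_right mult.assoc)
qed

text \<open>
  A bound on the weighted sum makes the shifted coefficients of each \<open>\<partial>bar\<^sub>j u\<close> square summable, so
  \<open>Riesz_Fischer\<close> provides a function with these coefficients, which is the weak derivative.
\<close>

lemma dbar_form_dom_iff:
  fixes u :: "complex^'n::finite \<Rightarrow> complex"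
  shows "u \<in> dbar_form_dom \<longleftrightarrow> u \<in> L2 gauss \<and> (\<lambda>i. level i * (norm (hcoef u i))\<^sup>2) summable_on UNIV"
proof (intro iffI conjI; (elim conjE)?)
  assume u: "u \<in> dbar_form_dom"
  then show "u \<in> L2 gauss"
    by (rule dbar_form_domD)
  have "(\<lambda>i. Re (of_real (level i) * hcoef u i * cnj (hcoef u i))) summable_on UNIV"
    using dbar_form_has_sum[OF u u] by (intro summable_on_Re has_sum_imp_summable)
  moreover have "Re (of_real (level i) * hcoef u i * cnj (hcoef u i)) = level i * (norm (hcoef u i))\<^sup>2" for i
    unfolding mult.assoc by (simp add: complex_mult_cnj cmod_power2)
  ultimately show "(\<lambda>i. level i * (norm (hcoef u i))\<^sup>2) summable_on UNIV"
    by simp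
next
  assume u: "u \<in> L2 gauss" and s: "(\<lambda>i. level i * (norm (hcoef u i))\<^sup>2) summable_on UNIV"
  have "\<exists>g\<in>L2 gauss. has_weak_dbar j u g" for j
  proof -
    let ?F = "\<lambda>i. real CARD('n) * real (snd i j) * (norm (hcoef u i))\<^sup>2"
    have "?F summable_on UNIV"
    proof (rule summable_on_comparison_test[OF s])
      show "?F i \<le> level i * (norm (hcoef u i))\<^sup>2" for i
        unfolding level_def using member_le_sum[of j UNIV "\<lambda>j. real (snd i j)"]
        by (intro mult_right_mono mult_left_mono) auto
    qed auto
    then have "(\<lambda>i. ?F (raise j i)) summable_on UNIV"
      by (subst summable_on_raise[of j ?F]) auto
    then have "(\<lambda>i. (norm (of_real (sqrt (real CARD('n) * real (Suc (snd i j)))) * hcoef u (raise j i)))\<^sup>2) summable_on UNIV"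
      by (simp add: norm_mult power_mult_distrib del: of_nat_Suc)
    from Hermite.Riesz_Fischer[OF this] obtain g where "g \<in> L2 gauss"
      "\<And>i. hcoef g i = of_real (sqrt (real CARD('n) * real (Suc (snd i j)))) * hcoef u (raise j i)"
      by blast
    then show ?thesis
      using has_weak_dbar_if_hcoef[OF u] by blast
  qed
  with u show "u \<in> dbar_form_dom"
    by (simp add: dbar_form_dom_def)
qed

text \<open>
  The form, tested with basis vectors, gives the coefficients of \<open>g\<close>. Conversely, square summability of
  \<open>level i * u\<^sub>i\<close> puts \<open>u\<close> into the form domain, and the form identity is Parseval's.
\<close>

theorem dbar_laplacian_diagonal:
  "(dbar_laplacian :: (complex^'n::finite) L2_operator) = Hermite.diag_op level"
proof (intro set_eqI iffI; safe)
  fix u g :: "complex^'n \<Rightarrow> complex"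
  assume "(u, g) \<in> dbar_laplacian"
  then have u: "u \<in> dbar_form_dom" and g: "g \<in> L2 gauss"
    and eq: "\<And>w. w \<in> dbar_form_dom \<Longrightarrow> dbar_form u w = L2_inner gauss g w"
    by (auto simp: dbar_laplacian_def form_operator_def)
  have "hcoef g i = of_real (level i) * hcoef u i" for i
  proof -
    have basis: "hbasis i \<in> (dbar_form_dom :: (complex^'n \<Rightarrow> complex) set)"
      using has_sum_single[of i "\<lambda>k. level k * (norm (hcoef (hbasis i :: complex^'n \<Rightarrow> complex) k))\<^sup>2"]
      by (auto simp: dbar_form_dom_iff Hermite.coef_basis intro: has_sum_imp_summable)
    have "((\<lambda>k. of_real (level k) * hcoef u k * cnj (hcoef (hbasis i) k)) has_sum hcoef g i) UNIV"
      using dbar_form_has_sum[OF u basis] eq[OF basis] by simp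
    moreover have "((\<lambda>k. of_real (level k) * hcoef u k * cnj (hcoef (hbasis i) k)) has_sum
        of_real (level i) * hcoef u i * cnj (hcoef (hbasis i) i)) UNIV"
      by (rule has_sum_single) (simp add: Hermite.coef_basis)
    ultimately show ?thesis
      using has_sum_unique by (fastforce simp: Hermite.coef_basis)
  qed
  then show "(u, g) \<in> Hermite.diag_op level"
    using dbar_form_domD(1)[OF u] g by (simp add: Hermite.diag_op_def)
next
  fix u g :: "complex^'n \<Rightarrow> complex"
  assume "(u, g) \<in> Hermite.diag_op level"
  then have u: "u \<in> L2 gauss" and g: "g \<in> L2 gauss" and eq: "\<And>i. hcoef g i = of_real (level i) * hcoef u i"
    by (auto simp: Hermite.diag_op_def)
  have "(\<lambda>i. (level i)\<^sup>2 * (norm (hcoef u i))\<^sup>2) summable_on UNIV"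
    using Hermite.coef_summable[OF g] by (simp add: eq norm_mult power_mult_distrib)
  from Hermite.weighted_summable[OF u this] have dom: "u \<in> dbar_form_dom"
    using u by (simp add: dbar_form_dom_iff level_nonneg)
  have "dbar_form u w = L2_inner gauss g w" if w: "w \<in> dbar_form_dom" for w
    using has_sum_unique[OF dbar_form_has_sum[OF dom w]] Hermite.Parseval[OF g dbar_form_domD(1)[OF w]]
    by (simp add: eq)
  then show "(u, g) \<in> dbar_laplacian"
    using dom g by (simp add: dbar_laplacian_def form_operator_def)
qed

section \<open>Entire functions and the Fock space\<close>

lemma entire_derivative:
  assumes "entire g"
  shows "(g has_derivative frechet_derivative g (at z)) (at z)"
    and "frechet_derivative g (at z) (c *s v) = c * frechet_derivative g (at z) v"
proof -
  obtain D where D: "(g has_derivative D) (at z)" "\<forall>c v. D (c *s v) = c * D v"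
    using assms unfolding entire_def by blast
  have "D = frechet_derivative g (at z)"
    by (rule frechet_derivative_at[OF D(1)])
  with D show "(g has_derivative frechet_derivative g (at z)) (at z)"
    "frechet_derivative g (at z) (c *s v) = c * frechet_derivative g (at z) v"
    by auto
qed

lemma entire_I:
  assumes "\<And>z. (g has_derivative D z) (at z)" "\<And>z c v. D z (c *s v) = c * D z v"
  shows "entire g"
  using assms unfolding entire_def by blast

lemma entire_const: "entire (\<lambda>z. c)"
  by (rule entire_I[where D = "\<lambda>z v. 0"]) auto

lemma entire_coord: "entire (\<lambda>z. z $ j)"
  by (rule entire_I[where D = "\<lambda>z v. v $ j"])
     (auto intro: bounded_linear_imp_has_derivative bounded_linear_vec_nth)

lemma entire_add: "entire f \<Longrightarrow> entire g \<Longrightarrow> entire (\<lambda>z. f z + g z)"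
  by (rule entire_I[OF has_derivative_add[OF entire_derivative(1) entire_derivative(1)]])
     (simp_all add: entire_derivative(2) ring_distribs)

lemma entire_mult: "entire f \<Longrightarrow> entire g \<Longrightarrow> entire (\<lambda>z. f z * g z)"
  by (rule entire_I[OF has_derivative_mult[OF entire_derivative(1) entire_derivative(1)]])
     (simp_all add: entire_derivative(2) algebra_simps)

lemma entire_diff: "entire f \<Longrightarrow> entire g \<Longrightarrow> entire (\<lambda>z. f z - g z)"
  using entire_add[of f "\<lambda>z. - 1 * g z"] entire_mult[OF entire_const[of "- 1"], of g] by simp

lemma entire_prod: "(\<And>i. i \<in> I \<Longrightarrow> entire (f i)) \<Longrightarrow> entire (\<lambda>z. \<Prod>i\<in>I. f i z)"
  by (induction I rule: infinite_finite_induct) (auto intro: entire_const entire_mult)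

lemma entire_sum: "(\<And>i. i \<in> I \<Longrightarrow> entire (f i)) \<Longrightarrow> entire (\<lambda>z. \<Sum>i\<in>I. f i z)"
  by (induction I rule: infinite_finite_induct) (auto intro: entire_const entire_add)

lemma entire_power: "entire f \<Longrightarrow> entire (\<lambda>z. f z ^ k)"
  by (induction k) (auto intro: entire_const entire_mult)

lemma entire_continuous:
  assumes "entire g"
  shows "continuous_on UNIV g"
  using has_derivative_continuous[OF entire_derivative(1)[OF assms]]
  by (auto simp: continuous_on_eq_continuous_at)

text \<open>Cauchy's estimate on complex lines.\<close>

lemma entire_derivative_bound:
  fixes g :: "complex^'n::finite \<Rightarrow> complex"
  assumes g: "entire g" and B: "\<And>w. norm (w - z) \<le> 1 \<Longrightarrow> norm (g w) \<le> B"
  shows "norm (frechet_derivative g (at z) v) \<le> B * norm v"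
proof (cases "v = 0")
  case True
  then show ?thesis
    using linear_0[OF has_derivative_linear[OF entire_derivative(1)[OF g]]] by simp
next
  case False
  define u where "u = (1 / norm v) *\<^sub>R v"
  have norm_mult_s: "norm (c *s u) = norm c" for c
  proof -
    have "c *s u = (1 / norm v) *\<^sub>R (c *s v)"
      by (simp add: u_def vec_eq_iff scaleR_conv_of_real)
    moreover have "norm (c *s v) = norm c * norm v"
      unfolding norm_vec_def by (simp add: norm_mult L2_set_right_distrib[symmetric])
    ultimately show ?thesis
      using False by simp
  qed
  have lin: "bounded_linear (\<lambda>c. c *s u)"
    unfolding linear_conv_bounded_linear[symmetric]
    by (auto simp: linear_iff vec_eq_iff algebra_simps)
  define f where "f c = g (z + c *s u)" for c
  have der: "(f has_field_derivative frechet_derivative g (at (z + c *s u)) u) (at c)" for c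
  proof -
    have "((\<lambda>c. z + c *s u) has_derivative (\<lambda>c. 0 + c *s u)) (at c)"
      by (intro has_derivative_add has_derivative_const bounded_linear_imp_has_derivative lin)
    then have aff: "((\<lambda>c. z + c *s u) has_derivative (\<lambda>c. c *s u)) (at c)"
      by simp
    have "(f has_derivative (\<lambda>h. frechet_derivative g (at (z + c *s u)) (h *s u))) (at c)"
      unfolding f_def by (rule has_derivative_compose[OF aff entire_derivative(1)[OF g]])
    then have "(f has_derivative (\<lambda>h. frechet_derivative g (at (z + c *s u)) u * h)) (at c)"
      by (simp only: entire_derivative(2)[OF g] mult.commute)
    then show ?thesis
      by (simp add: has_field_derivative_def)
  qed
  have hol: "f holomorphic_on UNIV"
    using der by (auto simp: holomorphic_on_def field_differentiable_def)
  have "norm ((deriv ^^ 1) f 0) \<le> fact 1 * B / 1 ^ 1"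
  proof (rule Cauchy_inequality)
    show "f holomorphic_on ball 0 1" "continuous_on (cball 0 1) f"
      using hol holomorphic_on_imp_continuous_on by (auto intro: holomorphic_on_subset)
    show "norm (f x) \<le> B" if "norm (0 - x) = 1" for x
      using that norm_mult_s[of x] unfolding f_def by (intro B) simp
  qed auto
  moreover have "deriv f 0 = frechet_derivative g (at z) u"
    using DERIV_imp_deriv[OF der[of 0]] by simp
  ultimately have "norm (frechet_derivative g (at z) u) \<le> B"
    by simp
  moreover have "frechet_derivative g (at z) v = norm v *\<^sub>R frechet_derivative g (at z) u"
    using False linear_scale[OF has_derivative_linear[OF entire_derivative(1)[OF g, of z]], of "1 / norm v" v]
    by (simp add: u_def)
  ultimately show ?thesis
    using mult_right_mono[of "norm (frechet_derivative g (at z) u)" B "norm v"] by (simp add: mult.commute)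
qed

lemma entire_loc_Lipschitz_diff:
  fixes g :: "complex^'n::finite \<Rightarrow> complex"
  assumes g: "entire g"
  shows "loc_Lipschitz_diff g"
  unfolding loc_Lipschitz_diff_def
proof (intro conjI allI)
  show "g differentiable (at x)" for x
    using entire_derivative(1)[OF g] by (auto simp: differentiable_def)
  fix v R
  have "bounded (g ` cball 0 (R + 1))"
    by (intro compact_imp_bounded compact_continuous_image continuous_on_subset[OF entire_continuous[OF g]]) auto
  then obtain B where B: "\<And>x. norm x \<le> R + 1 \<Longrightarrow> norm (g x) \<le> B"
    using bounded_image_cball by metis
  have "norm (frechet_derivative g (at x) v) \<le> B * norm v" if "norm x \<le> R" for x
  proof (rule entire_derivative_bound[OF g])
    fix w assume "norm (w - x) \<le> 1"
    then show "norm (g w) \<le> B"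
      using norm_triangle_ineq[of "w - x" x] that by (intro B) simp
  qed
  then show "\<exists>B. \<forall>x. norm x \<le> R \<longrightarrow> norm (frechet_derivative g (at x) v) \<le> B"
    by blast
qed

lemma entire_dbar: "entire g \<Longrightarrow> dbar j g z = 0"
proof -
  assume g: "entire g"
  have "axis j \<i> = \<i> *s axis j (1 :: complex)"
    by (simp add: vec_eq_iff axis_def)
  then show "dbar j g z = 0"
    unfolding dbar_def using entire_derivative(2)[OF g, of z \<i> "axis j 1"] by simp
qed

text \<open>
  An entire function has classical derivatives \<open>\<partial>bar\<^sub>j g = 0\<close>, hence also weak ones, and these are
  multiples of the coefficients at raised indices.
\<close>

lemma entire_hcoef:
  fixes g :: "complex^'n::finite \<Rightarrow> complex"
  assumes g: "entire g" "g \<in> L2 gauss" and i: "snd i \<noteq> (\<lambda>_. 0)"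
  shows "hcoef g i = 0"
proof -
  obtain j where "snd i j > 0"
    using i by auto
  then obtain k where k: "i = raise j k"
    using range_raise[of i j] by auto
  have "dbar j g = (\<lambda>z. 0)"
    using entire_dbar[OF g(1)] by auto
  then have "has_weak_dbar j g (\<lambda>z. 0)"
    using loc_Lipschitz_diff_weak_dbar[OF entire_loc_Lipschitz_diff[OF g(1)], of j] by simp
  from weak_dbar_hcoef[OF this g(2) L2_zero, of k]
  have "of_real (sqrt (real CARD('n) * real (Suc (snd k j)))) * hcoef g i = 0"
    by (simp add: k L2_inner_def)
  then show ?thesis
    by (simp del: of_nat_Suc)
qed

text \<open>
  Cauchy's estimate bounds the derivatives on a ball by the values on a larger one, so the derived series
  converges locally uniformly as well.
\<close>

lemma entire_suminf:
  fixes T :: "nat \<Rightarrow> complex^'n::finite \<Rightarrow> complex"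
  assumes T: "\<And>k. entire (T k)"
    and M: "\<And>R. \<exists>M. summable M \<and> (\<forall>k z. norm z \<le> R \<longrightarrow> norm (T k z) \<le> M k)"
  shows "entire (\<lambda>z. \<Sum>k. T k z)"
proof -
  define T' where "T' k z = frechet_derivative (T k) (at z)" for k z
  define g' where "g' z h = (\<Sum>k. T' k z h)" for z h
  have T': "(T k has_derivative T' k z) (at z)" "T' k z (c *s v) = c * T' k z v" for k z c v
    unfolding T'_def using entire_derivative[OF T] by auto
  have main: "((\<lambda>z. \<Sum>k. T k z) has_derivative g' z) (at z) \<and> (\<forall>c v. g' z (c *s v) = c * g' z v)" for z
  proof -
    define R where "R = norm z + 1"
    obtain M where M: "summable M" "\<And>k w. norm w \<le> R + 1 \<Longrightarrow> norm (T k w) \<le> M k"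
      using assms(2)[of "R + 1"] by blast
    have M_nonneg: "M k \<ge> 0" for k
      using order_trans[OF norm_ge_zero M(2)[of 0 k]] by (simp add: R_def)
    have T'_bound: "norm (T' k x h) \<le> M k * norm h" if "norm x \<le> R" for k x h
      unfolding T'_def
    proof (rule entire_derivative_bound[OF T])
      fix w assume "norm (w - x) \<le> 1"
      then show "norm (T k w) \<le> M k"
        using norm_triangle_ineq[of "w - x" x] that by (intro M(2)) simp
    qed
    have sT': "summable (\<lambda>k. T' k x h)" if "norm x \<le> R" for x h
      by (rule summable_comparison_test'[of "\<lambda>k. M k * norm h" 0])
         (use T'_bound[OF that] M(1) in \<open>auto intro: summable_mult2\<close>)
    have "\<exists>g. \<forall>x\<in>ball 0 R. (\<lambda>k. T k x) sums g x \<and> (g has_derivative g' x) (at x within ball 0 R)"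
    proof (rule has_derivative_series)
      show "(T k has_derivative T' k x) (at x within ball 0 R)" for k x
        by (rule has_derivative_at_withinI[OF T'(1)])
      show "(0 :: complex^'n) \<in> ball 0 R"
        by (simp add: R_def add_nonneg_pos)
      show "(\<lambda>k. T k 0) sums (\<Sum>k. T k 0)"
        by (intro summable_sums summable_comparison_test'[OF M(1), of 0]) (auto intro!: M(2) simp: R_def)
      fix e :: real
      assume e: "e > 0"
      have "(\<lambda>n. \<Sum>k. M (k + n)) \<longlonglongrightarrow> 0"
        using suminf_exist_split2[OF M(1)] .
      then have "\<forall>\<^sub>F n in sequentially. (\<Sum>k. M (k + n)) < e"
        using e by (rule order_tendstoD)
      then show "\<forall>\<^sub>F n in sequentially. \<forall>x\<in>ball 0 R. \<forall>h. norm ((\<Sum>k<n. T' k x h) - g' x h) \<le> e * norm h"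
      proof eventually_elim
        case (elim n)
        show ?case
        proof (intro ballI allI)
          fix x h :: "complex^'n"
          assume "x \<in> ball 0 R"
          then have x: "norm x \<le> R" by simp
          have "norm ((\<Sum>k<n. T' k x h) - g' x h) = norm (\<Sum>k. T' (k + n) x h)"
            unfolding g'_def using suminf_split_initial_segment[OF sT'[OF x], of h n]
            by (simp add: norm_minus_commute)
          also have "\<dots> \<le> (\<Sum>k. M (k + n) * norm h)"
            by (rule norm_suminf_le) (use M(1) T'_bound[OF x] in \<open>auto intro!: summable_mult2 simp: summable_iff_shift\<close>)
          also have "\<dots> = (\<Sum>k. M (k + n)) * norm h"
            using M(1) by (intro suminf_mult2[symmetric]) (simp add: summable_iff_shift)
          also have "\<dots> \<le> e * norm h"
            using elim by (intro mult_right_mono) auto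
          finally show "norm ((\<Sum>k<n. T' k x h) - g' x h) \<le> e * norm h" .
        qed
      qed
    qed auto
    then obtain g where g: "\<And>x. x \<in> ball 0 R \<Longrightarrow> (\<lambda>k. T k x) sums g x"
      "\<And>x. x \<in> ball 0 R \<Longrightarrow> (g has_derivative g' x) (at x within ball 0 R)"
      by blast
    have z: "z \<in> ball 0 R"
      by (simp add: R_def)
    have "(g has_derivative g' z) (at z)"
      using g(2)[OF z] at_within_open[OF z open_ball] by simp
    then have "((\<lambda>z. \<Sum>k. T k z) has_derivative g' z) (at z)"
      by (rule has_derivative_transform_within_open[OF _ open_ball z])
         (use g(1) in \<open>auto simp: sums_iff\<close>)
    moreover have "g' z (c *s v) = c * g' z v" for c v
      unfolding g'_def T'(2) by (rule suminf_mult[OF sT']) (simp add: R_def)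
    ultimately show ?thesis by blast
  qed
  then show ?thesis
    by (intro entire_I[of _ g']) auto
qed

lemma hbasis_entire:
  assumes "snd i = (\<lambda>_. 0)"
  shows "entire (hbasis i)"
  unfolding hbasis_def[abs_def] Herm_def assms herm_left_0
  by (intro entire_mult entire_const entire_prod entire_power entire_coord)

text \<open>
  The reproducing kernel bound \<open>\<Sum>\<^sub>a \<bar>e\<^sub>a (z)\<bar>\<^sup>2 = exp (n \<bar>z\<bar>\<^sup>2)\<close> (up to the total mass), in the form of an
  inequality for finite partial sums.
\<close>

lemma hbasis_square_sum_le:
  fixes z :: "complex^'n::finite"
  assumes F: "finite F" and hol: "\<And>i. i \<in> F \<Longrightarrow> snd i = (\<lambda>_. 0)"
  shows "(\<Sum>i\<in>F. (norm (hbasis i z))\<^sup>2) \<le> exp (real CARD('n) * (norm z)\<^sup>2) / gmass TYPE('n)"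
proof -
  define x where "x j = real CARD('n) * (norm (z $ j))\<^sup>2" for j
  have x: "x j \<ge> 0" for j
    by (simp add: x_def)
  have hbasis_sq: "(norm (hbasis i z))\<^sup>2 = (\<Prod>j\<in>UNIV. x j ^ fst i j / fact (fst i j)) / gmass TYPE('n)" if i: "i \<in> F" for i
  proof -
    have "(norm (Herm (fst i) (snd i) z))\<^sup>2 = (\<Prod>j\<in>UNIV. ((real CARD('n) * norm (z $ j)) ^ fst i j)\<^sup>2)"
      unfolding Herm_def hol[OF i] herm_left_0
      by (simp add: prod_norm[symmetric] norm_power norm_mult prod_power_distrib)
    also have "\<dots> = (\<Prod>j\<in>UNIV. (real CARD('n) ^ fst i j * fact (fst i j)) * (x j ^ fst i j / fact (fst i j)))"
    proof (rule prod.cong[OF refl])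
      fix j
      have "((real CARD('n) * norm (z $ j)) ^ fst i j)\<^sup>2 = ((real CARD('n) * norm (z $ j))\<^sup>2) ^ fst i j"
        by (simp add: power_mult[symmetric] mult.commute)
      also have "(real CARD('n) * norm (z $ j))\<^sup>2 = real CARD('n) * x j"
        by (simp add: x_def power2_eq_square)
      finally show "((real CARD('n) * norm (z $ j)) ^ fst i j)\<^sup>2
          = (real CARD('n) ^ fst i j * fact (fst i j)) * (x j ^ fst i j / fact (fst i j))"
        by (simp add: power_mult_distrib)
    qed
    also have "\<dots> = mfact (fst i) * (\<Prod>j\<in>UNIV. x j ^ fst i j / fact (fst i j))"
      unfolding mfact_def by (rule prod.distrib)
    finally have H: "(norm (Herm (fst i) (snd i) z))\<^sup>2 = mfact (fst i) * (\<Prod>j\<in>UNIV. x j ^ fst i j / fact (fst i j))" .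
    have "(norm (hbasis i z))\<^sup>2 = (norm (Herm (fst i) (snd i) z))\<^sup>2 / (mfact (fst i) * gmass TYPE('n))"
      using mfact_pos[of "fst i"] gmass_pos[where 'n = 'n]
      by (simp add: hbasis_def hol[OF i] norm_mult norm_divide power_mult_distrib power_divide)
    then show ?thesis
      unfolding H using mfact_pos[of "fst i"] by simp
  qed
  define m where "m = Max (insert 0 ((\<lambda>(i, j). fst i j) ` (F \<times> (UNIV :: 'n set))))"
  have m: "fst i j \<le> m" if "i \<in> F" for i j
    unfolding m_def using F that by (intro Max_ge) force+
  have "(\<Sum>i\<in>F. \<Prod>j\<in>UNIV. x j ^ fst i j / fact (fst i j))
      = (\<Sum>a\<in>fst ` F. \<Prod>j\<in>UNIV. x j ^ a j / fact (a j))"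
    by (rule sum.reindex[symmetric, unfolded o_def]) (rule inj_onI, rule prod_eqI, simp_all add: hol)
  also have "\<dots> \<le> (\<Sum>a\<in>(\<Pi>\<^sub>E j\<in>UNIV. {..m}). \<Prod>j\<in>UNIV. x j ^ a j / fact (a j))"
    by (rule sum_mono2) (use m x in \<open>auto intro!: finite_PiE prod_nonneg\<close>)
  also have "\<dots> = (\<Prod>j\<in>UNIV. \<Sum>k\<le>m. x j ^ k / fact k)"
    by (rule prod_sum_PiE[symmetric]) auto
  also have "\<dots> \<le> (\<Prod>j\<in>UNIV. exp (x j))"
  proof (intro prod_mono conjI)
    fix j
    show "0 \<le> (\<Sum>k\<le>m. x j ^ k / fact k)"
      using x by (intro sum_nonneg) auto
    have "(\<Sum>k\<le>m. x j ^ k / fact k) \<le> (\<Sum>k. x j ^ k / fact k)"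
      using summable_exp_generic[of "x j"] x
      by (intro sum_le_suminf) (auto simp: divide_inverse mult.commute)
    then show "(\<Sum>k\<le>m. x j ^ k / fact k) \<le> exp (x j)"
      by (simp add: exp_def divide_inverse mult.commute)
  qed
  also have "\<dots> = exp (\<Sum>j\<in>UNIV. x j)"
    by (simp add: exp_sum)
  also have "(\<Sum>j\<in>UNIV. x j) = real CARD('n) * (norm z)\<^sup>2"
    by (simp add: x_def power2_norm_eq_inner inner_vec_def sum_distrib_left)
  finally have "(\<Sum>i\<in>F. \<Prod>j\<in>UNIV. x j ^ fst i j / fact (fst i j)) \<le> exp (real CARD('n) * (norm z)\<^sup>2)" .
  then show ?thesis
    using gmass_pos[where 'n = 'n] by (simp add: hbasis_sq divide_right_mono flip: sum_divide_distrib)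
qed

lemma norm_partial_le:
  fixes z :: "complex^'n::finite"
  assumes F: "finite F" and hol: "\<And>i. i \<in> F \<Longrightarrow> snd i = (\<lambda>_. 0)"
  shows "(norm (Hermite.partial c F z))\<^sup>2
     \<le> (\<Sum>i\<in>F. (norm (c i))\<^sup>2) * (exp (real CARD('n) * (norm z)\<^sup>2) / gmass TYPE('n))"
proof -
  have "norm (Hermite.partial c F z) \<le> (\<Sum>i\<in>F. norm (c i) * norm (hbasis i z))"
    unfolding Hermite.partial_def by (rule order_trans[OF norm_sum]) (simp add: norm_mult)
  then have "(norm (Hermite.partial c F z))\<^sup>2 \<le> (\<Sum>i\<in>F. norm (c i) * norm (hbasis i z))\<^sup>2"
    by (rule power_mono) simp
  also have "\<dots> \<le> (\<Sum>i\<in>F. (norm (c i))\<^sup>2) * (\<Sum>i\<in>F. (norm (hbasis i z))\<^sup>2)"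
    by (rule Cauchy_Schwarz_ineq_sum)
  also have "\<dots> \<le> (\<Sum>i\<in>F. (norm (c i))\<^sup>2) * (exp (real CARD('n) * (norm z)\<^sup>2) / gmass TYPE('n))"
    by (intro mult_left_mono hbasis_square_sum_le F hol sum_nonneg) auto
  finally show ?thesis .
qed

text \<open>
  The Riesz-Fischer partial sums converge locally uniformly, by the kernel bound, so the limit has an
  entire representative.
\<close>

lemma fock_space_Riesz_Fischer:
  fixes c :: "('n::finite \<Rightarrow> nat) \<times> ('n \<Rightarrow> nat) \<Rightarrow> complex"
  assumes c: "(\<lambda>i. (norm (c i))\<^sup>2) summable_on UNIV" and hol: "\<And>i. snd i \<noteq> (\<lambda>_. 0) \<Longrightarrow> c i = 0"
  shows "\<exists>g\<in>fock_space. \<forall>i. hcoef (g :: complex^'n \<Rightarrow> complex) i = c i"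
proof -
  obtain u G where u: "u \<in> L2 (gauss :: (complex^'n) measure)" "\<And>i. hcoef u i = c i"
    and fin: "\<And>k. finite (G k)"
    and inc: "\<And>k. (L2_norm gauss (\<lambda>x::complex^'n. Hermite.partial c (G (Suc k)) x - Hermite.partial c (G k) x))\<^sup>2 \<le> 1 / 8 ^ k"
    and lim: "AE x in gauss. (\<lambda>k. Hermite.partial c (G k) x) \<longlonglongrightarrow> u x"
    using Hermite.Riesz_Fischer[OF c] by blast
  define S where "S k z = Hermite.partial c (G k) (z :: complex^'n)" for k z
  define T where "T k z = S (Suc k) z - S k z" for k z
  have entS: "entire (S k)" for k
  proof -
    have "entire (\<lambda>z::complex^'n. c i * hbasis i z)" for i
      using hol[of i] by (cases "snd i = (\<lambda>_. 0)") (auto intro: entire_mult entire_const hbasis_entire)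
    then show ?thesis
      unfolding S_def Hermite.partial_def by (intro entire_sum)
  qed
  have entT: "entire (T k)" for k
    unfolding T_def by (intro entire_diff entS)
  have T_bound: "(norm (T k z))\<^sup>2 \<le> 1 / 8 ^ k * (exp (real CARD('n) * (norm z)\<^sup>2) / gmass TYPE('n))" for k z
  proof -
    define F where "F = {i \<in> G (Suc k) \<union> G k. snd i = (\<lambda>_. 0)}"
    define d where "d i = (if i \<in> G (Suc k) then c i else 0) - (if i \<in> G k then c i else 0)" for i
    have F: "finite F"
      using fin by (simp add: F_def)
    have restrict: "S l z = (\<Sum>i\<in>F. (if i \<in> G l then c i else 0) * hbasis i z)" if "l = k \<or> l = Suc k" for l z
      unfolding S_def Hermite.partial_def
      by (rule sum.mono_neutral_cong) (use that fin F hol in \<open>auto simp: F_def\<close>)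
    have T: "T k = Hermite.partial d F"
      by (rule ext) (simp add: T_def restrict Hermite.partial_def d_def left_diff_distrib sum_subtractf)
    have "(\<Sum>i\<in>F. (norm (d i))\<^sup>2) = (L2_norm gauss (T k))\<^sup>2"
      unfolding T by (rule Hermite.norm_partial[OF F, symmetric])
    also have "\<dots> \<le> 1 / 8 ^ k"
      using inc[of k] by (simp add: T_def[abs_def] S_def)
    finally have "(\<Sum>i\<in>F. (norm (d i))\<^sup>2) \<le> 1 / 8 ^ k" .
    then have "(\<Sum>i\<in>F. (norm (d i))\<^sup>2) * (exp (real CARD('n) * (norm z)\<^sup>2) / gmass TYPE('n))
        \<le> 1 / 8 ^ k * (exp (real CARD('n) * (norm z)\<^sup>2) / gmass TYPE('n))"
      using gmass_pos[where 'n = 'n] by (intro mult_right_mono) auto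
    then show ?thesis
      unfolding T using norm_partial_le[OF F, of d z] by (auto simp: F_def)
  qed
  have M: "\<exists>M. summable M \<and> (\<forall>k z. norm z \<le> R \<longrightarrow> norm (T k z) \<le> M k)" for R
  proof -
    define K where "K = sqrt (exp (real CARD('n) * R\<^sup>2) / gmass TYPE('n))"
    have "norm (T k z) \<le> (1 / 2) ^ k * K" if "norm z \<le> R" for k z
    proof (rule power2_le_imp_le)
      have "(norm (T k z))\<^sup>2 \<le> (1 / 4) ^ k * (exp (real CARD('n) * R\<^sup>2) / gmass TYPE('n))"
      proof (rule order_trans[OF T_bound mult_mono])
        show "1 / 8 ^ k \<le> (1 / 4 :: real) ^ k"
          by (simp add: power_divide frac_le power_mono)
        show "exp (real CARD('n) * (norm z)\<^sup>2) / gmass TYPE('n) \<le> exp (real CARD('n) * R\<^sup>2) / gmass TYPE('n)"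
          using gmass_pos[where 'n = 'n] that by (intro divide_right_mono) (auto intro!: power_mono)
      qed (use gmass_pos[where 'n = 'n] in auto)
      also have "\<dots> = ((1 / 2) ^ k * K)\<^sup>2"
        using gmass_pos[where 'n = 'n] by (simp add: K_def power_mult_distrib power_divide four_power_eq[of k])
      finally show "(norm (T k z))\<^sup>2 \<le> ((1 / 2) ^ k * K)\<^sup>2" .
    qed (use gmass_pos[where 'n = 'n] in \<open>auto simp: K_def\<close>)
    then show ?thesis
      by (intro exI[of _ "\<lambda>k. (1 / 2) ^ k * K"]) (auto intro!: summable_mult2)
  qed
  define g where "g z = S 0 z + (\<Sum>k. T k z)" for z
  have ent: "entire g"
    unfolding g_def by (intro entire_add entS entire_suminf entT M)
  have S_lim: "(\<lambda>k. S k z) \<longlonglongrightarrow> g z" for z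
  proof -
    obtain M0 where M0: "summable M0" "\<And>k w. norm w \<le> norm z \<Longrightarrow> norm (T k w) \<le> M0 k"
      using M[of "norm z"] by blast
    have "(\<lambda>k. T k z) sums (\<Sum>k. T k z)"
      by (intro summable_sums summable_comparison_test'[OF M0(1), of 0]) (auto intro!: M0(2))
    then have "(\<lambda>k. S 0 z + (\<Sum>i<k. T i z)) \<longlonglongrightarrow> g z"
      unfolding g_def sums_def by (intro tendsto_add tendsto_const)
    then show ?thesis
      unfolding T_def sum_lessThan_telescope[of "\<lambda>i. S i z"] by simp
  qed
  have ae: "AE z in gauss. u z = g z"
    using lim by eventually_elim (use S_lim LIMSEQ_unique in \<open>auto simp: S_def\<close>)
  have gm: "g \<in> borel_measurable gauss"
    using entire_continuous[OF ent] by (auto intro: borel_measurable_continuous_onI)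
  have "g \<in> L2 gauss"
    by (rule L2_cong_AE[OF u(1) gm ae])
  moreover have "hcoef g i = c i" for i
    using Hermite.coef_cong_AE[OF L2_measurable[OF u(1)] gm ae] u(2) by metis
  ultimately show ?thesis
    using ent by (auto simp: fock_space_def)
qed

lemma hbasis_fock: "snd i = (\<lambda>_. 0) \<Longrightarrow> hbasis i \<in> fock_space"
  by (simp add: fock_space_def hbasis_entire)

lemma fock_space_L2: "g \<in> fock_space \<Longrightarrow> g \<in> L2 gauss"
  by (simp add: fock_space_def)

lemma fock_space_hcoef: "g \<in> fock_space \<Longrightarrow> snd i \<noteq> (\<lambda>_. 0) \<Longrightarrow> hcoef g i = 0"
  by (rule entire_hcoef) (auto simp: fock_space_def)

text \<open>
  The basis vectors with \<open>b = 0\<close> are holomorphic, and by Parseval's identity they suffice as test functions.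
\<close>

lemma orth_fock_space_iff:
  fixes f :: "complex^'n::finite \<Rightarrow> complex"
  shows "f \<in> L2_orth gauss fock_space \<longleftrightarrow> f \<in> L2 gauss \<and> (\<forall>i. snd i = (\<lambda>_. 0) \<longrightarrow> hcoef f i = 0)"
proof (intro iffI conjI allI impI; (elim conjE)?)
  assume f: "f \<in> L2_orth gauss fock_space"
  then show "f \<in> L2 gauss" "snd i = (\<lambda>_. 0) \<Longrightarrow> hcoef f i = 0" for i
    unfolding L2_orth_def using hbasis_fock by blast+
next
  assume f: "f \<in> L2 gauss" "\<forall>i. snd i = (\<lambda>_. 0) \<longrightarrow> hcoef f i = 0"
  have "L2_inner gauss f g = 0" if g: "g \<in> fock_space" for g
  proof -
    have zero: "hcoef f i * cnj (hcoef g i) = 0" for i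
      using f(2)[rule_format, of i] fock_space_hcoef[OF g, of i] by (cases "snd i = (\<lambda>_. 0)") simp_all
    have "((\<lambda>i :: ('n \<Rightarrow> nat) \<times> ('n \<Rightarrow> nat). 0) has_sum L2_inner gauss f g) UNIV"
      using Hermite.Parseval[OF f(1) fock_space_L2[OF g]] by (simp only: zero)
    then show ?thesis
      using has_sum_0_simp by (rule has_sum_unique)
  qed
  with f show "f \<in> L2_orth gauss fock_space"
    by (simp add: L2_orth_def)
qed

text \<open>
  The projection is a choice of representative. Its coefficients are forced, since those at \<open>b \<noteq> 0\<close> vanish on
  the Fock space and those at \<open>b = 0\<close> vanish on the orthogonal complement.
\<close>

lemma proj_fock_space:
  fixes w :: "complex^'n::finite \<Rightarrow> complex"
  assumes w: "w \<in> L2 gauss"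
  shows "L2_proj gauss fock_space w \<in> fock_space"
    and "hcoef (L2_proj gauss fock_space w) i = (if snd i = (\<lambda>_. 0) then hcoef w i else 0)"
proof -
  let ?c = "\<lambda>i. if snd i = (\<lambda>_. 0) then hcoef w i else 0"
  have "(\<lambda>i. (norm (?c i))\<^sup>2) summable_on UNIV"
    by (rule summable_on_comparison_test[OF Hermite.coef_summable[OF w]]) auto
  then obtain p where p: "p \<in> fock_space" "\<And>i. hcoef p i = ?c i"
    using fock_space_Riesz_Fischer[of ?c] by auto
  have "(\<lambda>x. w x - p x) \<in> L2_orth gauss fock_space"
    using w p by (simp add: orth_fock_space_iff L2_diff fock_space_L2 Hermite.coef_diff)
  with p(1) have "\<exists>p. p \<in> fock_space \<and> (\<lambda>x. w x - p x) \<in> L2_orth gauss fock_space"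
    by blast
  then have P: "L2_proj gauss fock_space w \<in> fock_space \<and>
      (\<lambda>x. w x - L2_proj gauss fock_space w x) \<in> L2_orth gauss fock_space"
    unfolding L2_proj_def by (rule someI_ex)
  then show "L2_proj gauss fock_space w \<in> fock_space" ..
  show "hcoef (L2_proj gauss fock_space w) i = ?c i"
  proof (cases "snd i = (\<lambda>_. 0)")
    case True
    then have "hcoef (\<lambda>x. w x - L2_proj gauss fock_space w x) i = 0"
      using P unfolding orth_fock_space_iff by blast
    then show ?thesis
      using True P w by (simp add: Hermite.coef_diff fock_space_L2)
  qed (use fock_space_hcoef[OF conjunct1[OF P], of i] in simp)
qed

lemma proj_orth_fock_space:
  fixes w :: "complex^'n::finite \<Rightarrow> complex"
  assumes w: "w \<in> L2 gauss"
  shows "L2_proj gauss (L2_orth gauss fock_space) w \<in> L2 gauss"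
    and "hcoef (L2_proj gauss (L2_orth gauss fock_space) w) i = (if snd i = (\<lambda>_. 0) then 0 else hcoef w i)"
proof -
  let ?O = "L2_orth gauss (fock_space :: (complex^'n \<Rightarrow> complex) set)"
  let ?P = "L2_proj gauss fock_space w"
  note PL2 = fock_space_L2[OF proj_fock_space(1)[OF w]]
  have "(\<lambda>x. w x - ?P x) \<in> ?O"
    using w by (simp add: orth_fock_space_iff L2_diff PL2 Hermite.coef_diff proj_fock_space)
  moreover have "(\<lambda>x. w x - (w x - ?P x)) \<in> L2_orth gauss ?O"
  proof -
    have "L2_inner gauss ?P s = 0" if s: "s \<in> ?O" for s
      using s proj_fock_space(1)[OF w] L2_inner_commute[of gauss ?P s] by (simp add: L2_orth_def)
    then show ?thesis
      using PL2 by (simp add: L2_orth_def)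
  qed
  ultimately have "\<exists>p. p \<in> ?O \<and> (\<lambda>x. w x - p x) \<in> L2_orth gauss ?O"
    by (intro exI[of _ "\<lambda>x. w x - ?P x"] conjI)
  then have Q: "L2_proj gauss ?O w \<in> ?O \<and> (\<lambda>x. w x - L2_proj gauss ?O w x) \<in> L2_orth gauss ?O"
    unfolding L2_proj_def by (rule someI_ex)
  then show L: "L2_proj gauss ?O w \<in> L2 gauss"
    by (simp add: L2_orth_def)
  show "hcoef (L2_proj gauss ?O w) i = (if snd i = (\<lambda>_. 0) then 0 else hcoef w i)"
  proof (cases "snd i = (\<lambda>_. 0)")
    case True
    then have "hcoef (L2_proj gauss ?O w) i = 0"
      using Q unfolding orth_fock_space_iff by blast
    with True show ?thesis by simp
  next
    case False
    then have "hbasis i \<in> ?O"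
      by (auto simp: orth_fock_space_iff Hermite.coef_basis)
    then have "hcoef (\<lambda>x. w x - L2_proj gauss ?O w x) i = 0"
      using Q by (simp add: L2_orth_def)
    then show ?thesis
      using False w L by (simp add: Hermite.coef_diff)
  qed
qed

section \<open>Second derivatives of the inverse square root\<close>

lemma level_eq_0_iff: "level i = 0 \<longleftrightarrow> snd i = (\<lambda>_. 0)"
proof -
  have "level i = 0 \<longleftrightarrow> (\<forall>j\<in>UNIV. real (snd i j) = 0)"
    unfolding level_def by (simp add: sum_nonneg_eq_0_iff)
  then show ?thesis by auto
qed

lemma level_raise: "level (raise j i) = level i + real CARD('n)"
  for i :: "('n::finite \<Rightarrow> nat) \<times> ('n \<Rightarrow> nat)"
  using sum_up[of j "snd i"] by (simp add: level_def algebra_simps flip: of_nat_sum)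

text \<open>The spectral gap: it makes the inverse square root bounded.\<close>

lemma level_ge_1: "level i > 0 \<Longrightarrow> level i \<ge> 1"
proof -
  have "level i = real (CARD('a) * (\<Sum>j\<in>UNIV. snd i j))"
    by (simp add: level_def)
  then show "level i > 0 \<Longrightarrow> level i \<ge> 1"
    by (simp only: of_nat_0_less_iff of_nat_1_eq_iff one_le_numeral)
qed

lemma dbar_form_norm_has_sum:
  fixes u :: "complex^'n::finite \<Rightarrow> complex"
  assumes u: "u \<in> dbar_form_dom"
  shows "((\<lambda>i. level i * (norm (hcoef u i))\<^sup>2) has_sum (\<Sum>j\<in>UNIV. (L2_norm gauss (weak_dbar j u))\<^sup>2)) UNIV"
proof -
  have "((\<lambda>i. Re (of_real (level i) * hcoef u i * cnj (hcoef u i))) has_sum Re (dbar_form u u)) UNIV"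
    by (intro has_sum_Re dbar_form_has_sum u)
  moreover have "Re (of_real (level i) * hcoef u i * cnj (hcoef u i)) = level i * (norm (hcoef u i))\<^sup>2" for i
    unfolding mult.assoc by (simp add: complex_mult_cnj cmod_power2)
  moreover have "Re (dbar_form u u) = (\<Sum>j\<in>UNIV. (L2_norm gauss (weak_dbar j u))\<^sup>2)"
    unfolding dbar_form_def L2_inner_self Re_sum Re_complex_of_real ..
  ultimately show ?thesis
    by simp
qed

text \<open>
  In the Hermite basis \<open>v = N\<^sup>-\<^sup>1\<^sup>/\<^sup>2 p\<close> has coefficients \<open>p\<^sub>i / \<surd>level i\<close>. Two derivatives contribute
  the weight \<open>level i (level i - n)\<close>, because the first one lowers the level by \<open>n\<close>.
\<close>

theorem second_dbar_derivatives:
  fixes w :: "complex^'n::finite \<Rightarrow> complex"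
  assumes w: "w \<in> dbar_form_dom"
  defines "p \<equiv> L2_proj gauss (L2_orth gauss fock_space) w"
  defines "v \<equiv> inv_sqrt_dbar_laplacian p"
  shows "v \<in> dbar_form_dom" and "weak_dbar k v \<in> dbar_form_dom"
    and "(\<Sum>j\<in>UNIV. \<Sum>k\<in>UNIV. (L2_norm gauss (weak_dbar j (weak_dbar k v)))\<^sup>2)
           = (\<Sum>j\<in>UNIV. (L2_norm gauss (weak_dbar j w))\<^sup>2) - real CARD('n) * (L2_norm gauss p)\<^sup>2"
proof -
  note wL2 = dbar_form_domD(1)[OF w]
  have pL2: "p \<in> L2 gauss" and p: "\<And>i. hcoef p i = (if snd i = (\<lambda>_. 0) then 0 else hcoef w i)"
    unfolding p_def by (rule proj_orth_fock_space[OF wL2])+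
  define \<phi> :: "real \<Rightarrow> real" where "\<phi> t = (if t > 0 then 1 / sqrt t else 0)" for t
  have \<phi>_meas: "\<phi> \<in> borel_measurable borel"
    unfolding \<phi>_def by measurable
  have \<phi>_sq: "(\<phi> (level i))\<^sup>2 = (if level i > 0 then 1 / level i else 0)" for i :: "('n \<Rightarrow> nat) \<times> ('n \<Rightarrow> nat)"
    by (simp add: \<phi>_def power_divide)
  have "(\<lambda>i. (\<phi> (level i))\<^sup>2 * (norm (hcoef p i))\<^sup>2) summable_on UNIV"
  proof (rule summable_on_comparison_test[OF Hermite.coef_summable[OF pL2]])
    fix i :: "('n \<Rightarrow> nat) \<times> ('n \<Rightarrow> nat)"
    have "(\<phi> (level i))\<^sup>2 \<le> 1"
      unfolding \<phi>_sq using level_ge_1[of i] by simp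
    then show "(\<phi> (level i))\<^sup>2 * (norm (hcoef p i))\<^sup>2 \<le> (norm (hcoef p i))\<^sup>2"
      by (rule mult_left_le_one_le[rotated 2]) auto
  qed auto
  note calc = Hermite.coef_spectral_calculus[OF \<phi>_meas pL2 this]
  have v_eq: "v = spectral_calculus gauss (Hermite.diag_op level) \<phi> p"
    by (simp add: v_def inv_sqrt_dbar_laplacian_def dbar_laplacian_diagonal \<phi>_def[abs_def])
  have vL2: "v \<in> L2 gauss" and v: "\<And>i. hcoef v i = of_real (\<phi> (level i)) * hcoef p i"
    unfolding v_eq by (rule calc)+
  have v_sq: "level i * (norm (hcoef v i))\<^sup>2 = (norm (hcoef p i))\<^sup>2" for i
  proof (cases "level i = 0")
    case True
    then show ?thesis
      by (simp add: p level_eq_0_iff)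
  next
    case False
    then have "level i > 0"
      using level_nonneg[of i] by simp
    then show ?thesis
      unfolding v norm_mult power_mult_distrib norm_of_real power2_abs \<phi>_sq by simp
  qed
  have p_le: "(norm (hcoef p i))\<^sup>2 \<le> (norm (hcoef w i))\<^sup>2" for i
    by (simp add: p)
  show v_dom: "v \<in> dbar_form_dom"
    using vL2 Hermite.coef_summable[OF pL2] by (simp add: dbar_form_dom_iff v_sq)
  \<comment> \<open>At \<open>raise k i\<close> this is the contribution of index \<open>i\<close> to the form at \<open>\<partial>bar\<^sub>k v\<close>, expressed through \<open>v\<close>.\<close>
  define F where "F k i = (level i - real CARD('n)) * (real CARD('n) * real (snd i k)) * (norm (hcoef v i))\<^sup>2" for k i
  have F_raise: "F k (raise k i) = level i * (norm (hcoef (weak_dbar k v) i))\<^sup>2" for k i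
  proof -
    define m where "m = real CARD('n) * real (Suc (snd i k))"
    have "(norm (hcoef (weak_dbar k v) i))\<^sup>2 = m * (norm (hcoef v (raise k i)))\<^sup>2"
      unfolding dbar_form_domD(4)[OF v_dom] m_def[symmetric] norm_mult power_mult_distrib
      by (simp add: m_def)
    then show ?thesis
      by (simp add: F_def level_raise m_def)
  qed
  have F0: "F k i = 0" if "snd i k = 0" for k i
    using that by (simp add: F_def)
  have w_sum: "((\<lambda>i. level i * (norm (hcoef w i))\<^sup>2) has_sum (\<Sum>j\<in>UNIV. (L2_norm gauss (weak_dbar j w))\<^sup>2)) UNIV"
    by (rule dbar_form_norm_has_sum[OF w])
  have F_summable: "F k summable_on UNIV" for k
  proof (rule summable_on_comparison_test[OF has_sum_imp_summable[OF w_sum]])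
    fix i :: "('n \<Rightarrow> nat) \<times> ('n \<Rightarrow> nat)"
    show nonneg: "0 \<le> F k i"
    proof (cases "snd i k = 0")
      case False
      then obtain i' where "i = raise k i'"
        using range_raise[of i k] by auto
      then show ?thesis
        by (simp add: F_raise level_nonneg)
    qed (simp add: F0)
    have "real CARD('n) * real (snd i k) \<le> level i"
      unfolding level_def using member_le_sum[of k UNIV "\<lambda>j. real (snd i j)"] by (intro mult_left_mono) auto
    moreover have "level i - real CARD('n) \<le> level i"
      by simp
    ultimately have "(level i - real CARD('n)) * (real CARD('n) * real (snd i k)) \<le> level i * level i"
      by (intro order_trans[OF mult_right_mono mult_left_mono] level_nonneg) auto
    then have "F k i \<le> level i * level i * (norm (hcoef v i))\<^sup>2"
      unfolding F_def by (rule mult_right_mono) simp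
    also have "\<dots> = level i * (norm (hcoef p i))\<^sup>2"
      by (simp add: mult.assoc v_sq)
    also have "\<dots> \<le> level i * (norm (hcoef w i))\<^sup>2"
      by (intro mult_left_mono p_le level_nonneg)
    finally show "F k i \<le> level i * (norm (hcoef w i))\<^sup>2" .
  qed
  show dv_dom: "weak_dbar k v \<in> dbar_form_dom" for k
  proof -
    have "(\<lambda>i. F k (raise k i)) summable_on UNIV"
      using F_summable[of k] by (subst summable_on_raise[of k "F k"]) (simp_all add: F0)
    then show ?thesis
      using dbar_form_domD(3)[OF v_dom, of k] by (simp add: dbar_form_dom_iff F_raise)
  qed
  have "((\<lambda>i. F k (raise k i)) has_sum (\<Sum>j\<in>UNIV. (L2_norm gauss (weak_dbar j (weak_dbar k v)))\<^sup>2)) UNIV" for k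
    unfolding F_raise by (rule dbar_form_norm_has_sum[OF dv_dom])
  then have "(F k has_sum (\<Sum>j\<in>UNIV. (L2_norm gauss (weak_dbar j (weak_dbar k v)))\<^sup>2)) UNIV" for k
    by (subst (asm) has_sum_raise[of k "F k" for k]) (simp_all add: F0)
  then have "((\<lambda>i. \<Sum>k\<in>UNIV. F k i) has_sum (\<Sum>k\<in>UNIV. \<Sum>j\<in>UNIV. (L2_norm gauss (weak_dbar j (weak_dbar k v)))\<^sup>2)) UNIV"
    by (intro has_sum_finite_sum)
  moreover have "(\<Sum>k\<in>UNIV. F k i) = level i * (norm (hcoef w i))\<^sup>2 - real CARD('n) * (norm (hcoef p i))\<^sup>2" for i
  proof -
    have "(\<Sum>k\<in>UNIV. F k i) = (level i - real CARD('n)) * (level i * (norm (hcoef v i))\<^sup>2)"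
      by (simp add: F_def level_def sum_distrib_left sum_distrib_right mult_ac)
    also have "\<dots> = level i * (norm (hcoef w i))\<^sup>2 - real CARD('n) * (norm (hcoef p i))\<^sup>2"
      unfolding v_sq using level_eq_0_iff[of i] by (auto simp: p left_diff_distrib)
    finally show ?thesis .
  qed
  ultimately have "((\<lambda>i. level i * (norm (hcoef w i))\<^sup>2 - real CARD('n) * (norm (hcoef p i))\<^sup>2) has_sum
      (\<Sum>k\<in>UNIV. \<Sum>j\<in>UNIV. (L2_norm gauss (weak_dbar j (weak_dbar k v)))\<^sup>2)) UNIV"
    by simp
  moreover have neg: "((\<lambda>i. - (real CARD('n) * (norm (hcoef p i))\<^sup>2)) has_sum - (real CARD('n) * (L2_norm gauss p)\<^sup>2)) UNIV"
    using has_sum_cmult_right[OF Hermite.Parseval_norm[OF pL2], of "real CARD('n)"]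
    by (simp add: has_sum_uminus)
  moreover have "((\<lambda>i. level i * (norm (hcoef w i))\<^sup>2 + - (real CARD('n) * (norm (hcoef p i))\<^sup>2)) has_sum
      (\<Sum>j\<in>UNIV. (L2_norm gauss (weak_dbar j w))\<^sup>2) + - (real CARD('n) * (L2_norm gauss p)\<^sup>2)) UNIV"
    by (intro has_sum_add w_sum neg)
  ultimately have "(\<Sum>k\<in>UNIV. \<Sum>j\<in>UNIV. (L2_norm gauss (weak_dbar j (weak_dbar k v)))\<^sup>2)
      = (\<Sum>j\<in>UNIV. (L2_norm gauss (weak_dbar j w))\<^sup>2) - real CARD('n) * (L2_norm gauss p)\<^sup>2"
    using has_sum_unique by fastforce
  then show "(\<Sum>j\<in>UNIV. \<Sum>k\<in>UNIV. (L2_norm gauss (weak_dbar j (weak_dbar k v)))\<^sup>2)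
      = (\<Sum>j\<in>UNIV. (L2_norm gauss (weak_dbar j w))\<^sup>2) - real CARD('n) * (L2_norm gauss p)\<^sup>2"
    by (subst sum.swap)
qed

section \<open>Invariance of the Gaussian measure under linear isometries\<close>

text \<open>
  The image \<open>\<nu>\<close> of Lebesgue measure \<open>\<lambda>\<close> under an isometry is translation invariant. Computing
  \<open>\<integral>\<integral> 1\<^sub>A (x) 1\<^sub>B (y - x) d\<nu> d\<lambda>\<close> in two ways for a ball \<open>B\<close> around \<open>0\<close> gives \<open>\<nu> A * \<lambda> B = \<lambda> A * \<nu> B\<close>, and
  \<open>\<nu> B = \<lambda> B\<close> because the isometry preserves the ball.
\<close>

lemma lborel_distr_isometry:
  fixes T :: "'a::euclidean_space \<Rightarrow> 'a"
  assumes lin: "linear T" and iso: "\<And>x. norm (T x) = norm x"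
  shows "distr lborel borel T = lborel"
proof -
  define \<nu> where "\<nu> = distr lborel borel T"
  have T_cont: "continuous_on UNIV T"
    using lin by (simp add: linear_continuous_on linear_conv_bounded_linear)
  then have [measurable]: "T \<in> borel_measurable borel"
    by (rule borel_measurable_continuous_onI)
  have sets [simp, measurable_cong]: "sets \<nu> = sets borel" and space [simp]: "space \<nu> = UNIV"
    by (simp_all add: \<nu>_def)
  have "inj T"
    using linear_injective_0[OF lin] iso by (metis norm_eq_zero)
  then have "surj T"
    by (rule linear_injective_imp_surjective[OF lin _ refl])
  have shift_image: "(\<integral>\<^sup>+x. F (x + c) \<partial>\<nu>) = (\<integral>\<^sup>+x. F x \<partial>\<nu>)"
    if [measurable]: "F \<in> borel_measurable borel" for F :: "'a \<Rightarrow> ennreal" and c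
  proof -
    obtain d where d: "c = T d"
      using \<open>surj T\<close> by (metis surjD)
    have "(\<integral>\<^sup>+x. F (x + c) \<partial>\<nu>) = (\<integral>\<^sup>+x. F (T (d + x)) \<partial>lborel)"
      unfolding \<nu>_def by (subst nn_integral_distr) (auto simp: d linear_add[OF lin] add.commute)
    also have "\<dots> = (\<integral>\<^sup>+x. F (T x) \<partial>distr lborel borel ((+) d))"
      by (subst nn_integral_distr) auto
    also have "\<dots> = (\<integral>\<^sup>+x. F x \<partial>\<nu>)"
      unfolding \<nu>_def lborel_distr_plus by (subst nn_integral_distr) auto
    finally show ?thesis .
  qed
  have shift_leb: "(\<integral>\<^sup>+x. F (c + x) \<partial>lborel) = (\<integral>\<^sup>+x. F x \<partial>lborel)"
    if [measurable]: "F \<in> borel_measurable borel" for F :: "'a \<Rightarrow> ennreal" and c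
  proof -
    have "(\<integral>\<^sup>+x. F (c + x) \<partial>lborel) = (\<integral>\<^sup>+x. F x \<partial>distr lborel borel ((+) c))"
      by (subst nn_integral_distr) auto
    then show ?thesis
      by (simp add: lborel_distr_plus)
  qed
  have ball: "emeasure \<nu> (ball 0 r) = emeasure lborel (ball (0 :: 'a) r)" for r
  proof -
    have "T -` ball 0 r = ball 0 r"
      using iso by (auto simp: dist_norm)
    then show ?thesis
      by (simp add: \<nu>_def emeasure_distr)
  qed
  interpret \<nu>: sigma_finite_measure \<nu>
  proof
    show "\<exists>A. countable A \<and> A \<subseteq> sets \<nu> \<and> \<Union> A = space \<nu> \<and> (\<forall>a\<in>A. emeasure \<nu> a \<noteq> \<infinity>)"
    proof (intro exI conjI ballI)
      show "\<Union> (range (\<lambda>k::nat. ball (0 :: 'a) (real k))) = space \<nu>"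
        using reals_Archimedean2 by auto
      show "emeasure \<nu> a \<noteq> \<infinity>" if "a \<in> range (\<lambda>k::nat. ball (0 :: 'a) (real k))" for a
        using that emeasure_lborel_ball_finite by (auto simp: ball less_top)
    qed auto
  qed
  interpret pair: pair_sigma_finite \<nu> lborel ..
  have "emeasure \<nu> A = emeasure lborel A" if A [measurable]: "A \<in> sets borel" for A
  proof -
    define B where "B = ball (0 :: 'a) 1"
    have [measurable]: "B \<in> sets borel"
      by (simp add: B_def)
    have "emeasure \<nu> A * emeasure lborel B = (\<integral>\<^sup>+x. indicator A x * emeasure lborel B \<partial>\<nu>)"
      by (simp add: nn_integral_multc)
    also have "\<dots> = (\<integral>\<^sup>+x. (\<integral>\<^sup>+y. indicator A x * indicator B (y - x) \<partial>lborel) \<partial>\<nu>)"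
    proof (rule nn_integral_cong)
      fix x
      have "(\<integral>\<^sup>+y. indicator B (- x + y) \<partial>lborel) = (\<integral>\<^sup>+y. indicator B y \<partial>lborel)"
        by (rule shift_leb) simp
      then show "indicator A x * emeasure lborel B = (\<integral>\<^sup>+y. indicator A x * indicator B (y - x) \<partial>lborel)"
        by (simp add: nn_integral_cmult)
    qed
    also have "\<dots> = (\<integral>\<^sup>+y. (\<integral>\<^sup>+x. indicator A x * indicator B (y - x) \<partial>\<nu>) \<partial>lborel)"
      by (rule pair.Fubini'[symmetric]) measurable
    also have "\<dots> = (\<integral>\<^sup>+y. (\<integral>\<^sup>+x. indicator A (x + y) * indicator B (y - (x + y)) \<partial>\<nu>) \<partial>lborel)"
      by (rule nn_integral_cong, rule shift_image[symmetric]) measurable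
    also have "\<dots> = (\<integral>\<^sup>+y. (\<integral>\<^sup>+x. indicator A (x + y) * indicator B x \<partial>\<nu>) \<partial>lborel)"
      by (simp add: B_def indicator_def)
    also have "\<dots> = (\<integral>\<^sup>+x. (\<integral>\<^sup>+y. indicator A (x + y) * indicator B x \<partial>lborel) \<partial>\<nu>)"
      by (rule pair.Fubini') measurable
    also have "\<dots> = (\<integral>\<^sup>+x. emeasure lborel A * indicator B x \<partial>\<nu>)"
    proof (rule nn_integral_cong)
      fix x
      have "(\<integral>\<^sup>+y. indicator A (x + y) \<partial>lborel) = (\<integral>\<^sup>+y. indicator A y \<partial>lborel)"
        by (rule shift_leb) simp
      then show "(\<integral>\<^sup>+y. indicator A (x + y) * indicator B x \<partial>lborel) = emeasure lborel A * indicator B x"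
        by (simp add: nn_integral_multc)
    qed
    also have "\<dots> = emeasure lborel A * emeasure lborel B"
      by (simp add: nn_integral_cmult ball[of 1, folded B_def])
    finally have "emeasure \<nu> A * emeasure lborel B = emeasure lborel A * emeasure lborel B" .
    moreover have "emeasure lborel B \<noteq> \<infinity>" "emeasure lborel B \<noteq> 0"
      using emeasure_lborel_ball_finite[of "0 :: 'a" 1] content_ball_pos[of 1 "0 :: 'a"]
      by (auto simp: B_def measure_def less_top)
    ultimately show ?thesis
      by (simp add: mult.commute[of _ "emeasure lborel B"] ennreal_mult_cancel_left)
  qed
  then show ?thesis
    unfolding \<nu>_def[symmetric] by (intro measure_eqI) auto
qed

lemma integral_gauss_isometry:
  fixes T :: "complex^'n::finite \<Rightarrow> complex^'n" and f :: "complex^'n \<Rightarrow> complex"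
  assumes lin: "linear T" and iso: "\<And>x. norm (T x) = norm x" and [measurable]: "f \<in> borel_measurable borel"
  shows "(\<integral>z. f (T z) \<partial>gauss) = (\<integral>z. f z \<partial>gauss)"
proof -
  have "continuous_on UNIV T"
    using lin by (simp add: linear_continuous_on linear_conv_bounded_linear)
  then have [measurable]: "T \<in> borel_measurable borel"
    by (rule borel_measurable_continuous_onI)
  have "(\<integral>z. f (T z) \<partial>gauss) = (\<integral>z. gdens (T z) *\<^sub>R f (T z) \<partial>lborel)"
    by (subst integral_gauss) (simp_all add: iso)
  also have "\<dots> = (\<integral>z. gdens z *\<^sub>R f z \<partial>distr lborel borel T)"
    by (subst integral_distr) auto
  also have "\<dots> = (\<integral>z. f z \<partial>gauss)"
    by (subst integral_gauss) (simp_all add: lborel_distr_isometry[OF lin iso])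
  finally show ?thesis .
qed

text \<open>Rotations preserve the integral, and a suitable one changes the sign of \<open>F\<close>.\<close>

lemma integral_gauss_rotation_eq_0:
  fixes F :: "complex^'n::finite \<Rightarrow> complex"
  assumes F: "F \<in> borel_measurable borel"
    and rot: "\<And>c z. norm c = 1 \<Longrightarrow> F (c *s z) = c ^ a * cnj c ^ b * F z" and ab: "a \<noteq> b"
  shows "(\<integral>z. F z \<partial>gauss) = 0"
proof -
  \<comment> \<open>The rotation for which the character takes the value \<open>- 1\<close>.\<close>
  define t where "t = pi / (real a - real b)"
  define c where "c = cis t"
  have "c ^ a = cis (real a * t)" "cnj c ^ b = cis (real b * - t)"
    unfolding c_def cis_cnj by (rule Complex.DeMoivre)+
  then have "c ^ a * cnj c ^ b = cis (real a * t + real b * - t)"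
    by (simp only: cis_mult)
  also have "real a * t + real b * - t = (real a - real b) * t"
    by (simp add: algebra_simps)
  also have "(real a - real b) * t = pi"
    using ab by (simp add: t_def)
  finally have c: "c ^ a * cnj c ^ b = - 1"
    by simp
  have "(\<integral>z. F (c *s z) \<partial>gauss) = (\<integral>z. F z \<partial>gauss)"
  proof (rule integral_gauss_isometry[OF _ _ F])
    show "linear ((*s) c)"
      by (auto simp: linear_iff vec_eq_iff algebra_simps)
    show "norm (c *s z) = norm z" for z :: "complex^'n"
      unfolding norm_vec_def by (simp add: norm_mult c_def)
  qed
  moreover have "F (c *s z) = - F z" for z
    using rot[of c z] c by (simp add: c_def)
  ultimately show ?thesis
    by (simp add: eq_neg_iff_add_eq_0 flip: mult_2)
qed

lemma hbasis_rotation: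
  fixes z :: "complex^'n::finite"
  assumes "snd i = (\<lambda>_. 0)"
  shows "hbasis i (c *s z) = c ^ (\<Sum>j\<in>UNIV. fst i j) * hbasis i z"
  unfolding hbasis_def Herm_def assms herm_left_0
  by (simp add: power_mult_distrib prod.distrib power_sum mult_ac)

section \<open>The Vandermonde determinant\<close>

abbreviation pairs :: "('n::{finite,linorder} \<times> 'n) set" where
  "pairs \<equiv> {(j, k). j < k}"

lemma vandermonde_eq: "vandermonde z = (\<Prod>p\<in>pairs. z $ snd p - z $ fst p)"
  by (simp add: vandermonde_def case_prod_unfold)

lemma slow_growth_vandermonde: "slow_growth (vandermonde :: complex^'n::{finite,linorder} \<Rightarrow> complex)"
  unfolding vandermonde_eq[abs_def] by (intro slow_growth_prod slow_growth_diff slow_growth_coord)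

lemma entire_vandermonde: "entire (vandermonde :: complex^'n::{finite,linorder} \<Rightarrow> complex)"
  unfolding vandermonde_eq[abs_def] by (intro entire_prod entire_diff entire_coord)

lemma Ck_on_vandermonde: "Ck_on k UNIV (vandermonde :: complex^'n::{finite,linorder} \<Rightarrow> complex)"
proof -
  have "Ck_on k UNIV (\<lambda>z::(complex, 'n) vec. z $ i + - 1 * z $ j)" for i j
    by (intro Ck_on_add Ck_on_mult Ck_on_const Ck_on_bounded_linear bounded_linear_vec_nth)
  then have "Ck_on k UNIV (\<lambda>z::(complex, 'n) vec. z $ i - z $ j)" for i j
    by simp
  then show ?thesis
    unfolding vandermonde_eq[abs_def] by (intro Ck_on_prod)
qed

lemma vandermonde_measurable [measurable]: "vandermonde \<in> borel_measurable borel"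
  by (rule slow_growth_measurable[OF slow_growth_vandermonde])

lemma vandermonde_fock: "vandermonde \<in> fock_space"
  by (simp add: fock_space_def entire_vandermonde slow_growth_L2[OF slow_growth_vandermonde])

lemma vandermonde_rotation: "vandermonde (c *s z) = c ^ card (pairs :: ('n \<times> 'n) set) * vandermonde (z :: complex^'n::{finite,linorder})"
proof -
  have "vandermonde (c *s z) = (\<Prod>p\<in>pairs. c * (z $ snd p - z $ fst p))"
    by (simp add: vandermonde_eq right_diff_distrib)
  then show ?thesis
    by (simp add: prod.distrib vandermonde_eq)
qed

lemma vandermonde_eq_0_iff: "vandermonde z = 0 \<longleftrightarrow> z \<notin> distinct_coords"
proof -
  have "vandermonde z = 0 \<longleftrightarrow> (\<exists>j k. j < k \<and> z $ k = z $ j)"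
    by (auto simp: vandermonde_eq prod_zero_iff)
  also have "\<dots> \<longleftrightarrow> z \<notin> distinct_coords"
  proof
    assume "z \<notin> distinct_coords"
    then obtain j k where "j \<noteq> k" "z $ j = z $ k"
      by (auto simp: distinct_coords_def)
    then show "\<exists>j k. j < k \<and> z $ k = z $ j"
      by (metis neq_iff)
  next
    assume "\<exists>j k. j < k \<and> z $ k = z $ j"
    then obtain j k where "j < k" "z $ k = z $ j"
      by blast
    then have "j \<noteq> k" "z $ j = z $ k"
      by auto
    then show "z \<notin> distinct_coords"
      unfolding distinct_coords_def by blast
  qed
  finally show ?thesis .
qed

lemma AE_vandermonde: "AE z in gauss. vandermonde (z :: complex^'n::{finite,linorder}) \<noteq> 0"
proof -
  have ne: "AE z in lborel. (z :: (complex, 'n) vec) $ j \<noteq> z $ k" if "j \<noteq> k" for j k :: 'n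
  proof -
    \<comment> \<open>The coordinates differ already in their real parts, off a real hyperplane.\<close>
    define a :: "(complex, 'n) vec" where "a = axis j 1 - axis k 1"
    have "a $ j = 1"
      using that by (simp add: a_def axis_def)
    then have "a \<noteq> 0"
      by auto
    have "closed {x. a \<bullet> x = 0}"
      by (rule closed_hyperplane)
    then have "{x. a \<bullet> x = 0} \<in> null_sets lborel"
      using negligible_hyperplane[of a 0] \<open>a \<noteq> 0\<close>
      by (subst null_sets_completion_iff[symmetric]) (auto simp: negligible_iff_null_sets)
    then have "AE x in lborel. a \<bullet> x \<noteq> 0"
      using AE_not_in by fastforce
    then show ?thesis
    proof eventually_elim
      case (elim z)
      have "a \<bullet> z = Re (z $ j) - Re (z $ k)"
        by (simp add: a_def inner_diff_left inner_commute[of "axis _ _"] inner_axis_complex)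
      with elim show ?case by auto
    qed
  qed
  have "AE z in lborel. \<forall>p\<in>(pairs :: ('n \<times> 'n) set). (z :: (complex, 'n) vec) $ snd p \<noteq> z $ fst p"
  proof (rule AE_finite_allI)
    fix p :: "'n \<times> 'n"
    assume "p \<in> pairs"
    then have "snd p \<noteq> fst p"
      by auto
    then show "AE z in lborel. (z :: (complex, 'n) vec) $ snd p \<noteq> z $ fst p"
      by (rule ne)
  qed simp
  then have "AE z in lborel. vandermonde (z :: (complex, 'n) vec) \<noteq> 0"
    by eventually_elim (simp add: vandermonde_eq)
  then show ?thesis
    by (simp add: AE_gauss)
qed

lemma norm_const_eq: "norm_const TYPE('n) = (L2_norm gauss (vandermonde :: complex^'n::{finite,linorder} \<Rightarrow> complex))\<^sup>2"
  by (simp add: norm_const_def L2_norm_square)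

lemma norm_const_pos: "norm_const TYPE('n::{finite,linorder}) > 0"
proof -
  have "norm_const TYPE('n) \<noteq> 0"
  proof
    assume "norm_const TYPE('n) = 0"
    then have "AE z in gauss. vandermonde (z :: (complex, 'n) vec) = 0"
      unfolding norm_const_eq by (rule L2_norm_square_eq_0[OF slow_growth_L2[OF slow_growth_vandermonde]])
    with AE_vandermonde have "AE z in gauss :: ((complex, 'n) vec) measure. False"
      by eventually_elim simp
    then have "AE z in lborel :: ((complex, 'n) vec) measure. False"
      by (simp only: AE_gauss)
    then show False
      by (simp add: AE_iff_measurable[of UNIV lborel])
  qed
  moreover have "norm_const TYPE('n) \<ge> 0"
    by (simp add: norm_const_eq)
  ultimately show ?thesis by simp
qed

subsection \<open>Permutations of the coordinates\<close>

abbreviation permute :: "('n \<Rightarrow> 'n) \<Rightarrow> complex^'n::finite \<Rightarrow> (complex, 'n) vec" where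
  "permute \<sigma> z \<equiv> (\<chi> i. z $ \<sigma> i)"

lemma integral_gauss_permute:
  fixes f :: "complex^'n::finite \<Rightarrow> complex"
  assumes \<sigma>: "bij \<sigma>" and f: "f \<in> borel_measurable borel"
  shows "(\<integral>z. f (permute \<sigma> z) \<partial>gauss) = (\<integral>z. f z \<partial>gauss)"
proof (rule integral_gauss_isometry[OF _ _ f])
  show "linear (permute \<sigma>)"
    by (auto simp: linear_iff vec_eq_iff)
  show "norm (permute \<sigma> z) = norm z" for z :: "(complex, 'n) vec"
    unfolding norm_vec_def L2_set_def
    using sum.reindex_bij_betw[OF \<sigma>, of "\<lambda>i. (norm (z $ i))\<^sup>2"] by simp
qed

text \<open>A permutation of the coordinates permutes the unordered pairs, and reverses some of them.\<close>

lemma vandermonde_permute: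
  assumes \<sigma>: "bij (\<sigma> :: 'n::{finite,linorder} \<Rightarrow> 'n)"
  shows "\<exists>s. (s = 1 \<or> s = - 1) \<and> (\<forall>z. vandermonde (permute \<sigma> z) = s * vandermonde z)"
proof -
  define \<tau> where "\<tau> p = (if \<sigma> (fst p) < \<sigma> (snd p) then (\<sigma> (fst p), \<sigma> (snd p)) else (\<sigma> (snd p), \<sigma> (fst p)))" for p
  define s :: "'n \<times> 'n \<Rightarrow> complex" where "s p = (if \<sigma> (fst p) < \<sigma> (snd p) then 1 else - 1)" for p
  have inj: "\<sigma> x = \<sigma> y \<longleftrightarrow> x = y" for x y
    using bij_is_inj[OF \<sigma>] by (simp add: inj_eq)
  have maps: "\<tau> ` pairs \<subseteq> pairs"
    using inj by (auto simp: \<tau>_def neq_iff) (metis inj less_irrefl neq_iff)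
  have injt: "inj_on \<tau> pairs"
    by (rule inj_onI) (auto simp: \<tau>_def inj split: if_splits)
  have "\<tau> ` pairs = pairs"
    by (rule card_subset_eq[OF _ maps card_image[OF injt]]) simp
  then have bij: "bij_betw \<tau> pairs pairs"
    using injt by (simp add: bij_betw_def)
  have "vandermonde (permute \<sigma> z) = (\<Prod>p\<in>pairs. s p) * vandermonde z" for z
  proof -
    have "vandermonde (permute \<sigma> z) = (\<Prod>p\<in>pairs. s p * (z $ snd (\<tau> p) - z $ fst (\<tau> p)))"
      unfolding vandermonde_eq by (rule prod.cong) (auto simp: s_def \<tau>_def)
    also have "\<dots> = (\<Prod>p\<in>pairs. s p) * (\<Prod>p\<in>pairs. z $ snd (\<tau> p) - z $ fst (\<tau> p))"
      by (rule prod.distrib)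
    also have "(\<Prod>p\<in>pairs. z $ snd (\<tau> p) - z $ fst (\<tau> p)) = vandermonde z"
      unfolding vandermonde_eq by (rule prod.reindex_bij_betw[OF bij])
    finally show ?thesis .
  qed
  moreover have "(\<Prod>p\<in>P. s p) = 1 \<or> (\<Prod>p\<in>P. s p) = - 1" for P
    by (induction P rule: infinite_finite_induct) (auto simp: s_def)
  ultimately show ?thesis by blast
qed

text \<open>
  For a transposition of \<open>a\<close> and \<open>b\<close> the sign is negative: divide by \<open>z\<^sub>b - z\<^sub>a\<close> and let \<open>z\<^sub>b\<close> tend to \<open>z\<^sub>a\<close>. The
  remaining product \<open>Q\<close> has a nonzero limit, which is fixed by the transposition.
\<close>

lemma vandermonde_transpose:
  fixes a b :: "'n::{finite,linorder}"
  assumes ab: "a \<noteq> b"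
  shows "vandermonde (permute (Transposition.transpose a b) z) = - vandermonde z"
proof -
  have wlog: "vandermonde (permute (Transposition.transpose a b) z) = - vandermonde z" if ab: "a < b" for a b :: 'n and z
  proof -
    let ?\<tau> = "Transposition.transpose a b"
    obtain s where s: "s = 1 \<or> s = - 1" "\<And>z. vandermonde (permute ?\<tau> z) = s * vandermonde z"
      using vandermonde_permute[of ?\<tau>] by auto
    define Q where "Q z = (\<Prod>p\<in>pairs - {(a, b)}. z $ snd p - z $ fst p)" for z :: "(complex, 'n) vec"
    have V: "vandermonde z = (z $ b - z $ a) * Q z" for z
      unfolding vandermonde_eq Q_def using ab by (subst prod.remove[of pairs "(a, b)"]) auto
    obtain f :: "'n \<Rightarrow> nat" where f: "inj f"
      using finite_imp_inj_to_nat_seg[of "UNIV :: 'n set"] by auto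
    define y :: "complex \<Rightarrow> (complex, 'n) vec" where
      "y t = (\<chi> i. if i = a then 0 else if i = b then t else of_nat (Suc (f i)))" for t
    have contQ: "continuous_on UNIV Q"
      unfolding Q_def by (intro continuous_intros)
    have conty: "continuous_on UNIV y" "continuous_on UNIV (\<lambda>t. permute ?\<tau> (y t))"
    proof -
      have "continuous_on UNIV (\<lambda>t. y t $ i)" for i
        by (cases "i = a"; cases "i = b") (simp_all add: y_def)
      then have "continuous_on UNIV (\<lambda>t. \<chi> i. y t $ i)" "continuous_on UNIV (\<lambda>t. permute ?\<tau> (y t))"
        by (rule continuous_on_vec_lambda)+
      then show "continuous_on UNIV y" "continuous_on UNIV (\<lambda>t. permute ?\<tau> (y t))"
        by simp_all
    qed
    have cont: "continuous_on UNIV (\<lambda>t. Q (permute ?\<tau> (y t)) + s * Q (y t))"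
      using conty contQ by (auto intro!: continuous_intros continuous_on_compose2[OF contQ])
    have "Q (permute ?\<tau> (y t)) + s * Q (y t) = 0" if "t \<noteq> 0" for t
    proof -
      have y: "y t $ a = 0" "y t $ b = t"
        using ab by (auto simp: y_def)
      then have "permute ?\<tau> (y t) $ a = t" "permute ?\<tau> (y t) $ b = 0"
        by simp_all
      then have "(0 - t) * Q (permute ?\<tau> (y t)) = s * ((t - 0) * Q (y t))"
        using s(2)[of "y t"] unfolding V y by (simp only:)
      then have "s * (t * Q (y t)) = - (t * Q (permute ?\<tau> (y t)))"
        by simp
      then have "t * (Q (permute ?\<tau> (y t)) + s * Q (y t)) = 0"
        by (simp add: distrib_left mult.left_commute)
      then show ?thesis using that by simp
    qed
    then have "((\<lambda>t. Q (permute ?\<tau> (y t)) + s * Q (y t)) \<longlongrightarrow> 0) (at 0)"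
      by (intro tendsto_eventually) (auto simp: eventually_at_filter)
    moreover have "((\<lambda>t. Q (permute ?\<tau> (y t)) + s * Q (y t)) \<longlongrightarrow> Q (permute ?\<tau> (y 0)) + s * Q (y 0)) (at 0)"
      using cont by (simp add: continuous_on_def)
    ultimately have "Q (permute ?\<tau> (y 0)) + s * Q (y 0) = 0"
      using tendsto_unique trivial_limit_at by blast
    moreover have "permute ?\<tau> (y 0) = y 0"
      by (auto simp: y_def vec_eq_iff Transposition.transpose_def)
    ultimately have "(1 + s) * Q (y 0) = 0"
      by (simp add: ring_distribs)
    moreover have "Q (y 0) \<noteq> 0"
      unfolding Q_def using f ab by (auto simp: y_def prod_zero_iff inj_eq simp del: of_nat_Suc split: if_splits)
    ultimately have "s = - 1"
      using s(1) by auto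
    with s(2) show ?thesis by simp
  qed
  show ?thesis
    using wlog[of a b z] wlog[of b a z] ab by (cases "a < b") (auto simp: transpose_commute)
qed

text \<open>
  The sign character is read off from the Vandermonde determinant itself, so that no independent notion of
  the sign of a permutation enters.
\<close>

definition alternating :: "(complex^'n::{finite,linorder} \<Rightarrow> complex) \<Rightarrow> bool" where
  "alternating u \<longleftrightarrow> u \<in> L2 gauss \<and> (\<forall>\<sigma> s. bij \<sigma> \<longrightarrow> (\<forall>z. vandermonde (permute \<sigma> z) = s * vandermonde z)
     \<longrightarrow> (\<forall>z. u (permute \<sigma> z) = s * u z))"

lemma alternating_vandermonde: "alternating vandermonde"
  using fock_space_L2[OF vandermonde_fock] by (simp add: alternating_def)

lemma mfact_permute:
  fixes \<sigma> :: "'n::finite \<Rightarrow> 'n"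
  shows "bij \<sigma> \<Longrightarrow> mfact (a \<circ> \<sigma>) = mfact a"
  unfolding mfact_def by (simp add: prod.reindex_bij_betw[where h = \<sigma> and g = "\<lambda>j. real CARD('n) ^ a j * fact (a j)"])

lemma hbasis_permute:
  fixes z :: "complex^'n::finite"
  assumes \<sigma>: "bij \<sigma>"
  shows "hbasis (a \<circ> \<sigma>, b \<circ> \<sigma>) (permute \<sigma> z) = hbasis (a, b) z"
  unfolding hbasis_def Herm_def fst_conv snd_conv mfact_permute[OF \<sigma>]
  by (simp add: prod.reindex_bij_betw[OF \<sigma>, where g = "\<lambda>j. herm (real CARD('n)) (a j) (b j) (z $ j)"])

lemma hcoef_permute:
  fixes u :: "complex^'n::{finite,linorder} \<Rightarrow> complex"
  assumes u: "alternating u" and \<sigma>: "bij \<sigma>" and s: "\<And>z. vandermonde (permute \<sigma> z) = s * vandermonde z"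
  shows "hcoef u (a \<circ> \<sigma>, b \<circ> \<sigma>) = s * hcoef u (a, b)"
proof -
  have m: "(\<lambda>z. u z * cnj (hbasis i z)) \<in> borel_measurable borel" for i
    using u L2_measurable[of u gauss] slow_growth_measurable[OF slow_growth_cnj[OF slow_growth_hbasis[of i]]]
    by (auto simp: alternating_def)
  have "hcoef u (a \<circ> \<sigma>, b \<circ> \<sigma>) = (\<integral>z. u (permute \<sigma> z) * cnj (hbasis (a \<circ> \<sigma>, b \<circ> \<sigma>) (permute \<sigma> z)) \<partial>gauss)"
    unfolding L2_inner_def by (rule integral_gauss_permute[OF \<sigma> m, symmetric])
  also have "\<dots> = (\<integral>z. s * (u z * cnj (hbasis (a, b) z)) \<partial>gauss)"
  proof -
    have "u (permute \<sigma> z) = s * u z" for z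
      using u \<sigma> s unfolding alternating_def by blast
    then show ?thesis
      unfolding hbasis_permute[OF \<sigma>] by (simp add: mult.assoc)
  qed
  finally show ?thesis
    by (simp add: L2_inner_def)
qed

text \<open>Exchanging two equal exponents fixes the coefficient and changes its sign.\<close>

lemma hcoef_repeated:
  fixes u :: "complex^'n::{finite,linorder} \<Rightarrow> complex"
  assumes u: "alternating u" and a: "\<not> inj a"
  shows "hcoef u (a, \<lambda>_. 0) = 0"
proof -
  obtain j k where jk: "j \<noteq> k" "a j = a k"
    using a by (auto simp: inj_def)
  let ?\<tau> = "Transposition.transpose j k"
  have "a \<circ> ?\<tau> = a"
    using jk by (auto simp: fun_eq_iff Transposition.transpose_def)
  then have "hcoef u (a, \<lambda>_. 0) = - 1 * hcoef u (a, \<lambda>_. 0)"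
    using hcoef_permute[OF u, of ?\<tau> "- 1" a "\<lambda>_. 0"] vandermonde_transpose[OF jk(1)]
    by (simp add: comp_def)
  then show ?thesis
    by simp
qed

subsection \<open>Exponents of minimal degree\<close>

lemma card_ordered_pairs:
  fixes r :: "'n::finite \<Rightarrow> 'b::linorder"
  assumes "inj r"
  shows "2 * card {(j, k). r j < r k} = card {(j, k :: 'n). j \<noteq> k}"
proof -
  have "{(j, k). j \<noteq> k} = {(j, k). r j < r k} \<union> {(j, k). r k < r j}"
    using assms by (auto simp: inj_eq neq_iff) (metis assms inj_eq neq_iff)
  then have "card {(j, k :: 'n). j \<noteq> k} = card {(j, k). r j < r k} + card {(j, k). r k < r j}"
    by (simp, intro card_Un_disjoint) auto
  also have "card {(j, k). r k < r j} = card (prod.swap ` {(j, k). r j < r k})"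
    by (rule arg_cong[of _ _ card]) force
  also have "\<dots> = card {(j, k). r j < r k}"
    by (rule card_image) (auto intro: inj_onI)
  finally show ?thesis by simp
qed

text \<open>
  Distinct exponents satisfy \<open>a k \<ge> card {j. a j < a k}\<close>. Summing over \<open>k\<close> counts every pair once, so
  the degree is at least that of the Vandermonde determinant, with equality only for permutations of
  \<open>0, \<dots>, n - 1\<close>.
\<close>

lemma sum_exponents:
  fixes a :: "'n::{finite,linorder} \<Rightarrow> nat"
  assumes inj: "inj a"
  shows "card (pairs :: ('n \<times> 'n) set) \<le> (\<Sum>k\<in>UNIV. a k)"
    and "(\<Sum>k\<in>UNIV. a k) = card (pairs :: ('n \<times> 'n) set) \<Longrightarrow> a k < CARD('n)"
proof -
  define rk where "rk k = card {j. a j < a k}" for k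
  have rk_le: "rk k \<le> a k" for k
  proof -
    have "rk k = card (a ` {j. a j < a k})"
      unfolding rk_def using inj by (intro card_image[symmetric] inj_on_subset[OF inj]) auto
    also have "\<dots> \<le> card {..<a k}"
      by (rule card_mono) auto
    finally show ?thesis by simp
  qed
  have "(\<Sum>k\<in>UNIV. rk k) = card (SIGMA k:UNIV. {j. a j < a k})"
    unfolding rk_def by (subst card_SigmaI) auto
  also have "(SIGMA k:UNIV. {j. a j < a k}) = prod.swap ` {(j, k). a j < a k}"
    by force
  also have "card \<dots> = card {(j, k). a j < a k}"
    by (rule card_image) (auto intro: inj_onI)
  also have "\<dots> = card (pairs :: ('n \<times> 'n) set)"
    using card_ordered_pairs[OF inj] card_ordered_pairs[of "\<lambda>x::'n. x"] by simp
  finally have sum: "(\<Sum>k\<in>UNIV. rk k) = card (pairs :: ('n \<times> 'n) set)" .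
  show "card (pairs :: ('n \<times> 'n) set) \<le> (\<Sum>k\<in>UNIV. a k)"
    unfolding sum[symmetric] by (rule sum_mono[OF rk_le])
  assume eq: "(\<Sum>k\<in>UNIV. a k) = card (pairs :: ('n \<times> 'n) set)"
  have "a k = rk k"
  proof (rule ccontr)
    assume "a k \<noteq> rk k"
    then have "rk k < a k"
      using rk_le[of k] by simp
    then have "(\<Sum>k\<in>UNIV. rk k) < (\<Sum>k\<in>UNIV. a k)"
      by (intro sum_strict_mono_ex1) (auto simp: rk_le)
    then show False
      using eq sum by simp
  qed
  also have "rk k < CARD('n)"
    unfolding rk_def by (rule psubset_card_mono) auto
  finally show "a k < CARD('n)" .
qed

definition minimal_exponents :: "('n::finite \<Rightarrow> nat) set" where
  "minimal_exponents = {a. inj a \<and> (\<forall>k. a k < CARD('n))}"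

lemma finite_minimal_exponents: "finite (minimal_exponents :: ('n::finite \<Rightarrow> nat) set)"
proof (rule finite_subset)
  show "minimal_exponents \<subseteq> (\<Pi>\<^sub>E k\<in>(UNIV :: 'n set). {..<CARD('n)})"
    by (auto simp: minimal_exponents_def)
qed (auto intro: finite_PiE)

lemma minimal_exponents_permute:
  fixes a b :: "'n::finite \<Rightarrow> nat"
  assumes a: "a \<in> minimal_exponents" and b: "b \<in> minimal_exponents"
  obtains \<sigma> where "bij \<sigma>" "a = b \<circ> \<sigma>"
proof -
  have range: "range c = {..<CARD('n)}" and inj: "inj c" if "c \<in> minimal_exponents" for c :: "'n \<Rightarrow> nat"
  proof -
    show inj: "inj c"
      using that by (simp add: minimal_exponents_def)
    have "range c \<subseteq> {..<CARD('n)}"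
      using that by (auto simp: minimal_exponents_def)
    then show "range c = {..<CARD('n)}"
      by (intro card_subset_eq) (simp_all add: card_image[OF inj])
  qed
  define \<sigma> where "\<sigma> k = inv b (a k)" for k
  have b\<sigma>: "b (\<sigma> k) = a k" for k
    unfolding \<sigma>_def using range[OF a] range[OF b] by (intro f_inv_into_f) auto
  have "inj \<sigma>"
    by (rule injI) (metis b\<sigma> inj[OF a] injD)
  then have "bij \<sigma>"
    by (simp add: bij_def finite_UNIV_inj_surj)
  with b\<sigma> show ?thesis
    by (intro that[of \<sigma>]) auto
qed

text \<open>
  The determinant is holomorphic, alternating, and homogeneous of degree \<open>card pairs\<close>. These properties exclude
  nonzero \<open>b\<close>, repeated exponents, and all other degrees, respectively.
\<close>

lemma vandermonde_hcoef_eq_0: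
  fixes i :: "('n::{finite,linorder} \<Rightarrow> nat) \<times> ('n \<Rightarrow> nat)"
  assumes "\<not> (snd i = (\<lambda>_. 0) \<and> fst i \<in> minimal_exponents)"
  shows "hcoef vandermonde i = 0"
proof (cases "snd i = (\<lambda>_. 0)")
  case False
  then show ?thesis
    by (rule fock_space_hcoef[OF vandermonde_fock])
next
  case True
  then have i: "i = (fst i, \<lambda>_. 0)"
    by (simp add: prod_eq_iff)
  show ?thesis
  proof (cases "inj (fst i)")
    case False
    then show ?thesis
      using hcoef_repeated[OF alternating_vandermonde] i by metis
  next
    case True
    have deg: "(\<Sum>k\<in>UNIV. fst i k) \<noteq> card (pairs :: ('n \<times> 'n) set)"
      using assms True \<open>snd i = _\<close> sum_exponents(2)[OF True] by (auto simp: minimal_exponents_def)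
    show ?thesis
      unfolding L2_inner_def
    proof (rule integral_gauss_rotation_eq_0[OF _ _ deg[symmetric]])
      show "(\<lambda>z. vandermonde z * cnj (hbasis i z)) \<in> borel_measurable borel"
        by (intro slow_growth_measurable slow_growth_mult slow_growth_vandermonde slow_growth_cnj slow_growth_hbasis)
    qed (simp add: vandermonde_rotation hbasis_rotation[OF \<open>snd i = _\<close>])
  qed
qed

text \<open>
  The minimal exponents are permutations of each other, and the two signs cancel in \<open>u\<^sub>a cnj V\<^sub>a\<close>, so all terms
  of the expansion are equal.
\<close>

lemma alternating_inner_vandermonde:
  fixes u :: "complex^'n::{finite,linorder} \<Rightarrow> complex"
  assumes u: "alternating u" and a: "a \<in> minimal_exponents"
  shows "L2_inner gauss u vandermonde
     = of_nat (card (minimal_exponents :: ('n \<Rightarrow> nat) set)) * (hcoef u (a, \<lambda>_. 0) * cnj (hcoef vandermonde (a, \<lambda>_. 0)))"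
proof -
  let ?t = "\<lambda>i. hcoef u i * cnj (hcoef (vandermonde :: (complex, 'n) vec \<Rightarrow> complex) i)"
  let ?I = "(\<lambda>b. (b, \<lambda>_. 0)) ` (minimal_exponents :: ('n \<Rightarrow> nat) set)"
  have uL2: "u \<in> L2 gauss"
    using u by (simp add: alternating_def)
  have "(?t has_sum L2_inner gauss u vandermonde) UNIV"
    by (rule Hermite.Parseval[OF uL2 fock_space_L2[OF vandermonde_fock]])
  moreover have "(?t has_sum (\<Sum>i\<in>?I. ?t i)) UNIV"
  proof (rule has_sum_cong_neutral[THEN iffD1, OF _ _ _ has_sum_finite])
    show "finite ?I"
      by (intro finite_imageI finite_minimal_exponents)
    show "?t i = 0" if "i \<in> UNIV - ?I" for i
    proof -
      have "\<not> (snd i = (\<lambda>_. 0) \<and> fst i \<in> minimal_exponents)"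
        using that by (auto simp: image_iff prod_eq_iff)
      then show ?thesis
        using vandermonde_hcoef_eq_0[of i] by simp
    qed
  qed auto
  ultimately have "L2_inner gauss u vandermonde = (\<Sum>i\<in>?I. ?t i)"
    by (rule has_sum_unique)
  also have "\<dots> = (\<Sum>b\<in>minimal_exponents. ?t (b, \<lambda>_. 0))"
    by (subst sum.reindex) (auto intro: inj_onI)
  also have "\<dots> = (\<Sum>b\<in>(minimal_exponents :: ('n \<Rightarrow> nat) set). ?t (a, \<lambda>_. 0))"
  proof (rule sum.cong[OF refl])
    fix b :: "'n \<Rightarrow> nat"
    assume "b \<in> minimal_exponents"
    then obtain \<sigma> where \<sigma>: "bij \<sigma>" "b = a \<circ> \<sigma>"
      using minimal_exponents_permute[OF _ a] by metis
    obtain s where s: "s = 1 \<or> s = - 1" "\<And>z. vandermonde (permute \<sigma> z) = s * vandermonde z"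
      using vandermonde_permute[OF \<sigma>(1)] by auto
    have eq: "hcoef u' (b, \<lambda>_. 0) = s * hcoef u' (a, \<lambda>_. 0)" if "alternating u'" for u'
      using hcoef_permute[OF that \<sigma>(1) s(2), of a "\<lambda>_. 0"] by (simp add: \<sigma>(2) comp_def)
    then show "?t (b, \<lambda>_. 0) = ?t (a, \<lambda>_. 0)"
      unfolding eq[OF u] eq[OF alternating_vandermonde] using s(1) by auto
  qed
  finally show ?thesis
    by simp
qed

text \<open>
  Repeated exponents have coefficient zero, distinct ones have at least the degree of the determinant, and
  in the lowest degree a nonzero coefficient would be seen by the inner product with \<open>V\<close>.
\<close>

lemma hcoef_low_degree:
  fixes u :: "complex^'n::{finite,linorder} \<Rightarrow> complex"
  assumes u: "alternating u" and orth: "L2_inner gauss u vandermonde = 0"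
    and nz: "hcoef u (a, \<lambda>_. 0) \<noteq> 0"
  shows "card (pairs :: ('n \<times> 'n) set) < (\<Sum>k\<in>UNIV. a k)"
proof -
  have inj: "inj a"
    using hcoef_repeated[OF u] nz by blast
  have "(\<Sum>k\<in>UNIV. a k) \<noteq> card (pairs :: ('n \<times> 'n) set)"
  proof
    assume "(\<Sum>k\<in>UNIV. a k) = card (pairs :: ('n \<times> 'n) set)"
    then have a: "a \<in> minimal_exponents"
      using inj sum_exponents(2)[OF inj] by (auto simp: minimal_exponents_def)
    have "L2_inner gauss vandermonde (vandermonde :: (complex, 'n) vec \<Rightarrow> complex) \<noteq> 0"
      using norm_const_pos[where 'n = 'n] unfolding L2_inner_self norm_const_eq by simp
    then have "hcoef (vandermonde :: (complex, 'n) vec \<Rightarrow> complex) (a, \<lambda>_. 0) \<noteq> 0"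
      "card (minimal_exponents :: ('n \<Rightarrow> nat) set) \<noteq> 0"
      unfolding alternating_inner_vandermonde[OF alternating_vandermonde a] by auto
    then show False
      using orth nz unfolding alternating_inner_vandermonde[OF u a] by simp
  qed
  then show ?thesis
    using sum_exponents(1)[OF inj] by simp
qed

text \<open>
  Up to a constant this is the integral of \<open>h\<^sup>2 = (g / V)\<^sup>2\<close> against \<open>\<bar>V\<bar>\<^sup>2\<close>. After expansion of both factors \<open>g\<close>,
  every term has degree larger than that of \<open>V\<^sup>2\<close>, so the rotations annihilate its integral.
\<close>

lemma integral_fock_square:
  fixes g :: "complex^'n::{finite,linorder} \<Rightarrow> complex"
  assumes g: "g \<in> L2 gauss" and supp: "\<And>i. hcoef g i \<noteq> 0 \<Longrightarrow>
      snd i = (\<lambda>_. 0) \<and> card (pairs :: ('n \<times> 'n) set) < (\<Sum>k\<in>UNIV. fst i k)"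
  shows "(\<integral>z. g z * (g z * (cnj (vandermonde z) / vandermonde z)) \<partial>gauss) = 0"
proof -
  \<comment> \<open>The image of complex conjugation under \<open>U\<close>.\<close>
  define twist where "twist f z = cnj (f z) * (vandermonde z / cnj (vandermonde z))" for f and z :: "(complex, 'n) vec"
  have twist_L2: "twist f \<in> L2 gauss" if f: "f \<in> L2 gauss" for f
  proof (rule L2_bound[OF _ L2_integrable_square[OF f]])
    have "f \<in> borel_measurable borel"
      using L2_measurable[OF f] by simp
    then show "twist f \<in> borel_measurable gauss"
      unfolding twist_def
      by (auto intro!: borel_measurable_times borel_measurable_divide measurable_compose[OF _ borel_measurable_cnj])
    have "norm (vandermonde z / cnj (vandermonde z)) \<le> 1" for z :: "(complex, 'n) vec"
      by (simp add: norm_divide)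
    then have "norm (twist f z) \<le> norm (f z)" for z
      unfolding twist_def norm_mult complex_mod_cnj by (intro mult_left_le) auto
    then show "AE z in gauss. (norm (twist f z))\<^sup>2 \<le> (norm (f z))\<^sup>2"
      by (auto intro!: power_mono)
  qed
  have inner_twist: "L2_inner gauss f (twist f') = (\<integral>z. f z * (f' z * (cnj (vandermonde z) / vandermonde z)) \<partial>gauss)" for f f'
    by (simp add: L2_inner_def twist_def)
  then have swap: "L2_inner gauss f (twist f') = L2_inner gauss f' (twist f)" for f f'
    by (simp add: mult_ac)
  have zero_sum: "S = 0" if "(f has_sum S) UNIV" "\<And>i. f i = 0" for f :: "('n \<Rightarrow> nat) \<times> ('n \<Rightarrow> nat) \<Rightarrow> complex" and S
    using that has_sum_unique[OF that(1), of 0] has_sum_0[of UNIV f] by simp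
  have basis: "L2_inner gauss (hbasis i) (twist (hbasis k)) = 0" if i: "hcoef g i \<noteq> 0" and k: "hcoef g k \<noteq> 0" for i k
  proof -
    let ?d = "card (pairs :: ('n \<times> 'n) set)"
    let ?m = "(\<Sum>l\<in>UNIV. fst i l) + (\<Sum>l\<in>UNIV. fst k l)"
    show ?thesis
      unfolding inner_twist
    proof (rule integral_gauss_rotation_eq_0)
      show "?m \<noteq> 2 * ?d"
        using supp[OF i] supp[OF k] by simp
      show "(\<lambda>z. hbasis i z * (hbasis k z * (cnj (vandermonde z) / vandermonde z))) \<in> borel_measurable borel"
        using slow_growth_measurable[OF slow_growth_hbasis[of i]] slow_growth_measurable[OF slow_growth_hbasis[of k]]
        by (auto intro!: borel_measurable_times borel_measurable_divide measurable_compose[OF _ borel_measurable_cnj])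
      fix c :: complex and z :: "(complex, 'n) vec"
      assume c: "norm c = 1"
      then have "c * cnj c = 1"
        by (simp flip: complex_norm_square)
      then have "c \<noteq> 0"
        by auto
      with \<open>c * cnj c = 1\<close> have inv: "1 / c = cnj c" "c \<noteq> 0"
        by (simp_all add: divide_eq_eq mult.commute)
      have "cnj (vandermonde (c *s z)) / vandermonde (c *s z) = (cnj c ^ ?d * (1 / c) ^ ?d) * (cnj (vandermonde z) / vandermonde z)"
        using inv(2) by (simp add: vandermonde_rotation power_one_over)
      also have "cnj c ^ ?d * (1 / c) ^ ?d = cnj c ^ (2 * ?d)"
        unfolding inv(1) by (simp add: mult_2 power_add)
      finally show "hbasis i (c *s z) * (hbasis k (c *s z) * (cnj (vandermonde (c *s z)) / vandermonde (c *s z)))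
          = c ^ ?m * cnj c ^ (2 * ?d) * (hbasis i z * (hbasis k z * (cnj (vandermonde z) / vandermonde z)))"
        using supp[OF i] supp[OF k] by (simp add: hbasis_rotation power_add mult_ac)
    qed
  qed
  have step: "L2_inner gauss (hbasis i) (twist g) = 0" if i: "hcoef g i \<noteq> 0" for i
  proof -
    have "((\<lambda>k. hcoef g k * cnj (hcoef (twist (hbasis i)) k)) has_sum L2_inner gauss g (twist (hbasis i))) UNIV"
      by (intro Hermite.Parseval g twist_L2 Hermite.basis_L2)
    moreover have "hcoef g k * cnj (hcoef (twist (hbasis i)) k) = 0" for k
      using basis[OF _ i, of k] by (simp flip: L2_inner_commute) blast
    ultimately show ?thesis
      unfolding swap[of "hbasis i" g] by (rule zero_sum)
  qed
  have "((\<lambda>i. hcoef g i * cnj (hcoef (twist g) i)) has_sum L2_inner gauss g (twist g)) UNIV"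
    by (intro Hermite.Parseval g twist_L2)
  moreover have "hcoef g i * cnj (hcoef (twist g) i) = 0" for i
    using step[of i] by (simp flip: L2_inner_commute) blast
  ultimately have "L2_inner gauss g (twist g) = 0"
    by (rule zero_sum)
  then show ?thesis
    by (simp only: inner_twist)
qed

section \<open>The Ginibre ensemble\<close>

abbreviation vdens :: "complex^'n::{finite,linorder} \<Rightarrow> real" where
  "vdens z \<equiv> (norm (vandermonde z))\<^sup>2 / norm_const TYPE('n)"

lemma sets_ginibre [simp, measurable_cong]: "sets ginibre = sets borel"
  and space_ginibre [simp]: "space ginibre = UNIV"
  by (simp_all add: ginibre_def)

lemma measurable_ginibre [simp]: "borel_measurable ginibre = borel_measurable borel"
  by (rule measurable_cong_sets) simp_all

lemma vdens_nonneg: "vdens (z :: complex^'n::{finite,linorder}) \<ge> 0"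
  using norm_const_pos[where 'n = 'n] by simp

lemma integral_ginibre:
  fixes f :: "complex^'n::{finite,linorder} \<Rightarrow> 'b::{banach, second_countable_topology}"
  assumes [measurable]: "f \<in> borel_measurable borel"
  shows "(\<integral>z. f z \<partial>ginibre) = (\<integral>z. vdens z *\<^sub>R f z \<partial>gauss)"
  unfolding ginibre_def by (subst integral_density) (auto simp: less_imp_le[OF norm_const_pos])

lemma integrable_ginibre:
  fixes f :: "complex^'n::{finite,linorder} \<Rightarrow> 'b::{banach, second_countable_topology}"
  assumes [measurable]: "f \<in> borel_measurable borel"
  shows "integrable ginibre f \<longleftrightarrow> integrable gauss (\<lambda>z. vdens z *\<^sub>R f z)"
  unfolding ginibre_def by (subst integrable_density) (auto simp: less_imp_le[OF norm_const_pos])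

lemma integrable_vdens: "integrable gauss (\<lambda>z. vdens (z :: complex^'n::{finite,linorder}))"
  using L2_integrable_square[OF slow_growth_L2[OF slow_growth_vandermonde[where 'n = 'n]]] by simp

lemma integral_vdens: "(\<integral>z. vdens (z :: complex^'n::{finite,linorder}) \<partial>gauss) = 1"
proof -
  have "(\<integral>z. vdens (z :: (complex, 'n) vec) \<partial>gauss) = (\<integral>z. (norm (vandermonde (z :: (complex, 'n) vec)))\<^sup>2 \<partial>gauss) / norm_const TYPE('n)"
    by (rule integral_divide_zero)
  also have "\<dots> = norm_const TYPE('n) / norm_const TYPE('n)"
    by (simp only: norm_const_def)
  finally show ?thesis
    using norm_const_pos[where 'n = 'n] by simp
qed

lemma finite_measure_ginibre: "finite_measure (ginibre :: (complex^'n::{finite,linorder}) measure)"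
proof (rule finite_measureI)
  have "emeasure (ginibre :: ((complex, 'n) vec) measure) UNIV = (\<integral>\<^sup>+z. ennreal (vdens (z :: (complex, 'n) vec)) \<partial>gauss)"
    unfolding ginibre_def by (subst emeasure_density) auto
  also have "\<dots> = ennreal (\<integral>z. vdens (z :: (complex, 'n) vec) \<partial>gauss)"
    by (rule nn_integral_eq_integral[OF integrable_vdens]) (simp add: vdens_nonneg)
  finally show "emeasure (ginibre :: ((complex, 'n) vec) measure) (space ginibre) \<noteq> \<infinity>"
    by (simp add: integral_vdens)
qed

lemma integrable_ginibre_bounded:
  fixes g :: "complex^'n::{finite,linorder} \<Rightarrow> real"
  assumes "continuous_on UNIV g" "\<And>z. \<bar>g z\<bar> \<le> B"
  shows "integrable ginibre g"
  by (rule finite_measure.integrable_const_bound[OF finite_measure_ginibre, of _ B])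
     (use assms in \<open>auto intro: borel_measurable_continuous_onI\<close>)

lemma integral_ginibre_1: "(\<integral>z. 1 \<partial>(ginibre :: (complex^'n::{finite,linorder}) measure)) = (1 :: real)"
  by (subst integral_ginibre, simp) (simp only: real_scaleR_def mult_1_right integral_vdens)

section \<open>Compactly supported functions and the generator\<close>

lemma Ck_on_extend:
  fixes f :: "'a::euclidean_space \<Rightarrow> 'b::real_normed_vector"
  assumes S: "open S" and K: "closed K" "K \<subseteq> S"
  shows "Ck_on k S f \<Longrightarrow> (\<And>x. x \<notin> K \<Longrightarrow> f x = 0) \<Longrightarrow> Ck_on k UNIV f"
proof (induction k arbitrary: f)
  case 0
  have "continuous_on (- K) f"
    by (rule continuous_on_eq[OF continuous_on_const[of _ 0]]) (use 0 in auto)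
  then have "continuous_on (S \<union> - K) f"
    using 0 S K by (intro continuous_on_open_Un) auto
  moreover have "S \<union> - K = UNIV"
    using K by auto
  ultimately show ?case by simp
next
  case (Suc k)
  have off: "(f has_derivative (\<lambda>v. 0)) (at x)" if "x \<notin> K" for x
    by (rule has_derivative_transform_within_open[of "\<lambda>x. 0" _ _ _ "- K"])
       (use that Suc.prems K in auto)
  have "f differentiable (at x)" for x
  proof (cases "x \<in> K")
    case True
    then have "x \<in> S" using K by auto
    then show ?thesis
      using Suc.prems S by (auto simp: differentiable_on_eq_differentiable_at)
  next
    case False
    then show ?thesis
      using off by (auto simp: differentiable_def)
  qed
  moreover have "Ck_on k UNIV (\<lambda>x. frechet_derivative f (at x) v)" for v
  proof (rule Suc.IH)
    show "Ck_on k S (\<lambda>x. frechet_derivative f (at x) v)"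
      using Suc.prems by auto
    show "frechet_derivative f (at x) v = 0" if "x \<notin> K" for x
      using fun_cong[OF frechet_derivative_at[OF off[OF that]], of v] by simp
  qed
  ultimately show ?case
    by (auto simp: differentiable_on_def intro: differentiable_at_withinI)
qed

lemma integrable_compact_support:
  fixes g :: "'a::euclidean_space \<Rightarrow> 'b::{banach, second_countable_topology}"
  assumes g: "continuous_on UNIV g" and K: "compact K" "\<And>x. x \<notin> K \<Longrightarrow> g x = 0"
  shows "integrable lborel g"
proof -
  have "integrable lborel (\<lambda>x. indicator K x *\<^sub>R g x)"
    by (rule borel_integrable_compact[OF K(1) continuous_on_subset[OF g]]) simp
  moreover have "(\<lambda>x. indicator K x *\<^sub>R g x) = g"
    using K(2) by (auto simp: indicator_def)
  ultimately show ?thesis by simp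
qed

lemma bounded_compact_support:
  fixes g :: "'a::euclidean_space \<Rightarrow> real"
  assumes g: "continuous_on UNIV g" and K: "compact K" "\<And>x. x \<notin> K \<Longrightarrow> g x = 0"
  shows "\<exists>B. \<forall>x. \<bar>g x\<bar> \<le> B"
proof -
  have "bounded (g ` K)"
    by (intro compact_imp_bounded compact_continuous_image continuous_on_subset[OF g] K) auto
  then obtain B where B: "\<And>x. x \<in> K \<Longrightarrow> \<bar>g x\<bar> \<le> B"
    by (auto simp: bounded_iff)
  have "\<bar>g x\<bar> \<le> max B 0" for x
    using B[of x] K(2)[of x] by (cases "x \<in> K") auto
  then show ?thesis by blast
qed

lemma open_distinct_coords: "open (distinct_coords :: (complex^'n::{finite,linorder}) set)"
proof -
  have "distinct_coords = {z :: (complex, 'n) vec. vandermonde z \<noteq> 0}"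
    using vandermonde_eq_0_iff by blast
  also have "open \<dots>"
    by (intro open_Collect_neq slow_growth_continuous slow_growth_vandermonde continuous_on_const)
  finally show ?thesis .
qed

definition potential_deriv :: "complex^'n::{finite,linorder} \<Rightarrow> (complex, 'n) vec \<Rightarrow> real" where
  "potential_deriv z v = real CARD('n) * (\<Sum>j\<in>UNIV. 2 * (z $ j \<bullet> v $ j))
     - 2 * (\<Sum>p\<in>pairs. ((z $ fst p - z $ snd p) \<bullet> (v $ fst p - v $ snd p)) / (norm (z $ fst p - z $ snd p))\<^sup>2)"

lemma potential_eq:
  "potential (z :: complex^'n::{finite,linorder}) = real CARD('n) * (\<Sum>j\<in>UNIV. (norm (z $ j))\<^sup>2)
     - 2 * (\<Sum>p\<in>pairs. ln (norm (z $ fst p - z $ snd p)))"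
  by (simp add: potential_def case_prod_unfold)

lemma potential_has_derivative:
  fixes z :: "complex^'n::{finite,linorder}"
  assumes z: "z \<in> distinct_coords"
  shows "(potential has_derivative potential_deriv z) (at z)"
proof -
  have ne: "z $ fst p - z $ snd p \<noteq> 0" if "p \<in> pairs" for p
    using z that by (auto simp: distinct_coords_def)
  have coord: "((\<lambda>z. z $ j) has_derivative (\<lambda>v. v $ j)) (at z)" for j
    by (intro bounded_linear_imp_has_derivative bounded_linear_vec_nth)
  have sq: "((\<lambda>z. (norm (z $ j))\<^sup>2) has_derivative (\<lambda>v. 2 * (z $ j \<bullet> v $ j))) (at z)" for j
  proof -
    have "((\<lambda>z. z $ j \<bullet> z $ j) has_derivative (\<lambda>v. z $ j \<bullet> v $ j + v $ j \<bullet> z $ j)) (at z)"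
      by (intro has_derivative_inner coord)
    then show ?thesis
      by (simp add: power2_norm_eq_inner inner_commute)
  qed
  have ln: "((\<lambda>z. ln (norm (z $ fst p - z $ snd p))) has_derivative
      (\<lambda>v. ((z $ fst p - z $ snd p) \<bullet> (v $ fst p - v $ snd p)) / (norm (z $ fst p - z $ snd p))\<^sup>2)) (at z)"
    if p: "p \<in> pairs" for p
  proof -
    let ?x = "z $ fst p - z $ snd p"
    have norm: "((\<lambda>z. norm (z $ fst p - z $ snd p)) has_derivative (\<lambda>v. (v $ fst p - v $ snd p) \<bullet> sgn ?x)) (at z)"
      by (rule has_derivative_compose[OF has_derivative_diff[OF coord coord] has_derivative_norm[OF ne[OF p]]])
    have "(ln has_derivative (\<lambda>h. 1 / norm ?x * h)) (at (norm ?x))"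
      using DERIV_ln_divide[of "norm ?x"] ne[OF p] unfolding has_field_derivative_def zero_less_norm_iff .
    from has_derivative_compose[OF norm this]
    have "((\<lambda>z. ln (norm (z $ fst p - z $ snd p))) has_derivative (\<lambda>v. 1 / norm ?x * ((v $ fst p - v $ snd p) \<bullet> sgn ?x))) (at z)" .
    moreover have "1 / norm ?x * (v \<bullet> sgn ?x) = (?x \<bullet> v) / (norm ?x)\<^sup>2" for v
      by (simp add: sgn_div_norm power2_eq_square inner_commute divide_inverse)
    ultimately show ?thesis by simp
  qed
  have "((\<lambda>z. real CARD('n) * (\<Sum>j\<in>UNIV. (norm (z $ j))\<^sup>2) - 2 * (\<Sum>p\<in>pairs. ln (norm (z $ fst p - z $ snd p))))
      has_derivative potential_deriv z) (at z)"
    unfolding potential_deriv_def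
    by (intro has_derivative_diff has_derivative_mult_right has_derivative_sum sq ln)
  then show ?thesis
    by (simp add: potential_eq[abs_def])
qed

lemma continuous_on_potential_deriv:
  "continuous_on (distinct_coords :: (complex^'n::{finite,linorder}) set) (\<lambda>z. potential_deriv z v)"
  unfolding potential_deriv_def
  by (intro continuous_intros) (auto simp: distinct_coords_def)

text \<open>The Lebesgue density of the ensemble.\<close>

definition gindens :: "complex^'n::{finite,linorder} \<Rightarrow> real" where
  "gindens z = gdens z * vdens z"

lemma gindens_eq_exp_potential:
  fixes z :: "complex^'n::{finite,linorder}"
  assumes z: "z \<in> distinct_coords"
  shows "gindens z = (real CARD('n) / pi) ^ CARD('n) / norm_const TYPE('n) * exp (- potential z)"
proof -
  have ne: "norm (z $ fst p - z $ snd p) > 0" if "p \<in> pairs" for p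
    using z that by (auto simp: distinct_coords_def)
  have "exp (- potential z) = exp (- real CARD('n) * (norm z)\<^sup>2) * exp (\<Sum>p\<in>pairs. 2 * ln (norm (z $ fst p - z $ snd p)))"
    unfolding potential_eq
    by (simp add: power2_norm_eq_inner inner_vec_def sum_distrib_left sum_negf flip: exp_add)
  also have "exp (\<Sum>p\<in>pairs. 2 * ln (norm (z $ fst p - z $ snd p))) = (\<Prod>p\<in>pairs. (norm (z $ fst p - z $ snd p))\<^sup>2)"
    unfolding exp_sum[OF finite]
  proof (rule prod.cong[OF refl])
    fix p :: "'n \<times> 'n"
    assume p: "p \<in> pairs"
    have "exp (2 * ln (norm (z $ fst p - z $ snd p))) = exp (ln (norm (z $ fst p - z $ snd p))) ^ 2"
      by (simp add: exp_double)
    then show "exp (2 * ln (norm (z $ fst p - z $ snd p))) = (norm (z $ fst p - z $ snd p))\<^sup>2"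
      using ne[OF p] by simp
  qed
  also have "\<dots> = (norm (vandermonde z))\<^sup>2"
    by (simp add: vandermonde_eq prod_norm[symmetric] prod_power_distrib norm_minus_commute)
  finally show ?thesis
    by (simp add: gindens_def)
qed

lemma continuous_on_gindens: "continuous_on UNIV (gindens :: complex^'n::{finite,linorder} \<Rightarrow> real)"
  unfolding gindens_def
  using slow_growth_continuous[OF slow_growth_vandermonde] norm_const_pos[where 'n = 'n]
  by (intro continuous_intros) auto

lemma integral_ginibre_lborel:
  fixes g :: "complex^'n::{finite,linorder} \<Rightarrow> real"
  assumes [measurable]: "g \<in> borel_measurable borel"
  shows "(\<integral>z. g z \<partial>ginibre) = (\<integral>z. gindens z * g z \<partial>lborel)"
  by (simp add: integral_ginibre integral_gauss gindens_def mult.assoc)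

lemma sum_Basis_complex_vec:
  fixes F :: "complex^'n::finite \<Rightarrow> 'b::comm_monoid_add"
  shows "(\<Sum>b\<in>Basis. F b) = (\<Sum>j\<in>UNIV. F (axis j 1) + F (axis j \<i>))"
proof -
  have Basis: "(Basis :: ((complex, 'n) vec) set) = (\<lambda>(j, u). axis j u) ` (UNIV \<times> {1, \<i>})"
    by (auto simp: Basis_vec_def Basis_complex_def)
  have inj: "inj_on (\<lambda>(j, u). axis j u :: (complex, 'n) vec) (UNIV \<times> {1, \<i>})"
    by (auto simp: inj_on_def axis_eq_axis)
  have "(\<Sum>b\<in>Basis. F b) = (\<Sum>(j, u)\<in>UNIV \<times> {1, \<i>}. F (axis j u))"
    unfolding Basis by (subst sum.reindex[OF inj]) (simp add: case_prod_unfold)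
  also have "\<dots> = (\<Sum>j\<in>UNIV. \<Sum>u\<in>{1, \<i>}. F (axis j u))"
    by (rule sum.cartesian_product[symmetric])
  finally show ?thesis
    by (simp add: complex_eq_iff)
qed

lemma grad_norm_square: "(norm (grad f x))\<^sup>2 = (\<Sum>b\<in>Basis. (frechet_derivative f (at x) b)\<^sup>2)"
proof -
  have "(norm (grad f x))\<^sup>2 = (\<Sum>b\<in>Basis. (grad f x \<bullet> b) * (grad f x \<bullet> b))"
    unfolding power2_norm_eq_inner by (rule euclidean_inner)
  also have "\<dots> = (\<Sum>b\<in>Basis. (frechet_derivative f (at x) b)\<^sup>2)"
    by (rule sum.cong) (auto simp: grad_def power2_eq_square)
  finally show ?thesis .
qed

lemma grad_inner: "grad f x \<bullet> grad g x = (\<Sum>b\<in>Basis. frechet_derivative f (at x) b * frechet_derivative g (at x) b)"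
  by (subst euclidean_inner, rule sum.cong) (auto simp: grad_def)

context
  fixes f :: "complex^'n::{finite,linorder} \<Rightarrow> real"
    and K :: "(complex, 'n) vec set" and m :: real
  assumes f_smooth: "\<And>k. Ck_on k UNIV f"
    and K: "compact K" "K \<subseteq> distinct_coords" and f_supp: "\<And>z. z \<notin> K \<Longrightarrow> f z = 0"
begin

lemma supported_deriv: "(f has_derivative frechet_derivative f (at z)) (at z)"
  by (rule Ck_on_Suc_D(1)[OF f_smooth[of "Suc 0"]])

lemma supported_deriv2:
  "((\<lambda>x. frechet_derivative f (at x) v) has_derivative frechet_derivative (\<lambda>x. frechet_derivative f (at x) v) (at z)) (at z)"
  by (rule Ck_on_Suc_D(1)[OF Ck_on_Suc_D(2)[OF f_smooth[of "Suc (Suc 0)"]]])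

lemma supported_deriv_eq_0: "z \<notin> K \<Longrightarrow> frechet_derivative f (at z) v = 0"
proof -
  assume z: "z \<notin> K"
  have "(f has_derivative (\<lambda>v. 0)) (at z)"
    by (rule has_derivative_transform_within_open[of "\<lambda>x. 0" _ _ _ "- K"])
       (use z f_supp compact_imp_closed[OF K(1)] in auto)
  from fun_cong[OF frechet_derivative_at[OF this], of v] show ?thesis by simp
qed

lemma supported_deriv2_eq_0: "z \<notin> K \<Longrightarrow> frechet_derivative (\<lambda>x. frechet_derivative f (at x) v) (at z) u = 0"
proof -
  assume z: "z \<notin> K"
  have "((\<lambda>x. frechet_derivative f (at x) v) has_derivative (\<lambda>v. 0)) (at z)"
    by (rule has_derivative_transform_within_open[of "\<lambda>x. 0" _ _ _ "- K"])
       (use z supported_deriv_eq_0 compact_imp_closed[OF K(1)] in auto)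
  from fun_cong[OF frechet_derivative_at[OF this], of u] show ?thesis by simp
qed

lemma supported_continuous:
  "continuous_on A f" "continuous_on A (\<lambda>z. frechet_derivative f (at z) v)"
  "continuous_on A (\<lambda>z. frechet_derivative (\<lambda>x. frechet_derivative f (at x) v) (at z) u)"
  using Ck_on_continuous[OF f_smooth[of 0]] Ck_on_continuous[OF Ck_on_Suc_D(2)[OF f_smooth[of "Suc 0"]]]
    Ck_on_continuous[OF Ck_on_Suc_D(2)[OF Ck_on_Suc_D(2)[OF f_smooth[of "Suc (Suc 0)"]]]]
  by (auto intro: continuous_on_subset)

lemma continuous_extend_by_zero: "continuous_on distinct_coords g \<Longrightarrow> (\<And>z. z \<notin> K \<Longrightarrow> g z = 0) \<Longrightarrow> continuous_on UNIV g"
  for g :: "(complex, 'n) vec \<Rightarrow> real"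
  using Ck_on_extend[OF open_distinct_coords compact_imp_closed[OF K(1)] K(2), of 0 g] by simp

lemma generator_eq:
  "real CARD('n) * generator f z
     = (\<Sum>b\<in>Basis. frechet_derivative (\<lambda>y. frechet_derivative f (at y) b) (at z) b
           - potential_deriv z b * frechet_derivative f (at z) b)"
proof -
  have "frechet_derivative potential (at z) b * frechet_derivative f (at z) b
      = potential_deriv z b * frechet_derivative f (at z) b" for b
  proof (cases "z \<in> K")
    case True
    then have "z \<in> distinct_coords" using K by auto
    from frechet_derivative_at[OF potential_has_derivative[OF this]] show ?thesis
      by simp
  qed (simp add: supported_deriv_eq_0)
  then have "grad potential z \<bullet> grad f z = (\<Sum>b\<in>Basis. potential_deriv z b * frechet_derivative f (at z) b)"
    unfolding grad_inner by (intro sum.cong refl)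
  then show ?thesis
    by (simp add: generator_def laplacian_def sum_subtractf)
qed

lemma generator_continuous: "continuous_on UNIV (generator f)"
proof (rule continuous_extend_by_zero)
  have "generator f = (\<lambda>z. (\<Sum>b\<in>Basis. frechet_derivative (\<lambda>y. frechet_derivative f (at y) b) (at z) b
           - potential_deriv z b * frechet_derivative f (at z) b) / real CARD('n))"
    using generator_eq by (auto simp: field_simps)
  moreover have "continuous_on distinct_coords \<dots>"
    by (intro continuous_intros supported_continuous continuous_on_potential_deriv) auto
  ultimately show "continuous_on distinct_coords (generator f)"
    by simp
  show "generator f z = 0" if "z \<notin> K" for z
    using generator_eq[of z] that by (simp add: supported_deriv_eq_0 supported_deriv2_eq_0)
qed

lemma generator_supp: "z \<notin> K \<Longrightarrow> generator f z = 0"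
  using generator_eq[of z] by (simp add: supported_deriv_eq_0 supported_deriv2_eq_0)

text \<open>
  Since the density is a multiple of \<open>exp (- \<Phi>)\<close>, the divergence of \<open>(f - m) \<nabla>f exp (- \<Phi>)\<close> is
  \<open>(\<bar>\<nabla>f\<bar>\<^sup>2 + n (f - m) A f) exp (- \<Phi>)\<close>. The support of \<open>f\<close> avoids the singularities of \<open>\<Phi>\<close>.
\<close>

lemma generator_integration_by_parts:
  "(\<integral>z. (f z - m) * generator f z \<partial>ginibre) = - energy f"
proof -
  let ?n = "real CARD('n)"
  define f1 where "f1 b z = frechet_derivative f (at z) b" for b z
  define f2 where "f2 b z = frechet_derivative (\<lambda>y. frechet_derivative f (at y) b) (at z) b" for b z
  define D where "D b z = (f1 b z)\<^sup>2 * gindens z + (f z - m) * f2 b z * gindens z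
      - (f z - m) * f1 b z * potential_deriv z b * gindens z" for b z
  have off: "f1 b z = 0" "f2 b z = 0" if "z \<notin> K" for b z
    using that by (simp_all add: f1_def f2_def supported_deriv_eq_0 supported_deriv2_eq_0)
  have cont: "continuous_on A (f1 b)" "continuous_on A (f2 b)" for b A
    unfolding f1_def f2_def by (intro supported_continuous)+
  have contg: "continuous_on A gindens" for A :: "(complex, 'n) vec set"
    by (rule continuous_on_subset[OF continuous_on_gindens]) simp
  have D_cont: "continuous_on UNIV (D b)" for b
  proof (rule continuous_extend_by_zero)
    show "continuous_on distinct_coords (D b)"
      unfolding D_def by (intro continuous_intros cont contg supported_continuous continuous_on_potential_deriv)
  qed (simp add: D_def off)
  have D_supp: "D b z = 0" if "z \<notin> K" for b z
    using that by (simp add: D_def off)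
  have D_int: "integrable lborel (D b)" for b
    by (rule integrable_compact_support[OF D_cont K(1) D_supp])
  have D0: "(\<integral>z. D b z \<partial>lborel) = 0" for b
  proof -
    define \<psi> where "\<psi> z = (f z - m) * f1 b z * gindens z" for z
    have "integrable lborel \<psi>"
      by (rule integrable_compact_support[OF _ K(1)])
         (auto simp: \<psi>_def off intro!: continuous_intros cont contg supported_continuous)
    moreover have "(\<psi> has_derivative (\<lambda>v. if v = b then D b z else frechet_derivative \<psi> (at z) v)) (at z)" for z
    proof (cases "z \<in> K")
      case True
      then have z: "z \<in> distinct_coords" using K by auto
      define C where "C = (?n / pi) ^ CARD('n) / norm_const TYPE('n)"
      have exp_der: "((\<lambda>z. exp (- potential z)) has_derivative (\<lambda>v. exp (- potential z) * - potential_deriv z v)) (at z)"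
        using has_derivative_exp[OF has_derivative_minus[OF potential_has_derivative[OF z]]]
        by (simp add: mult.commute)
      have "((\<lambda>z. (f z - m) * f1 b z * (C * exp (- potential z))) has_derivative
         (\<lambda>v. (f z - m) * f1 b z * (C * (exp (- potential z) * - potential_deriv z v))
            + ((f z - m) * frechet_derivative (f1 b) (at z) v + (frechet_derivative f (at z) v - 0) * f1 b z) * (C * exp (- potential z)))) (at z)"
        unfolding f1_def
        by (intro has_derivative_mult has_derivative_mult_right has_derivative_diff has_derivative_const
              exp_der supported_deriv supported_deriv2)
      then have der: "(\<psi> has_derivative
         (\<lambda>v. (f z - m) * f1 b z * (C * (exp (- potential z) * - potential_deriv z v))
            + ((f z - m) * frechet_derivative (f1 b) (at z) v + (frechet_derivative f (at z) v - 0) * f1 b z) * (C * exp (- potential z)))) (at z)"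
        by (rule has_derivative_transform_within_open[OF _ open_distinct_coords z])
           (simp add: \<psi>_def gindens_eq_exp_potential C_def)
      have "frechet_derivative \<psi> (at z) b = D b z"
        unfolding frechet_derivative_at[OF der, symmetric]
        using gindens_eq_exp_potential[OF z, folded C_def]
        by (simp add: D_def f1_def[of b z] f1_def[of b, abs_def] f2_def power2_eq_square algebra_simps)
      then have "(\<lambda>v. if v = b then D b z else frechet_derivative \<psi> (at z) v) = frechet_derivative \<psi> (at z)"
        by auto
      then show ?thesis
        using der frechet_derivative_at[OF der] by simp
    next
      case False
      have der: "(\<psi> has_derivative (\<lambda>v. 0)) (at z)"
        by (rule has_derivative_transform_within_open[of "\<lambda>x. 0" _ _ _ "- K"])
           (use False off compact_imp_closed[OF K(1)] in \<open>auto simp: \<psi>_def\<close>)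
      then show ?thesis
        using frechet_derivative_at[OF der, symmetric] D_supp[OF False] by (simp cong: if_cong)
    qed
    then have "((\<lambda>z. complex_of_real (\<psi> z)) has_derivative
        (\<lambda>v. of_real (if v = b then D b z else frechet_derivative \<psi> (at z) v))) (at z)" for z
      by (rule has_derivative_of_real)
    from directional_derivative[OF this, where b = b]
    have "((\<lambda>t. complex_of_real (\<psi> (z + t *\<^sub>R b))) has_vector_derivative of_real (D b z)) (at 0)" for z
      by simp
    ultimately have "(\<integral>z. complex_of_real (D b z) \<partial>lborel) = 0"
      using D_int by (intro integral_directional_derivative_eq_0[of "\<lambda>z. complex_of_real (\<psi> z)"]) auto
    then show ?thesis
      by simp
  qed
  have grad_cont: "continuous_on UNIV (\<lambda>z. (norm (grad f z))\<^sup>2)"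
    unfolding grad_norm_square by (intro continuous_intros supported_continuous)
  have grad_supp: "(norm (grad f z))\<^sup>2 = 0" if "z \<notin> K" for z
    unfolding grad_norm_square using that by (simp add: supported_deriv_eq_0)
  have prod_cont: "continuous_on UNIV (\<lambda>z. (f z - m) * generator f z)"
    by (intro continuous_intros supported_continuous generator_continuous)
  have sumD: "(\<Sum>b\<in>Basis. D b z) = gindens z * (norm (grad f z))\<^sup>2 + ?n * (gindens z * ((f z - m) * generator f z))" for z
  proof -
    have "(\<Sum>b\<in>Basis. D b z) = gindens z * (\<Sum>b\<in>Basis. (f1 b z)\<^sup>2)
        + gindens z * (f z - m) * (\<Sum>b\<in>Basis. f2 b z - potential_deriv z b * f1 b z)"
      by (simp add: D_def sum_distrib_left algebra_simps flip: sum.distrib)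
    then show ?thesis
      using generator_eq[of z] by (simp add: grad_norm_square f1_def f2_def mult_ac)
  qed
  have int1: "integrable lborel (\<lambda>z. gindens z * (norm (grad f z))\<^sup>2)"
    by (rule integrable_compact_support[OF _ K(1)]) (auto intro!: continuous_on_mult contg grad_cont simp: grad_supp[unfolded power_eq_0_iff])
  have int2: "integrable lborel (\<lambda>z. gindens z * ((f z - m) * generator f z))"
    by (rule integrable_compact_support[OF _ K(1)]) (auto intro!: continuous_on_mult contg prod_cont simp: generator_supp)
  have "0 = (\<integral>z. (\<Sum>b\<in>Basis. D b z) \<partial>lborel)"
    using D_int D0 by simp
  also have "\<dots> = (\<integral>z. gindens z * (norm (grad f z))\<^sup>2 \<partial>lborel) + ?n * (\<integral>z. gindens z * ((f z - m) * generator f z) \<partial>lborel)"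
    unfolding sumD using int1 int2 by simp
  also have "\<dots> = (\<integral>z. (norm (grad f z))\<^sup>2 \<partial>ginibre) + ?n * (\<integral>z. (f z - m) * generator f z \<partial>ginibre)"
    using grad_cont prod_cont by (subst (1 2) integral_ginibre_lborel) (auto intro: borel_measurable_continuous_onI)
  finally show ?thesis
    by (simp add: energy_def field_simps)
qed

lemma frechet_derivative_shift: "frechet_derivative (\<lambda>z. f z - m) (at z) = frechet_derivative f (at z)"
  using frechet_derivative_at[OF has_derivative_diff[OF supported_deriv[of z] has_derivative_const[of m]]] by simp

lemma generator_shift: "generator (\<lambda>z. f z - m) = generator f"
  by (simp add: generator_def[abs_def] laplacian_def grad_def frechet_derivative_shift)

lemma supported_integrable:
  shows "integrable ginibre f" "integrable ginibre (\<lambda>z. (f z)\<^sup>2)" "integrable ginibre (generator f)"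
    "integrable ginibre (\<lambda>z. (generator f z)\<^sup>2)" "integrable ginibre (\<lambda>z. (f z - m) * generator f z)"
    "integrable ginibre (\<lambda>z. (f z - m)\<^sup>2)" "\<exists>B. \<forall>z. \<bar>f z - m\<bar> \<le> B"
    "\<And>v. \<exists>B. \<forall>z. \<bar>frechet_derivative f (at z) v\<bar> \<le> B"
proof -
  obtain B1 where B1: "\<And>z. \<bar>f z\<bar> \<le> B1"
    using bounded_compact_support[OF supported_continuous(1) K(1)] f_supp by metis
  obtain B2 where B2: "\<And>z. \<bar>generator f z\<bar> \<le> B2"
    using bounded_compact_support[OF generator_continuous K(1)] generator_supp by metis
  have B3: "\<bar>f z - m\<bar> \<le> B1 + \<bar>m\<bar>" for z
    using B1[of z] by linarith
  show "\<exists>B. \<forall>z. \<bar>f z - m\<bar> \<le> B"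
    using B3 by blast
  show "\<exists>B. \<forall>z. \<bar>frechet_derivative f (at z) v\<bar> \<le> B" for v
    using bounded_compact_support[OF supported_continuous(2) K(1)] supported_deriv_eq_0 by metis
  have prod: "\<bar>x * y\<bar> \<le> A * B" if "\<bar>x\<bar> \<le> A" "\<bar>y\<bar> \<le> B" for x y A B :: real
    using that by (simp add: abs_mult mult_mono' order_trans[OF abs_ge_zero])
  show "integrable ginibre f"
    by (rule integrable_ginibre_bounded[OF supported_continuous(1) B1])
  show "integrable ginibre (\<lambda>z. (f z)\<^sup>2)"
    unfolding power2_eq_square
    by (rule integrable_ginibre_bounded[OF _ prod[OF B1 B1]]) (intro continuous_intros supported_continuous)
  show "integrable ginibre (generator f)"
    by (rule integrable_ginibre_bounded[OF generator_continuous B2])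
  show "integrable ginibre (\<lambda>z. (generator f z)\<^sup>2)"
    unfolding power2_eq_square
    by (rule integrable_ginibre_bounded[OF _ prod[OF B2 B2]]) (intro continuous_intros generator_continuous)
  show "integrable ginibre (\<lambda>z. (f z - m) * generator f z)"
    by (rule integrable_ginibre_bounded[OF _ prod[OF B3 B2]]) (intro continuous_intros generator_continuous supported_continuous)
  show "integrable ginibre (\<lambda>z. (f z - m)\<^sup>2)"
    unfolding power2_eq_square
    by (rule integrable_ginibre_bounded[OF _ prod[OF B3 B3]]) (intro continuous_intros supported_continuous)
qed

end

section \<open>The unitary image of a symmetric function\<close>

lemma slow_growth_bounded:
  fixes g :: "'a::euclidean_space \<Rightarrow> complex"
  assumes g: "continuous_on UNIV g" and B: "\<And>z. norm (g z) \<le> B"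
  shows "slow_growth g"
  unfolding slow_growth_def
proof (intro conjI g allI impI exI)
  show B0: "0 \<le> B"
    using B norm_ge_zero order_trans by blast
  show "norm (g x) \<le> B * exp (d * (norm x)\<^sup>2)" if "d > 0" for d x
  proof -
    have "B * 1 \<le> B * exp (d * (norm x)\<^sup>2)"
      using B0 that by (intro mult_left_mono) auto
    then show ?thesis
      using B[of x] by simp
  qed
qed

lemma U_map_eq:
  "U_map g = (\<lambda>z. complex_of_real (1 / sqrt (norm_const TYPE('n))) * (vandermonde z * g z))"
  for g :: "complex^'n::{finite,linorder} \<Rightarrow> complex"
  by (simp add: U_map_def[abs_def] fun_eq_iff)

lemma slow_growth_U_map:
  fixes \<phi> :: "complex^'n::{finite,linorder} \<Rightarrow> real"
  assumes "continuous_on UNIV \<phi>" and "\<And>z. \<bar>\<phi> z\<bar> \<le> B"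
  shows "slow_growth (U_map (\<lambda>z. complex_of_real (\<phi> z)))"
  unfolding U_map_eq
  by (intro slow_growth_cmult slow_growth_mult slow_growth_vandermonde slow_growth_bounded[of _ B] continuous_intros)
     (use assms in auto)

text \<open>
  Since the Vandermonde determinant is holomorphic, the derivatives \<open>\<partial>bar\<^sub>j\<close> of \<open>U \<phi>\<close> only see \<open>\<phi>\<close>, and
  for real \<open>\<phi>\<close> one has \<open>4 \<bar>\<partial>bar\<^sub>j \<phi>\<bar>\<^sup>2 = (\<partial>\<^sub>x \<phi>)\<^sup>2 + (\<partial>\<^sub>y \<phi>)\<^sup>2\<close> in each coordinate. So the Dirichlet form of
  the ensemble becomes the form of \<open>\<partial>bar\<close>.
\<close>

lemma U_map_dbar_form:
  fixes \<phi> :: "complex^'n::{finite,linorder} \<Rightarrow> real"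
  assumes smooth: "\<And>k. Ck_on k UNIV \<phi>" and bdd: "\<And>z. \<bar>\<phi> z\<bar> \<le> B"
    and bdd1: "\<And>v. \<exists>B. \<forall>z. \<bar>frechet_derivative \<phi> (at z) v\<bar> \<le> B"
  defines "w \<equiv> U_map (\<lambda>z. complex_of_real (\<phi> z))"
  shows "w \<in> dbar_form_dom"
    and "(\<Sum>j\<in>UNIV. (L2_norm gauss (weak_dbar j w))\<^sup>2) = real CARD('n) * energy \<phi> / 4"
proof -
  define c where "c = complex_of_real (1 / sqrt (norm_const TYPE('n)))"
  define \<phi>1 where "\<phi>1 v z = frechet_derivative \<phi> (at z) v" for v z
  define D where "D j z = c / 2 * (vandermonde z * (of_real (\<phi>1 (axis j 1) z) + \<i> * of_real (\<phi>1 (axis j \<i>) z)))" for j z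
  have w: "w = (\<lambda>z. c * (vandermonde z * of_real (\<phi> z)))"
    by (simp add: w_def U_map_eq c_def)
  have w_L2: "w \<in> L2 gauss"
    unfolding w_def by (rule slow_growth_L2[OF slow_growth_U_map[OF Ck_on_continuous[OF smooth[of 0]] bdd]])
  have dbar: "dbar j w z = D j z" for j z
  proof -
    let ?V = "frechet_derivative (vandermonde :: (complex, 'n) vec \<Rightarrow> complex) (at z)"
    have V: "(vandermonde has_derivative ?V) (at z)"
      by (rule Ck_on_Suc_D(1)[OF Ck_on_vandermonde[of "Suc 0"]])
    have \<phi>: "((\<lambda>z. complex_of_real (\<phi> z)) has_derivative (\<lambda>v. of_real (\<phi>1 v z))) (at z)"
      unfolding \<phi>1_def by (rule has_derivative_of_real[OF Ck_on_Suc_D(1)[OF smooth[of "Suc 0"]]])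
    have "(w has_derivative (\<lambda>v. c * (vandermonde z * of_real (\<phi>1 v z) + ?V v * of_real (\<phi> z)))) (at z)"
      unfolding w by (intro has_derivative_mult_right has_derivative_mult V \<phi>)
    then have der: "frechet_derivative w (at z) = (\<lambda>v. c * (vandermonde z * of_real (\<phi>1 v z) + ?V v * of_real (\<phi> z)))"
      by (rule frechet_derivative_at[symmetric])
    have "?V (axis j 1) + \<i> * ?V (axis j \<i>) = 0"
      using entire_dbar[OF entire_vandermonde, of j z] by (simp add: dbar_def)
    then have "c * of_real (\<phi> z) * (?V (axis j 1) + \<i> * ?V (axis j \<i>)) = 0"
      by simp
    then show ?thesis
      unfolding dbar_def der D_def by (simp add: algebra_simps)
  qed
  have "Ck_on k UNIV w" for k
    unfolding w by (intro Ck_on_mult Ck_on_const Ck_on_vandermonde Ck_on_of_real smooth)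
  from loc_Lipschitz_diff_weak_dbar[OF loc_Lipschitz_diff_Ck[OF this[of "Suc 0"]]]
  have weak: "has_weak_dbar j w (D j)" for j
    using dbar by (metis ext)
  have \<phi>1_growth: "slow_growth (\<lambda>z. complex_of_real (\<phi>1 v z))" for v
  proof -
    obtain B where B: "\<And>z. \<bar>\<phi>1 v z\<bar> \<le> B"
      using bdd1[of v] by (auto simp: \<phi>1_def)
    have "continuous_on UNIV (\<phi>1 v)"
      unfolding \<phi>1_def by (rule Ck_on_continuous[OF Ck_on_Suc_D(2)[OF smooth[of "Suc 0"]]])
    then show ?thesis
      by (intro slow_growth_bounded[of _ B] continuous_intros) (use B in auto)
  qed
  have D_L2: "D j \<in> L2 gauss" for j
    unfolding D_def
    by (intro slow_growth_L2 slow_growth_cmult slow_growth_mult slow_growth_add slow_growth_vandermonde \<phi>1_growth)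
  show "w \<in> dbar_form_dom"
    using w_L2 weak D_L2 by (auto simp: dbar_form_dom_def)
  then have weak_L2: "weak_dbar j w \<in> L2 gauss" for j
    by (rule dbar_form_domD(3))
  have c2: "(norm c)\<^sup>2 = 1 / norm_const TYPE('n)"
    using norm_const_pos[where 'n = 'n] by (simp add: c_def power_divide norm_divide)
  have norm_D: "(norm (D j z))\<^sup>2 = vdens z * ((\<phi>1 (axis j 1) z)\<^sup>2 + (\<phi>1 (axis j \<i>) z)\<^sup>2) / 4" for j z
  proof -
    have "(norm (complex_of_real a + \<i> * of_real b))\<^sup>2 = a\<^sup>2 + b\<^sup>2" for a b
      by (simp add: cmod_power2)
    then show ?thesis
      by (simp add: D_def norm_mult norm_divide power_mult_distrib power_divide c2)
  qed
  have "(L2_norm gauss (weak_dbar j w))\<^sup>2 = (\<integral>z. (norm (D j z))\<^sup>2 \<partial>gauss)" for j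
    unfolding L2_norm_square
  proof (rule integral_cong_AE)
    show "AE z in gauss. (norm (weak_dbar j w z))\<^sup>2 = (norm (D j z))\<^sup>2"
      using weak_dbar(2)[OF weak[of j]] unfolding AE_gauss by eventually_elim simp
  qed (use L2_measurable[OF weak_L2] L2_measurable[OF D_L2] in measurable)
  then have "(\<Sum>j\<in>UNIV. (L2_norm gauss (weak_dbar j w))\<^sup>2) = (\<Sum>j\<in>UNIV. \<integral>z. (norm (D j z))\<^sup>2 \<partial>gauss)"
    by simp
  also have "\<dots> = (\<integral>z. (\<Sum>j\<in>UNIV. (norm (D j z))\<^sup>2) \<partial>gauss)"
    by (rule Bochner_Integration.integral_sum[symmetric]) (rule L2_integrable_square[OF D_L2])
  also have "\<dots> = (\<integral>z. vdens z *\<^sub>R ((norm (grad \<phi> z))\<^sup>2 / 4) \<partial>gauss)"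
    by (rule Bochner_Integration.integral_cong[OF refl])
       (simp add: norm_D grad_norm_square sum_Basis_complex_vec \<phi>1_def sum_distrib_left sum_divide_distrib)
  also have "\<dots> = (\<integral>z. (norm (grad \<phi> z))\<^sup>2 / 4 \<partial>ginibre)"
  proof (rule integral_ginibre[symmetric])
    have "continuous_on UNIV (\<lambda>z. (norm (grad \<phi> z))\<^sup>2 / 4)"
      unfolding grad_norm_square
      by (intro continuous_intros Ck_on_continuous[OF Ck_on_Suc_D(2)[OF smooth[of "Suc 0"]]]) auto
    then show "(\<lambda>z. (norm (grad \<phi> z))\<^sup>2 / 4) \<in> borel_measurable borel"
      by (rule borel_measurable_continuous_onI)
  qed
  finally show "(\<Sum>j\<in>UNIV. (L2_norm gauss (weak_dbar j w))\<^sup>2) = real CARD('n) * energy \<phi> / 4"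
    by (simp add: energy_def)
qed

text \<open>
  In \<open>L\<^sup>2(\<gamma>\<^sub>n)\<close> the remainder is \<open>w - P - q\<close>, where \<open>w = U \<phi>\<close>, \<open>P\<close> is the holomorphic part of \<open>w\<close> and \<open>q\<close>
  is its conjugate, multiplied by the phase of \<open>V\<^sup>2\<close>. This conjugation is an isometry, and it fixes \<open>w\<close>
  since \<open>\<phi>\<close> is real. So \<open>\<langle>w, P\<rangle> = \<parallel>P\<parallel>\<^sup>2\<close> determines all inner products except
  \<open>\<langle>P, q\<rangle> = \<integral>h\<^sup>2 d\<mu>\<^sub>n\<close>. The latter is zero: since \<open>\<phi>\<close> is symmetric with mean zero, only polynomials of larger degree
  than \<open>V\<close> occur in \<open>P\<close>.
\<close>

lemma remainder_norm:
  fixes \<phi> :: "complex^'n::{finite,linorder} \<Rightarrow> real"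
  assumes cont: "continuous_on UNIV \<phi>" and bdd: "\<And>z. \<bar>\<phi> z\<bar> \<le> B"
    and sym: "symmetric_fun \<phi>" and mean: "mean \<phi> = 0"
  defines "w \<equiv> U_map (\<lambda>z. complex_of_real (\<phi> z))"
  defines "P \<equiv> L2_proj gauss fock_space w"
  defines "r \<equiv> \<lambda>z. complex_of_real (\<phi> z) - U_inv P z - cnj (U_inv P z)"
  shows "r \<in> L2 ginibre"
    and "(L2_norm ginibre r)\<^sup>2 = (L2_norm gauss w)\<^sup>2 - 2 * (L2_norm gauss P)\<^sup>2"
    and "(L2_norm gauss w)\<^sup>2 = (\<integral>z. (\<phi> z)\<^sup>2 \<partial>ginibre)"
proof -
  let ?V = "vandermonde :: (complex, 'n) vec \<Rightarrow> complex"
  define s where "s = sqrt (norm_const TYPE('n))"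
  have s: "s > 0" "s * s = norm_const TYPE('n)"
    using norm_const_pos[where 'n = 'n] by (auto simp: s_def)
  have w: "w z = ?V z * of_real (\<phi> z) / of_real s" for z
    by (simp add: w_def U_map_def s_def)
  have w_L2: "w \<in> L2 gauss"
    unfolding w_def by (rule slow_growth_L2[OF slow_growth_U_map[OF cont bdd]])
  have P_L2: "P \<in> L2 gauss"
    unfolding P_def by (rule fock_space_L2[OF proj_fock_space(1)[OF w_L2]])
  have [measurable]: "\<phi> \<in> borel_measurable borel" "w \<in> borel_measurable borel" "P \<in> borel_measurable borel"
      "?V \<in> borel_measurable borel"
    using L2_measurable[OF w_L2] L2_measurable[OF P_L2] borel_measurable_continuous_onI[OF cont]
      slow_growth_measurable[OF slow_growth_vandermonde] by simp_all
  have V0: "AE z in gauss. ?V z \<noteq> 0"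
    by (rule AE_vandermonde)
  \<comment> \<open>The image of \<open>cnj h\<close> under \<open>U\<close>.\<close>
  define q where "q z = cnj (P z) * (?V z / cnj (?V z))" for z
  have cnj_meas [measurable]: "(\<lambda>z. cnj (g z)) \<in> borel_measurable borel"
    if "g \<in> borel_measurable borel" for g :: "(complex, 'n) vec \<Rightarrow> complex"
    using that by (rule measurable_compose[OF _ borel_measurable_cnj])
  have [measurable]: "q \<in> borel_measurable borel" "r \<in> borel_measurable borel"
    unfolding q_def r_def U_inv_def by measurable
  have norm_q: "AE z in gauss. (norm (P z))\<^sup>2 = (norm (q z))\<^sup>2"
    using V0 by eventually_elim (simp add: q_def norm_mult norm_divide)
  have q_L2: "q \<in> L2 gauss"
    by (rule L2_bound[OF _ L2_integrable_square[OF P_L2]]) (use norm_q in auto)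
  have norm_q_P: "(L2_norm gauss q)\<^sup>2 = (L2_norm gauss P)\<^sup>2"
    unfolding L2_norm_square by (rule integral_cong_AE[symmetric]) (use norm_q in auto)
  have norm_wP: "L2_inner gauss w P = of_real ((L2_norm gauss P)\<^sup>2)"
  proof -
    have "((\<lambda>i. hcoef w i * cnj (hcoef P i)) has_sum L2_inner gauss w P) UNIV"
      by (rule Hermite.Parseval[OF w_L2 P_L2])
    moreover have "((\<lambda>i. hcoef P i * cnj (hcoef P i)) has_sum L2_inner gauss P P) UNIV"
      by (rule Hermite.Parseval[OF P_L2 P_L2])
    moreover have "hcoef w i * cnj (hcoef P i) = hcoef P i * cnj (hcoef P i)" for i
      unfolding P_def proj_fock_space(2)[OF w_L2] by simp
    ultimately have "L2_inner gauss w P = L2_inner gauss P P"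
      using has_sum_unique by fastforce
    then show ?thesis
      by (simp add: L2_inner_self)
  qed
  have "L2_inner gauss w q = (\<integral>z. cnj (w z * cnj (P z)) \<partial>gauss)"
    unfolding L2_inner_def
  proof (rule integral_cong_AE)
    show "AE z in gauss. w z * cnj (q z) = cnj (w z * cnj (P z))"
      using V0 by eventually_elim (simp add: w q_def field_simps)
  qed measurable
  also have "\<dots> = cnj (L2_inner gauss w P)"
    unfolding L2_inner_def by (rule Bochner_Integration.integral_cnj)
  finally have inner_wq: "L2_inner gauss w q = of_real ((L2_norm gauss P)\<^sup>2)"
    by (simp add: norm_wP)
  have inner_Pq: "L2_inner gauss P q = 0"
  proof -
    have "L2_inner gauss w ?V = (\<integral>z. complex_of_real (s * (vdens z *\<^sub>R \<phi> z)) \<partial>gauss)"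
      unfolding L2_inner_def
    proof (rule Bochner_Integration.integral_cong[OF refl])
      show "w z * cnj (?V z) = complex_of_real (s * (vdens z *\<^sub>R \<phi> z))" for z
        using s(1) complex_norm_square[of "?V z"] by (simp add: w s(2)[symmetric] field_simps)
    qed
    also have "\<dots> = of_real (s * mean \<phi>)"
      by (simp only: integral_complex_of_real mean_def integral_mult_right_zero)
         (simp only: integral_ginibre[OF \<open>\<phi> \<in> borel_measurable borel\<close>])
    finally have orth: "L2_inner gauss w ?V = 0"
      by (simp add: mean)
    have alt: "alternating w"
      using w_L2 sym by (auto simp: alternating_def w symmetric_fun_def)
    have "(\<integral>z. P z * (P z * (cnj (?V z) / ?V z)) \<partial>gauss) = 0"
    proof (rule integral_fock_square[OF P_L2])
      fix i assume "hcoef P i \<noteq> 0"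
      then have i: "snd i = (\<lambda>_. 0)" "hcoef w i \<noteq> 0"
        unfolding P_def proj_fock_space(2)[OF w_L2] by (auto split: if_splits)
      then have "hcoef w (fst i, \<lambda>_. 0) \<noteq> 0"
        by (metis prod.collapse)
      with i show "snd i = (\<lambda>_. 0) \<and> card (pairs :: ('n \<times> 'n) set) < (\<Sum>k\<in>UNIV. fst i k)"
        using hcoef_low_degree[OF alt orth] by blast
    qed
    then show ?thesis
      by (simp add: L2_inner_def q_def)
  qed
  define R where "R z = w z - P z - q z" for z
  have wP_L2: "(\<lambda>z. w z - P z) \<in> L2 gauss"
    by (rule L2_diff[OF w_L2 P_L2])
  have R_L2: "R \<in> L2 gauss"
    unfolding R_def by (rule L2_diff[OF wP_L2 q_L2])
  have R: "AE z in gauss. (norm (R z))\<^sup>2 = vdens z *\<^sub>R (norm (r z))\<^sup>2"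
    using V0
  proof eventually_elim
    fix z assume z: "?V z \<noteq> 0"
    have "R z = ?V z / of_real s * r z"
      using z s(1) by (simp add: R_def w q_def r_def U_inv_def s_def[symmetric] field_simps)
    then show "(norm (R z))\<^sup>2 = vdens z *\<^sub>R (norm (r z))\<^sup>2"
      using s by (simp add: norm_mult norm_divide power_mult_distrib power_divide power2_eq_square)
  qed
  have [measurable]: "R \<in> borel_measurable borel"
    unfolding R_def by measurable
  have "integrable gauss (\<lambda>z. vdens z *\<^sub>R (norm (r z))\<^sup>2)"
    by (rule integrable_cong_AE_imp[OF L2_integrable_square[OF R_L2]]) (use R in auto)
  then show "r \<in> L2 ginibre"
    by (intro L2_I) (simp_all add: integrable_ginibre)
  have "(L2_norm ginibre r)\<^sup>2 = (L2_norm gauss R)\<^sup>2"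
    unfolding L2_norm_square
    by (subst integral_ginibre, simp, rule integral_cong_AE) (use R in auto)
  also have "\<dots> = (L2_norm gauss (\<lambda>z. w z - P z))\<^sup>2 + (L2_norm gauss q)\<^sup>2
      - 2 * Re (L2_inner gauss (\<lambda>z. w z - P z) q)"
    unfolding R_def by (rule L2_norm_square_diff[OF wP_L2 q_L2])
  also have "\<dots> = (L2_norm gauss w)\<^sup>2 - 2 * (L2_norm gauss P)\<^sup>2"
    by (simp add: L2_norm_square_diff[OF w_L2 P_L2] L2_inner_diff_left[OF w_L2 P_L2 q_L2]
        norm_wP inner_wq inner_Pq norm_q_P)
  finally show "(L2_norm ginibre r)\<^sup>2 = (L2_norm gauss w)\<^sup>2 - 2 * (L2_norm gauss P)\<^sup>2" .
  show "(L2_norm gauss w)\<^sup>2 = (\<integral>z. (\<phi> z)\<^sup>2 \<partial>ginibre)"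
    unfolding L2_norm_square
    by (subst integral_ginibre) (simp_all add: w norm_mult norm_divide power_mult_distrib power_divide s(2)[symmetric] flip: power2_eq_square)
qed

lemma proj_norm:
  fixes w :: "complex^'n::finite \<Rightarrow> complex"
  assumes w: "w \<in> L2 gauss"
  shows "(L2_norm gauss (L2_proj gauss (L2_orth gauss fock_space) w))\<^sup>2
    = (L2_norm gauss w)\<^sup>2 - (L2_norm gauss (L2_proj gauss fock_space w))\<^sup>2"
proof -
  let ?p = "L2_proj gauss (L2_orth gauss fock_space) w" and ?P = "L2_proj gauss fock_space w"
  have "((\<lambda>i. (norm (hcoef ?p i))\<^sup>2 + (norm (hcoef ?P i))\<^sup>2) has_sum ((L2_norm gauss ?p)\<^sup>2 + (L2_norm gauss ?P)\<^sup>2)) UNIV"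
    by (intro has_sum_add Hermite.Parseval_norm proj_orth_fock_space(1)[OF w] fock_space_L2[OF proj_fock_space(1)[OF w]])
  moreover have "(norm (hcoef ?p i))\<^sup>2 + (norm (hcoef ?P i))\<^sup>2 = (norm (hcoef w i))\<^sup>2" for i
    by (simp add: proj_orth_fock_space(2)[OF w] proj_fock_space(2)[OF w])
  ultimately have "((\<lambda>i. (norm (hcoef w i))\<^sup>2) has_sum ((L2_norm gauss ?p)\<^sup>2 + (L2_norm gauss ?P)\<^sup>2)) UNIV"
    by simp
  from has_sum_unique[OF this Hermite.Parseval_norm[OF w]] show ?thesis
    by simp
qed

section \<open>The two identities\<close>

theorem theorem1p10:
  fixes f :: "complex^'n::{finite,linorder} \<Rightarrow> real"
  assumes f_test: "f \<in> test_functions distinct_coords"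
    and f_sym: "symmetric_fun f"
  shows
    "let n = real CARD('n);
         ft = (\<lambda>z. f z - mean f);
         w = U_map (\<lambda>z. complex_of_real (ft z));
         h = U_inv (L2_proj gauss fock_space w);
         r = (\<lambda>z. complex_of_real (ft z) - h z - cnj (h z));
         v = inv_sqrt_dbar_laplacian (L2_proj gauss (L2_orth gauss fock_space) w)
     in r \<in> L2 ginibre \<and>
        (\<forall>k. has_weak_dbar k v (weak_dbar k v)) \<and>
        (\<forall>j k. has_weak_dbar j (weak_dbar k v) (weak_dbar j (weak_dbar k v)) \<and>
               weak_dbar j (weak_dbar k v) \<in> L2 gauss) \<and>
        energy f - 2 * Var f =
          2 * (L2_norm ginibre r)\<^sup>2
          + 4 / n * (\<Sum>j\<in>UNIV. \<Sum>k\<in>UNIV. (L2_norm gauss (weak_dbar j (weak_dbar k v)))\<^sup>2) \<and>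
        (L2_norm ginibre (generator f))\<^sup>2 - 2 * energy f =
          (L2_norm ginibre (\<lambda>z. generator ft z + 2 * ft z))\<^sup>2
          + 4 * (L2_norm ginibre r)\<^sup>2
          + 8 / n * (\<Sum>j\<in>UNIV. \<Sum>k\<in>UNIV. (L2_norm gauss (weak_dbar j (weak_dbar k v)))\<^sup>2)"
proof -
  define m where "m = mean f"
  define ft where "ft z = f z - m" for z
  define w where "w = U_map (\<lambda>z. complex_of_real (ft z))"
  define r where "r z = complex_of_real (ft z) - U_inv (L2_proj gauss fock_space w) z
    - cnj (U_inv (L2_proj gauss fock_space w) z)" for z
  define v where "v = inv_sqrt_dbar_laplacian (L2_proj gauss (L2_orth gauss fock_space) w)"
  define N where "N = (\<Sum>j\<in>UNIV. \<Sum>k\<in>UNIV. (L2_norm gauss (weak_dbar j (weak_dbar k v)))\<^sup>2)"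
  define G where "G = (L2_norm gauss (L2_proj gauss fock_space w))\<^sup>2"
  let ?n = "real CARD('n)"
  obtain K where K: "compact K" "K \<subseteq> distinct_coords" and supp: "\<And>z. z \<notin> K \<Longrightarrow> f z = 0"
    and smooth0: "\<And>k. Ck_on k distinct_coords f"
    using f_test unfolding test_functions_def smooth_on_def by blast
  have smooth: "Ck_on k UNIV f" for k
    by (rule Ck_on_extend[OF open_distinct_coords compact_imp_closed[OF K(1)] K(2) smooth0 supp])
  note ints = supported_integrable(1,2,4)[OF smooth K supp] supported_integrable(5,6,7)[OF smooth K supp, of m]
    supported_integrable(8)[OF smooth K supp]
  have ft_smooth: "Ck_on k UNIV ft" for k
    unfolding ft_def diff_conv_add_uminus by (intro Ck_on_add smooth Ck_on_const)
  obtain B where B: "\<And>z. \<bar>ft z\<bar> \<le> B"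
    using ints(6) unfolding ft_def by blast
  have deriv: "frechet_derivative ft (at z) = frechet_derivative f (at z)" for z
    unfolding ft_def by (rule frechet_derivative_shift[OF smooth K supp])
  have energy_ft: "energy ft = energy f"
    by (simp add: energy_def grad_def deriv)
  have int_1: "integrable ginibre (\<lambda>z :: (complex, 'n) vec. c :: real)" for c
    by (rule integrable_ginibre_bounded[of _ "\<bar>c\<bar>"]) auto
  have int_c: "(\<integral>z. c \<partial>(ginibre :: ((complex, 'n) vec) measure)) = c" for c :: real
    using integral_ginibre_1[where 'n = 'n] integral_mult_right_zero[of ginibre c "\<lambda>z :: (complex, 'n) vec. 1 :: real"] by (simp only: mult_1_right)
  have mean_ft: "mean ft = 0"
    using ints(1) int_1 int_c by (simp add: mean_def ft_def m_def)
  have "(\<integral>z. (ft z)\<^sup>2 \<partial>ginibre) = (\<integral>z. (f z)\<^sup>2 - 2 * m * f z + m\<^sup>2 \<partial>ginibre)"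
    by (rule Bochner_Integration.integral_cong[OF refl]) (simp add: ft_def power2_eq_square algebra_simps)
  also have "\<dots> = Var f"
    using ints(1,2) int_1 int_c
    by (simp add: Var_def) (simp add: m_def mean_def power2_eq_square)
  finally have Var: "(\<integral>z. (ft z)\<^sup>2 \<partial>ginibre) = Var f" .
  have sym: "symmetric_fun ft"
    using f_sym by (simp add: symmetric_fun_def ft_def)
  have w_dom: "w \<in> dbar_form_dom"
    and w_form: "(\<Sum>j\<in>UNIV. (L2_norm gauss (weak_dbar j w))\<^sup>2) = ?n * energy f / 4"
    using U_map_dbar_form[OF ft_smooth B] ints(7) by (simp_all add: deriv w_def energy_ft)
  note rem = remainder_norm[OF Ck_on_continuous[OF ft_smooth[of 0]] B sym mean_ft, folded w_def, folded r_def G_def]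
  have r_norm: "(L2_norm ginibre r)\<^sup>2 = Var f - 2 * G" and w_norm: "(L2_norm gauss w)\<^sup>2 = Var f"
    using rem(2,3) Var by (simp_all add: r_def[abs_def])
  note second = second_dbar_derivatives[OF w_dom, folded v_def, folded N_def]
  have "N = ?n * energy f / 4 - ?n * (Var f - G)"
    using second(3) by (simp add: w_form proj_norm[OF dbar_form_domD(1)[OF w_dom]] w_norm G_def)
  then have "4 / ?n * N = energy f - 4 * (Var f - G)"
    by (simp add: field_simps)
  then have first: "energy f - 2 * Var f = 2 * (L2_norm ginibre r)\<^sup>2 + 4 / ?n * N"
    by (simp add: r_norm)
  have gen: "generator ft = generator f"
    unfolding ft_def by (rule generator_shift[OF smooth K supp])
  have "(L2_norm ginibre (\<lambda>z. generator ft z + 2 * ft z))\<^sup>2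
      = (\<integral>z. (generator f z)\<^sup>2 + 4 * (ft z * generator f z) + 4 * (ft z)\<^sup>2 \<partial>ginibre)"
    unfolding L2_norm_square gen
    by (rule Bochner_Integration.integral_cong[OF refl]) (simp add: power2_eq_square algebra_simps)
  also have "\<dots> = (L2_norm ginibre (generator f))\<^sup>2 + 4 * (\<integral>z. ft z * generator f z \<partial>ginibre) + 4 * (\<integral>z. (ft z)\<^sup>2 \<partial>ginibre)"
    using ints(3,4,5) unfolding L2_norm_square by (simp add: ft_def)
  also have "\<dots> = (L2_norm ginibre (generator f))\<^sup>2 - 4 * energy f + 4 * Var f"
    using generator_integration_by_parts[OF smooth K supp, of m] by (simp add: Var ft_def[symmetric])
  finally have "(L2_norm ginibre (generator f))\<^sup>2 - 2 * energy f
      = (L2_norm ginibre (\<lambda>z. generator ft z + 2 * ft z))\<^sup>2 + 4 * (L2_norm ginibre r)\<^sup>2 + 8 / ?n * N"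
    using first by simp
  with first show ?thesis
    unfolding Let_def
    using rem(1) dbar_form_domD(2)[OF second(1)] dbar_form_domD(2,3)[OF second(2)]
    by (simp add: ft_def[abs_def] m_def w_def r_def[abs_def] v_def N_def)
qed

end
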